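(* Let $\mathcal S$ and $\mathcal P$ be arbitrary graded vector bundles over a graded manifold $\mathcal M=(M,C^\infty_{\mathcal M})$. Then the canonical sheafification morphism $\mathrm{sff}:\mathcal S\otimes^P_{C^\infty_{\mathcal M}}\mathcal P\to\mathcal S\otimes_{C^\infty_{\mathcal M}}\mathcal P$ is an isomorphism. In other words, the naive tensor product presheaf $\mathcal S\otimes^P_{C^\infty_{\mathcal M}}\mathcal P$ is already a sheaf, so one can canonically identify $(\mathcal S\otimes_{C^\infty_{\mathcal M}}\mathcal P)(U)\cong\mathcal S(U)\otimes_{C^\infty_{\mathcal M}(U)}\mathcal P(U)$ for each open $U\subseteq M$.
   Context: Graded conventions. "Graded" means $\mathbb Z$-graded over $\mathbb R$. A graded vector space is a sequence $V=(V_i)_{i\in\mathbb Z}$ of real vector spaces; an element $v\in V$ is by definition homogeneous ($v\in V_i$, $i=|v|$) and only elements of equal degree are added. Graded algebras are associative, unital and graded commutative, $ab=(-1)^{|a||b|}ba$. Left graded modules are also right modules via $s\cdot f:=(-1)^{|f||s|}f\cdot s$, and tensor products of graded modules over a graded algebra are taken in the graded sense. Graded manifolds. For non-negative integers $(m_j)_{j\in\mathbb Z}$ with finite sum, let $\tilde m=\sum_{j\neq0}m_j$ and let $\xi^1,\dots,\xi^{\tilde m}$ be variables, exactly $m_j$ of them of degree $j$ for each $j\ne 0$. The sheaf $C^\infty_{(m_j)}$ on $\mathbb R^{m_0}$ assigns to an open $U$ the graded algebra whose degree $k$ elements are formal power series $\sum_{\mathbf p}f_{\mathbf p}\xi^{\mathbf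 p}$, $f_{\mathbf p}\in C^\infty(U)$, over multi-indices $\mathbf p\in\mathbb N_0^{\tilde m}$ with $\sum_i p_i|\xi^i|=k$ and $p_i\in\{0,1\}$ if $|\xi^i|$ is odd, multiplied by the rules of graded commutativity. A graded manifold of dimension $(m_j)$ is a pair $\mathcal M=(M,C^\infty_{\mathcal M})$, with $M$ a second countable Hausdorff space and $C^\infty_{\mathcal M}$ a sheaf of graded algebras on $M$ locally isomorphic to restrictions of $C^\infty_{(m_j)}$ to open subsets of $\mathbb R^{m_0}$. All graded manifolds are assumed connected (i.e. $M$ is connected). Graded vector bundles. A sheaf of $C^\infty_{\mathcal M}$-modules is a sheaf $\mathcal S$ of graded vector spaces on $M$ such that each $\mathcal S(U)$ is a graded $C^\infty_{\mathcal M}(U)$-module, compatibly with restrictions. A frame over $U$ is a finite family $s_1,\dots,s_r\in\mathcal S(U)$ such that each $s\in\mathcal S(U)$ is $\sum f^i s_i$ for unique $f^i\in C^\infty_{\mathcal M}(U)$; its graded rank is $(r_j)$, $r_j=\#\{i:|s_i|=j\}$. A graded vector bundle over $\mathcal M$ is a sheaf of $C^\infty_{\mathcal M}$-modules admitting frames, all of the same graded rank, over the sets of some open cover of $M$ (restrictions of frames to smaller open sets are frames). Tensor products. $\mathcal S\otimes^P_{C^\infty_{\mathcal M}}\mathcal P$ is the presheaf $U\mapsto\mathcal S(U)\otimes_{C^\infty_{\mathcal M}(U)}\mathcal P(U)$ with the obvious restrictions, $\mathcal S\otimes_{C^\infty_{\mathcal M}}\mathcal P$ is its sheafification, and $\mathrm{sff}$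 is the canonical $C^\infty_{\mathcal M}$-linear presheaf morphism from a presheaf to its sheafification. *)

theory Defs
  imports "HOL-Analysis.Analysis" "HOL-Algebra.AbelCoset" "HOL-Algebra.Module"
begin

section \<open>Graded linear algebra over the reals\<close>

definition real_ring :: "real ring" where
  "real_ring = \<lparr>carrier = UNIV, monoid.mult = (*), one = 1, ring.zero = 0, add = (+)\<rparr>"

definition linear_map ::
    "(real, 'a) module \<Rightarrow> (real, 'b) module \<Rightarrow> ('a \<Rightarrow> 'b) \<Rightarrow> bool" where
  "linear_map V W f \<longleftrightarrow> f \<in> carrier V \<rightarrow> carrier W \<and>
     (\<forall>x\<in>carrier V. \<forall>y\<in>carrier V. f (x \<oplus>\<^bsub>V\<^esub> y) = f x \<oplus>\<^bsub>W\<^esub> f y) \<and>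
     (\<forall>r. \<forall>x\<in>carrier V. f (r \<odot>\<^bsub>V\<^esub> x) = r \<odot>\<^bsub>W\<^esub> f x)"

definition bilinear_map ::
    "(real, 'a) module \<Rightarrow> (real, 'b) module \<Rightarrow> (real, 'c) module \<Rightarrow> ('a \<Rightarrow> 'b \<Rightarrow> 'c) \<Rightarrow> bool" where
  "bilinear_map U V W f \<longleftrightarrow> (\<forall>x\<in>carrier U. linear_map V W (f x)) \<and>
     (\<forall>y\<in>carrier V. linear_map U W (\<lambda>x. f x y))"

text \<open>
  The degree \<open>i\<close> part of a graded space is \<open>gr V i\<close>. Different degrees may share underlying
  elements, so every operation on homogeneous elements takes the degrees of its arguments as
  additional parameters. The fields \<open>mult\<close> and \<open>one\<close>, which the record type \<open>module\<close> inherits from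
  \<open>ring\<close>, carry no meaning here.
\<close>

record 'a graded_space =
  gr :: "int \<Rightarrow> (real, 'a) module"

record 'a graded_alg = "'a graded_space" +
  gmult :: "int \<Rightarrow> int \<Rightarrow> 'a \<Rightarrow> 'a \<Rightarrow> 'a"
  gone :: 'a

record ('a, 'b) graded_mod = "'b graded_space" +
  gact :: "int \<Rightarrow> int \<Rightarrow> 'a \<Rightarrow> 'b \<Rightarrow> 'b"

definition koszul_sign :: "int \<Rightarrow> int \<Rightarrow> real" where
  "koszul_sign i j = (if odd i \<and> odd j then - 1 else 1)"

locale graded_vector_space =
  fixes V :: "('a, 'z) graded_space_scheme"
  assumes vector_space: "Module.module real_ring (gr V i)"

locale graded_algebra = graded_vector_space A for A :: "'a graded_alg" +
  assumes mult_bilinear: "bilinear_map (gr A i) (gr A j) (gr A (i + j)) (gmult A i j)"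
    and mult_assoc: "\<lbrakk>a \<in> carrier (gr A i); b \<in> carrier (gr A j); c \<in> carrier (gr A k)\<rbrakk> \<Longrightarrow>
      gmult A (i + j) k (gmult A i j a b) c = gmult A i (j + k) a (gmult A j k b c)"
    and one_closed: "gone A \<in> carrier (gr A 0)"
    and one_mult: "a \<in> carrier (gr A i) \<Longrightarrow> gmult A 0 i (gone A) a = a"
    and mult_one: "a \<in> carrier (gr A i) \<Longrightarrow> gmult A i 0 a (gone A) = a"
    and graded_commute: "\<lbrakk>a \<in> carrier (gr A i); b \<in> carrier (gr A j)\<rbrakk> \<Longrightarrow>
      gmult A i j a b = koszul_sign i j \<odot>\<^bsub>gr A (i + j)\<^esub> gmult A j i b a"

locale graded_module = A: graded_algebra A + graded_vector_space M
  for A :: "'a graded_alg" and M :: "('a, 'b) graded_mod" +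
  assumes act_bilinear: "bilinear_map (gr A i) (gr M j) (gr M (i + j)) (gact M i j)"
    and act_assoc: "\<lbrakk>a \<in> carrier (gr A i); b \<in> carrier (gr A j); x \<in> carrier (gr M k)\<rbrakk> \<Longrightarrow>
      gact M (i + j) k (gmult A i j a b) x = gact M i (j + k) a (gact M j k b x)"
    and one_act: "x \<in> carrier (gr M i) \<Longrightarrow> gact M 0 i (gone A) x = x"

text \<open>The induced right action \<open>s \<cdot> f\<close> for \<open>\<bar>s\<bar> = i\<close> and \<open>\<bar>f\<bar> = l\<close>.\<close>

definition right_act :: "('a, 'b) graded_mod \<Rightarrow> int \<Rightarrow> int \<Rightarrow> 'b \<Rightarrow> 'a \<Rightarrow> 'b" where
  "right_act M i l s f = koszul_sign l i \<odot>\<^bsub>gr M (i + l)\<^esub> gact M l i f s"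

definition graded_algebra_hom ::
    "'a graded_alg \<Rightarrow> 'b graded_alg \<Rightarrow> (int \<Rightarrow> 'a \<Rightarrow> 'b) \<Rightarrow> bool" where
  "graded_algebra_hom A B f \<longleftrightarrow> graded_algebra A \<and> graded_algebra B \<and>
     (\<forall>i. linear_map (gr A i) (gr B i) (f i)) \<and>
     (\<forall>i j. \<forall>a\<in>carrier (gr A i). \<forall>b\<in>carrier (gr A j).
        f (i + j) (gmult A i j a b) = gmult B i j (f i a) (f j b)) \<and>
     f 0 (gone A) = gone B"

definition graded_module_hom :: "'a graded_alg \<Rightarrow> ('a, 'b) graded_mod \<Rightarrow> ('a, 'c) graded_mod \<Rightarrow>
    (int \<Rightarrow> 'b \<Rightarrow> 'c) \<Rightarrow> bool" where
  "graded_module_hom A M N f \<longleftrightarrow> graded_module A M \<and> graded_module A N \<and>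
     (\<forall>i. linear_map (gr M i) (gr N i) (f i)) \<and>
     (\<forall>i j. \<forall>a\<in>carrier (gr A i). \<forall>x\<in>carrier (gr M j).
        f (i + j) (gact M i j a x) = gact N i j a (f j x))"

definition graded_module_iso :: "'a graded_alg \<Rightarrow> ('a, 'b) graded_mod \<Rightarrow> ('a, 'c) graded_mod \<Rightarrow>
    (int \<Rightarrow> 'b \<Rightarrow> 'c) \<Rightarrow> bool" where
  "graded_module_iso A M N f \<longleftrightarrow> graded_module_hom A M N f \<and>
     (\<forall>i. bij_betw (f i) (carrier (gr M i)) (carrier (gr N i)))"


section \<open>Tensor products of graded modules\<close>

text \<open>The real vector space with basis \<open>B\<close>, as finitely supported functions.\<close>

definition free_space :: "'x set \<Rightarrow> (real, 'x \<Rightarrow> real) module" where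
  "free_space B = \<lparr>carrier = {\<phi>. finite {x. \<phi> x \<noteq> 0} \<and> {x. \<phi> x \<noteq> 0} \<subseteq> B},
     monoid.mult = undefined, one = undefined, ring.zero = (\<lambda>_. 0),
     add = (\<lambda>\<phi> \<psi> x. \<phi> x + \<psi> x), smult = (\<lambda>r \<phi> x. r * \<phi> x)\<rparr>"

text \<open>The linear extension of a map \<open>f\<close> of basis elements.\<close>

definition free_map :: "('x \<Rightarrow> 'y) \<Rightarrow> ('x \<Rightarrow> real) \<Rightarrow> 'y \<Rightarrow> real" where
  "free_map f \<phi> y = (\<Sum>x | \<phi> x \<noteq> 0 \<and> f x = y. \<phi> x)"

definition quotient_space :: "(real, 'x) module \<Rightarrow> 'x set \<Rightarrow> (real, 'x set) module" where
  "quotient_space V N = \<lparr>carrier = a_rcosets\<^bsub>V\<^esub> N,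
     monoid.mult = undefined, one = undefined, ring.zero = N,
     add = set_add V, smult = (\<lambda>r K. \<Union>x\<in>K. N +>\<^bsub>V\<^esub> (r \<odot>\<^bsub>V\<^esub> x))\<rparr>"

text \<open>The symbol \<open>(i, s, j, p)\<close> stands for \<open>s \<otimes> p\<close> with \<open>\<bar>s\<bar> = i\<close> and \<open>\<bar>p\<bar> = j\<close>.\<close>

type_synonym ('b, 'c) tensor_symbol = "int \<times> 'b \<times> int \<times> 'c"

definition tensor_free :: "('a, 'b) graded_mod \<Rightarrow> ('a, 'c) graded_mod \<Rightarrow> int \<Rightarrow>
    (real, ('b, 'c) tensor_symbol \<Rightarrow> real) module" where
  "tensor_free M N k = free_space {(i, s, j, p) | i s j p.
     i + j = k \<and> s \<in> carrier (gr M i) \<and> p \<in> carrier (gr N j)}"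

inductive_set tensor_relators ::
    "'a graded_alg \<Rightarrow> ('a, 'b) graded_mod \<Rightarrow> ('a, 'c) graded_mod \<Rightarrow> int \<Rightarrow>
      (('b, 'c) tensor_symbol \<Rightarrow> real) set"
  for A :: "'a graded_alg" and M :: "('a, 'b) graded_mod" and N :: "('a, 'c) graded_mod"
    and k :: int where
  add_left: "\<lbrakk>i + j = k; s \<in> carrier (gr M i); s' \<in> carrier (gr M i); p \<in> carrier (gr N j)\<rbrakk> \<Longrightarrow>
    (\<lambda>x. indicator {(i, s \<oplus>\<^bsub>gr M i\<^esub> s', j, p)} x
        - indicator {(i, s, j, p)} x - indicator {(i, s', j, p)} x) \<in> tensor_relators A M N k"
| add_right: "\<lbrakk>i + j = k; s \<in> carrier (gr M i); p \<in> carrier (gr N j); p' \<in> carrier (gr N j)\<rbrakk> \<Longrightarrow>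
    (\<lambda>x. indicator {(i, s, j, p \<oplus>\<^bsub>gr N j\<^esub> p')} x
        - indicator {(i, s, j, p)} x - indicator {(i, s, j, p')} x) \<in> tensor_relators A M N k"
| smult_left: "\<lbrakk>i + j = k; s \<in> carrier (gr M i); p \<in> carrier (gr N j)\<rbrakk> \<Longrightarrow>
    (\<lambda>x. indicator {(i, r \<odot>\<^bsub>gr M i\<^esub> s, j, p)} x - r * indicator {(i, s, j, p)} x)
      \<in> tensor_relators A M N k"
| smult_right: "\<lbrakk>i + j = k; s \<in> carrier (gr M i); p \<in> carrier (gr N j)\<rbrakk> \<Longrightarrow>
    (\<lambda>x. indicator {(i, s, j, r \<odot>\<^bsub>gr N j\<^esub> p)} x - r * indicator {(i, s, j, p)} x)
      \<in> tensor_relators A M N k"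
| balanced: "\<lbrakk>i + l + j = k; s \<in> carrier (gr M i); f \<in> carrier (gr A l); p \<in> carrier (gr N j)\<rbrakk> \<Longrightarrow>
    (\<lambda>x. indicator {(i + l, right_act M i l s f, j, p)} x
        - indicator {(i, s, l + j, gact N l j f p)} x) \<in> tensor_relators A M N k"

definition tensor_null :: "'a graded_alg \<Rightarrow> ('a, 'b) graded_mod \<Rightarrow> ('a, 'c) graded_mod \<Rightarrow> int \<Rightarrow>
    (('b, 'c) tensor_symbol \<Rightarrow> real) set" where
  "tensor_null A M N k =
     (\<lambda>H. submodule H real_ring (tensor_free M N k)) hull tensor_relators A M N k"

definition tensor_module :: "'a graded_alg \<Rightarrow> ('a, 'b) graded_mod \<Rightarrow> ('a, 'c) graded_mod \<Rightarrow>
    ('a, (('b, 'c) tensor_symbol \<Rightarrow> real) set) graded_mod" where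
  "tensor_module A M N =
     \<lparr>gr = (\<lambda>k. quotient_space (tensor_free M N k) (tensor_null A M N k)),
      gact = (\<lambda>l k f T. \<Union>\<phi>\<in>T. tensor_null A M N (l + k) +>\<^bsub>tensor_free M N (l + k)\<^esub>
         free_map (\<lambda>(i, s, j, p). (l + i, gact M l i f s, j, p)) \<phi>)\<rparr>"


section \<open>Sheaves of graded objects\<close>

text \<open>
  \<open>restr F U V i\<close> is the restriction map from \<open>U\<close> to \<open>V\<close> in degree \<open>i\<close>. Only the values of
  \<open>sections\<close> and \<open>restr\<close> at open sets matter.
\<close>

record ('m, 'a, 'z) graded_presheaf =
  sections :: "'m set \<Rightarrow> ('a, 'z) graded_space_scheme"
  restr :: "'m set \<Rightarrow> 'm set \<Rightarrow> int \<Rightarrow> 'a \<Rightarrow> 'a"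

type_synonym ('m, 'a) alg_presheaf = "('m, 'a, ('a, unit) graded_alg_ext) graded_presheaf"
type_synonym ('m, 'a, 'b) mod_presheaf = "('m, 'b, ('a, 'b, unit) graded_mod_ext) graded_presheaf"

locale presheaf =
  fixes X :: "'m topology" and F :: "('m, 'a, 'z) graded_presheaf"
  assumes sections_space: "openin X U \<Longrightarrow> graded_vector_space (sections F U)"
    and restr_linear: "\<lbrakk>openin X U; openin X V; V \<subseteq> U\<rbrakk> \<Longrightarrow>
      linear_map (gr (sections F U) i) (gr (sections F V) i) (restr F U V i)"
    and restr_id: "\<lbrakk>openin X U; s \<in> carrier (gr (sections F U) i)\<rbrakk> \<Longrightarrow> restr F U U i s = s"
    and restr_trans: "\<lbrakk>openin X U; openin X V; openin X W; W \<subseteq> V; V \<subseteq> U;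
      s \<in> carrier (gr (sections F U) i)\<rbrakk> \<Longrightarrow> restr F V W i (restr F U V i s) = restr F U W i s"

text \<open>The empty cover is allowed, so the sections over the empty set form the zero space.\<close>

locale sheaf = presheaf X F for X :: "'m topology" and F :: "('m, 'a, 'z) graded_presheaf" +
  assumes glue: "\<lbrakk>\<And>U. U \<in> \<U> \<Longrightarrow> openin X U;
      \<And>U. U \<in> \<U> \<Longrightarrow> s U \<in> carrier (gr (sections F U) i);
      \<And>U V. \<lbrakk>U \<in> \<U>; V \<in> \<U>\<rbrakk> \<Longrightarrow> restr F U (U \<inter> V) i (s U) = restr F V (U \<inter> V) i (s V)\<rbrakk> \<Longrightarrow>
    \<exists>!t. t \<in> carrier (gr (sections F (\<Union>\<U>)) i) \<and> (\<forall>U\<in>\<U>. restr F (\<Union>\<U>) U i t = s U)"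

locale algebra_presheaf = presheaf X C for X :: "'m topology" and C :: "('m, 'a) alg_presheaf" +
  assumes sections_algebra: "openin X U \<Longrightarrow> graded_algebra (sections C U)"
    and restr_algebra_hom: "\<lbrakk>openin X U; openin X V; V \<subseteq> U\<rbrakk> \<Longrightarrow>
      graded_algebra_hom (sections C U) (sections C V) (restr C U V)"

locale algebra_sheaf = algebra_presheaf X C + sheaf X C
  for X :: "'m topology" and C :: "('m, 'a) alg_presheaf"

locale module_presheaf = C: algebra_presheaf X C + presheaf X F
  for X :: "'m topology" and C :: "('m, 'a) alg_presheaf" and F :: "('m, 'a, 'b) mod_presheaf" +
  assumes sections_module: "openin X U \<Longrightarrow> graded_module (sections C U) (sections F U)"
    and restr_act: "\<lbrakk>openin X U; openin X V; V \<subseteq> U;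
        f \<in> carrier (gr (sections C U) i); s \<in> carrier (gr (sections F U) j)\<rbrakk> \<Longrightarrow>
      restr F U V (i + j) (gact (sections F U) i j f s) =
      gact (sections F V) i j (restr C U V i f) (restr F U V j s)"

locale module_sheaf = module_presheaf X C F + sheaf X F
  for X :: "'m topology" and C :: "('m, 'a) alg_presheaf" and F :: "('m, 'a, 'b) mod_presheaf"

definition algebra_presheaf_iso :: "'m topology \<Rightarrow> ('m, 'a) alg_presheaf \<Rightarrow>
    ('m, 'b) alg_presheaf \<Rightarrow> ('m set \<Rightarrow> int \<Rightarrow> 'a \<Rightarrow> 'b) \<Rightarrow> bool" where
  "algebra_presheaf_iso X C D \<Phi> \<longleftrightarrow> algebra_presheaf X C \<and> algebra_presheaf X D \<and>
     (\<forall>U. openin X U \<longrightarrow> graded_algebra_hom (sections C U) (sections D U) (\<Phi> U) \<and>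
        (\<forall>i. bij_betw (\<Phi> U i) (carrier (gr (sections C U) i)) (carrier (gr (sections D U) i)))) \<and>
     (\<forall>U V i. \<forall>f\<in>carrier (gr (sections C U) i). openin X U \<longrightarrow> openin X V \<longrightarrow> V \<subseteq> U \<longrightarrow>
        restr D U V i (\<Phi> U i f) = \<Phi> V i (restr C U V i f))"

definition module_presheaf_morphism :: "'m topology \<Rightarrow> ('m, 'a) alg_presheaf \<Rightarrow>
    ('m, 'a, 'b) mod_presheaf \<Rightarrow> ('m, 'a, 'c) mod_presheaf \<Rightarrow>
    ('m set \<Rightarrow> int \<Rightarrow> 'b \<Rightarrow> 'c) \<Rightarrow> bool" where
  "module_presheaf_morphism X C F G \<Phi> \<longleftrightarrow> module_presheaf X C F \<and> module_presheaf X C G \<and>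
     (\<forall>U. openin X U \<longrightarrow>
        graded_module_hom (sections C U) (sections F U) (sections G U) (\<Phi> U)) \<and>
     (\<forall>U V i. \<forall>s\<in>carrier (gr (sections F U) i). openin X U \<longrightarrow> openin X V \<longrightarrow> V \<subseteq> U \<longrightarrow>
        restr G U V i (\<Phi> U i s) = \<Phi> V i (restr F U V i s))"

definition module_presheaf_iso :: "'m topology \<Rightarrow> ('m, 'a) alg_presheaf \<Rightarrow>
    ('m, 'a, 'b) mod_presheaf \<Rightarrow> ('m, 'a, 'c) mod_presheaf \<Rightarrow>
    ('m set \<Rightarrow> int \<Rightarrow> 'b \<Rightarrow> 'c) \<Rightarrow> bool" where
  "module_presheaf_iso X C F G \<Phi> \<longleftrightarrow> module_presheaf_morphism X C F G \<Phi> \<and>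
     (\<exists>\<Psi>. module_presheaf_morphism X C G F \<Psi> \<and>
        (\<forall>U i. openin X U \<longrightarrow>
           (\<forall>s\<in>carrier (gr (sections F U) i). \<Psi> U i (\<Phi> U i s) = s) \<and>
           (\<forall>t\<in>carrier (gr (sections G U) i). \<Phi> U i (\<Psi> U i t) = t)))"


section \<open>Sheafification\<close>

text \<open>
  \<open>germ X F k x U s\<close> is the germ at \<open>x\<close> of a degree \<open>k\<close> section \<open>s\<close> over \<open>U\<close>, as an equivalence
  class of pairs. The unions in the operations on germs range over all representatives, and all
  members of such a union are the same germ. The sheafification consists of the functions assigning
  to each point of \<open>U\<close> a germ at that point which locally come from sections.
\<close>

type_synonym ('m, 'b) germ = "('m set \<times> 'b) set"

definition germ :: "'m topology \<Rightarrow> ('m, 'b, 'z) graded_presheaf \<Rightarrow> int \<Rightarrow> 'm \<Rightarrow>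
    'm set \<Rightarrow> 'b \<Rightarrow> ('m, 'b) germ" where
  "germ X F k x U s = {(V, t). openin X V \<and> x \<in> V \<and> t \<in> carrier (gr (sections F V) k) \<and>
     (\<exists>W. openin X W \<and> x \<in> W \<and> W \<subseteq> U \<inter> V \<and> restr F U W k s = restr F V W k t)}"

definition germ_add :: "'m topology \<Rightarrow> ('m, 'b, 'z) graded_presheaf \<Rightarrow> int \<Rightarrow> 'm \<Rightarrow>
    ('m, 'b) germ \<Rightarrow> ('m, 'b) germ \<Rightarrow> ('m, 'b) germ" where
  "germ_add X F k x g h = (\<Union>(U, s)\<in>g. \<Union>(V, t)\<in>h. germ X F k x (U \<inter> V)
     (restr F U (U \<inter> V) k s \<oplus>\<^bsub>gr (sections F (U \<inter> V)) k\<^esub> restr F V (U \<inter> V) k t))"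

definition germ_smult :: "'m topology \<Rightarrow> ('m, 'b, 'z) graded_presheaf \<Rightarrow> int \<Rightarrow> 'm \<Rightarrow>
    real \<Rightarrow> ('m, 'b) germ \<Rightarrow> ('m, 'b) germ" where
  "germ_smult X F k x r g = (\<Union>(U, s)\<in>g. germ X F k x U (r \<odot>\<^bsub>gr (sections F U) k\<^esub> s))"

definition germ_act :: "'m topology \<Rightarrow> ('m, 'a) alg_presheaf \<Rightarrow> ('m, 'a, 'b) mod_presheaf \<Rightarrow>
    int \<Rightarrow> int \<Rightarrow> 'm \<Rightarrow> 'm set \<Rightarrow> 'a \<Rightarrow> ('m, 'b) germ \<Rightarrow> ('m, 'b) germ" where
  "germ_act X C F l k x U f g = (\<Union>(V, t)\<in>g. germ X F (l + k) x (U \<inter> V)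
     (gact (sections F (U \<inter> V)) l k (restr C U (U \<inter> V) l f) (restr F V (U \<inter> V) k t)))"

definition sheafification :: "'m topology \<Rightarrow> ('m, 'a) alg_presheaf \<Rightarrow> ('m, 'a, 'b) mod_presheaf \<Rightarrow>
    ('m, 'a, 'm \<Rightarrow> ('m, 'b) germ) mod_presheaf" where
  "sheafification X C F =
     \<lparr>sections = (\<lambda>U. \<lparr>gr = (\<lambda>k.
        \<lparr>carrier = {\<sigma> \<in> extensional U. \<forall>x\<in>U. \<exists>V t. openin X V \<and> x \<in> V \<and> V \<subseteq> U \<and>
            t \<in> carrier (gr (sections F V) k) \<and> (\<forall>y\<in>V. \<sigma> y = germ X F k y V t)},
         monoid.mult = undefined, one = undefined,
         ring.zero = (\<lambda>x\<in>U. germ X F k x U \<zero>\<^bsub>gr (sections F U) k\<^esub>),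
         add = (\<lambda>\<sigma> \<tau>. \<lambda>x\<in>U. germ_add X F k x (\<sigma> x) (\<tau> x)),
         smult = (\<lambda>r \<sigma>. \<lambda>x\<in>U. germ_smult X F k x r (\<sigma> x))\<rparr>),
        gact = (\<lambda>l k f \<sigma>. \<lambda>x\<in>U. germ_act X C F l k x U f (\<sigma> x))\<rparr>),
      restr = (\<lambda>U V k \<sigma>. restrict \<sigma> V)\<rparr>"

definition sff :: "'m topology \<Rightarrow> ('m, 'a, 'b) mod_presheaf \<Rightarrow>
    'm set \<Rightarrow> int \<Rightarrow> 'b \<Rightarrow> 'm \<Rightarrow> ('m, 'b) germ" where
  "sff X F U k s = (\<lambda>x\<in>U. germ X F k x U s)"


section \<open>Tensor products of sheaves of modules\<close>

definition tensor_presheaf :: "('m, 'a) alg_presheaf \<Rightarrow> ('m, 'a, 'b) mod_presheaf \<Rightarrow>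
    ('m, 'a, 'c) mod_presheaf \<Rightarrow>
    ('m, 'a, (('b, 'c) tensor_symbol \<Rightarrow> real) set) mod_presheaf" where
  "tensor_presheaf C S P =
     \<lparr>sections = (\<lambda>U. tensor_module (sections C U) (sections S U) (sections P U)),
      restr = (\<lambda>U V k T. \<Union>\<phi>\<in>T. tensor_null (sections C V) (sections S V) (sections P V) k
         +>\<^bsub>tensor_free (sections S V) (sections P V) k\<^esub>
         free_map (\<lambda>(i, s, j, p). (i, restr S U V i s, j, restr P U V j p)) \<phi>)\<rparr>"

definition tensor_sheaf :: "'m topology \<Rightarrow> ('m, 'a) alg_presheaf \<Rightarrow> ('m, 'a, 'b) mod_presheaf \<Rightarrow>
    ('m, 'a, 'c) mod_presheaf \<Rightarrow>
    ('m, 'a, 'm \<Rightarrow> ('m, (('b, 'c) tensor_symbol \<Rightarrow> real) set) germ) mod_presheaf" where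
  "tensor_sheaf X C S P = sheafification X C (tensor_presheaf C S P)"


section \<open>Graded manifolds\<close>

text \<open>
  The space \<open>\<real>\<^sup>n\<close> is the topological space \<open>Euclidean_space n\<close> of sequences vanishing from index
  \<open>n\<close> on, so that \<open>n = 0\<close> is allowed. A function is of class \<open>C\<^sup>k\<close> on an open set \<open>U\<close> if its iterated
  partial derivatives up to order \<open>k\<close> exist and are continuous on \<open>U\<close>.
\<close>

primrec Ck_on :: "nat \<Rightarrow> nat \<Rightarrow> (nat \<Rightarrow> real) set \<Rightarrow> ((nat \<Rightarrow> real) \<Rightarrow> real) \<Rightarrow> bool" where
  "Ck_on 0 n U f \<longleftrightarrow> continuous_map (subtopology (Euclidean_space n) U) euclideanreal f"
| "Ck_on (Suc k) n U f \<longleftrightarrow> continuous_map (subtopology (Euclidean_space n) U) euclideanreal f \<and>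
     (\<forall>i<n. \<exists>g. Ck_on k n U g \<and>
        (\<forall>x\<in>U. ((\<lambda>t. f (x(i := t))) has_real_derivative g x) (at (x i))))"

text \<open>Smooth functions on \<open>U\<close> are extended by zero outside \<open>U\<close>.\<close>

definition smooth_functions :: "nat \<Rightarrow> (nat \<Rightarrow> real) set \<Rightarrow> ((nat \<Rightarrow> real) \<Rightarrow> real) set" where
  "smooth_functions n U = {f. (\<forall>k. Ck_on k n U f) \<and> (\<forall>x. x \<notin> U \<longrightarrow> f x = 0)}"

text \<open>
  The degrees of the variables \<open>\<xi>\<close> for the dimension \<open>m\<close>, listed in increasing order: \<open>m j\<close> of
  them have degree \<open>j\<close>, for each \<open>j \<noteq> 0\<close>.
\<close>

definition variable_degrees :: "(int \<Rightarrow> nat) \<Rightarrow> int list" where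
  "variable_degrees m =
     concat (map (\<lambda>j. replicate (m j) j) (sorted_list_of_set {j. j \<noteq> 0 \<and> m j \<noteq> 0}))"

text \<open>The multi-indices of the monomials of degree \<open>k\<close>.\<close>

definition multi_indices :: "int list \<Rightarrow> int \<Rightarrow> (nat \<Rightarrow> nat) set" where
  "multi_indices d k = {p. (\<forall>i\<ge>length d. p i = 0) \<and> (\<forall>i<length d. odd (d ! i) \<longrightarrow> p i \<le> 1) \<and>
     (\<Sum>i<length d. int (p i) * d ! i) = k}"

text \<open>
  Reordering \<open>\<xi>\<^sup>p \<xi>\<^sup>q\<close> into \<open>\<xi>\<^sup>p\<^sup>+\<^sup>q\<close> moves \<open>q j\<close> copies of the \<open>j\<close>-th variable past \<open>p i\<close> copies of
  the \<open>i\<close>-th one, for all \<open>j < i\<close>.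
\<close>

definition monomial_sign :: "int list \<Rightarrow> (nat \<Rightarrow> nat) \<Rightarrow> (nat \<Rightarrow> nat) \<Rightarrow> real" where
  "monomial_sign d p q =
     (\<Prod>i<length d. \<Prod>j<i. koszul_sign (int (p i) * d ! i) (int (q j) * d ! j))"

text \<open>
  A power series is the function sending a multi-index to its coefficient. The product has no term
  outside \<open>multi_indices\<close>, as odd variables square to zero.
\<close>

definition model_sheaf :: "(int \<Rightarrow> nat) \<Rightarrow>
    (nat \<Rightarrow> real, (nat \<Rightarrow> nat) \<Rightarrow> (nat \<Rightarrow> real) \<Rightarrow> real) alg_presheaf" where
  "model_sheaf m = (let d = variable_degrees m in
     \<lparr>sections = (\<lambda>U. \<lparr>gr = (\<lambda>k.
        \<lparr>carrier = {F. (\<forall>p\<in>multi_indices d k. F p \<in> smooth_functions (m 0) U) \<and>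
            (\<forall>p. p \<notin> multi_indices d k \<longrightarrow> F p = (\<lambda>_. 0))},
         monoid.mult = undefined, one = undefined, ring.zero = (\<lambda>p x. 0),
         add = (\<lambda>F G p x. F p x + G p x), smult = (\<lambda>r F p x. r * F p x)\<rparr>),
        gmult = (\<lambda>k l F G r x. if r \<in> multi_indices d (k + l)
          then \<Sum>p | \<forall>i. p i \<le> r i.
            monomial_sign d p (\<lambda>i. r i - p i) * F p x * G (\<lambda>i. r i - p i) x
          else 0),
        gone = (\<lambda>p x. if (\<forall>i. p i = 0) \<and> x \<in> U then 1 else 0)\<rparr>),
      restr = (\<lambda>U V k F p x. if x \<in> V then F p x else 0)\<rparr>)"

text \<open>The direct image of the restriction of \<open>C\<close> to \<open>U\<close> under a map \<open>h\<close> defined on \<open>U\<close>.\<close>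

definition direct_image :: "'m set \<Rightarrow> ('m \<Rightarrow> 'n) \<Rightarrow> ('m, 'a) alg_presheaf \<Rightarrow>
    ('n, 'a) alg_presheaf" where
  "direct_image U h C =
     \<lparr>sections = (\<lambda>W. sections C {y\<in>U. h y \<in> W}),
      restr = (\<lambda>W W'. restr C {y\<in>U. h y \<in> W} {y\<in>U. h y \<in> W'})\<rparr>"

locale graded_manifold = algebra_sheaf X C
  for m :: "int \<Rightarrow> nat" and X :: "'m topology" and C :: "('m, 'a) alg_presheaf" +
  assumes finite_dimension: "finite {j. m j \<noteq> 0}"
    and hausdorff: "Hausdorff_space X"
    and second_countable: "second_countable X"
    and connected: "connected_space X"
    and local_model: "x \<in> topspace X \<Longrightarrow> \<exists>U V h \<Phi>. openin X U \<and> x \<in> U \<and>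
      openin (Euclidean_space (m 0)) V \<and>
      homeomorphic_map (subtopology X U) (subtopology (Euclidean_space (m 0)) V) h \<and>
      algebra_presheaf_iso (subtopology (Euclidean_space (m 0)) V)
        (model_sheaf m) (direct_image U h C) \<Phi>"


section \<open>Graded vector bundles\<close>

text \<open>
  A frame is a list of homogeneous elements, each paired with its degree. The coefficients of a
  section of degree \<open>k\<close> have degree \<open>k - d\<close> on a frame element of degree \<open>d\<close>. That frames restrict
  to frames over smaller open sets is not imposed: it follows using bump functions on the manifold.
\<close>

definition is_frame :: "'a graded_alg \<Rightarrow> ('a, 'b) graded_mod \<Rightarrow> (int \<times> 'b) list \<Rightarrow> bool" where
  "is_frame A M e \<longleftrightarrow> (\<forall>(d, s)\<in>set e. s \<in> carrier (gr M d)) \<and>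
     (\<forall>k. \<forall>s\<in>carrier (gr M k).
        \<exists>!f. f \<in> (\<Pi>\<^sub>E i\<in>{..<length e}. carrier (gr A (k - fst (e ! i)))) \<and>
          s = (\<Oplus>\<^bsub>gr M k\<^esub>i\<in>{..<length e}.
                 gact M (k - fst (e ! i)) (fst (e ! i)) (f i) (snd (e ! i))))"

definition graded_rank :: "(int \<times> 'b) list \<Rightarrow> int \<Rightarrow> nat" where
  "graded_rank e j = length (filter (\<lambda>(d, s). d = j) e)"

locale graded_vector_bundle = module_sheaf X C S
  for X :: "'m topology" and C :: "('m, 'a) alg_presheaf" and S :: "('m, 'a, 'b) mod_presheaf" +
  assumes local_frames: "\<exists>\<U> \<rho>. (\<forall>U\<in>\<U>. openin X U) \<and> \<Union>\<U> = topspace X \<and>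
    (\<forall>U\<in>\<U>. \<exists>e. is_frame (sections C U) (sections S U) e \<and> graded_rank e = \<rho>)"

end

theory Submission
  imports Defs "HOL-Combinatorics.List_Permutation"
begin

text \<open>Sheafification is an isomorphism for every sheaf, so the point is that the tensor product
  presheaf is a sheaf. Let \<open>a\<close> be a cutoff function on \<open>M\<close> supported in an open set over which \<open>S\<close> is
  free with frame \<open>e\<^sub>1, \<dots>, e\<^sub>r\<close>. Multiplication by \<open>a\<^sup>2\<close> on \<open>S \<otimes> P\<close> factors, naturally in the open
  set, through the sheaf \<open>P\<^sup>r\<close>: cutting off the coordinates of the first factor by \<open>a\<close> gives
  \<open>S \<otimes> P \<rightarrow> P\<^sup>r\<close>, and \<open>(p\<^sub>b) \<mapsto> \<Sum> a e\<^sub>b \<otimes> p\<^sub>b\<close> leads back. Hence \<open>a\<^sup>2\<close> times a compatible family of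
  sections of the presheaf glues to a section, and \<open>a\<^sup>2\<close> kills sections that vanish locally.

  Tensors are finite sums, so only finitely many such functions can be combined. But \<open>M\<close> has a cover
  by finitely many disjoint unions of small open sets, and \<open>S\<close> is free over each such union: cover a
  chart by small cubes, coloured by the parities of their coordinates, so that cubes of one colour
  are disjoint; the same colours suffice for finite unions of chart neighbourhoods, hence for
  compact sets, and the shells of a compact exhaustion are separated by three more colours.\<close>

section \<open>Linear maps, quotients and free spaces\<close>

text \<open>The frame is taken from the first factor and the gluing is done in the second. Sections
  over an arbitrary open set have coordinates only over the part where the frame lives; coordinates
  and frame sections are each multiplied by a before being extended by zero, and this is the origin
  of the square. The combination of finitely many cutoffs replaces a partition of unity: the global
  functions of degree zero that make gluing work form an ideal, and finitely many members that equal
  1 on the sets of a cover generate 1, because the product of all 1 - b vanishes locally and hence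
  vanishes. Joining frames over a disjoint union requires one common list of degrees, which the
  constancy of the graded rank provides. Joining cutoffs requires local finiteness, so that every
  point outside the union has a neighbourhood on which all of them vanish.\<close>

abbreviation real_space :: "(real, 'a) module \<Rightarrow> bool" where
  "real_space V \<equiv> Module.module real_ring V"

lemma real_ring_simps [simp]:
  "carrier real_ring = UNIV" "x \<otimes>\<^bsub>real_ring\<^esub> y = x * y" "\<one>\<^bsub>real_ring\<^esub> = 1"
  "\<zero>\<^bsub>real_ring\<^esub> = 0" "x \<oplus>\<^bsub>real_ring\<^esub> y = x + y"
  by (auto simp: real_ring_def)

lemma cring_real_ring: "cring real_ring"
proof (rule cringI)
  show "abelian_group real_ring"
    by (rule abelian_groupI) (auto intro: exI[of _ "- x" for x])
  show "comm_monoid real_ring"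
    by (rule comm_monoidI) auto
qed (auto simp: algebra_simps)

context
  fixes V :: "(real, 'a) module"
  assumes V: "real_space V"
begin

lemma real_space_abelian_group: "abelian_group V"
  using V by (simp add: Module.module_def)

lemmas real_space_abelian_monoid = abelian_group.axioms(1)[OF real_space_abelian_group]

lemma real_space_smult_closed: "x \<in> carrier V \<Longrightarrow> r \<odot>\<^bsub>V\<^esub> x \<in> carrier V"
  using Module.module.smult_closed[OF V] by simp

lemma real_space_smult_one: "x \<in> carrier V \<Longrightarrow> 1 \<odot>\<^bsub>V\<^esub> x = x"
  using Module.module.smult_one[OF V] by simp

lemma real_space_smult_assoc:
  "x \<in> carrier V \<Longrightarrow> a \<odot>\<^bsub>V\<^esub> (b \<odot>\<^bsub>V\<^esub> x) = (a * b) \<odot>\<^bsub>V\<^esub> x"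
  using Module.module.smult_assoc1[OF V, of a b x] by simp

lemma real_space_smult_add:
  "\<lbrakk>x \<in> carrier V; y \<in> carrier V\<rbrakk> \<Longrightarrow> r \<odot>\<^bsub>V\<^esub> (x \<oplus>\<^bsub>V\<^esub> y) = r \<odot>\<^bsub>V\<^esub> x \<oplus>\<^bsub>V\<^esub> r \<odot>\<^bsub>V\<^esub> y"
  using Module.module.smult_r_distr[OF V] by simp

lemma real_space_add_smult:
  "x \<in> carrier V \<Longrightarrow> (a + b) \<odot>\<^bsub>V\<^esub> x = a \<odot>\<^bsub>V\<^esub> x \<oplus>\<^bsub>V\<^esub> b \<odot>\<^bsub>V\<^esub> x"
  using Module.module.smult_l_distr[OF V, of a b x] by simp

lemma real_space_zero_smult: "x \<in> carrier V \<Longrightarrow> 0 \<odot>\<^bsub>V\<^esub> x = \<zero>\<^bsub>V\<^esub>"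
  using Module.module.smult_l_null[OF V] by simp

lemma real_space_smult_zero: "r \<odot>\<^bsub>V\<^esub> \<zero>\<^bsub>V\<^esub> = \<zero>\<^bsub>V\<^esub>"
  using Module.module.smult_r_null[OF V] by simp

lemma real_space_minus_smult: "x \<in> carrier V \<Longrightarrow> (- 1) \<odot>\<^bsub>V\<^esub> x = \<ominus>\<^bsub>V\<^esub> x"
proof -
  assume x: "x \<in> carrier V"
  interpret abelian_group V by (rule real_space_abelian_group)
  have "(- 1) \<odot>\<^bsub>V\<^esub> x \<oplus>\<^bsub>V\<^esub> x = (- 1) \<odot>\<^bsub>V\<^esub> x \<oplus>\<^bsub>V\<^esub> 1 \<odot>\<^bsub>V\<^esub> x"
    using x by (simp add: real_space_smult_one)
  also have "\<dots> = \<zero>\<^bsub>V\<^esub>"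
    using x real_space_add_smult[of x "- 1" 1] by (simp add: real_space_zero_smult)
  finally show ?thesis using x by (simp add: minus_equality real_space_smult_closed)
qed

lemma real_space_minus_eq_zero_iff:
  assumes "x \<in> carrier V" "y \<in> carrier V"
  shows "x \<ominus>\<^bsub>V\<^esub> y = \<zero>\<^bsub>V\<^esub> \<longleftrightarrow> x = y"
proof -
  interpret abelian_group V by (rule real_space_abelian_group)
  show ?thesis
    using assms minus_equality[of x "\<ominus>\<^bsub>V\<^esub> y"] by (auto simp: a_minus_def r_neg)
qed

lemmas real_space_closed =
  abelian_monoid.a_closed[OF real_space_abelian_monoid]
  abelian_monoid.zero_closed[OF real_space_abelian_monoid]
  real_space_smult_closed
  abelian_group.minus_closed[OF real_space_abelian_group]

lemma submodule_iff:
  "submodule N real_ring V \<longleftrightarrow> N \<subseteq> carrier V \<and> \<zero>\<^bsub>V\<^esub> \<in> N \<and>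
     (\<forall>x\<in>N. \<forall>y\<in>N. x \<oplus>\<^bsub>V\<^esub> y \<in> N) \<and> (\<forall>r. \<forall>x\<in>N. r \<odot>\<^bsub>V\<^esub> x \<in> N)" (is "_ \<longleftrightarrow> ?R")
proof
  assume N: "submodule N real_ring V"
  interpret subgroup N "add_monoid V" using N by (simp add: submodule_def)
  from Module.module.submoduleE[OF V N] one_closed show ?R by auto
next
  assume R: ?R
  show "submodule N real_ring V"
  proof (rule Module.module.submoduleI[OF V])
    show "\<ominus>\<^bsub>V\<^esub> a \<in> N" if "a \<in> N" for a
      using R that by (metis real_space_minus_smult subsetD)
  qed (use R in auto)
qed

end

lemma linear_mapI:
  assumes "\<And>x. x \<in> carrier V \<Longrightarrow> f x \<in> carrier W"
    and "\<And>x y. \<lbrakk>x \<in> carrier V; y \<in> carrier V\<rbrakk> \<Longrightarrow> f (x \<oplus>\<^bsub>V\<^esub> y) = f x \<oplus>\<^bsub>W\<^esub> f y"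
    and "\<And>r x. x \<in> carrier V \<Longrightarrow> f (r \<odot>\<^bsub>V\<^esub> x) = r \<odot>\<^bsub>W\<^esub> f x"
  shows "linear_map V W f"
  using assms by (auto simp: linear_map_def)

lemma linear_map_closed: "\<lbrakk>linear_map V W f; x \<in> carrier V\<rbrakk> \<Longrightarrow> f x \<in> carrier W"
  and linear_map_add: "\<lbrakk>linear_map V W f; x \<in> carrier V; y \<in> carrier V\<rbrakk> \<Longrightarrow>
    f (x \<oplus>\<^bsub>V\<^esub> y) = f x \<oplus>\<^bsub>W\<^esub> f y"
  and linear_map_smult: "\<lbrakk>linear_map V W f; x \<in> carrier V\<rbrakk> \<Longrightarrow> f (r \<odot>\<^bsub>V\<^esub> x) = r \<odot>\<^bsub>W\<^esub> f x"
  by (auto simp: linear_map_def)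

lemma linear_map_comp:
  "\<lbrakk>linear_map U V g; linear_map V W f\<rbrakk> \<Longrightarrow> linear_map U W (\<lambda>x. f (g x))"
  by (auto simp: linear_map_def Pi_iff)

lemma linear_map_cong:
  "\<lbrakk>linear_map V W f; real_space V; \<And>x. x \<in> carrier V \<Longrightarrow> f x = g x\<rbrakk> \<Longrightarrow> linear_map V W g"
  by (auto simp: linear_map_def Pi_iff real_space_closed)

context
  fixes V :: "(real, 'a) module" and W :: "(real, 'b) module" and f
  assumes V: "real_space V" and W: "real_space W" and f: "linear_map V W f"
begin

lemma linear_map_zero: "f \<zero>\<^bsub>V\<^esub> = \<zero>\<^bsub>W\<^esub>"
  using linear_map_smult[OF f, of "\<zero>\<^bsub>V\<^esub>" 0] linear_map_closed[OF f]
  by (simp add: real_space_zero_smult V W real_space_closed)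

lemma linear_map_minus:
  assumes "x \<in> carrier V" "y \<in> carrier V"
  shows "f (x \<ominus>\<^bsub>V\<^esub> y) = f x \<ominus>\<^bsub>W\<^esub> f y"
proof -
  have "x \<ominus>\<^bsub>V\<^esub> y = x \<oplus>\<^bsub>V\<^esub> (- 1) \<odot>\<^bsub>V\<^esub> y"
    using assms by (simp add: a_minus_def real_space_minus_smult V)
  then have "f (x \<ominus>\<^bsub>V\<^esub> y) = f x \<oplus>\<^bsub>W\<^esub> (- 1) \<odot>\<^bsub>W\<^esub> f y"
    using assms by (simp add: linear_map_add[OF f] linear_map_smult[OF f] real_space_closed V)
  also have "\<dots> = f x \<ominus>\<^bsub>W\<^esub> f y"
    using assms linear_map_closed[OF f] by (simp add: a_minus_def real_space_minus_smult W)
  finally show ?thesis .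
qed

lemma linear_map_finsum:
  assumes "finite I" "\<And>i. i \<in> I \<Longrightarrow> g i \<in> carrier V"
  shows "f (\<Oplus>\<^bsub>V\<^esub>i\<in>I. g i) = (\<Oplus>\<^bsub>W\<^esub>i\<in>I. f (g i))"
  using assms
proof (induction I)
  case empty
  then show ?case
    by (simp add: abelian_monoid.finsum_empty[OF real_space_abelian_monoid] V W linear_map_zero)
next
  case (insert x F)
  interpret V: abelian_monoid V by (rule real_space_abelian_monoid[OF V])
  interpret W: abelian_monoid W by (rule real_space_abelian_monoid[OF W])
  from insert show ?case
    by (simp add: Pi_iff linear_map_add[OF f] linear_map_closed[OF f])
qed

end

lemma real_space_finsum_closed:
  "\<lbrakk>real_space V; \<And>i. i \<in> I \<Longrightarrow> g i \<in> carrier V\<rbrakk> \<Longrightarrow> (\<Oplus>\<^bsub>V\<^esub>i\<in>I. g i) \<in> carrier V"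
  by (simp add: Pi_iff abelian_monoid.finsum_closed[OF real_space_abelian_monoid])

lemma real_space_finsum_cong:
  assumes "real_space V" "\<And>i. i \<in> I \<Longrightarrow> g i \<in> carrier V" "\<And>i. i \<in> I \<Longrightarrow> f i = g i"
  shows "(\<Oplus>\<^bsub>V\<^esub>i\<in>I. f i) = (\<Oplus>\<^bsub>V\<^esub>i\<in>I. g i)"
  using assms by (intro abelian_monoid.finsum_cong'[OF real_space_abelian_monoid]) auto

lemma linear_map_smult_const:
  assumes "real_space W" "linear_map V W f"
  shows "linear_map V W (\<lambda>x. r \<odot>\<^bsub>W\<^esub> f x)"
  using assms by (intro linear_mapI)
   (auto simp: linear_map_add linear_map_smult linear_map_closed real_space_closed
      real_space_smult_add real_space_smult_assoc mult.commute)

lemma linear_map_finsum_fun: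
  assumes V: "real_space V" and W: "real_space W" and f: "\<And>i. i \<in> I \<Longrightarrow> linear_map V W (f i)" and "finite I"
  shows "linear_map V W (\<lambda>x. \<Oplus>\<^bsub>W\<^esub>i\<in>I. f i x)"
  using \<open>finite I\<close> f
proof (induction I)
  interpret W: abelian_monoid W by (rule real_space_abelian_monoid[OF W])
  { case empty
    show ?case by (auto intro!: linear_mapI simp: W real_space_smult_zero) }
  case (insert x F)
  have cl: "f i v \<in> carrier W" if "i \<in> insert x F" "v \<in> carrier V" for i v
    using that insert by (auto intro: linear_map_closed)
  have lin: "linear_map V W (f x)" "linear_map V W (\<lambda>x. \<Oplus>\<^bsub>W\<^esub>i\<in>F. f i x)"
    using insert by auto
  have eq: "(\<Oplus>\<^bsub>W\<^esub>i\<in>insert x F. f i v) = f x v \<oplus>\<^bsub>W\<^esub> (\<Oplus>\<^bsub>W\<^esub>i\<in>F. f i v)" if "v \<in> carrier V" for v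
    using insert that cl by (subst W.finsum_insert) auto
  have clF: "(\<Oplus>\<^bsub>W\<^esub>i\<in>F. f i v) \<in> carrier W" if "v \<in> carrier V" for v
    using linear_map_closed[OF lin(2) that] .
  show ?case
    using lin by (intro linear_mapI)
      (auto simp: eq V clF real_space_closed linear_map_add[OF lin(1)] linear_map_add[OF lin(2)]
        linear_map_smult[OF lin(1)] linear_map_smult[OF lin(2)] linear_map_closed[OF lin(1)] W.a_ac W
        real_space_smult_add intro!: W.finsum_closed cl)
qed

text \<open>Equational axioms pass along a surjection that respects the operations. This handles
  quotient spaces and spaces of germs, which would otherwise demand direct computation with cosets
  and equivalence classes.\<close>

lemma real_space_surj_image:
  fixes V :: "(real, 'a) module" and W :: "(real, 'b) module"
  assumes V: "real_space V" and f: "linear_map V W f"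
    and surj: "carrier W = f ` carrier V" and zero: "f \<zero>\<^bsub>V\<^esub> = \<zero>\<^bsub>W\<^esub>"
  shows "real_space W"
proof -
  interpret V: abelian_group V by (rule real_space_abelian_group[OF V])
  note f_add = linear_map_add[OF f, symmetric] and f_smult = linear_map_smult[OF f, symmetric]
  show ?thesis
  proof (rule moduleI)
    show "cring real_ring" by (rule cring_real_ring)
    show "abelian_group W"
    proof (rule abelian_groupI)
      fix x assume "x \<in> carrier W"
      then obtain v where v: "v \<in> carrier V" "x = f v" using surj by auto
      show "\<exists>y\<in>carrier W. y \<oplus>\<^bsub>W\<^esub> x = \<zero>\<^bsub>W\<^esub>"
        using v surj by (auto intro!: bexI[of _ "\<ominus>\<^bsub>V\<^esub> v"] simp: f_add V.l_neg zero)
    qed (auto simp: surj f_add zero[symmetric] V.a_ac)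
  qed (auto simp: surj f_add f_smult V V.a_closed real_space_closed real_space_smult_add
      real_space_add_smult real_space_smult_assoc real_space_smult_one)
qed

section \<open>Submodules, cosets and quotient spaces\<close>

context
  fixes V :: "(real, 'a) module" and N
  assumes V: "real_space V" and N: "submodule N real_ring V"
begin

lemma submodule_abelian_subgroup: "abelian_subgroup N V"
  using N by (intro abelian_subgroupI3 real_space_abelian_group V)
    (simp add: submodule_def additive_subgroup_def)

lemma coset_eq_iff:
  assumes "x \<in> carrier V" "y \<in> carrier V"
  shows "N +>\<^bsub>V\<^esub> x = N +>\<^bsub>V\<^esub> y \<longleftrightarrow> x \<ominus>\<^bsub>V\<^esub> y \<in> N"
proof -
  interpret abelian_subgroup N V by (rule submodule_abelian_subgroup)
  show ?thesis
    using a_rcos_module[OF assms(2,1)] assms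
    by (metis a_minus_def a_rcos_self a_repr_independence')
qed

lemma coset_memD: "\<lbrakk>x \<in> carrier V; y \<in> N +>\<^bsub>V\<^esub> x\<rbrakk> \<Longrightarrow> y \<in> carrier V \<and> N +>\<^bsub>V\<^esub> y = N +>\<^bsub>V\<^esub> x"
proof -
  interpret abelian_subgroup N V by (rule submodule_abelian_subgroup)
  show "\<lbrakk>x \<in> carrier V; y \<in> N +>\<^bsub>V\<^esub> x\<rbrakk> \<Longrightarrow> y \<in> carrier V \<and> N +>\<^bsub>V\<^esub> y = N +>\<^bsub>V\<^esub> x"
    by (metis a_elemrcos_carrier a_repr_independence')
qed

lemma coset_self: "x \<in> carrier V \<Longrightarrow> x \<in> N +>\<^bsub>V\<^esub> x"
  using abelian_subgroup.a_rcos_self[OF submodule_abelian_subgroup] .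

lemma coset_zero: "N +>\<^bsub>V\<^esub> \<zero>\<^bsub>V\<^esub> = N"
  using abelian_group.a_coset_add_zero[OF real_space_abelian_group[OF V]] N
  by (simp add: submodule_iff V)

end

text \<open>Maps on cosets are defined throughout as unions over all representatives. Two
  representatives differ by an element of \<open>N\<close>, whose image lies in \<open>N'\<close>,
  so all members of the union coincide and the union is a single coset.\<close>

lemma coset_map_eq:
  assumes V: "real_space V" and N: "submodule N real_ring V" and W: "real_space W" and N': "submodule N' real_ring W" and f: "linear_map V W f"
    and sub: "\<And>x. x \<in> N \<Longrightarrow> f x \<in> N'" and x: "x \<in> carrier V"
  shows "(\<Union>y\<in>N +>\<^bsub>V\<^esub> x. N' +>\<^bsub>W\<^esub> f y) = N' +>\<^bsub>W\<^esub> f x"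
proof -
  have "N' +>\<^bsub>W\<^esub> f y = N' +>\<^bsub>W\<^esub> f x" if "y \<in> N +>\<^bsub>V\<^esub> x" for y
  proof -
    have y: "y \<in> carrier V" "y \<ominus>\<^bsub>V\<^esub> x \<in> N"
      using coset_memD[OF V N x that] coset_eq_iff[OF V N] x by auto
    then have "f y \<ominus>\<^bsub>W\<^esub> f x \<in> N'"
      using sub x by (metis V W f linear_map_minus)
    then show ?thesis
      using coset_eq_iff[OF W N'] linear_map_closed[OF f] x y by simp
  qed
  then have "(\<Union>y\<in>N +>\<^bsub>V\<^esub> x. N' +>\<^bsub>W\<^esub> f y) = (\<Union>y\<in>N +>\<^bsub>V\<^esub> x. N' +>\<^bsub>W\<^esub> f x)"
    by (intro SUP_cong) auto
  also have "\<dots> = N' +>\<^bsub>W\<^esub> f x" using coset_self[OF V N x] by blast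
  finally show ?thesis .
qed

lemma quotient_space_simps [simp]:
  "x \<oplus>\<^bsub>quotient_space V N\<^esub> y = x <+>\<^bsub>V\<^esub> y" "\<zero>\<^bsub>quotient_space V N\<^esub> = N"
  "r \<odot>\<^bsub>quotient_space V N\<^esub> K = (\<Union>x\<in>K. N +>\<^bsub>V\<^esub> (r \<odot>\<^bsub>V\<^esub> x))"
  by (auto simp: quotient_space_def)

lemma carrier_quotient_space: "carrier (quotient_space V N) = (\<lambda>x. N +>\<^bsub>V\<^esub> x) ` carrier V"
  by (auto simp: quotient_space_def A_RCOSETS_def' a_r_coset_def')

lemma linear_map_coset:
  assumes V: "real_space V" and N: "submodule N real_ring V"
  shows "linear_map V (quotient_space V N) (\<lambda>x. N +>\<^bsub>V\<^esub> x)"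
proof (rule linear_mapI)
  fix r x assume "x \<in> carrier V"
  moreover have "linear_map V V (\<lambda>x. r \<odot>\<^bsub>V\<^esub> x)"
    by (rule linear_map_smult_const[OF V]) (auto intro: linear_mapI)
  ultimately show "N +>\<^bsub>V\<^esub> (r \<odot>\<^bsub>V\<^esub> x) = r \<odot>\<^bsub>quotient_space V N\<^esub> (N +>\<^bsub>V\<^esub> x)"
    using N by (simp add: coset_map_eq[OF V N V N] submodule_iff[OF V])
next
  fix x y assume "x \<in> carrier V" "y \<in> carrier V"
  then show "N +>\<^bsub>V\<^esub> (x \<oplus>\<^bsub>V\<^esub> y) = (N +>\<^bsub>V\<^esub> x) \<oplus>\<^bsub>quotient_space V N\<^esub> (N +>\<^bsub>V\<^esub> y)"
    by (simp add: abelian_subgroup.a_rcos_sum[OF submodule_abelian_subgroup[OF V N]])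
qed (auto simp: carrier_quotient_space)

lemma real_space_quotient_space:
  assumes V: "real_space V" and N: "submodule N real_ring V"
  shows "real_space (quotient_space V N)"
  by (rule real_space_surj_image[OF V linear_map_coset[OF V N]])
    (auto simp: carrier_quotient_space coset_zero[OF V N])

lemma linear_map_quotient:
  assumes V: "real_space V" and N: "submodule N real_ring V" and f: "linear_map V W f"
    and g: "\<And>x. x \<in> carrier V \<Longrightarrow> g (N +>\<^bsub>V\<^esub> x) = f x"
  shows "linear_map (quotient_space V N) W g"
proof -
  note c = linear_map_coset[OF V N]
  show ?thesis
  proof (rule linear_mapI)
    fix K L r assume "K \<in> carrier (quotient_space V N)"
    then obtain x where x: "x \<in> carrier V" "K = N +>\<^bsub>V\<^esub> x"
      by (auto simp: carrier_quotient_space)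
    then show "g K \<in> carrier W" using f by (simp add: g linear_map_closed)
    show "g (r \<odot>\<^bsub>quotient_space V N\<^esub> K) = r \<odot>\<^bsub>W\<^esub> g K"
      using x f by (simp only: linear_map_smult[OF c, symmetric] g V real_space_closed linear_map_smult)
    assume "L \<in> carrier (quotient_space V N)"
    then obtain y where y: "y \<in> carrier V" "L = N +>\<^bsub>V\<^esub> y"
      by (auto simp: carrier_quotient_space)
    show "g (K \<oplus>\<^bsub>quotient_space V N\<^esub> L) = g K \<oplus>\<^bsub>W\<^esub> g L"
      using x y f by (simp only: linear_map_add[OF c, symmetric] g V real_space_closed linear_map_add)
  qed
qed

lemma submodule_vimage:
  assumes V: "real_space V" and W: "real_space W" and f: "linear_map V W f"
    and N: "submodule N real_ring W"
  shows "submodule {x \<in> carrier V. f x \<in> N} real_ring V"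
  using N by (auto simp: submodule_iff V W real_space_closed linear_map_zero[OF V W f]
      linear_map_add[OF f] linear_map_smult[OF f])

lemma submodule_zero: "real_space W \<Longrightarrow> submodule {\<zero>\<^bsub>W\<^esub>} real_ring W"
  by (simp add: submodule_iff real_space_closed real_space_smult_zero
      abelian_monoid.l_zero[OF real_space_abelian_monoid])

lemma submodule_hull:
  assumes V: "real_space V" and "R \<subseteq> carrier V"
  shows "submodule ((\<lambda>H. submodule H real_ring V) hull R) real_ring V"
proof -
  have "submodule (carrier V) real_ring V"
    using V by (simp add: submodule_iff real_space_closed)
  with assms show ?thesis
    unfolding hull_def by (subst submodule_iff[OF V]) (auto simp: submodule_iff[OF V])
qed

section \<open>Free real vector spaces\<close>

lemma free_space_simps [simp]:
  "\<phi> \<in> carrier (free_space B) \<longleftrightarrow> finite {x. \<phi> x \<noteq> 0} \<and> {x. \<phi> x \<noteq> 0} \<subseteq> B"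
  "\<phi> \<oplus>\<^bsub>free_space B\<^esub> \<psi> = (\<lambda>x. \<phi> x + \<psi> x)" "\<zero>\<^bsub>free_space B\<^esub> = (\<lambda>_. 0)"
  "r \<odot>\<^bsub>free_space B\<^esub> \<phi> = (\<lambda>x. r * \<phi> x)"
  by (auto simp: free_space_def)

lemma real_space_free_space: "real_space (free_space B)"
proof (rule moduleI)
  have fin: "finite {x. \<phi> x + \<psi> x \<noteq> 0}" if "finite {x. \<phi> x \<noteq> 0}" "finite {x. \<psi> x \<noteq> 0}"
    for \<phi> \<psi> :: "'a \<Rightarrow> real"
    by (rule finite_subset[OF _ finite_UnI[OF that]]) auto
  show "abelian_group (free_space B)"
  proof (rule abelian_groupI)
    fix \<phi> assume "\<phi> \<in> carrier (free_space B)"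
    then show "\<exists>y\<in>carrier (free_space B). y \<oplus>\<^bsub>free_space B\<^esub> \<phi> = \<zero>\<^bsub>free_space B\<^esub>"
      by (auto intro!: bexI[of _ "\<lambda>x. - \<phi> x"])
  next
    fix \<phi> \<psi> assume "\<phi> \<in> carrier (free_space B)" "\<psi> \<in> carrier (free_space B)"
    then show "\<phi> \<oplus>\<^bsub>free_space B\<^esub> \<psi> \<in> carrier (free_space B)"
    proof -
      have "{x. \<phi> x + \<psi> x \<noteq> 0} \<subseteq> {x. \<phi> x \<noteq> 0} \<union> {x. \<psi> x \<noteq> 0}" by auto
      also have "\<dots> \<subseteq> B" using \<open>\<phi> \<in> _\<close> \<open>\<psi> \<in> _\<close> by simp
      finally show ?thesis
        using fin[of \<phi> \<psi>] \<open>\<phi> \<in> _\<close> \<open>\<psi> \<in> _\<close> by simp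
    qed
  qed (auto simp: algebra_simps)
  fix a :: real and \<phi> assume "\<phi> \<in> carrier (free_space B)"
  then show "a \<odot>\<^bsub>free_space B\<^esub> \<phi> \<in> carrier (free_space B)"
    by (auto intro: rev_finite_subset)
qed (auto simp: cring_real_ring algebra_simps)

lemma indicator_in_free_space: "x \<in> B \<Longrightarrow> indicator {x} \<in> carrier (free_space B)"
proof -
  have "{y. indicator {x} y \<noteq> (0::real)} = {x}" by (auto simp: indicator_def)
  then show "x \<in> B \<Longrightarrow> indicator {x} \<in> carrier (free_space B)" by simp
qed

lemma free_space_induct [consumes 1, case_names zero indicator add smult]:
  assumes "\<phi> \<in> carrier (free_space B)" and "P (\<lambda>_. 0)"
    and ind: "\<And>x. x \<in> B \<Longrightarrow> P (indicator {x})"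
    and add: "\<And>\<phi> \<psi>. \<lbrakk>\<phi> \<in> carrier (free_space B); \<psi> \<in> carrier (free_space B); P \<phi>; P \<psi>\<rbrakk>
      \<Longrightarrow> P (\<lambda>x. \<phi> x + \<psi> x)"
    and smult: "\<And>r \<phi>. \<lbrakk>\<phi> \<in> carrier (free_space B); P \<phi>\<rbrakk> \<Longrightarrow> P (\<lambda>x. r * \<phi> x)"
  shows "P \<phi>"
proof -
  \<comment> \<open>The set \<open>S\<close> need only contain the support, so the induction removes
    one point at a time even if the value at that point is zero.\<close>
  have "finite S \<Longrightarrow> {x. \<phi> x \<noteq> 0} \<subseteq> S \<Longrightarrow> S \<subseteq> B \<Longrightarrow> P \<phi>" for S \<phi>
  proof (induction S arbitrary: \<phi> rule: finite_induct)
    case empty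
    then have "\<phi> = (\<lambda>_. 0)" by auto
    then show ?case using assms(2) by simp
  next
    case (insert b S)
    have sub: "{x. (\<phi>(b := 0)) x \<noteq> 0} \<subseteq> S" using insert.prems by auto
    have 1: "P (\<phi>(b := 0))" using insert sub by auto
    have 2: "P (\<lambda>x. \<phi> b * indicator {b} x)"
      using insert.prems by (intro smult ind indicator_in_free_space) auto
    have sub': "{x. \<phi> b * indicator {b} x \<noteq> 0} \<subseteq> {b}"
      by (auto simp: indicator_def)
    have "(\<lambda>x. \<phi> b * indicator {b} x) \<in> carrier (free_space B)"
      using finite_subset[OF sub'] subset_trans[OF sub'] insert.prems(2) unfolding free_space_simps by simp
    moreover have "\<phi>(b := 0) \<in> carrier (free_space B)"
      using finite_subset[OF sub insert.hyps(1)] subset_trans[OF sub] insert.prems(2)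
      unfolding free_space_simps by simp
    ultimately have "P (\<lambda>x. (\<phi>(b := 0)) x + \<phi> b * indicator {b} x)"
      using 1 2 by (intro add)
    moreover have "(\<lambda>x. (\<phi>(b := 0)) x + \<phi> b * indicator {b} x) = \<phi>"
      by (auto simp: indicator_def)
    ultimately show ?case by simp
  qed
  then show ?thesis using assms(1) by auto
qed

text \<open>The universal property of the free space.\<close>

lemma free_space_extend:
  assumes W: "real_space W" and \<beta>: "\<And>x. x \<in> B \<Longrightarrow> \<beta> x \<in> carrier W"
  shows "\<exists>L. linear_map (free_space B) W L \<and> (\<forall>x\<in>B. L (indicator {x}) = \<beta> x)"
proof -
  interpret W: abelian_group W by (rule real_space_abelian_group[OF W])
  define L where "L \<phi> = (\<Oplus>\<^bsub>W\<^esub>x\<in>{x. \<phi> x \<noteq> 0}. \<phi> x \<odot>\<^bsub>W\<^esub> \<beta> x)" for \<phi> :: "'b \<Rightarrow> real"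
  have cl: "r \<odot>\<^bsub>W\<^esub> \<beta> x \<in> carrier W" if "x \<in> B" for r x
    using that by (simp add: W \<beta> real_space_closed)
  \<comment> \<open>The sum may run over any finite set of basis elements containing the support, so
    that the sums for \<phi>, \<psi> and \<phi> + \<psi> can share one index set.\<close>
  have L: "L \<phi> = (\<Oplus>\<^bsub>W\<^esub>x\<in>S. \<phi> x \<odot>\<^bsub>W\<^esub> \<beta> x)" if "finite S" "{x. \<phi> x \<noteq> 0} \<subseteq> S" "S \<subseteq> B" for \<phi> S
    unfolding L_def using that cl
    by (intro W.add.finprod_mono_neutral_cong_left) (auto simp: real_space_zero_smult W \<beta>)
  have "linear_map (free_space B) W L"
  proof (rule linear_mapI)
    fix \<phi> \<psi> r
    assume \<phi>: "\<phi> \<in> carrier (free_space B)"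
    show "L \<phi> \<in> carrier W" using \<phi> cl by (auto simp: L_def intro!: W.finsum_closed)
    show "L (r \<odot>\<^bsub>free_space B\<^esub> \<phi>) = r \<odot>\<^bsub>W\<^esub> L \<phi>"
    proof -
      let ?S = "{x. \<phi> x \<noteq> 0}"
      have "L (r \<odot>\<^bsub>free_space B\<^esub> \<phi>) = (\<Oplus>\<^bsub>W\<^esub>x\<in>?S. (r * \<phi> x) \<odot>\<^bsub>W\<^esub> \<beta> x)"
        using \<phi> by (subst L[of ?S]) auto
      also have "\<dots> = (\<Oplus>\<^bsub>W\<^esub>x\<in>?S. r \<odot>\<^bsub>W\<^esub> (\<phi> x \<odot>\<^bsub>W\<^esub> \<beta> x))"
        using \<phi> cl by (intro W.finsum_cong') (auto simp: W \<beta> real_space_smult_assoc)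
      also have "\<dots> = r \<odot>\<^bsub>W\<^esub> L \<phi>"
        using \<phi> cl unfolding L_def
        by (intro Module.module.finsum_smult_ldistr[OF W, symmetric]) auto
      finally show ?thesis .
    qed
    assume \<psi>: "\<psi> \<in> carrier (free_space B)"
    let ?S = "{x. \<phi> x \<noteq> 0} \<union> {x. \<psi> x \<noteq> 0}"
    have S: "finite ?S" "?S \<subseteq> B" using \<phi> \<psi> by auto
    have "L (\<phi> \<oplus>\<^bsub>free_space B\<^esub> \<psi>) = (\<Oplus>\<^bsub>W\<^esub>x\<in>?S. (\<phi> x + \<psi> x) \<odot>\<^bsub>W\<^esub> \<beta> x)"
      using S by (subst L[OF S(1) _ S(2)]) auto
    also have "\<dots> = (\<Oplus>\<^bsub>W\<^esub>x\<in>?S. \<phi> x \<odot>\<^bsub>W\<^esub> \<beta> x \<oplus>\<^bsub>W\<^esub> \<psi> x \<odot>\<^bsub>W\<^esub> \<beta> x)"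
      using S cl by (intro W.finsum_cong') (auto simp: real_space_add_smult W \<beta>)
    also have "\<dots> = L \<phi> \<oplus>\<^bsub>W\<^esub> L \<psi>"
      using S cl unfolding L[OF S(1) Un_upper1 S(2)] L[OF S(1) Un_upper2 S(2)]
      by (intro W.finsum_addf) auto
    finally show "L (\<phi> \<oplus>\<^bsub>free_space B\<^esub> \<psi>) = L \<phi> \<oplus>\<^bsub>W\<^esub> L \<psi>" .
  qed
  moreover have "L (indicator {x}) = \<beta> x" if "x \<in> B" for x
    using that cl by (subst L[of "{x}"]) (auto simp: indicator_def W \<beta> real_space_smult_one)
  ultimately show ?thesis by blast
qed

lemma free_map_indicator: "free_map f (indicator {x}) = indicator {f x}"
proof
  fix y
  have "{x'. indicator {x} x' \<noteq> (0::real) \<and> f x' = y} = (if f x = y then {x} else {})"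
    by (auto simp: indicator_def)
  then show "free_map f (indicator {x}) y = indicator {f x} y"
    by (simp add: free_map_def indicator_def)
qed

lemma linear_map_free_map:
  assumes f: "\<And>x. x \<in> B \<Longrightarrow> f x \<in> B'"
  shows "linear_map (free_space B) (free_space B') (free_map f)"
proof -
  \<comment> \<open>Written as a sum over a fixed finite set with the condition inside, additivity
    reduces to \<open>sum.distrib\<close>; the index sets in the definition vary with the
    support.\<close>
  have eq: "free_map f \<phi> y = (\<Sum>x\<in>S. if f x = y then \<phi> x else 0)"
    if "finite S" "{x. \<phi> x \<noteq> 0} \<subseteq> S" for \<phi> S y
    unfolding free_map_def using that by (intro sum.mono_neutral_cong_left) auto
  show ?thesis
  proof (rule linear_mapI)
    fix \<phi> \<psi> r
    assume \<phi>: "\<phi> \<in> carrier (free_space B)"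
    have sub: "{y. free_map f \<phi> y \<noteq> 0} \<subseteq> f ` {x. \<phi> x \<noteq> 0}"
    proof (rule subsetI, rule ccontr)
      fix y assume y: "y \<in> {y. free_map f \<phi> y \<noteq> 0}" "y \<notin> f ` {x. \<phi> x \<noteq> 0}"
      then have "{x. \<phi> x \<noteq> 0 \<and> f x = y} = {}" by auto
      then have "free_map f \<phi> y = 0" unfolding free_map_def by (simp only: sum.empty)
      with y show False by simp
    qed
    show "free_map f \<phi> \<in> carrier (free_space B')"
    proof -
      have "f ` {x. \<phi> x \<noteq> 0} \<subseteq> B'" using \<phi> f by auto
      then show ?thesis using \<phi> finite_subset[OF sub] subset_trans[OF sub] by simp
    qed
    show "free_map f (r \<odot>\<^bsub>free_space B\<^esub> \<phi>) = r \<odot>\<^bsub>free_space B'\<^esub> free_map f \<phi>"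
    proof
      fix y
      let ?S = "{x. \<phi> x \<noteq> 0}"
      have S: "finite ?S" "{x. r * \<phi> x \<noteq> 0} \<subseteq> ?S" using \<phi> by auto
      show "free_map f (r \<odot>\<^bsub>free_space B\<^esub> \<phi>) y = (r \<odot>\<^bsub>free_space B'\<^esub> free_map f \<phi>) y"
        unfolding free_space_simps eq[OF S] eq[OF S(1) subset_refl] sum_distrib_left
        by (rule sum.cong) auto
    qed
    assume \<psi>: "\<psi> \<in> carrier (free_space B)"
    let ?S = "{x. \<phi> x \<noteq> 0} \<union> {x. \<psi> x \<noteq> 0}"
    have S: "finite ?S" using \<phi> \<psi> by auto
    have sub: "{x. \<phi> x + \<psi> x \<noteq> 0} \<subseteq> ?S" by auto
    show "free_map f (\<phi> \<oplus>\<^bsub>free_space B\<^esub> \<psi>) = free_map f \<phi> \<oplus>\<^bsub>free_space B'\<^esub> free_map f \<psi>"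
    proof
      fix y
      have "free_map f (\<phi> \<oplus>\<^bsub>free_space B\<^esub> \<psi>) y =
          (\<Sum>x\<in>?S. (if f x = y then \<phi> x else 0) + (if f x = y then \<psi> x else 0))"
        unfolding free_space_simps eq[OF S sub] by (rule sum.cong) auto
      also have "\<dots> = free_map f \<phi> y + free_map f \<psi> y"
        unfolding sum.distrib eq[OF S Un_upper1] eq[OF S Un_upper2] ..
      finally show "free_map f (\<phi> \<oplus>\<^bsub>free_space B\<^esub> \<psi>) y = (free_map f \<phi> \<oplus>\<^bsub>free_space B'\<^esub> free_map f \<psi>) y"
        by simp
    qed
  qed
qed

section \<open>Tensor products of graded modules\<close>

lemma koszul_sign_simps [simp]:
  "koszul_sign 0 i = 1" "koszul_sign i 0 = 1" "koszul_sign i j * koszul_sign i j = 1"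
  "koszul_sign i j * (koszul_sign i j * r) = r"
  by (auto simp: koszul_sign_def)

lemma koszul_sign_commute: "koszul_sign i j = koszul_sign j i"
  by (auto simp: koszul_sign_def)

lemma koszul_sign_add: "koszul_sign l (i + j) = koszul_sign l i * koszul_sign l j"
  by (auto simp: koszul_sign_def)

context graded_vector_space
begin

lemmas gr_closed [simp] = real_space_closed[OF vector_space]
lemmas gr_finsum_closed = real_space_finsum_closed[OF vector_space]
lemmas gr_finsum_cong = real_space_finsum_cong[OF vector_space]
lemmas gr_smult_zero [simp] = real_space_smult_zero[OF vector_space]
lemmas gr_one_smult [simp] = real_space_smult_one[OF vector_space]
lemmas gr_smult_assoc = real_space_smult_assoc[OF vector_space]
lemmas gr_abelian_group = real_space_abelian_group[OF vector_space]
lemmas gr_abelian_monoid = real_space_abelian_monoid[OF vector_space]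

end

lemma (in graded_algebra) linear_mult: "a \<in> carrier (gr A i) \<Longrightarrow> linear_map (gr A j) (gr A (i + j)) (gmult A i j a)"
  and linear_mult_left: "b \<in> carrier (gr A j) \<Longrightarrow> linear_map (gr A i) (gr A (i + j)) (\<lambda>a. gmult A i j a b)"
  using mult_bilinear by (auto simp: bilinear_map_def)

lemma (in graded_algebra) mult_closed [simp]:
  "\<lbrakk>a \<in> carrier (gr A i); b \<in> carrier (gr A j)\<rbrakk> \<Longrightarrow> gmult A i j a b \<in> carrier (gr A (i + j))"
  by (rule linear_map_closed[OF linear_mult])

context graded_module
begin

lemma linear_act: "a \<in> carrier (gr A i) \<Longrightarrow> linear_map (gr M j) (gr M (i + j)) (gact M i j a)"
  and linear_act_left: "x \<in> carrier (gr M j) \<Longrightarrow> linear_map (gr A i) (gr M (i + j)) (\<lambda>a. gact M i j a x)"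
  using act_bilinear by (auto simp: bilinear_map_def)

lemma act_closed [simp]:
  "\<lbrakk>a \<in> carrier (gr A i); x \<in> carrier (gr M j)\<rbrakk> \<Longrightarrow> gact M i j a x \<in> carrier (gr M (i + j))"
  by (rule linear_map_closed[OF linear_act])

lemma act_smult:
  "\<lbrakk>a \<in> carrier (gr A i); x \<in> carrier (gr M j)\<rbrakk> \<Longrightarrow>
    gact M i j a (r \<odot>\<^bsub>gr M j\<^esub> x) = r \<odot>\<^bsub>gr M (i + j)\<^esub> gact M i j a x"
  by (rule linear_map_smult[OF linear_act])

lemma smult_act:
  "\<lbrakk>a \<in> carrier (gr A i); x \<in> carrier (gr M j)\<rbrakk> \<Longrightarrow>
    gact M i j (r \<odot>\<^bsub>gr A i\<^esub> a) x = r \<odot>\<^bsub>gr M (i + j)\<^esub> gact M i j a x"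
  by (rule linear_map_smult[OF linear_act_left])

text \<open>Graded commutativity of the algebra, carried over to the module through
  \<open>act_assoc\<close>; bilinearity of the action moves the sign from the product to the
  result.\<close>

lemma act_commute:
  assumes "a \<in> carrier (gr A i)" "b \<in> carrier (gr A j)" "x \<in> carrier (gr M k)"
  shows "gact M i (j + k) a (gact M j k b x) =
    koszul_sign i j \<odot>\<^bsub>gr M (i + (j + k))\<^esub> gact M j (i + k) b (gact M i k a x)"
proof -
  have ji: "gmult A j i b a \<in> carrier (gr A (i + j))"
    using A.mult_closed[OF assms(2,1)] by (simp add: add.commute)
  have "gact M i (j + k) a (gact M j k b x) = gact M (i + j) k (gmult A i j a b) x"
    using assms by (simp add: act_assoc)
  also have "\<dots> = gact M (i + j) k (koszul_sign i j \<odot>\<^bsub>gr A (i + j)\<^esub> gmult A j i b a) x"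
    using A.graded_commute[OF assms(1,2)] by simp
  also have "\<dots> = koszul_sign i j \<odot>\<^bsub>gr M (i + j + k)\<^esub> gact M (j + i) k (gmult A j i b a) x"
    using assms(3) ji by (simp add: smult_act add.commute)
  also have "\<dots> = koszul_sign i j \<odot>\<^bsub>gr M (i + (j + k))\<^esub> gact M j (i + k) b (gact M i k a x)"
    using assms by (simp add: act_assoc add.assoc)
  finally show ?thesis .
qed

lemma right_act_closed [simp]:
  "\<lbrakk>s \<in> carrier (gr M i); f \<in> carrier (gr A l)\<rbrakk> \<Longrightarrow> right_act M i l s f \<in> carrier (gr M (i + l))"
  using act_closed[of f l s i] by (simp add: right_act_def add.commute)

text \<open>Moving \<open>g\<close> past \<open>f\<close> and past \<open>s\<close> separately
  produces the same sign as moving it past their product, so the two actions commute. This makes the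
  left action on a tensor product compatible with the balancing relation.\<close>

lemma act_right_act:
  assumes "f \<in> carrier (gr A l)" "s \<in> carrier (gr M i)" "g \<in> carrier (gr A m)"
  shows "gact M l (i + m) f (right_act M i m s g) = right_act M (l + i) m (gact M l i f s) g"
proof -
  have 1: "gact M m i g s \<in> carrier (gr M (i + m))"
    using assms act_closed[of g m s i] by (simp add: add.commute)
  have 2: "gact M m (l + i) g (gact M l i f s) \<in> carrier (gr M (l + (i + m)))"
    using act_closed[OF assms(3) act_closed[OF assms(1,2)]] by (simp add: ac_simps)
  have "gact M l (i + m) f (right_act M i m s g) =
    koszul_sign m i \<odot>\<^bsub>gr M (l + (i + m))\<^esub> gact M l (m + i) f (gact M m i g s)"
    using assms 1 by (simp add: right_act_def act_smult add.commute)
  also have "\<dots> = right_act M (l + i) m (gact M l i f s) g"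
    using 2 act_commute[OF assms(1,3,2)]
    by (simp add: right_act_def gr_smult_assoc koszul_sign_add koszul_sign_commute[of l m] ac_simps)
  finally show ?thesis .
qed

end

section \<open>Pure tensors and the universal property of the tensor product\<close>

definition pure_tensor :: "'a graded_alg \<Rightarrow> ('a, 'b) graded_mod \<Rightarrow> ('a, 'c) graded_mod \<Rightarrow> int \<Rightarrow>
    int \<Rightarrow> 'b \<Rightarrow> int \<Rightarrow> 'c \<Rightarrow> (('b, 'c) tensor_symbol \<Rightarrow> real) set" where
  "pure_tensor A M N k i s j p =
     tensor_null A M N k +>\<^bsub>tensor_free M N k\<^esub> indicator {(i, s, j, p)}"

text \<open>Additivity and homogeneity in each factor and the balancing condition match the five
  kinds of relators one by one. The total degree \<open>k\<close> is a separate argument, tied to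
  the bidegrees by side conditions, so that the target space stays fixed while the degrees of the
  factors are rewritten.\<close>

definition balanced_bilinear :: "'a graded_alg \<Rightarrow> ('a, 'b) graded_mod \<Rightarrow> ('a, 'c) graded_mod \<Rightarrow>
    int \<Rightarrow> (real, 'd) module \<Rightarrow> (int \<Rightarrow> 'b \<Rightarrow> int \<Rightarrow> 'c \<Rightarrow> 'd) \<Rightarrow> bool" where
  "balanced_bilinear A M N k W \<beta> \<longleftrightarrow>
     (\<forall>i j. i + j = k \<longrightarrow> bilinear_map (gr M i) (gr N j) W (\<lambda>s p. \<beta> i s j p)) \<and>
     (\<forall>i l j. i + l + j = k \<longrightarrow> (\<forall>s\<in>carrier (gr M i). \<forall>f\<in>carrier (gr A l). \<forall>p\<in>carrier (gr N j).
        \<beta> (i + l) (right_act M i l s f) j p = \<beta> i s (l + j) (gact N l j f p)))"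

lemma balanced_bilinearI:
  assumes "\<And>i j s. \<lbrakk>i + j = k; s \<in> carrier (gr M i)\<rbrakk> \<Longrightarrow> linear_map (gr N j) W (\<beta> i s j)"
    and "\<And>i j p. \<lbrakk>i + j = k; p \<in> carrier (gr N j)\<rbrakk> \<Longrightarrow> linear_map (gr M i) W (\<lambda>s. \<beta> i s j p)"
    and "\<And>i l j s f p. \<lbrakk>i + l + j = k; s \<in> carrier (gr M i); f \<in> carrier (gr A l);
      p \<in> carrier (gr N j)\<rbrakk> \<Longrightarrow> \<beta> (i + l) (right_act M i l s f) j p = \<beta> i s (l + j) (gact N l j f p)"
  shows "balanced_bilinear A M N k W \<beta>"
  using assms by (auto simp: balanced_bilinear_def bilinear_map_def)

lemma balanced_bilinearD:
  assumes "balanced_bilinear A M N k W \<beta>"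
  shows "\<lbrakk>i + j = k; s \<in> carrier (gr M i)\<rbrakk> \<Longrightarrow> linear_map (gr N j) W (\<beta> i s j)"
    and "\<lbrakk>i + j = k; p \<in> carrier (gr N j)\<rbrakk> \<Longrightarrow> linear_map (gr M i) W (\<lambda>s. \<beta> i s j p)"
    and "\<lbrakk>i + l + j = k; s \<in> carrier (gr M i); f \<in> carrier (gr A l); p \<in> carrier (gr N j)\<rbrakk> \<Longrightarrow>
      \<beta> (i + l) (right_act M i l s f) j p = \<beta> i s (l + j) (gact N l j f p)"
  using assms by (auto simp: balanced_bilinear_def bilinear_map_def)

lemma (in graded_module) balanced_bilinear_cong:
  assumes N: "graded_module A N" and bal: "balanced_bilinear A M N k W \<beta>"
    and eq: "\<And>i s j p. \<lbrakk>i + j = k; s \<in> carrier (gr M i); p \<in> carrier (gr N j)\<rbrakk> \<Longrightarrow> \<beta> i s j p = \<gamma> i s j p"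
  shows "balanced_bilinear A M N k W \<gamma>"
proof -
  interpret N: graded_module A N by (rule N)
  show ?thesis
  proof (rule balanced_bilinearI)
    fix i j s assume *: "i + j = k" "s \<in> carrier (gr M i)"
    show "linear_map (gr N j) W (\<gamma> i s j)"
      by (rule linear_map_cong[OF balanced_bilinearD(1)[OF bal *] N.vector_space]) (rule eq[OF *])
  next
    fix i j p assume *: "i + j = k" "p \<in> carrier (gr N j)"
    show "linear_map (gr M i) W (\<lambda>s. \<gamma> i s j p)"
      by (rule linear_map_cong[OF balanced_bilinearD(2)[OF bal *] vector_space]) (rule eq[OF *(1) _ *(2)])
  next
    fix i l j s f p
    assume *: "i + l + j = k" "s \<in> carrier (gr M i)" "f \<in> carrier (gr A l)" "p \<in> carrier (gr N j)"
    have "\<beta> (i + l) (right_act M i l s f) j p = \<gamma> (i + l) (right_act M i l s f) j p"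
      "\<beta> i s (l + j) (gact N l j f p) = \<gamma> i s (l + j) (gact N l j f p)"
      using * by (auto intro!: eq)
    with balanced_bilinearD(3)[OF bal *]
    show "\<gamma> (i + l) (right_act M i l s f) j p = \<gamma> i s (l + j) (gact N l j f p)" by simp
  qed
qed

lemma tensor_module_simps:
  "gr (tensor_module A M N) k = quotient_space (tensor_free M N k) (tensor_null A M N k)"
  "gact (tensor_module A M N) l k f T =
     (\<Union>\<phi>\<in>T. tensor_null A M N (l + k) +>\<^bsub>tensor_free M N (l + k)\<^esub>
         free_map (\<lambda>(i, s, j, p). (l + i, gact M l i f s, j, p)) \<phi>)"
  by (auto simp: tensor_module_def)

locale tensor_pair = M: graded_module A M + N: graded_module A N
  for A :: "'a graded_alg" and M :: "('a, 'b) graded_mod" and N :: "('a, 'c) graded_mod"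
begin

abbreviation "symbols k \<equiv> {(i, s, j, p) | i s j p. i + j = k \<and> s \<in> carrier (gr M i) \<and> p \<in> carrier (gr N j)}"
abbreviation "ten \<equiv> pure_tensor A M N"
abbreviation "T \<equiv> tensor_module A M N"

lemma real_space_tensor_free: "real_space (tensor_free M N k)"
  unfolding tensor_free_def by (rule real_space_free_space)

lemma indicator_in_tensor_free:
  "\<lbrakk>i + j = k; s \<in> carrier (gr M i); p \<in> carrier (gr N j)\<rbrakk> \<Longrightarrow>
    indicator {(i, s, j, p)} \<in> carrier (tensor_free M N k)"
  unfolding tensor_free_def by (rule indicator_in_free_space) auto

lemma tensor_free_minus:
  assumes "\<phi> \<in> carrier (tensor_free M N k)" "\<psi> \<in> carrier (tensor_free M N k)"
  shows "\<phi> \<ominus>\<^bsub>tensor_free M N k\<^esub> \<psi> = (\<lambda>x. \<phi> x - \<psi> x)"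
  using assms real_space_minus_smult[OF real_space_tensor_free[of k], of \<psi>, symmetric]
  by (simp add: a_minus_def) (simp add: tensor_free_def)

lemma tensor_free_ops:
  "\<phi> \<oplus>\<^bsub>tensor_free M N k\<^esub> \<psi> = (\<lambda>x. \<phi> x + \<psi> x)" "r \<odot>\<^bsub>tensor_free M N k\<^esub> \<phi> = (\<lambda>x. r * \<phi> x)"
  "\<zero>\<^bsub>tensor_free M N k\<^esub> = (\<lambda>_. 0)"
  by (auto simp: tensor_free_def)

text \<open>The relators are inspected only once: each is a difference a - b of elements on which
  every linear map with balanced bilinear values on symbols agrees. Both the inclusion of the
  relators in the free space and the statement on kernels are read off from this form.\<close>

lemma tensor_relators_cases:
  assumes "\<phi> \<in> tensor_relators A M N k"
  shows "\<exists>a b. \<phi> = a \<ominus>\<^bsub>tensor_free M N k\<^esub> b \<and>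
    a \<in> carrier (tensor_free M N k) \<and> b \<in> carrier (tensor_free M N k) \<and>
    (\<forall>L. linear_map (tensor_free M N k) W L \<longrightarrow>
      balanced_bilinear A M N k W (\<lambda>i s j p. L (indicator {(i, s, j, p)})) \<longrightarrow> L a = L b)"
proof -
  let ?F = "tensor_free M N k"
  let ?P = "\<lambda>a b. \<phi> = a \<ominus>\<^bsub>?F\<^esub> b \<and> a \<in> carrier ?F \<and> b \<in> carrier ?F \<and>
    (\<forall>L. linear_map ?F W L \<longrightarrow>
      balanced_bilinear A M N k W (\<lambda>i s j p. L (indicator {(i, s, j, p)})) \<longrightarrow> L a = L b)"
  note I = indicator_in_tensor_free and cl = real_space_closed[OF real_space_tensor_free]
  from assms show ?thesis
  proof cases
    case (add_left i j s s' p)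
    let ?a = "indicator {(i, s \<oplus>\<^bsub>gr M i\<^esub> s', j, p)}"
    let ?b = "indicator {(i, s, j, p)} \<oplus>\<^bsub>?F\<^esub> indicator {(i, s', j, p)}"
    have "?a \<in> carrier ?F" "?b \<in> carrier ?F" using add_left by (auto intro!: I cl)
    moreover have "\<phi> = ?a \<ominus>\<^bsub>?F\<^esub> ?b"
      unfolding tensor_free_minus[OF calculation] by (simp add: add_left tensor_free_ops algebra_simps)
    moreover have "L ?a = L ?b" if "linear_map ?F W L"
      "balanced_bilinear A M N k W (\<lambda>i s j p. L (indicator {(i, s, j, p)}))" for L
      using linear_map_add[OF balanced_bilinearD(2)[OF that(2)]] linear_map_add[OF that(1)]
        add_left by (simp add: I)
    ultimately have "?P ?a ?b" by blast
    then show ?thesis by blast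
  next
    case (add_right i j s p p')
    let ?a = "indicator {(i, s, j, p \<oplus>\<^bsub>gr N j\<^esub> p')}"
    let ?b = "indicator {(i, s, j, p)} \<oplus>\<^bsub>?F\<^esub> indicator {(i, s, j, p')}"
    have "?a \<in> carrier ?F" "?b \<in> carrier ?F" using add_right by (auto intro!: I cl)
    moreover have "\<phi> = ?a \<ominus>\<^bsub>?F\<^esub> ?b"
      unfolding tensor_free_minus[OF calculation] by (simp add: add_right tensor_free_ops algebra_simps)
    moreover have "L ?a = L ?b" if "linear_map ?F W L"
      "balanced_bilinear A M N k W (\<lambda>i s j p. L (indicator {(i, s, j, p)}))" for L
      using linear_map_add[OF balanced_bilinearD(1)[OF that(2)]] linear_map_add[OF that(1)]
        add_right by (simp add: I)
    ultimately have "?P ?a ?b" by blast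
    then show ?thesis by blast
  next
    case (smult_left i j s p r)
    let ?a = "indicator {(i, r \<odot>\<^bsub>gr M i\<^esub> s, j, p)}"
    let ?b = "r \<odot>\<^bsub>?F\<^esub> indicator {(i, s, j, p)}"
    have "?a \<in> carrier ?F" "?b \<in> carrier ?F" using smult_left by (auto intro!: I cl)
    moreover have "\<phi> = ?a \<ominus>\<^bsub>?F\<^esub> ?b"
      unfolding tensor_free_minus[OF calculation] by (simp add: smult_left tensor_free_ops)
    moreover have "L ?a = L ?b" if "linear_map ?F W L"
      "balanced_bilinear A M N k W (\<lambda>i s j p. L (indicator {(i, s, j, p)}))" for L
      using linear_map_smult[OF balanced_bilinearD(2)[OF that(2)]] linear_map_smult[OF that(1)]
        smult_left by (simp add: I)
    ultimately have "?P ?a ?b" by blast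
    then show ?thesis by blast
  next
    case (smult_right i j s p r)
    let ?a = "indicator {(i, s, j, r \<odot>\<^bsub>gr N j\<^esub> p)}"
    let ?b = "r \<odot>\<^bsub>?F\<^esub> indicator {(i, s, j, p)}"
    have "?a \<in> carrier ?F" "?b \<in> carrier ?F" using smult_right by (auto intro!: I cl)
    moreover have "\<phi> = ?a \<ominus>\<^bsub>?F\<^esub> ?b"
      unfolding tensor_free_minus[OF calculation] by (simp add: smult_right tensor_free_ops)
    moreover have "L ?a = L ?b" if "linear_map ?F W L"
      "balanced_bilinear A M N k W (\<lambda>i s j p. L (indicator {(i, s, j, p)}))" for L
      using linear_map_smult[OF balanced_bilinearD(1)[OF that(2)]] linear_map_smult[OF that(1)]
        smult_right by (simp add: I)
    ultimately have "?P ?a ?b" by blast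
    then show ?thesis by blast
  next
    case (balanced i l j s f p)
    let ?a = "indicator {(i + l, right_act M i l s f, j, p)}"
    let ?b = "indicator {(i, s, l + j, gact N l j f p)}"
    have "?a \<in> carrier ?F" "?b \<in> carrier ?F" using balanced by (auto intro!: I)
    moreover have "\<phi> = ?a \<ominus>\<^bsub>?F\<^esub> ?b"
      unfolding tensor_free_minus[OF calculation] by (simp add: balanced)
    moreover have "L ?a = L ?b" if "linear_map ?F W L"
      "balanced_bilinear A M N k W (\<lambda>i s j p. L (indicator {(i, s, j, p)}))" for L
      using balanced_bilinearD(3)[OF that(2)] balanced by simp
    ultimately have "?P ?a ?b" by blast
    then show ?thesis by blast
  qed
qed

lemma tensor_relators_subset: "tensor_relators A M N k \<subseteq> carrier (tensor_free M N k)"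
proof
  fix \<phi> assume \<phi>: "\<phi> \<in> tensor_relators A M N k"
  obtain a b where "\<phi> = a \<ominus>\<^bsub>tensor_free M N k\<^esub> b"
    "a \<in> carrier (tensor_free M N k)" "b \<in> carrier (tensor_free M N k)"
    using tensor_relators_cases[OF \<phi>, of "gr M 0"] by blast
  then show "\<phi> \<in> carrier (tensor_free M N k)"
    by (simp add: real_space_closed[OF real_space_tensor_free])
qed

lemma submodule_tensor_null: "submodule (tensor_null A M N k) real_ring (tensor_free M N k)"
  unfolding tensor_null_def
  by (rule submodule_hull[OF real_space_tensor_free tensor_relators_subset])

text \<open>The kernel of \<open>L\<close> is a submodule containing the relators, and
  \<open>tensor_null\<close> is the smallest such.\<close>

lemma tensor_null_kernel:
  assumes W: "real_space W" and L: "linear_map (tensor_free M N k) W L"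
    and bal: "balanced_bilinear A M N k W (\<lambda>i s j p. L (indicator {(i, s, j, p)}))"
    and \<phi>: "\<phi> \<in> tensor_null A M N k"
  shows "L \<phi> = \<zero>\<^bsub>W\<^esub>"
proof -
  let ?F = "tensor_free M N k"
  have "tensor_null A M N k \<subseteq> {\<phi> \<in> carrier ?F. L \<phi> \<in> {\<zero>\<^bsub>W\<^esub>}}"
    unfolding tensor_null_def
  proof (rule hull_minimal)
    show "submodule {\<phi> \<in> carrier ?F. L \<phi> \<in> {\<zero>\<^bsub>W\<^esub>}} real_ring ?F"
      by (rule submodule_vimage[OF real_space_tensor_free W L submodule_zero[OF W]])
    show "tensor_relators A M N k \<subseteq> {\<phi> \<in> carrier ?F. L \<phi> \<in> {\<zero>\<^bsub>W\<^esub>}}"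
    proof
      fix \<phi> assume \<phi>: "\<phi> \<in> tensor_relators A M N k"
      then obtain a b where ab: "\<phi> = a \<ominus>\<^bsub>?F\<^esub> b" "a \<in> carrier ?F" "b \<in> carrier ?F" "L a = L b"
        using tensor_relators_cases[OF \<phi>, of W] L bal by blast
      have "L \<phi> = \<zero>\<^bsub>W\<^esub>"
        using ab linear_map_minus[OF real_space_tensor_free W L] linear_map_closed[OF L]
        by (simp add: a_minus_def abelian_group.r_neg[OF real_space_abelian_group[OF W]])
      then show "\<phi> \<in> {\<phi> \<in> carrier ?F. L \<phi> \<in> {\<zero>\<^bsub>W\<^esub>}}"
        using \<phi> tensor_relators_subset by auto
    qed
  qed
  with \<phi> show ?thesis by blast
qed

lemma real_space_tensor: "real_space (gr T k)"
  unfolding tensor_module_simps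
  by (rule real_space_quotient_space[OF real_space_tensor_free submodule_tensor_null])

lemma linear_map_tensor_coset:
  "linear_map (tensor_free M N k) (gr T k) (\<lambda>\<phi>. tensor_null A M N k +>\<^bsub>tensor_free M N k\<^esub> \<phi>)"
  unfolding tensor_module_simps by (rule linear_map_coset[OF real_space_tensor_free submodule_tensor_null])

lemma balanced_bilinear_pure_tensor: "balanced_bilinear A M N k (gr T k) (ten k)"
proof -
  let ?F = "tensor_free M N k" and ?N = "tensor_null A M N k"
  note I = indicator_in_tensor_free and cl = real_space_closed[OF real_space_tensor_free]
  note add = linear_map_add[OF linear_map_tensor_coset[of k]]
    and smult = linear_map_smult[OF linear_map_tensor_coset[of k]]
    and closed = linear_map_closed[OF linear_map_tensor_coset[of k]]
  have eq: "?N +>\<^bsub>?F\<^esub> a = ?N +>\<^bsub>?F\<^esub> b"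
    if "(\<lambda>x. a x - b x) \<in> tensor_relators A M N k" "a \<in> carrier ?F" "b \<in> carrier ?F" for a b
    using that hull_subset[of "tensor_relators A M N k"]
    by (subst coset_eq_iff[OF real_space_tensor_free submodule_tensor_null])
      (auto simp: tensor_free_minus tensor_null_def)
  show ?thesis
  proof (rule balanced_bilinearI)
    fix i j s assume k: "i + j = k" and s: "s \<in> carrier (gr M i)"
    show "linear_map (gr N j) (gr T k) (ten k i s j)"
    proof (rule linear_mapI)
      fix p p' r assume p: "p \<in> carrier (gr N j)"
      show "ten k i s j p \<in> carrier (gr T k)" using k s p by (simp add: pure_tensor_def closed I)
      have "(\<lambda>x. indicator {(i, s, j, r \<odot>\<^bsub>gr N j\<^esub> p)} x - (r \<odot>\<^bsub>?F\<^esub> indicator {(i, s, j, p)}) x)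
          \<in> tensor_relators A M N k"
        using tensor_relators.smult_right[OF k s p] by (simp add: tensor_free_ops)
      from eq[OF this] show "ten k i s j (r \<odot>\<^bsub>gr N j\<^esub> p) = r \<odot>\<^bsub>gr T k\<^esub> ten k i s j p"
        using k s p by (simp add: pure_tensor_def smult[symmetric] I cl)
      assume p': "p' \<in> carrier (gr N j)"
      have "(\<lambda>x. indicator {(i, s, j, p \<oplus>\<^bsub>gr N j\<^esub> p')} x -
          (indicator {(i, s, j, p)} \<oplus>\<^bsub>?F\<^esub> indicator {(i, s, j, p')}) x) \<in> tensor_relators A M N k"
        using tensor_relators.add_right[OF k s p p'] by (simp add: tensor_free_ops algebra_simps)
      from eq[OF this] show "ten k i s j (p \<oplus>\<^bsub>gr N j\<^esub> p') = ten k i s j p \<oplus>\<^bsub>gr T k\<^esub> ten k i s j p'"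
        using k s p p' by (simp add: pure_tensor_def add[symmetric] I cl)
    qed
  next
    fix i j p assume k: "i + j = k" and p: "p \<in> carrier (gr N j)"
    show "linear_map (gr M i) (gr T k) (\<lambda>s. ten k i s j p)"
    proof (rule linear_mapI)
      fix s s' r assume s: "s \<in> carrier (gr M i)"
      show "ten k i s j p \<in> carrier (gr T k)" using k s p by (simp add: pure_tensor_def closed I)
      have "(\<lambda>x. indicator {(i, r \<odot>\<^bsub>gr M i\<^esub> s, j, p)} x - (r \<odot>\<^bsub>?F\<^esub> indicator {(i, s, j, p)}) x)
          \<in> tensor_relators A M N k"
        using tensor_relators.smult_left[OF k s p] by (simp add: tensor_free_ops)
      from eq[OF this] show "ten k i (r \<odot>\<^bsub>gr M i\<^esub> s) j p = r \<odot>\<^bsub>gr T k\<^esub> ten k i s j p"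
        using k s p by (simp add: pure_tensor_def smult[symmetric] I cl)
      assume s': "s' \<in> carrier (gr M i)"
      have "(\<lambda>x. indicator {(i, s \<oplus>\<^bsub>gr M i\<^esub> s', j, p)} x -
          (indicator {(i, s, j, p)} \<oplus>\<^bsub>?F\<^esub> indicator {(i, s', j, p)}) x) \<in> tensor_relators A M N k"
        using tensor_relators.add_left[OF k s s' p] by (simp add: tensor_free_ops algebra_simps)
      from eq[OF this] show "ten k i (s \<oplus>\<^bsub>gr M i\<^esub> s') j p = ten k i s j p \<oplus>\<^bsub>gr T k\<^esub> ten k i s' j p"
        using k s p s' by (simp add: pure_tensor_def add[symmetric] I cl)
    qed
  next
    fix i l j s f p
    assume "i + l + j = k" "s \<in> carrier (gr M i)" "f \<in> carrier (gr A l)" "p \<in> carrier (gr N j)"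
    then show "ten k (i + l) (right_act M i l s f) j p = ten k i s (l + j) (gact N l j f p)"
      unfolding pure_tensor_def by (intro eq tensor_relators.balanced I) auto
  qed
qed

lemmas ten_linear_right = balanced_bilinearD(1)[OF balanced_bilinear_pure_tensor]
lemmas ten_linear_left = balanced_bilinearD(2)[OF balanced_bilinear_pure_tensor]
lemmas ten_balanced = balanced_bilinearD(3)[OF balanced_bilinear_pure_tensor]

text \<open>Scalar multiples have no case of their own, because a scalar is absorbed by the first
  factor of a pure tensor.\<close>

lemma tensor_induct [consumes 1, case_names zero pure add]:
  assumes t: "t \<in> carrier (gr T k)" and zero: "P \<zero>\<^bsub>gr T k\<^esub>"
    and pure: "\<And>i s j p. \<lbrakk>i + j = k; s \<in> carrier (gr M i); p \<in> carrier (gr N j)\<rbrakk> \<Longrightarrow> P (ten k i s j p)"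
    and add: "\<And>t u. \<lbrakk>t \<in> carrier (gr T k); u \<in> carrier (gr T k); P t; P u\<rbrakk> \<Longrightarrow> P (t \<oplus>\<^bsub>gr T k\<^esub> u)"
  shows "P t"
proof -
  let ?F = "tensor_free M N k" and ?N = "tensor_null A M N k"
  note lin = linear_map_tensor_coset[of k]
  \<comment> \<open>Strengthened by an arbitrary scalar, so that the scalar case of the induction
    over the free space merely multiplies two scalars.\<close>
  have "\<forall>r. P (r \<odot>\<^bsub>gr T k\<^esub> (?N +>\<^bsub>?F\<^esub> \<phi>))" if "\<phi> \<in> carrier ?F" for \<phi>
    using that unfolding tensor_free_def
  proof (induction \<phi> rule: free_space_induct)
    case zero
    have "?N +>\<^bsub>?F\<^esub> (\<lambda>_. 0) = \<zero>\<^bsub>gr T k\<^esub>"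
      using linear_map_zero[OF real_space_tensor_free real_space_tensor lin]
      by (simp add: tensor_free_ops)
    then show ?case
      using assms(2) real_space_smult_zero[OF real_space_tensor] by (simp add: tensor_free_def)
  next
    case (indicator x)
    then obtain i s j p where x: "x = (i, s, j, p)" "i + j = k" "s \<in> carrier (gr M i)" "p \<in> carrier (gr N j)"
      by auto
    have "r \<odot>\<^bsub>gr T k\<^esub> ten k i s j p = ten k i (r \<odot>\<^bsub>gr M i\<^esub> s) j p" for r
      using x by (simp add: linear_map_smult[OF ten_linear_left])
    then show ?case
      using pure x by (simp add: pure_tensor_def tensor_free_def)
  next
    case (add \<phi> \<psi>)
    then have \<phi>: "\<phi> \<in> carrier ?F" "\<psi> \<in> carrier ?F" by (simp_all add: tensor_free_def)
    have "r \<odot>\<^bsub>gr T k\<^esub> (?N +>\<^bsub>?F\<^esub> (\<lambda>x. \<phi> x + \<psi> x)) =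
      r \<odot>\<^bsub>gr T k\<^esub> (?N +>\<^bsub>?F\<^esub> \<phi>) \<oplus>\<^bsub>gr T k\<^esub> r \<odot>\<^bsub>gr T k\<^esub> (?N +>\<^bsub>?F\<^esub> \<psi>)" for r
      using linear_map_add[OF lin \<phi>] linear_map_closed[OF lin \<phi>(1)] linear_map_closed[OF lin \<phi>(2)]
      by (simp add: tensor_free_ops real_space_smult_add[OF real_space_tensor])
    then show ?case
      using assms(4) add.IH linear_map_closed[OF lin \<phi>(1)] linear_map_closed[OF lin \<phi>(2)]
        real_space_smult_closed[OF real_space_tensor]
      by (simp add: tensor_free_def[symmetric])
  next
    case (smult r \<phi>)
    then have \<phi>: "\<phi> \<in> carrier ?F" by (simp add: tensor_free_def)
    have "q \<odot>\<^bsub>gr T k\<^esub> (?N +>\<^bsub>?F\<^esub> (\<lambda>x. r * \<phi> x)) = (q * r) \<odot>\<^bsub>gr T k\<^esub> (?N +>\<^bsub>?F\<^esub> \<phi>)" for q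
      using linear_map_smult[OF lin \<phi>] linear_map_closed[OF lin \<phi>]
      by (simp add: tensor_free_ops real_space_smult_assoc[OF real_space_tensor])
    then show ?case using smult.IH by (simp add: tensor_free_def[symmetric])
  qed
  moreover obtain \<phi> where "\<phi> \<in> carrier ?F" "t = ?N +>\<^bsub>?F\<^esub> \<phi>"
    using t by (auto simp: tensor_module_simps carrier_quotient_space)
  ultimately show ?thesis
    using real_space_smult_one[OF real_space_tensor t] by metis
qed

lemma tensor_map_eq:
  assumes "real_space W" "linear_map (gr T k) W f" "linear_map (gr T k) W g"
    and "\<And>i s j p. \<lbrakk>i + j = k; s \<in> carrier (gr M i); p \<in> carrier (gr N j)\<rbrakk> \<Longrightarrow>
      f (ten k i s j p) = g (ten k i s j p)"
    and "t \<in> carrier (gr T k)"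
  shows "f t = g t"
  using assms(5)
proof (induction t rule: tensor_induct)
  case zero
  show ?case using assms(1-3) by (simp add: linear_map_zero[OF real_space_tensor])
qed (use assms in \<open>simp_all add: linear_map_add\<close>)

text \<open>Existence half of the universal property; uniqueness is \<open>tensor_map_eq\<close>.
  The extension of \<beta> to the free space vanishes on \<open>tensor_null\<close> and therefore
  descends to cosets.\<close>

lemma tensor_lift:
  assumes W: "real_space W" and bal: "balanced_bilinear A M N k W \<beta>"
  shows "\<exists>L. linear_map (gr T k) W L \<and>
    (\<forall>i s j p. i + j = k \<longrightarrow> s \<in> carrier (gr M i) \<longrightarrow> p \<in> carrier (gr N j) \<longrightarrow>
      L (ten k i s j p) = \<beta> i s j p)"
proof -
  let ?F = "tensor_free M N k" and ?N = "tensor_null A M N k"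
  have "\<exists>L. linear_map (free_space (symbols k)) W L \<and>
      (\<forall>x\<in>symbols k. L (indicator {x}) = (case x of (i, s, j, p) \<Rightarrow> \<beta> i s j p))"
    using balanced_bilinearD(1)[OF bal] W
    by (intro free_space_extend) (auto intro: linear_map_closed)
  then obtain L where L: "linear_map ?F W L"
    and L_ind: "\<And>i s j p. \<lbrakk>i + j = k; s \<in> carrier (gr M i); p \<in> carrier (gr N j)\<rbrakk> \<Longrightarrow>
      L (indicator {(i, s, j, p)}) = \<beta> i s j p"
    unfolding tensor_free_def by auto
  have bal': "balanced_bilinear A M N k W (\<lambda>i s j p. L (indicator {(i, s, j, p)}))"
    using L_ind by (intro M.balanced_bilinear_cong[OF N.graded_module_axioms bal]) auto
  \<comment> \<open>\<open>G\<close> evaluates \<open>L\<close> at a chosen representative; the next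
    step shows that every representative gives the same value.\<close>
  define G where "G t = L (SOME \<phi>. \<phi> \<in> carrier ?F \<and> t = ?N +>\<^bsub>?F\<^esub> \<phi>)" for t
  have G: "G (?N +>\<^bsub>?F\<^esub> \<phi>) = L \<phi>" if "\<phi> \<in> carrier ?F" for \<phi>
  proof -
    define \<psi> where "\<psi> = (SOME \<psi>. \<psi> \<in> carrier ?F \<and> ?N +>\<^bsub>?F\<^esub> \<phi> = ?N +>\<^bsub>?F\<^esub> \<psi>)"
    have \<psi>: "\<psi> \<in> carrier ?F \<and> ?N +>\<^bsub>?F\<^esub> \<phi> = ?N +>\<^bsub>?F\<^esub> \<psi>"
      unfolding \<psi>_def by (rule someI[of _ \<phi>]) (simp add: that)
    then have "\<phi> \<ominus>\<^bsub>?F\<^esub> \<psi> \<in> ?N"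
      using coset_eq_iff[OF real_space_tensor_free submodule_tensor_null that] by blast
    then have "L (\<phi> \<ominus>\<^bsub>?F\<^esub> \<psi>) = \<zero>\<^bsub>W\<^esub>" by (rule tensor_null_kernel[OF W L bal'])
    then have "L \<phi> \<ominus>\<^bsub>W\<^esub> L \<psi> = \<zero>\<^bsub>W\<^esub>"
      using linear_map_minus[OF real_space_tensor_free W L that] \<psi> by simp
    then have "L \<phi> = L \<psi>"
      using real_space_minus_eq_zero_iff[OF W]
        linear_map_closed[OF L] that \<psi> by simp
    then show ?thesis by (simp add: G_def \<psi>_def)
  qed
  have "linear_map (gr T k) W G"
    unfolding tensor_module_simps
    by (rule linear_map_quotient[OF real_space_tensor_free submodule_tensor_null L G])
  moreover have "G (ten k i s j p) = \<beta> i s j p"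
    if "i + j = k" "s \<in> carrier (gr M i)" "p \<in> carrier (gr N j)" for i s j p
    using that by (simp add: pure_tensor_def G indicator_in_tensor_free L_ind)
  ultimately show ?thesis by blast
qed

end

text \<open>Common source of two constructions: the action of an algebra element, where
  \<open>g\<close> shifts the degree over a fixed algebra, and the restriction maps, where
  \<open>g\<close> keeps the degree and the algebra changes. Hence two algebras, two degrees and a
  map \<open>g\<close> on symbols.\<close>

lemma tensor_free_map:
  fixes A :: "'a graded_alg" and M :: "('a, 'b) graded_mod" and N :: "('a, 'c) graded_mod"
    and A' :: "'d graded_alg" and M' :: "('d, 'e) graded_mod" and N' :: "('d, 'f) graded_mod"
  assumes "tensor_pair A M N" "tensor_pair A' M' N'"
    and g: "\<And>i s j p. \<lbrakk>i + j = k; s \<in> carrier (gr M i); p \<in> carrier (gr N j)\<rbrakk> \<Longrightarrow>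
      \<exists>i' s' j' p'. g (i, s, j, p) = (i', s', j', p') \<and> i' + j' = k' \<and>
        s' \<in> carrier (gr M' i') \<and> p' \<in> carrier (gr N' j')"
    and bal: "balanced_bilinear A M N k (gr (tensor_module A' M' N') k')
      (\<lambda>i s j p. case g (i, s, j, p) of (i', s', j', p') \<Rightarrow> pure_tensor A' M' N' k' i' s' j' p')"
  defines "G \<equiv> \<lambda>t. \<Union>\<phi>\<in>t. tensor_null A' M' N' k' +>\<^bsub>tensor_free M' N' k'\<^esub> free_map g \<phi>"
  shows "linear_map (gr (tensor_module A M N) k) (gr (tensor_module A' M' N') k') G"
    and "\<lbrakk>i + j = k; s \<in> carrier (gr M i); p \<in> carrier (gr N j)\<rbrakk> \<Longrightarrow>
      G (pure_tensor A M N k i s j p) =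
        (case g (i, s, j, p) of (i', s', j', p') \<Rightarrow> pure_tensor A' M' N' k' i' s' j' p')"
proof -
  interpret T: tensor_pair A M N by fact
  interpret T': tensor_pair A' M' N' by fact
  let ?F = "tensor_free M N k" and ?F' = "tensor_free M' N' k'"
  let ?N = "tensor_null A M N k" and ?N' = "tensor_null A' M' N' k'"
  note F = T.real_space_tensor_free[of k] and F' = T'.real_space_tensor_free[of k']
    and N = T.submodule_tensor_null[of k] and N' = T'.submodule_tensor_null[of k']
  have fm: "linear_map ?F ?F' (free_map g)"
    unfolding tensor_free_def by (rule linear_map_free_map) (use g in force)
  define L where "L \<phi> = ?N' +>\<^bsub>?F'\<^esub> free_map g \<phi>" for \<phi>
  have L: "linear_map ?F (gr T'.T k') L"
    unfolding L_def by (rule linear_map_comp[OF fm T'.linear_map_tensor_coset])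
  have L_ind: "L (indicator {(i, s, j, p)}) =
      (case g (i, s, j, p) of (i', s', j', p') \<Rightarrow> pure_tensor A' M' N' k' i' s' j' p')" for i s j p
    by (simp add: L_def free_map_indicator pure_tensor_def split: prod.split)
  have "free_map g \<phi> \<in> ?N'" if "\<phi> \<in> ?N" for \<phi>
  proof -
    have \<phi>: "\<phi> \<in> carrier ?F" using that N by (auto simp: submodule_iff[OF F])
    have "L \<phi> = \<zero>\<^bsub>gr T'.T k'\<^esub>"
      using that bal by (intro T.tensor_null_kernel[OF T'.real_space_tensor L]) (simp_all add: L_ind)
    \<comment> \<open>The zero of the quotient is the coset \<open>?N'\<close> itself, and a coset
      contains each of its representatives, here \<open>free_map g \<phi>\<close>.\<close>
    then have "L \<phi> = ?N'" by (simp add: tensor_module_simps)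
    then show ?thesis
      using coset_self[OF F' N' linear_map_closed[OF fm \<phi>]] by (simp add: L_def)
  qed
  then have G: "G (?N +>\<^bsub>?F\<^esub> \<phi>) = L \<phi>" if "\<phi> \<in> carrier ?F" for \<phi>
    unfolding G_def L_def using coset_map_eq[OF F N F' N' fm] that by blast
  show "linear_map (gr T.T k) (gr T'.T k') G"
    unfolding tensor_module_simps(1)[of A M N]
    by (rule linear_map_quotient[OF F N L G])
  show "\<lbrakk>i + j = k; s \<in> carrier (gr M i); p \<in> carrier (gr N j)\<rbrakk> \<Longrightarrow>
      G (pure_tensor A M N k i s j p) =
        (case g (i, s, j, p) of (i', s', j', p') \<Rightarrow> pure_tensor A' M' N' k' i' s' j' p')"
    by (simp add: pure_tensor_def[of A M N] G T.indicator_in_tensor_free L_ind)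
qed

section \<open>The module structure on the tensor product\<close>

context tensor_pair
begin

lemma tensor_action:
  assumes f: "f \<in> carrier (gr A l)"
  shows linear_tensor_act: "linear_map (gr T k) (gr T (l + k)) (gact T l k f)"
    and act_pure_tensor: "\<lbrakk>i + j = k; s \<in> carrier (gr M i); p \<in> carrier (gr N j)\<rbrakk> \<Longrightarrow>
      gact T l k f (ten k i s j p) = ten (l + k) (l + i) (gact M l i f s) j p"
proof -
  let ?g = "\<lambda>(i, s, j, p). (l + i, gact M l i f s, j, p)"
  have bal: "balanced_bilinear A M N k (gr T (l + k))
      (\<lambda>i s j p. ten (l + k) (l + i) (gact M l i f s) j p)"
  proof (rule balanced_bilinearI)
    fix i j s assume "i + j = k" "s \<in> carrier (gr M i)"
    then show "linear_map (gr N j) (gr T (l + k)) (ten (l + k) (l + i) (gact M l i f s) j)"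
      using f by (intro ten_linear_right) auto
  next
    fix i j p assume "i + j = k" "p \<in> carrier (gr N j)"
    then show "linear_map (gr M i) (gr T (l + k)) (\<lambda>s. ten (l + k) (l + i) (gact M l i f s) j p)"
      using f by (intro linear_map_comp[OF M.linear_act ten_linear_left]) auto
  next
    fix i m j s g p
    assume *: "i + m + j = k" "s \<in> carrier (gr M i)" "g \<in> carrier (gr A m)" "p \<in> carrier (gr N j)"
    have "ten (l + k) (l + i + m) (right_act M (l + i) m (gact M l i f s) g) j p =
      ten (l + k) (l + i) (gact M l i f s) (m + j) (gact N m j g p)"
      using * f by (intro ten_balanced) auto
    then show "ten (l + k) (l + (i + m)) (gact M l (i + m) f (right_act M i m s g)) j p =
      ten (l + k) (l + i) (gact M l i f s) (m + j) (gact N m j g p)"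
      using * f by (simp add: M.act_right_act add.assoc)
  qed
  note * = tensor_free_map[OF tensor_pair_axioms tensor_pair_axioms, of k ?g "l + k"]
  have g: "\<exists>i' s' j' p'. ?g (i, s, j, p) = (i', s', j', p') \<and> i' + j' = l + k \<and>
        s' \<in> carrier (gr M i') \<and> p' \<in> carrier (gr N j')"
    if "i + j = k" "s \<in> carrier (gr M i)" "p \<in> carrier (gr N j)" for i s j p
    using that f by auto
  show "linear_map (gr T k) (gr T (l + k)) (gact T l k f)"
    unfolding tensor_module_simps(2)[abs_def] by (rule *(1)) (use g bal in auto)
  show "gact T l k f (ten k i s j p) = ten (l + k) (l + i) (gact M l i f s) j p"
    if "i + j = k" "s \<in> carrier (gr M i)" "p \<in> carrier (gr N j)" for i j s p
    unfolding tensor_module_simps(2) using g bal that by (subst *(2)) auto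
qed

lemma tensor_act_closed:
  "\<lbrakk>f \<in> carrier (gr A l); t \<in> carrier (gr T k)\<rbrakk> \<Longrightarrow> gact T l k f t \<in> carrier (gr T (l + k))"
  by (rule linear_map_closed[OF linear_tensor_act])

text \<open>The action is built as a map linear in the tensor. Linearity in \<open>f\<close> is a
  separate matter, proved by induction on the tensor \<open>t\<close>: it holds for pure tensors,
  and a sum of maps linear in \<open>f\<close> is again linear in \<open>f\<close>.\<close>

lemma linear_tensor_act_left:
  assumes "t \<in> carrier (gr T k)"
  shows "linear_map (gr A l) (gr T (l + k)) (\<lambda>f. gact T l k f t)"
proof -
  interpret Tk: abelian_monoid "gr T n" for n
    by (rule real_space_abelian_monoid[OF real_space_tensor])
  note act_lin = linear_tensor_act
  show ?thesis
  proof (rule tensor_induct[OF assms, where P = "\<lambda>t. linear_map (gr A l) (gr T (l + k)) (\<lambda>f. gact T l k f t)"])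
    have "linear_map (gr A l) (gr T (l + k)) (\<lambda>_. \<zero>\<^bsub>gr T (l + k)\<^esub>)"
      by (intro linear_mapI) (auto simp: real_space_smult_zero[OF real_space_tensor])
    then show "linear_map (gr A l) (gr T (l + k)) (\<lambda>f. gact T l k f \<zero>\<^bsub>gr T k\<^esub>)"
      by (rule linear_map_cong[OF _ M.A.vector_space])
        (rule linear_map_zero[OF real_space_tensor real_space_tensor act_lin, symmetric])
  next
    fix i s j p
    assume pure: "i + j = k" "s \<in> carrier (gr M i)" "p \<in> carrier (gr N j)"
    have "linear_map (gr A l) (gr T (l + k)) (\<lambda>f. ten (l + k) (l + i) (gact M l i f s) j p)"
      using pure by (intro linear_map_comp[OF M.linear_act_left ten_linear_left]) auto
    then show "linear_map (gr A l) (gr T (l + k)) (\<lambda>f. gact T l k f (ten k i s j p))"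
      by (rule linear_map_cong[OF _ M.A.vector_space]) (simp add: act_pure_tensor pure)
  next
    fix t u
    assume tu: "t \<in> carrier (gr T k)" "u \<in> carrier (gr T k)"
      and IH: "linear_map (gr A l) (gr T (l + k)) (\<lambda>f. gact T l k f t)"
        "linear_map (gr A l) (gr T (l + k)) (\<lambda>f. gact T l k f u)"
    have "linear_map (gr A l) (gr T (l + k)) (\<lambda>f. gact T l k f t \<oplus>\<^bsub>gr T (l + k)\<^esub> gact T l k f u)"
    proof (rule linear_mapI)
      fix f g r assume f: "f \<in> carrier (gr A l)"
      note cl = tensor_act_closed[OF f tu(1)] tensor_act_closed[OF f tu(2)]
      show "gact T l k f t \<oplus>\<^bsub>gr T (l + k)\<^esub> gact T l k f u \<in> carrier (gr T (l + k))"
        using cl by simp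
      show "gact T l k (r \<odot>\<^bsub>gr A l\<^esub> f) t \<oplus>\<^bsub>gr T (l + k)\<^esub> gact T l k (r \<odot>\<^bsub>gr A l\<^esub> f) u =
          r \<odot>\<^bsub>gr T (l + k)\<^esub> (gact T l k f t \<oplus>\<^bsub>gr T (l + k)\<^esub> gact T l k f u)"
        using cl by (simp only: linear_map_smult[OF IH(1) f] linear_map_smult[OF IH(2) f]
          real_space_smult_add[OF real_space_tensor])
      assume g: "g \<in> carrier (gr A l)"
      note cl = cl tensor_act_closed[OF g tu(1)] tensor_act_closed[OF g tu(2)]
      show "gact T l k (f \<oplus>\<^bsub>gr A l\<^esub> g) t \<oplus>\<^bsub>gr T (l + k)\<^esub> gact T l k (f \<oplus>\<^bsub>gr A l\<^esub> g) u =
          (gact T l k f t \<oplus>\<^bsub>gr T (l + k)\<^esub> gact T l k f u) \<oplus>\<^bsub>gr T (l + k)\<^esub>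
          (gact T l k g t \<oplus>\<^bsub>gr T (l + k)\<^esub> gact T l k g u)"
        unfolding linear_map_add[OF IH(1) f g] linear_map_add[OF IH(2) f g]
        using cl by (simp add: Tk.a_ac)
    qed
    then show "linear_map (gr A l) (gr T (l + k)) (\<lambda>f. gact T l k f (t \<oplus>\<^bsub>gr T k\<^esub> u))"
      by (rule linear_map_cong[OF _ M.A.vector_space])
        (rule linear_map_add[OF act_lin tu, symmetric])
  qed
qed

lemma graded_module_tensor: "graded_module A T"
proof (intro graded_module.intro graded_vector_space.intro graded_module_axioms.intro
    M.A.graded_algebra_axioms)
  show "Module.module real_ring (gr T k)" for k by (rule real_space_tensor)
  show "bilinear_map (gr A i) (gr T j) (gr T (i + j)) (gact T i j)" for i j
    by (auto simp: bilinear_map_def linear_tensor_act linear_tensor_act_left)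
  fix a b x i j k
  assume a: "a \<in> carrier (gr A i)" and x: "x \<in> carrier (gr T k)"
  {
    assume b: "b \<in> carrier (gr A j)"
    have l1: "linear_map (gr T k) (gr T (i + (j + k))) (gact T (i + j) k (gmult A i j a b))"
      using linear_tensor_act[of "gmult A i j a b" "i + j" k] a b by (simp add: add.assoc)
    have l2: "linear_map (gr T k) (gr T (i + (j + k))) (\<lambda>x. gact T i (j + k) a (gact T j k b x))"
      using a b by (intro linear_map_comp[OF linear_tensor_act linear_tensor_act])
    show "gact T (i + j) k (gmult A i j a b) x = gact T i (j + k) a (gact T j k b x)"
      by (rule tensor_map_eq[OF real_space_tensor l1 l2 _ x])
        (use a b in \<open>simp add: act_pure_tensor M.act_assoc add.assoc\<close>)
  }
next
  fix x i
  assume x: "x \<in> carrier (gr T i)"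
  have l1: "linear_map (gr T i) (gr T i) (gact T 0 i (gone A))"
    using linear_tensor_act[of "gone A" 0 i] M.A.one_closed by simp
  have l2: "linear_map (gr T i) (gr T i) (\<lambda>x. x)" by (auto intro: linear_mapI)
  show "gact T 0 i (gone A) x = x"
    by (rule tensor_map_eq[OF real_space_tensor l1 l2 _ x])
      (use M.A.one_closed in \<open>simp add: act_pure_tensor M.one_act\<close>)
qed

end

section \<open>The tensor product presheaf\<close>

lemma algebra_hom_linear: "graded_algebra_hom A B f \<Longrightarrow> linear_map (gr A i) (gr B i) (f i)"
  by (simp add: graded_algebra_hom_def)

lemma tensor_presheaf_simps:
  "sections (tensor_presheaf C S P) U = tensor_module (sections C U) (sections S U) (sections P U)"
  "restr (tensor_presheaf C S P) U V k t =
    (\<Union>\<phi>\<in>t. tensor_null (sections C V) (sections S V) (sections P V) k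
         +>\<^bsub>tensor_free (sections S V) (sections P V) k\<^esub>
         free_map (\<lambda>(i, s, j, p). (i, restr S U V i s, j, restr P U V j p)) \<phi>)"
  by (simp_all add: tensor_presheaf_def)

locale presheaf_pair = S: module_presheaf X C S + P: module_presheaf X C P
  for X :: "'m topology" and C :: "('m, 'a) alg_presheaf" and S :: "('m, 'a, 'b) mod_presheaf"
    and P :: "('m, 'a, 'c) mod_presheaf"
begin

abbreviation "TP \<equiv> tensor_presheaf C S P"
abbreviation "ten U \<equiv> pure_tensor (sections C U) (sections S U) (sections P U)"

lemma tensor_pair_sections: "openin X U \<Longrightarrow> tensor_pair (sections C U) (sections S U) (sections P U)"
  by (simp add: tensor_pair_def S.sections_module P.sections_module)

context
  fixes U V
  assumes U: "openin X U" and V: "openin X V" and VU: "V \<subseteq> U"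
begin

lemma tensor_restriction:
  shows linear_tensor_restr:
      "linear_map (gr (sections TP U) k) (gr (sections TP V) k) (restr TP U V k)"
    and restr_pure_tensor: "\<lbrakk>i + j = k; s \<in> carrier (gr (sections S U) i);
      p \<in> carrier (gr (sections P U) j)\<rbrakk> \<Longrightarrow>
      restr TP U V k (ten U k i s j p) = ten V k i (restr S U V i s) j (restr P U V j p)"
proof -
  interpret TU: tensor_pair "sections C U" "sections S U" "sections P U"
    by (rule tensor_pair_sections[OF U])
  interpret TV: tensor_pair "sections C V" "sections S V" "sections P V"
    by (rule tensor_pair_sections[OF V])
  note Sl = S.restr_linear[OF U V VU] and Pl = P.restr_linear[OF U V VU]
  note Scl = linear_map_closed[OF Sl] and Pcl = linear_map_closed[OF Pl]
    and Ccl = linear_map_closed[OF S.C.restr_linear[OF U V VU]]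
  let ?g = "\<lambda>(i, s, j, p). (i, restr S U V i s, j, restr P U V j p)"
  \<comment> \<open>Restriction respects the right action together with its sign, which is what the
    balancing condition over \<open>V\<close> asks for.\<close>
  have right: "restr S U V (i + l) (right_act (sections S U) i l s f) =
      right_act (sections S V) i l (restr S U V i s) (restr C U V l f)"
    if "s \<in> carrier (gr (sections S U) i)" "f \<in> carrier (gr (sections C U) l)" for i l s f
    using that S.restr_act[OF U V VU that(2,1)] TU.M.act_closed[OF that(2,1)]
    by (simp add: right_act_def linear_map_smult[OF Sl] add.commute)
  have bal: "balanced_bilinear (sections C U) (sections S U) (sections P U) k
      (gr (sections TP V) k) (\<lambda>i s j p. ten V k i (restr S U V i s) j (restr P U V j p))"
    unfolding tensor_presheaf_simps
  proof (rule balanced_bilinearI)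
    fix i j s assume "i + j = k" "s \<in> carrier (gr (sections S U) i)"
    then show "linear_map (gr (sections P U) j) (gr TV.T k)
        (\<lambda>p. ten V k i (restr S U V i s) j (restr P U V j p))"
      by (intro linear_map_comp[OF Pl TV.ten_linear_right]) (auto intro: Scl)
  next
    fix i j p assume "i + j = k" "p \<in> carrier (gr (sections P U) j)"
    then show "linear_map (gr (sections S U) i) (gr TV.T k)
        (\<lambda>s. ten V k i (restr S U V i s) j (restr P U V j p))"
      by (intro linear_map_comp[OF Sl TV.ten_linear_left]) (auto intro: Pcl)
  next
    fix i m j s g p
    assume *: "i + m + j = k" "s \<in> carrier (gr (sections S U) i)"
      "g \<in> carrier (gr (sections C U) m)" "p \<in> carrier (gr (sections P U) j)"
    then show "ten V k (i + m) (restr S U V (i + m) (right_act (sections S U) i m s g)) j (restr P U V j p) =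
      ten V k i (restr S U V i s) (m + j) (restr P U V (m + j) (gact (sections P U) m j g p))"
      by (simp add: right P.restr_act[OF U V VU] TV.ten_balanced Scl Pcl Ccl)
  qed
  note * = tensor_free_map[OF TU.tensor_pair_axioms TV.tensor_pair_axioms, of k ?g k]
  have g: "\<exists>i' s' j' p'. ?g (i, s, j, p) = (i', s', j', p') \<and> i' + j' = k \<and>
        s' \<in> carrier (gr (sections S V) i') \<and> p' \<in> carrier (gr (sections P V) j')"
    if "i + j = k" "s \<in> carrier (gr (sections S U) i)" "p \<in> carrier (gr (sections P U) j)" for i s j p
    using that Scl Pcl by auto
  show "linear_map (gr (sections TP U) k) (gr (sections TP V) k) (restr TP U V k)"
    unfolding tensor_presheaf_simps(1) tensor_presheaf_simps(2)[abs_def]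
    by (rule *(1)) (use g bal in \<open>auto simp: tensor_presheaf_simps\<close>)
  show "restr TP U V k (ten U k i s j p) = ten V k i (restr S U V i s) j (restr P U V j p)"
    if "i + j = k" "s \<in> carrier (gr (sections S U) i)" "p \<in> carrier (gr (sections P U) j)" for i s j p
    unfolding tensor_presheaf_simps(2) using g bal that
    by (subst *(2)) (auto simp: tensor_presheaf_simps)
qed

end

lemma sections_tensor_module: "openin X U \<Longrightarrow> graded_module (sections C U) (sections TP U)"
  using tensor_pair.graded_module_tensor[OF tensor_pair_sections] by (simp add: tensor_presheaf_simps)

lemma tensor_section_map_eq:
  assumes "openin X U" "real_space W" "linear_map (gr (sections TP U) k) W f"
    "linear_map (gr (sections TP U) k) W g"
    and "\<And>i s j p. \<lbrakk>i + j = k; s \<in> carrier (gr (sections S U) i); p \<in> carrier (gr (sections P U) j)\<rbrakk> \<Longrightarrow>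
      f (ten U k i s j p) = g (ten U k i s j p)"
    and "t \<in> carrier (gr (sections TP U) k)"
  shows "f t = g t"
  using tensor_pair.tensor_map_eq[OF tensor_pair_sections[OF assms(1)] assms(2)] assms(3-)
  unfolding tensor_presheaf_simps by blast

lemma real_space_tensor_sections: "openin X U \<Longrightarrow> real_space (gr (sections TP U) k)"
  using tensor_pair.real_space_tensor[OF tensor_pair_sections] by (simp add: tensor_presheaf_simps)

lemma tensor_restr_act:
  assumes U: "openin X U" and V: "openin X V" and VU: "V \<subseteq> U"
    and f: "f \<in> carrier (gr (sections C U) i)" and t: "t \<in> carrier (gr (sections TP U) j)"
  shows "restr TP U V (i + j) (gact (sections TP U) i j f t) =
      gact (sections TP V) i j (restr C U V i f) (restr TP U V j t)"
proof -
  interpret TU: tensor_pair "sections C U" "sections S U" "sections P U"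
    by (rule tensor_pair_sections[OF U])
  interpret TV: tensor_pair "sections C V" "sections S V" "sections P V"
    by (rule tensor_pair_sections[OF V])
  note TUl = TU.linear_tensor_act[folded tensor_presheaf_simps(1)]
  note TVl = TV.linear_tensor_act[folded tensor_presheaf_simps(1)]
  note TUp = TU.act_pure_tensor[folded tensor_presheaf_simps(1)]
  note TVp = TV.act_pure_tensor[folded tensor_presheaf_simps(1)]
  note Sl = S.restr_linear[OF U V VU] and Pl = P.restr_linear[OF U V VU]
    and Cl = S.C.restr_linear[OF U V VU]
  have 1: "linear_map (gr (sections TP U) j) (gr (sections TP V) (i + j))
      (\<lambda>t. restr TP U V (i + j) (gact (sections TP U) i j f t))"
    by (rule linear_map_comp[OF TUl[OF f] linear_tensor_restr[OF U V VU]])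
  have 2: "linear_map (gr (sections TP U) j) (gr (sections TP V) (i + j))
      (\<lambda>t. gact (sections TP V) i j (restr C U V i f) (restr TP U V j t))"
    by (rule linear_map_comp[OF linear_tensor_restr[OF U V VU] TVl]) (rule linear_map_closed[OF Cl f])
  show ?thesis
  proof (rule tensor_section_map_eq[OF U real_space_tensor_sections[OF V] 1 2 _ t])
    fix a s b p assume *: "a + b = j" "s \<in> carrier (gr (sections S U) a)" "p \<in> carrier (gr (sections P U) b)"
    then show "restr TP U V (i + j) (gact (sections TP U) i j f (ten U j a s b p)) =
      gact (sections TP V) i j (restr C U V i f) (restr TP U V j (ten U j a s b p))"
      using f TU.M.act_closed[OF f *(2)]
      by (simp add: TUp TVp restr_pure_tensor[OF U V VU] S.restr_act[OF U V VU]
          linear_map_closed[OF Sl] linear_map_closed[OF Pl] linear_map_closed[OF Cl])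
  qed
qed

lemma module_presheaf_tensor: "module_presheaf X C TP"
proof (intro module_presheaf.intro presheaf.intro module_presheaf_axioms.intro
    S.C.algebra_presheaf_axioms)
  show "graded_vector_space (sections TP U)" if "openin X U" for U
    using sections_tensor_module[OF that] by (simp add: graded_module_def)
  show "graded_module (sections C U) (sections TP U)" if "openin X U" for U
    by (rule sections_tensor_module[OF that])
  show "linear_map (gr (sections TP U) i) (gr (sections TP V) i) (restr TP U V i)"
    if "openin X U" "openin X V" "V \<subseteq> U" for U V i
    by (rule linear_tensor_restr[OF that])
  show "restr TP U U i s = s" if U: "openin X U" and s: "s \<in> carrier (gr (sections TP U) i)" for U s i
    by (rule tensor_section_map_eq[OF U real_space_tensor_sections[OF U] linear_tensor_restr[OF U U subset_refl] _ _ s])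
      (auto intro: linear_mapI simp: restr_pure_tensor[OF U U] S.restr_id[OF U] P.restr_id[OF U])
  show "restr TP V W i (restr TP U V i s) = restr TP U W i s"
    if U: "openin X U" and V: "openin X V" and W: "openin X W" and WV: "W \<subseteq> V" and VU: "V \<subseteq> U"
      and s: "s \<in> carrier (gr (sections TP U) i)" for U V W s i
  proof -
    have WU: "W \<subseteq> U" using WV VU by auto
    show ?thesis
      by (rule tensor_section_map_eq[OF U real_space_tensor_sections[OF W]
            linear_map_comp[OF linear_tensor_restr[OF U V VU] linear_tensor_restr[OF V W WV]]
            linear_tensor_restr[OF U W WU] _ s])
        (simp add: restr_pure_tensor U V W WV VU WU S.restr_trans P.restr_trans
          linear_map_closed[OF S.restr_linear] linear_map_closed[OF P.restr_linear])
  qed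
qed (use tensor_restr_act in auto)

end

section \<open>Sheafification of a sheaf\<close>

text \<open>Counterpart of \<open>real_space_surj_image\<close> for modules. It gives the
  sheafification its module structure once \<open>sff\<close> is known to respect the
  operations.\<close>

lemma graded_module_surj_image:
  fixes A :: "'a graded_alg" and M :: "('a, 'b) graded_mod" and N :: "('a, 'c) graded_mod"
  assumes "graded_module A M"
    and lin: "\<And>k. linear_map (gr M k) (gr N k) (f k)"
    and surj: "\<And>k. carrier (gr N k) = f k ` carrier (gr M k)"
    and zero: "\<And>k. f k \<zero>\<^bsub>gr M k\<^esub> = \<zero>\<^bsub>gr N k\<^esub>"
    and act: "\<And>l k a x. \<lbrakk>a \<in> carrier (gr A l); x \<in> carrier (gr M k)\<rbrakk> \<Longrightarrow>
      gact N l k a (f k x) = f (l + k) (gact M l k a x)"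
  shows "graded_module A N"
proof -
  interpret M: graded_module A M by fact
  note f_closed = linear_map_closed[OF lin] and f_add = linear_map_add[OF lin, symmetric]
    and f_smult = linear_map_smult[OF lin, symmetric]
  show ?thesis
  proof (intro graded_module.intro graded_vector_space.intro graded_module_axioms.intro
      M.A.graded_algebra_axioms)
    show "real_space (gr N k)" for k
      by (rule real_space_surj_image[OF M.vector_space lin surj zero])
    show "bilinear_map (gr A i) (gr N j) (gr N (i + j)) (gact N i j)" for i j
      unfolding bilinear_map_def
    proof (intro conjI ballI)
      fix a assume a: "a \<in> carrier (gr A i)"
      show "linear_map (gr N j) (gr N (i + j)) (gact N i j a)"
        using a linear_map_add[OF M.linear_act[OF a]] linear_map_smult[OF M.linear_act[OF a]]
        by (intro linear_mapI) (auto simp: surj f_add f_smult act)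
    next
      fix y assume "y \<in> carrier (gr N j)"
      then obtain x where x: "x \<in> carrier (gr M j)" "y = f j x" using surj by auto
      show "linear_map (gr A i) (gr N (i + j)) (\<lambda>a. gact N i j a y)"
        using x linear_map_add[OF M.linear_act_left[OF x(1)]] linear_map_smult[OF M.linear_act_left[OF x(1)]]
        by (intro linear_mapI) (auto simp: surj f_add f_smult act)
    qed
    show "gact N (i + j) k (gmult A i j a b) y = gact N i (j + k) a (gact N j k b y)"
      if "a \<in> carrier (gr A i)" "b \<in> carrier (gr A j)" "y \<in> carrier (gr N k)" for a b y i j k
      using that by (auto simp: surj act M.act_assoc add.assoc)
    show "gact N 0 i (gone A) y = y" if "y \<in> carrier (gr N i)" for y i
      using that by (auto simp: surj act M.A.one_closed M.one_act)
  qed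
qed

lemma linear_map_the_inv_into:
  assumes V: "real_space V" and f: "linear_map V W f" and bij: "bij_betw f (carrier V) (carrier W)"
  shows "linear_map W V (the_inv_into (carrier V) f)"
proof -
  have inj: "inj_on f (carrier V)" and surj: "carrier W = f ` carrier V"
    using bij by (auto simp: bij_betw_def)
  show ?thesis
    by (intro linear_mapI)
      (auto simp: surj linear_map_add[OF f, symmetric] linear_map_smult[OF f, symmetric]
        the_inv_into_f_f[OF inj] real_space_closed V)
qed

text \<open>An isomorphism is defined through an inverse morphism. The sectionwise inverses are
  automatically linear and commute with the action and with restrictions, which follows by writing
  every argument as an image under \<Phi>.\<close>

lemma module_presheaf_iso_bij:
  assumes mor: "module_presheaf_morphism X C F G \<Phi>"
    and bij: "\<And>U i. openin X U \<Longrightarrow>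
      bij_betw (\<Phi> U i) (carrier (gr (sections F U) i)) (carrier (gr (sections G U) i))"
  shows "module_presheaf_iso X C F G \<Phi>"
proof -
  interpret F: module_presheaf X C F using mor by (simp add: module_presheaf_morphism_def)
  interpret G: module_presheaf X C G using mor by (simp add: module_presheaf_morphism_def)
  define \<Psi> where "\<Psi> U i = the_inv_into (carrier (gr (sections F U) i)) (\<Phi> U i)" for U i
  have inj: "inj_on (\<Phi> U i) (carrier (gr (sections F U) i))"
    and surj: "carrier (gr (sections G U) i) = \<Phi> U i ` carrier (gr (sections F U) i)"
    if "openin X U" for U i
    using bij[OF that, of i] by (auto simp: bij_betw_def)
  have \<Psi>\<Phi>: "\<Psi> U i (\<Phi> U i s) = s" if "openin X U" "s \<in> carrier (gr (sections F U) i)" for U i s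
    using that by (simp add: \<Psi>_def the_inv_into_f_f[OF inj])
  have hom: "graded_module_hom (sections C U) (sections F U) (sections G U) (\<Phi> U)" if "openin X U" for U
    using mor that by (simp add: module_presheaf_morphism_def)
  have nat: "restr G U V i (\<Phi> U i s) = \<Phi> V i (restr F U V i s)"
    if "s \<in> carrier (gr (sections F U) i)" "openin X U" "openin X V" "V \<subseteq> U" for U V i s
    using mor that by (simp add: module_presheaf_morphism_def)
  have "module_presheaf_morphism X C G F \<Psi>"
    unfolding module_presheaf_morphism_def
  proof (intro conjI allI impI ballI)
    show "module_presheaf X C G" "module_presheaf X C F" by unfold_locales
    fix U assume U: "openin X U"
    interpret FU: graded_module "sections C U" "sections F U" by (rule F.sections_module[OF U])
    show "graded_module_hom (sections C U) (sections G U) (sections F U) (\<Psi> U)"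
      unfolding graded_module_hom_def
    proof (intro conjI allI ballI F.sections_module G.sections_module U)
      show "linear_map (gr (sections G U) i) (gr (sections F U) i) (\<Psi> U i)" for i
        unfolding \<Psi>_def using hom[OF U] bij[OF U]
        by (intro linear_map_the_inv_into) (auto simp: graded_module_hom_def FU.vector_space)
      fix i j a x assume a: "a \<in> carrier (gr (sections C U) i)" and "x \<in> carrier (gr (sections G U) j)"
      then obtain y where y: "y \<in> carrier (gr (sections F U) j)" "x = \<Phi> U j y"
        using surj[OF U] by auto
      have "gact (sections G U) i j a x = \<Phi> U (i + j) (gact (sections F U) i j a y)"
        using hom[OF U] a y by (simp add: graded_module_hom_def)
      then show "\<Psi> U (i + j) (gact (sections G U) i j a x) = gact (sections F U) i j a (\<Psi> U j x)"
        using y a by (simp add: \<Psi>\<Phi>[OF U])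
    qed
  next
    fix U V i t
    assume "t \<in> carrier (gr (sections G U) i)" and UV: "openin X U" "openin X V" "V \<subseteq> U"
    then obtain y where y: "y \<in> carrier (gr (sections F U) i)" "t = \<Phi> U i y"
      using surj[OF UV(1)] by auto
    then show "restr F U V i (\<Psi> U i t) = \<Psi> V i (restr G U V i t)"
      using UV linear_map_closed[OF F.restr_linear[OF UV] y(1)] by (simp add: \<Psi>\<Phi> nat)
  qed
  then show ?thesis
    unfolding module_presheaf_iso_def using mor by (auto intro!: exI[of _ \<Psi>] simp: \<Psi>\<Phi> surj)
qed

section \<open>Germs and their operations\<close>

context presheaf
begin

lemma restr_closed:
  "\<lbrakk>openin X U; openin X V; V \<subseteq> U; s \<in> carrier (gr (sections F U) i)\<rbrakk> \<Longrightarrow>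
    restr F U V i s \<in> carrier (gr (sections F V) i)"
  by (rule linear_map_closed[OF restr_linear])

lemma restr_add:
  "\<lbrakk>openin X U; openin X V; V \<subseteq> U; s \<in> carrier (gr (sections F U) i); t \<in> carrier (gr (sections F U) i)\<rbrakk> \<Longrightarrow>
    restr F U V i (s \<oplus>\<^bsub>gr (sections F U) i\<^esub> t) = restr F U V i s \<oplus>\<^bsub>gr (sections F V) i\<^esub> restr F U V i t"
  by (rule linear_map_add[OF restr_linear])

lemma restr_smult:
  "\<lbrakk>openin X U; openin X V; V \<subseteq> U; s \<in> carrier (gr (sections F U) i)\<rbrakk> \<Longrightarrow>
    restr F U V i (r \<odot>\<^bsub>gr (sections F U) i\<^esub> s) = r \<odot>\<^bsub>gr (sections F V) i\<^esub> restr F U V i s"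
  by (rule linear_map_smult[OF restr_linear])

lemma real_space_sections: "openin X U \<Longrightarrow> real_space (gr (sections F U) i)"
  using sections_space by (simp add: graded_vector_space_def)

lemma restr_zero:
  "\<lbrakk>openin X U; openin X V; V \<subseteq> U\<rbrakk> \<Longrightarrow> restr F U V i \<zero>\<^bsub>gr (sections F U) i\<^esub> = \<zero>\<^bsub>gr (sections F V) i\<^esub>"
  by (rule linear_map_zero[OF real_space_sections real_space_sections restr_linear])

lemma germ_self: "\<lbrakk>openin X U; x \<in> U; s \<in> carrier (gr (sections F U) k)\<rbrakk> \<Longrightarrow> (U, s) \<in> germ X F k x U s"
  by (auto simp: germ_def)

lemma germ_eqI:
  assumes "openin X U" "openin X V" "openin X W" "x \<in> W" "W \<subseteq> U \<inter> V"
    "s \<in> carrier (gr (sections F U) k)" "t \<in> carrier (gr (sections F V) k)"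
    and eq: "restr F U W k s = restr F V W k t"
  shows "germ X F k x U s = germ X F k x V t"
proof -
  \<comment> \<open>Only one inclusion is proved, but for arbitrary sections, so that exchanging the
    two gives the other. Representatives are compared on the intersection
    \<open>W \<inter> W'\<close>.\<close>
  have "germ X F k x U s \<subseteq> germ X F k x V t"
    if *: "openin X U" "openin X V" "W \<subseteq> U \<inter> V"
    "s \<in> carrier (gr (sections F U) k)" "t \<in> carrier (gr (sections F V) k)"
    "restr F U W k s = restr F V W k t" for U V s t
  proof (clarsimp simp: germ_def)
    fix V' t' W'
    assume V': "openin X V'" "x \<in> V'" "t' \<in> carrier (gr (sections F V') k)"
      and W': "openin X W'" "x \<in> W'" "W' \<subseteq> U" "W' \<subseteq> V'" "restr F U W' k s = restr F V' W' k t'"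
    have o: "openin X (W \<inter> W')" using assms W' by auto
    have "restr F V (W \<inter> W') k t = restr F W (W \<inter> W') k (restr F V W k t)"
      using * assms(3) o by (subst restr_trans) auto
    also have "\<dots> = restr F W (W \<inter> W') k (restr F U W k s)" using * by simp
    also have "\<dots> = restr F U (W \<inter> W') k s" using * assms(3) o by (subst restr_trans) auto
    also have "\<dots> = restr F W' (W \<inter> W') k (restr F U W' k s)"
      using * W' o by (subst restr_trans) auto
    also have "\<dots> = restr F W' (W \<inter> W') k (restr F V' W' k t')" using W' by simp
    also have "\<dots> = restr F V' (W \<inter> W') k t'" using V' W' o by (subst restr_trans) auto
    finally show "\<exists>W. openin X W \<and> x \<in> W \<and> W \<subseteq> V \<and> W \<subseteq> V' \<and> restr F V W k t = restr F V' W k t'"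
      using o W' assms(4) * by (intro exI[of _ "W \<inter> W'"]) auto
  qed
  from this[of U V s t] this[of V U t s] assms show ?thesis by auto
qed

lemma germ_eqD:
  assumes "germ X F k x U s = germ X F k x V t" "openin X V" "x \<in> V" "t \<in> carrier (gr (sections F V) k)"
  obtains W where "openin X W" "x \<in> W" "W \<subseteq> U \<inter> V" "restr F U W k s = restr F V W k t"
proof -
  from germ_self[OF assms(2-4)] have "(V, t) \<in> germ X F k x U s" using assms(1) by simp
  then show ?thesis using that by (auto simp: germ_def)
qed

lemma germ_memD:
  assumes "(V, t) \<in> germ X F k x U s"
  obtains W where "openin X V" "x \<in> V" "t \<in> carrier (gr (sections F V) k)"
    "openin X W" "x \<in> W" "W \<subseteq> U \<inter> V" "restr F U W k s = restr F V W k t"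
  using assms by (auto simp: germ_def)

lemma germ_restr:
  "\<lbrakk>openin X U; openin X V; V \<subseteq> U; x \<in> V; s \<in> carrier (gr (sections F U) k)\<rbrakk> \<Longrightarrow>
    germ X F k x V (restr F U V k s) = germ X F k x U s"
  by (rule germ_eqI[of V U V]) (auto intro: restr_closed simp: restr_id[OF _ restr_closed])

text \<open>\<open>germ_add\<close> is a union over all pairs of representatives. Each pair agrees
  with \<open>s\<close> and \<open>t\<close> on a small neighbourhood of \<open>x\<close>, so every
  member of the union is the same germ, and the family is nonempty.\<close>

lemma germ_add_germ:
  assumes U: "openin X U" "x \<in> U" and s: "s \<in> carrier (gr (sections F U) k)"
    and t: "t \<in> carrier (gr (sections F U) k)"
  shows "germ_add X F k x (germ X F k x U s) (germ X F k x U t) =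
    germ X F k x U (s \<oplus>\<^bsub>gr (sections F U) k\<^esub> t)"
proof -
  note cl = real_space_closed[OF real_space_sections]
  have "germ X F k x (V \<inter> V')
      (restr F V (V \<inter> V') k s' \<oplus>\<^bsub>gr (sections F (V \<inter> V')) k\<^esub> restr F V' (V \<inter> V') k t') =
    germ X F k x U (s \<oplus>\<^bsub>gr (sections F U) k\<^esub> t)"
    if s': "(V, s') \<in> germ X F k x U s" and t': "(V', t') \<in> germ X F k x U t" for V s' V' t'
  proof -
    from s' obtain W where W: "openin X V" "x \<in> V" "s' \<in> carrier (gr (sections F V) k)"
      "openin X W" "x \<in> W" "W \<subseteq> U \<inter> V" "restr F U W k s = restr F V W k s'" by (rule germ_memD)
    from t' obtain W' where W': "openin X V'" "x \<in> V'" "t' \<in> carrier (gr (sections F V') k)"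
      "openin X W'" "x \<in> W'" "W' \<subseteq> U \<inter> V'" "restr F U W' k t = restr F V' W' k t'" by (rule germ_memD)
    define Q where "Q = W \<inter> W'"
    have Q: "openin X Q" "x \<in> Q" "Q \<subseteq> U" "Q \<subseteq> V" "Q \<subseteq> V'" "Q \<subseteq> W" "Q \<subseteq> W'" "Q \<subseteq> V \<inter> V'"
      using W W' by (auto simp: Q_def)
    have o: "openin X (V \<inter> V')" using W W' by auto
    have s'Q: "restr F V Q k s' = restr F U Q k s"
      using restr_trans[OF W(1,4) Q(1) Q(6) _ W(3)] restr_trans[OF U(1) W(4) Q(1) Q(6) _ s] W by auto
    have t'Q: "restr F V' Q k t' = restr F U Q k t"
      using restr_trans[OF W'(1,4) Q(1) Q(7) _ W'(3)] restr_trans[OF U(1) W'(4) Q(1) Q(7) _ t] W' by auto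
    have r: "restr F V (V \<inter> V') k s' \<in> carrier (gr (sections F (V \<inter> V')) k)"
      "restr F V' (V \<inter> V') k t' \<in> carrier (gr (sections F (V \<inter> V')) k)"
      using W W' o by (auto intro: restr_closed)
    show ?thesis
    proof (rule germ_eqI[OF o U(1) Q(1,2)])
      show "Q \<subseteq> V \<inter> V' \<inter> U" using Q by auto
      show "restr F (V \<inter> V') Q k
          (restr F V (V \<inter> V') k s' \<oplus>\<^bsub>gr (sections F (V \<inter> V')) k\<^esub> restr F V' (V \<inter> V') k t') =
        restr F U Q k (s \<oplus>\<^bsub>gr (sections F U) k\<^esub> t)"
        using r o Q W W' U s t by (simp add: restr_add restr_trans s'Q t'Q)
    qed (use r s t in \<open>auto intro: cl o U\<close>)
  qed
  then show ?thesis
    unfolding germ_add_def using germ_self[OF U s] germ_self[OF U t] by fast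
qed

lemma germ_smult_germ:
  assumes U: "openin X U" "x \<in> U" and s: "s \<in> carrier (gr (sections F U) k)"
  shows "germ_smult X F k x r (germ X F k x U s) = germ X F k x U (r \<odot>\<^bsub>gr (sections F U) k\<^esub> s)"
proof -
  note cl = real_space_closed[OF real_space_sections]
  have "germ X F k x V (r \<odot>\<^bsub>gr (sections F V) k\<^esub> s') = germ X F k x U (r \<odot>\<^bsub>gr (sections F U) k\<^esub> s)"
    if s': "(V, s') \<in> germ X F k x U s" for V s'
  proof -
    from s' obtain W where W: "openin X V" "x \<in> V" "s' \<in> carrier (gr (sections F V) k)"
      "openin X W" "x \<in> W" "W \<subseteq> U \<inter> V" "restr F U W k s = restr F V W k s'" by (rule germ_memD)
    then show ?thesis
      using U s by (intro germ_eqI[of V U W]) (auto simp: restr_smult intro: cl)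
  qed
  then show ?thesis
    unfolding germ_smult_def using germ_self[OF U s] by fast
qed

end

lemma (in module_presheaf) germ_act_germ:
  assumes U: "openin X U" "x \<in> U" and f: "f \<in> carrier (gr (sections C U) l)"
    and s: "s \<in> carrier (gr (sections F U) k)"
  shows "germ_act X C F l k x U f (germ X F k x U s) = germ X F (l + k) x U (gact (sections F U) l k f s)"
proof -
  have "germ X F (l + k) x (U \<inter> V)
      (gact (sections F (U \<inter> V)) l k (restr C U (U \<inter> V) l f) (restr F V (U \<inter> V) k s')) =
      germ X F (l + k) x U (gact (sections F U) l k f s)"
    if s': "(V, s') \<in> germ X F k x U s" for V s'
  proof -
    from s' obtain W where W: "openin X V" "x \<in> V" "s' \<in> carrier (gr (sections F V) k)"
      "openin X W" "x \<in> W" "W \<subseteq> U \<inter> V" "restr F U W k s = restr F V W k s'" by (rule germ_memD)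
    have o: "openin X (U \<inter> V)" using U W by auto
    have r: "restr C U (U \<inter> V) l f \<in> carrier (gr (sections C (U \<inter> V)) l)"
      "restr F V (U \<inter> V) k s' \<in> carrier (gr (sections F (U \<inter> V)) k)"
      using o U W f by (auto intro: restr_closed C.restr_closed)
    show ?thesis
    proof (rule germ_eqI[OF o U(1) W(4,5)])
      show "restr F (U \<inter> V) W (l + k)
          (gact (sections F (U \<inter> V)) l k (restr C U (U \<inter> V) l f) (restr F V (U \<inter> V) k s')) =
        restr F U W (l + k) (gact (sections F U) l k f s)"
        using r o W U f s by (simp add: restr_act restr_trans C.restr_trans)
    qed (use W r f s U in \<open>auto intro!: graded_module.act_closed[OF sections_module] o\<close>)
  qed
  then show ?thesis
    unfolding germ_act_def using germ_self[OF U s] by fast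
qed

lemma sheafification_simps:
  "carrier (gr (sections (sheafification X C F) U) k) =
    {\<sigma> \<in> extensional U. \<forall>x\<in>U. \<exists>V t. openin X V \<and> x \<in> V \<and> V \<subseteq> U \<and>
            t \<in> carrier (gr (sections F V) k) \<and> (\<forall>y\<in>V. \<sigma> y = germ X F k y V t)}"
  "\<zero>\<^bsub>gr (sections (sheafification X C F) U) k\<^esub> = (\<lambda>x\<in>U. germ X F k x U \<zero>\<^bsub>gr (sections F U) k\<^esub>)"
  "\<sigma> \<oplus>\<^bsub>gr (sections (sheafification X C F) U) k\<^esub> \<tau> = (\<lambda>x\<in>U. germ_add X F k x (\<sigma> x) (\<tau> x))"
  "r \<odot>\<^bsub>gr (sections (sheafification X C F) U) k\<^esub> \<sigma> = (\<lambda>x\<in>U. germ_smult X F k x r (\<sigma> x))"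
  "gact (sections (sheafification X C F) U) l k f \<sigma> = (\<lambda>x\<in>U. germ_act X C F l k x U f (\<sigma> x))"
  "restr (sheafification X C F) U V k \<sigma> = restrict \<sigma> V"
  by (simp_all add: sheafification_def)

text \<open>The uniqueness half of gluing, applied to the cover by all open subsets on which the two
  sections agree.\<close>

lemma (in sheaf) section_eqI:
  assumes U: "openin X U" and s: "s \<in> carrier (gr (sections F U) i)" and t: "t \<in> carrier (gr (sections F U) i)"
    and loc: "\<And>x. x \<in> U \<Longrightarrow> \<exists>W. openin X W \<and> x \<in> W \<and> W \<subseteq> U \<and> restr F U W i s = restr F U W i t"
  shows "s = t"
proof -
  define \<W> where "\<W> = {W. openin X W \<and> W \<subseteq> U \<and> restr F U W i s = restr F U W i t}"
  have un: "\<Union>\<W> = U" using loc by (force simp: \<W>_def)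
  have "\<exists>!r. r \<in> carrier (gr (sections F (\<Union>\<W>)) i) \<and> (\<forall>W\<in>\<W>. restr F (\<Union>\<W>) W i r = restr F U W i s)"
  proof (rule glue)
    fix V W assume "V \<in> \<W>" "W \<in> \<W>"
    then show "restr F V (V \<inter> W) i (restr F U V i s) = restr F W (V \<inter> W) i (restr F U W i s)"
      using U s by (subst (1 2) restr_trans) (auto simp: \<W>_def)
  qed (use U s t in \<open>auto simp: \<W>_def intro: restr_closed\<close>)
  moreover have "\<forall>W\<in>\<W>. restr F U W i t = restr F U W i s" by (simp add: \<W>_def)
  ultimately show ?thesis using s t unfolding un by blast
qed

section \<open>The canonical map of a sheaf into its sheafification\<close>

context module_sheaf
begin

abbreviation "SF \<equiv> sheafification X C F"

lemma sff_inj: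
  assumes U: "openin X U"
  shows "inj_on (sff X F U k) (carrier (gr (sections F U) k))"
proof (rule inj_onI)
  fix s t assume s: "s \<in> carrier (gr (sections F U) k)" and t: "t \<in> carrier (gr (sections F U) k)"
    and eq: "sff X F U k s = sff X F U k t"
  show "s = t"
  proof (rule section_eqI[OF U s t])
    fix x assume x: "x \<in> U"
    have "germ X F k x U s = germ X F k x U t"
      using fun_cong[OF eq, of x] x by (simp add: sff_def)
    then show "\<exists>W. openin X W \<and> x \<in> W \<and> W \<subseteq> U \<and> restr F U W k s = restr F U W k t"
      using germ_eqD[OF _ U x t] by (metis inf.idem)
  qed
qed

text \<open>A section of the sheafification is given locally by sections of \<open>F\<close> whose
  germs agree at every common point; hence these agree near each point of the overlaps, thus on the
  overlaps, and glue.\<close>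

lemma sff_surj:
  assumes U: "openin X U"
  shows "carrier (gr (sections SF U) k) = sff X F U k ` carrier (gr (sections F U) k)"
proof (intro equalityI subsetI)
  fix \<sigma> assume "\<sigma> \<in> sff X F U k ` carrier (gr (sections F U) k)"
  then obtain s where "s \<in> carrier (gr (sections F U) k)" "\<sigma> = sff X F U k s" by auto
  then show "\<sigma> \<in> carrier (gr (sections SF U) k)"
    using U by (auto simp: sheafification_simps sff_def intro!: exI[of _ U] exI[of _ s])
next
  fix \<sigma> assume \<sigma>: "\<sigma> \<in> carrier (gr (sections SF U) k)"
  define \<U> where "\<U> = {V. openin X V \<and> V \<subseteq> U \<and> (\<exists>t. t \<in> carrier (gr (sections F V) k) \<and>
    (\<forall>y\<in>V. \<sigma> y = germ X F k y V t))}"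
  have "\<exists>V\<in>\<U>. x \<in> V" if "x \<in> U" for x
    using \<sigma> that unfolding sheafification_simps \<U>_def mem_Collect_eq Bex_def by meson
  then have un: "\<Union>\<U> = U" by (auto simp: \<U>_def)
  have "\<exists>s. \<forall>V\<in>\<U>. s V \<in> carrier (gr (sections F V) k) \<and> (\<forall>y\<in>V. \<sigma> y = germ X F k y V (s V))"
    by (rule bchoice) (simp add: \<U>_def)
  then obtain s where s: "\<And>V. V \<in> \<U> \<Longrightarrow> s V \<in> carrier (gr (sections F V) k)"
    and \<sigma>s: "\<And>V y. V \<in> \<U> \<Longrightarrow> y \<in> V \<Longrightarrow> \<sigma> y = germ X F k y V (s V)" by blast
  have op: "openin X V" if "V \<in> \<U>" for V using that by (auto simp: \<U>_def)
  have "\<exists>!t. t \<in> carrier (gr (sections F (\<Union>\<U>)) k) \<and> (\<forall>V\<in>\<U>. restr F (\<Union>\<U>) V k t = s V)"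
  proof (rule glue[OF op s])
    fix V W assume V: "V \<in> \<U>" and W: "W \<in> \<U>"
    have o: "openin X (V \<inter> W)" using op V W by auto
    show "restr F V (V \<inter> W) k (s V) = restr F W (V \<inter> W) k (s W)"
    proof (rule section_eqI[OF o])
      show "restr F V (V \<inter> W) k (s V) \<in> carrier (gr (sections F (V \<inter> W)) k)"
        "restr F W (V \<inter> W) k (s W) \<in> carrier (gr (sections F (V \<inter> W)) k)"
        using V W op o s by (auto intro: restr_closed)
      fix x assume x: "x \<in> V \<inter> W"
      have "germ X F k x V (s V) = germ X F k x W (s W)"
        using \<sigma>s[OF V, of x] \<sigma>s[OF W, of x] x by simp
      then obtain Q where "openin X Q" "x \<in> Q" "Q \<subseteq> V \<inter> W" "restr F V Q k (s V) = restr F W Q k (s W)"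
        using x W by (elim germ_eqD[OF _ op[OF W] _ s[OF W]]) auto
      then show "\<exists>Q. openin X Q \<and> x \<in> Q \<and> Q \<subseteq> V \<inter> W \<and>
          restr F (V \<inter> W) Q k (restr F V (V \<inter> W) k (s V)) = restr F (V \<inter> W) Q k (restr F W (V \<inter> W) k (s W))"
        using V W op o s by (intro exI[of _ Q]) (auto simp: restr_trans)
    qed
  qed
  then obtain t where t: "t \<in> carrier (gr (sections F U) k)" "\<And>V. V \<in> \<U> \<Longrightarrow> restr F U V k t = s V"
    unfolding un by blast
  have "\<sigma> x = sff X F U k t x" for x
  proof (cases "x \<in> U")
    case True
    then obtain V where V: "V \<in> \<U>" "x \<in> V" using un by auto
    then have "V \<subseteq> U" by (auto simp: \<U>_def)
    with V True show ?thesis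
      using germ_restr[OF U op[OF V(1)] _ V(2) t(1)] t(2)[OF V(1)] \<sigma>s[OF V] by (simp add: sff_def)
  next
    case False
    then show ?thesis using \<sigma> by (auto simp: sff_def sheafification_simps extensional_def)
  qed
  then show "\<sigma> \<in> sff X F U k ` carrier (gr (sections F U) k)" using t(1) by blast
qed

lemma sff_linear:
  assumes U: "openin X U"
  shows "linear_map (gr (sections F U) k) (gr (sections SF U) k) (sff X F U k)"
proof (rule linear_mapI)
  fix s t r assume s: "s \<in> carrier (gr (sections F U) k)"
  then show "sff X F U k s \<in> carrier (gr (sections SF U) k)" by (simp add: sff_surj[OF U])
  show "sff X F U k (r \<odot>\<^bsub>gr (sections F U) k\<^esub> s) = r \<odot>\<^bsub>gr (sections SF U) k\<^esub> sff X F U k s"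
    using U s by (auto simp: sheafification_simps sff_def fun_eq_iff germ_smult_germ)
  assume t: "t \<in> carrier (gr (sections F U) k)"
  show "sff X F U k (s \<oplus>\<^bsub>gr (sections F U) k\<^esub> t) = sff X F U k s \<oplus>\<^bsub>gr (sections SF U) k\<^esub> sff X F U k t"
    using U s t by (auto simp: sheafification_simps sff_def fun_eq_iff germ_add_germ)
qed

lemma sff_act:
  assumes U: "openin X U" and "f \<in> carrier (gr (sections C U) l)" "s \<in> carrier (gr (sections F U) k)"
  shows "gact (sections SF U) l k f (sff X F U k s) = sff X F U (l + k) (gact (sections F U) l k f s)"
  using assms by (auto simp: sheafification_simps sff_def fun_eq_iff germ_act_germ)

lemma sff_restr:
  assumes "openin X U" "openin X V" "V \<subseteq> U" "s \<in> carrier (gr (sections F U) k)"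
  shows "restr SF U V k (sff X F U k s) = sff X F V k (restr F U V k s)"
  using assms by (auto simp: sheafification_simps sff_def fun_eq_iff germ_restr)

text \<open>Here it matters that \<open>F\<close> is a sheaf: then \<open>sff\<close> is onto and
  carries the axioms from sections of \<open>F\<close> over to families of germs.\<close>

lemma sheafification_sections_module:
  assumes U: "openin X U"
  shows "graded_module (sections C U) (sections SF U)"
proof (rule graded_module_surj_image[OF sections_module[OF U] sff_linear[OF U] sff_surj[OF U]])
  show "sff X F U k \<zero>\<^bsub>gr (sections F U) k\<^esub> = \<zero>\<^bsub>gr (sections SF U) k\<^esub>" for k
    by (simp add: sheafification_simps sff_def)
qed (rule sff_act[OF U])

lemma module_presheaf_sheafification: "module_presheaf X C SF"
proof (intro module_presheaf.intro presheaf.intro module_presheaf_axioms.intro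
    C.algebra_presheaf_axioms)
  show "graded_vector_space (sections SF U)" if "openin X U" for U
    using sheafification_sections_module[OF that] by (simp add: graded_module_def)
  show "graded_module (sections C U) (sections SF U)" if "openin X U" for U
    by (rule sheafification_sections_module[OF that])
  show "linear_map (gr (sections SF U) i) (gr (sections SF V) i) (restr SF U V i)"
    if UV: "openin X U" "openin X V" "V \<subseteq> U" for U V i
  proof -
    note ops = linear_map_add[OF sff_linear, symmetric] linear_map_smult[OF sff_linear, symmetric]
    note cl = real_space_closed[OF real_space_sections]
    show ?thesis
      using UV by (intro linear_mapI)
        (auto simp: sff_surj UV ops sff_restr restr_closed restr_add restr_smult cl)
  qed
  show "restr SF U U i s = s" if "openin X U" "s \<in> carrier (gr (sections SF U) i)" for U i s
    using that by (auto simp: sff_surj sff_restr restr_id)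
  show "restr SF V W i (restr SF U V i s) = restr SF U W i s"
    if "openin X U" "openin X V" "openin X W" "W \<subseteq> V" "V \<subseteq> U" "s \<in> carrier (gr (sections SF U) i)"
    for U V W i s
    using that by (auto simp: sheafification_simps fun_eq_iff restrict_def)
  show "restr SF U V (i + j) (gact (sections SF U) i j f s) =
      gact (sections SF V) i j (restr C U V i f) (restr SF U V j s)"
    if "openin X U" "openin X V" "V \<subseteq> U" "f \<in> carrier (gr (sections C U) i)"
      "s \<in> carrier (gr (sections SF U) j)" for U V i j f s
    using that by (auto simp: sff_surj sff_restr sff_act restr_closed C.restr_closed restr_act
        graded_module.act_closed[OF sections_module])
qed

lemma sff_hom:
  assumes U: "openin X U"
  shows "graded_module_hom (sections C U) (sections F U) (sections SF U) (sff X F U)"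
  using sections_module[OF U] sheafification_sections_module[OF U] sff_linear[OF U] sff_act[OF U]
  by (simp add: graded_module_hom_def)

lemma sff_bij: "openin X U \<Longrightarrow>
    bij_betw (sff X F U k) (carrier (gr (sections F U) k)) (carrier (gr (sections SF U) k))"
  by (simp add: bij_betw_def sff_inj sff_surj)

theorem sheafification_iso: "module_presheaf_iso X C F SF (sff X F)"
  using module_presheaf_axioms module_presheaf_sheafification sff_hom sff_restr
  by (intro module_presheaf_iso_bij sff_bij) (auto simp: module_presheaf_morphism_def)

end

section \<open>Multiplication by global functions of degree zero\<close>

text \<open>In degree zero no signs occur, so this is an ordinary commutative ring. Packaged as one,
  it makes ring homomorphisms and the \<open>algebra\<close> method available for computations with
  bump functions.\<close>

definition ring0 :: "'a graded_alg \<Rightarrow> 'a ring" where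
  "ring0 A = \<lparr>carrier = carrier (gr A 0), monoid.mult = gmult A 0 0, one = gone A,
     ring.zero = \<zero>\<^bsub>gr A 0\<^esub>, add = add (gr A 0)\<rparr>"

lemma ring0_simps:
  "carrier (ring0 A) = carrier (gr A 0)" "x \<otimes>\<^bsub>ring0 A\<^esub> y = gmult A 0 0 x y" "\<one>\<^bsub>ring0 A\<^esub> = gone A"
  "\<zero>\<^bsub>ring0 A\<^esub> = \<zero>\<^bsub>gr A 0\<^esub>" "x \<oplus>\<^bsub>ring0 A\<^esub> y = x \<oplus>\<^bsub>gr A 0\<^esub> y"
  by (simp_all add: ring0_def)

lemma (in graded_algebra) cring_ring0: "cring (ring0 A)"
proof -
  interpret A0: abelian_group "gr A 0" by (rule gr_abelian_group)
  note add = linear_map_add[OF linear_mult[of _ 0 0]] linear_map_add[OF linear_mult_left[of _ 0 0]]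
  show ?thesis
  proof (rule cringI)
    show "abelian_group (ring0 A)"
    proof (rule abelian_groupI)
      fix x assume "x \<in> carrier (ring0 A)"
      then show "\<exists>y\<in>carrier (ring0 A). y \<oplus>\<^bsub>ring0 A\<^esub> x = \<zero>\<^bsub>ring0 A\<^esub>"
        by (auto simp: ring0_simps intro!: bexI[of _ "\<ominus>\<^bsub>gr A 0\<^esub> x"] A0.l_neg)
    qed (auto simp: ring0_simps A0.a_ac)
    show "comm_monoid (ring0 A)"
    proof (rule comm_monoidI)
      fix x y assume "x \<in> carrier (ring0 A)" "y \<in> carrier (ring0 A)"
      then show "x \<otimes>\<^bsub>ring0 A\<^esub> y \<in> carrier (ring0 A)" "x \<otimes>\<^bsub>ring0 A\<^esub> y = y \<otimes>\<^bsub>ring0 A\<^esub> x"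
        using mult_closed[of x 0 y 0] mult_closed[of y 0 x 0] graded_commute[of x 0 y 0] gr_one_smult[of "gmult A 0 0 y x" 0]
        by (auto simp: ring0_simps)
    next
      fix x y z assume "x \<in> carrier (ring0 A)" "y \<in> carrier (ring0 A)" "z \<in> carrier (ring0 A)"
      then show "x \<otimes>\<^bsub>ring0 A\<^esub> y \<otimes>\<^bsub>ring0 A\<^esub> z = x \<otimes>\<^bsub>ring0 A\<^esub> (y \<otimes>\<^bsub>ring0 A\<^esub> z)"
        using mult_assoc[of x 0 y 0 z 0] by (simp add: ring0_simps)
    qed (auto simp: ring0_simps one_closed one_mult)
    fix x y z assume "x \<in> carrier (ring0 A)" "y \<in> carrier (ring0 A)" "z \<in> carrier (ring0 A)"
    then show "(x \<oplus>\<^bsub>ring0 A\<^esub> y) \<otimes>\<^bsub>ring0 A\<^esub> z = x \<otimes>\<^bsub>ring0 A\<^esub> z \<oplus>\<^bsub>ring0 A\<^esub> y \<otimes>\<^bsub>ring0 A\<^esub> z"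
      using add by (simp add: ring0_simps)
  qed
qed

context algebra_presheaf
begin

abbreviation "functions \<equiv> ring0 (sections C (topspace X))"

lemma cring_functions: "cring functions"
  by (rule graded_algebra.cring_ring0[OF sections_algebra[OF openin_topspace]])

lemma restr_ring_hom:
  assumes "openin X U" "openin X V" "V \<subseteq> U"
  shows "ring_hom_cring (ring0 (sections C U)) (ring0 (sections C V)) (restr C U V 0)"
proof -
  have h: "graded_algebra_hom (sections C U) (sections C V) (restr C U V)"
    by (rule restr_algebra_hom[OF assms])
  have m: "restr C U V (0 + 0) (gmult (sections C U) 0 0 a b) =
      gmult (sections C V) 0 0 (restr C U V 0 a) (restr C U V 0 b)"
    if "a \<in> carrier (gr (sections C U) 0)" "b \<in> carrier (gr (sections C U) 0)" for a b
    using h that unfolding graded_algebra_hom_def by blast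
  have l: "linear_map (gr (sections C U) 0) (gr (sections C V) 0) (restr C U V 0)"
    and o: "restr C U V 0 (gone (sections C U)) = gone (sections C V)"
    using h by (auto simp: graded_algebra_hom_def)
  show ?thesis
    using linear_map_closed[OF l] linear_map_add[OF l] m o
    by (intro ring_hom_cring.intro ring_hom_cring_axioms.intro graded_algebra.cring_ring0 ring_hom_memI
        sections_algebra assms) (simp_all add: ring0_simps)
qed

lemma restr_one: "\<lbrakk>openin X U; openin X V; V \<subseteq> U\<rbrakk> \<Longrightarrow> restr C U V 0 (gone (sections C U)) = gone (sections C V)"
  using restr_algebra_hom by (simp add: graded_algebra_hom_def)

end

context module_presheaf
begin

definition scal :: "'m set \<Rightarrow> int \<Rightarrow> 'a \<Rightarrow> 'b \<Rightarrow> 'b" where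
  "scal U k g = gact (sections F U) 0 k (restr C (topspace X) U 0 g)"

lemma restr_function_closed:
  "\<lbrakk>openin X U; g \<in> carrier C.functions\<rbrakk> \<Longrightarrow> restr C (topspace X) U 0 g \<in> carrier (gr (sections C U) 0)"
  by (intro C.restr_closed) (auto simp: ring0_simps dest: openin_subset)

lemma scal_linear:
  assumes "openin X U" "g \<in> carrier C.functions"
  shows "linear_map (gr (sections F U) k) (gr (sections F U) k) (scal U k g)"
  using graded_module.linear_act[OF sections_module[OF assms(1)] restr_function_closed[OF assms], of k]
  by (simp add: scal_def[abs_def])

lemma scal_closed:
  "\<lbrakk>openin X U; g \<in> carrier C.functions; t \<in> carrier (gr (sections F U) k)\<rbrakk> \<Longrightarrow>
    scal U k g t \<in> carrier (gr (sections F U) k)"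
  by (rule linear_map_closed[OF scal_linear])

lemma scal_add:
  assumes "openin X U" "g \<in> carrier C.functions" "h \<in> carrier C.functions" "t \<in> carrier (gr (sections F U) k)"
  shows "scal U k (g \<oplus>\<^bsub>C.functions\<^esub> h) t = scal U k g t \<oplus>\<^bsub>gr (sections F U) k\<^esub> scal U k h t"
  using linear_map_add[OF graded_module.linear_act_left[OF sections_module[OF assms(1)] assms(4)]
      restr_function_closed[OF assms(1,2)] restr_function_closed[OF assms(1,3)]] assms
    C.restr_add[OF openin_topspace assms(1) openin_subset[OF assms(1)], of g 0 h]
  by (simp add: scal_def ring0_simps)

lemma scal_mult:
  assumes "openin X U" "g \<in> carrier C.functions" "h \<in> carrier C.functions" "t \<in> carrier (gr (sections F U) k)"
  shows "scal U k (g \<otimes>\<^bsub>C.functions\<^esub> h) t = scal U k g (scal U k h t)"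
proof -
  interpret r: ring_hom_cring C.functions "ring0 (sections C U)" "restr C (topspace X) U 0"
    by (rule C.restr_ring_hom[OF openin_topspace assms(1) openin_subset[OF assms(1)]])
  interpret FU: graded_module "sections C U" "sections F U" by (rule sections_module[OF assms(1)])
  show ?thesis
    using FU.act_assoc[OF restr_function_closed[OF assms(1,2)] restr_function_closed[OF assms(1,3)] assms(4)]
      r.hom_mult[OF assms(2,3)]
    by (simp add: scal_def ring0_simps)
qed

lemma scal_eq_self:
  assumes "openin X U" "restr C (topspace X) U 0 g = gone (sections C U)" "t \<in> carrier (gr (sections F U) k)"
  shows "scal U k g t = t"
  using graded_module.one_act[OF sections_module[OF assms(1)] assms(3)] assms(2) by (simp add: scal_def)

lemma scal_one: "\<lbrakk>openin X U; t \<in> carrier (gr (sections F U) k)\<rbrakk> \<Longrightarrow> scal U k (\<one>\<^bsub>C.functions\<^esub>) t = t"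
  using C.restr_one[OF openin_topspace] openin_subset[of X U] by (intro scal_eq_self) (auto simp: ring0_simps)

lemma scal_eq_zero:
  assumes U: "openin X U" and "restr C (topspace X) U 0 g = \<zero>\<^bsub>gr (sections C U) 0\<^esub>"
    and t: "t \<in> carrier (gr (sections F U) k)"
  shows "scal U k g t = \<zero>\<^bsub>gr (sections F U) k\<^esub>"
  using linear_map_zero[OF C.real_space_sections[OF U] real_space_sections[OF U]
      graded_module.linear_act_left[OF sections_module[OF U] t, of 0, simplified]] assms(2)
  by (simp add: scal_def)

lemma restr_scal:
  assumes U: "openin X U" and V: "openin X V" and VU: "V \<subseteq> U" and g: "g \<in> carrier C.functions"
    and t: "t \<in> carrier (gr (sections F U) k)"
  shows "restr F U V k (scal U k g t) = scal V k g (restr F U V k t)"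
proof -
  have "restr C U V 0 (restr C (topspace X) U 0 g) = restr C (topspace X) V 0 g"
    using g U V VU openin_subset[OF U] by (intro C.restr_trans) (auto simp: ring0_simps)
  then show ?thesis
    using restr_act[OF U V VU restr_function_closed[OF U g] t] by (simp add: scal_def)
qed

lemma scal_act:
  assumes U: "openin X U" and g: "g \<in> carrier C.functions" and f: "f \<in> carrier (gr (sections C U) l)"
    and t: "t \<in> carrier (gr (sections F U) k)"
  shows "scal U (l + k) g (gact (sections F U) l k f t) = gact (sections F U) l k f (scal U k g t)"
proof -
  interpret FU: graded_module "sections C U" "sections F U" by (rule sections_module[OF U])
  note r = restr_function_closed[OF U g]
  show ?thesis
    using FU.act_commute[OF r f t] FU.act_closed[OF r t] f
      FU.gr_one_smult[OF FU.act_closed[OF f FU.act_closed[OF r t, simplified]]]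
    by (simp add: scal_def)
qed

text \<open>The functions that glue form an ideal; \<open>F\<close> is a sheaf if it is the unit ideal.\<close>

definition compatible :: "'m set set \<Rightarrow> int \<Rightarrow> ('m set \<Rightarrow> 'b) \<Rightarrow> bool" where
  "compatible \<U> k s \<longleftrightarrow> (\<forall>U\<in>\<U>. openin X U \<and> s U \<in> carrier (gr (sections F U) k)) \<and>
     (\<forall>U\<in>\<U>. \<forall>V\<in>\<U>. restr F U (U \<inter> V) k (s U) = restr F V (U \<inter> V) k (s V))"

lemma compatibleD:
  assumes "compatible \<U> k s"
  shows "U \<in> \<U> \<Longrightarrow> openin X U" "U \<in> \<U> \<Longrightarrow> s U \<in> carrier (gr (sections F U) k)" "openin X (\<Union>\<U>)"
  using assms unfolding compatible_def by blast+

text \<open>The two sheaf axioms weakened by the factor \<open>g\<close>: gluings exist up to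
  \<open>g\<close>, and uniqueness takes its linear form, where a section that vanishes locally is
  killed by \<open>g\<close>. All covers and degrees are quantified inside, so that \<open>g\<close>
  alone carries the property.\<close>

definition glues :: "'a \<Rightarrow> bool" where
  "glues g \<longleftrightarrow> g \<in> carrier C.functions \<and>
     (\<forall>\<U> k s. compatible \<U> k s \<longrightarrow> (\<exists>t\<in>carrier (gr (sections F (\<Union>\<U>)) k).
        \<forall>U\<in>\<U>. restr F (\<Union>\<U>) U k t = scal U k g (s U))) \<and>
     (\<forall>\<U> k. \<forall>t\<in>carrier (gr (sections F (\<Union>\<U>)) k). (\<forall>U\<in>\<U>. openin X U) \<longrightarrow>
        (\<forall>U\<in>\<U>. restr F (\<Union>\<U>) U k t = \<zero>\<^bsub>gr (sections F U) k\<^esub>) \<longrightarrow>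
        scal (\<Union>\<U>) k g t = \<zero>\<^bsub>gr (sections F (\<Union>\<U>)) k\<^esub>)"

lemma gluesD:
  assumes "glues g"
  shows "g \<in> carrier C.functions"
    and "compatible \<U> k s \<Longrightarrow> \<exists>t\<in>carrier (gr (sections F (\<Union>\<U>)) k).
        \<forall>U\<in>\<U>. restr F (\<Union>\<U>) U k t = scal U k g (s U)"
    and "\<lbrakk>t \<in> carrier (gr (sections F (\<Union>\<U>)) k); \<forall>U\<in>\<U>. openin X U;
        \<forall>U\<in>\<U>. restr F (\<Union>\<U>) U k t = \<zero>\<^bsub>gr (sections F U) k\<^esub>\<rbrakk> \<Longrightarrow>
        scal (\<Union>\<U>) k g t = \<zero>\<^bsub>gr (sections F (\<Union>\<U>)) k\<^esub>"
  using assms unfolding glues_def by simp_all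

lemma glues_add:
  assumes g: "glues g" and h: "glues h"
  shows "glues (g \<oplus>\<^bsub>C.functions\<^esub> h)"
proof -
  interpret R: cring C.functions by (rule C.cring_functions)
  have gc: "g \<in> carrier C.functions" "h \<in> carrier C.functions" using gluesD(1)[OF g] gluesD(1)[OF h] .
  show ?thesis
    unfolding glues_def
  proof (intro conjI allI impI ballI)
    show "g \<oplus>\<^bsub>C.functions\<^esub> h \<in> carrier C.functions" using gc by simp
  next
    fix \<U> k s assume c: "compatible \<U> k s"
    obtain t where t: "t \<in> carrier (gr (sections F (\<Union>\<U>)) k)"
      "\<forall>U\<in>\<U>. restr F (\<Union>\<U>) U k t = scal U k g (s U)" using gluesD(2)[OF g c] by blast
    obtain u where u: "u \<in> carrier (gr (sections F (\<Union>\<U>)) k)"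
      "\<forall>U\<in>\<U>. restr F (\<Union>\<U>) U k u = scal U k h (s U)" using gluesD(2)[OF h c] by blast
    have o: "openin X (\<Union>\<U>)" using c by (rule compatibleD)
    show "\<exists>t\<in>carrier (gr (sections F (\<Union>\<U>)) k).
        \<forall>U\<in>\<U>. restr F (\<Union>\<U>) U k t = scal U k (g \<oplus>\<^bsub>C.functions\<^esub> h) (s U)"
    proof (rule bexI[of _ "t \<oplus>\<^bsub>gr (sections F (\<Union>\<U>)) k\<^esub> u"], intro ballI)
      fix U assume U: "U \<in> \<U>"
      note sU = compatibleD(1,2)[OF c U]
      show "restr F (\<Union>\<U>) U k (t \<oplus>\<^bsub>gr (sections F (\<Union>\<U>)) k\<^esub> u) = scal U k (g \<oplus>\<^bsub>C.functions\<^esub> h) (s U)"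
        unfolding restr_add[OF o sU(1) Union_upper[OF U] t(1) u(1)] scal_add[OF sU(1) gc sU(2)]
        using t(2) u(2) U by simp
    qed (rule real_space_closed(1)[OF real_space_sections[OF o] t(1) u(1)])
  next
    fix \<U> k t assume t: "t \<in> carrier (gr (sections F (\<Union>\<U>)) k)" and op: "\<forall>U\<in>\<U>. openin X U"
      and z: "\<forall>U\<in>\<U>. restr F (\<Union>\<U>) U k t = \<zero>\<^bsub>gr (sections F U) k\<^esub>"
    have o: "openin X (\<Union>\<U>)" using op by auto
    have "scal (\<Union>\<U>) k g t = \<zero>\<^bsub>gr (sections F (\<Union>\<U>)) k\<^esub>" "scal (\<Union>\<U>) k h t = \<zero>\<^bsub>gr (sections F (\<Union>\<U>)) k\<^esub>"
      by (rule gluesD(3)[OF g t op z], rule gluesD(3)[OF h t op z])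
    then show "scal (\<Union>\<U>) k (g \<oplus>\<^bsub>C.functions\<^esub> h) t = \<zero>\<^bsub>gr (sections F (\<Union>\<U>)) k\<^esub>"
      using scal_add[OF o gc t] abelian_monoid.l_zero[OF real_space_abelian_monoid[OF real_space_sections[OF o]]]
        real_space_closed[OF real_space_sections[OF o]] by simp
  qed
qed

lemma glues_mult:
  assumes g: "glues g" and h: "h \<in> carrier C.functions"
  shows "glues (h \<otimes>\<^bsub>C.functions\<^esub> g)"
proof -
  interpret R: cring C.functions by (rule C.cring_functions)
  have gc: "g \<in> carrier C.functions" using gluesD(1)[OF g] .
  show ?thesis
    unfolding glues_def
  proof (intro conjI allI impI ballI)
    show "h \<otimes>\<^bsub>C.functions\<^esub> g \<in> carrier C.functions" using gc h by simp
  next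
    fix \<U> k s assume c: "compatible \<U> k s"
    obtain t where t: "t \<in> carrier (gr (sections F (\<Union>\<U>)) k)"
      "\<forall>U\<in>\<U>. restr F (\<Union>\<U>) U k t = scal U k g (s U)" using gluesD(2)[OF g c] by blast
    have o: "openin X (\<Union>\<U>)" using c by (rule compatibleD)
    show "\<exists>t\<in>carrier (gr (sections F (\<Union>\<U>)) k).
        \<forall>U\<in>\<U>. restr F (\<Union>\<U>) U k t = scal U k (h \<otimes>\<^bsub>C.functions\<^esub> g) (s U)"
    proof (rule bexI[of _ "scal (\<Union>\<U>) k h t"], intro ballI)
      fix U assume U: "U \<in> \<U>"
      note sU = compatibleD(1,2)[OF c U]
      show "restr F (\<Union>\<U>) U k (scal (\<Union>\<U>) k h t) = scal U k (h \<otimes>\<^bsub>C.functions\<^esub> g) (s U)"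
        unfolding restr_scal[OF o sU(1) Union_upper[OF U] h t(1)] scal_mult[OF sU(1) h gc sU(2)]
        using t(2) U by simp
    qed (rule scal_closed[OF o h t(1)])
  next
    fix \<U> k t assume t: "t \<in> carrier (gr (sections F (\<Union>\<U>)) k)" and op: "\<forall>U\<in>\<U>. openin X U"
      and z: "\<forall>U\<in>\<U>. restr F (\<Union>\<U>) U k t = \<zero>\<^bsub>gr (sections F U) k\<^esub>"
    have o: "openin X (\<Union>\<U>)" using op by auto
    have "scal (\<Union>\<U>) k g t = \<zero>\<^bsub>gr (sections F (\<Union>\<U>)) k\<^esub>"
      by (rule gluesD(3)[OF g t op z])
    then show "scal (\<Union>\<U>) k (h \<otimes>\<^bsub>C.functions\<^esub> g) t = \<zero>\<^bsub>gr (sections F (\<Union>\<U>)) k\<^esub>"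
      using scal_mult[OF o h gc t]
        linear_map_zero[OF real_space_sections[OF o] real_space_sections[OF o] scal_linear[OF o h]] by simp
  qed
qed

lemma glues_zero: "glues (\<zero>\<^bsub>C.functions\<^esub>)"
proof -
  interpret R: cring C.functions by (rule C.cring_functions)
  have z: "scal U k (\<zero>\<^bsub>C.functions\<^esub>) t = \<zero>\<^bsub>gr (sections F U) k\<^esub>"
    if "openin X U" "t \<in> carrier (gr (sections F U) k)" for U k t
    using that openin_subset[OF that(1)]
    by (intro scal_eq_zero) (auto simp: ring0_simps C.restr_zero)
  show ?thesis
    unfolding glues_def
  proof (intro conjI allI impI ballI)
    fix \<U> k s assume c: "compatible \<U> k s"
    then have o: "openin X (\<Union>\<U>)" by (rule compatibleD)
    show "\<exists>t\<in>carrier (gr (sections F (\<Union>\<U>)) k).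
        \<forall>U\<in>\<U>. restr F (\<Union>\<U>) U k t = scal U k (\<zero>\<^bsub>C.functions\<^esub>) (s U)"
    proof (rule bexI[of _ "\<zero>\<^bsub>gr (sections F (\<Union>\<U>)) k\<^esub>"], intro ballI)
      fix U assume U: "U \<in> \<U>"
      show "restr F (\<Union>\<U>) U k \<zero>\<^bsub>gr (sections F (\<Union>\<U>)) k\<^esub> = scal U k (\<zero>\<^bsub>C.functions\<^esub>) (s U)"
        unfolding z[OF compatibleD(1,2)[OF c U]] by (rule restr_zero[OF o compatibleD(1)[OF c U] Union_upper[OF U]])
    qed (rule real_space_closed(2)[OF real_space_sections[OF o]])
  qed (auto simp: z openin_Union)
qed

lemma sheaf_if_glues_one:
  assumes "glues (\<one>\<^bsub>C.functions\<^esub>)"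
  shows "sheaf X F"
proof (intro sheaf.intro presheaf_axioms sheaf_axioms.intro)
  fix \<U> s i
  assume op: "\<And>U. U \<in> \<U> \<Longrightarrow> openin X U" and s: "\<And>U. U \<in> \<U> \<Longrightarrow> s U \<in> carrier (gr (sections F U) i)"
    and comp: "\<And>U V. \<lbrakk>U \<in> \<U>; V \<in> \<U>\<rbrakk> \<Longrightarrow> restr F U (U \<inter> V) i (s U) = restr F V (U \<inter> V) i (s V)"
  have o: "openin X (\<Union>\<U>)" using op by auto
  have "compatible \<U> i s" unfolding compatible_def by (intro conjI ballI op s comp)
  then obtain t where t: "t \<in> carrier (gr (sections F (\<Union>\<U>)) i)"
    "\<And>U. U \<in> \<U> \<Longrightarrow> restr F (\<Union>\<U>) U i t = scal U i (\<one>\<^bsub>C.functions\<^esub>) (s U)"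
    using gluesD(2)[OF assms \<open>compatible \<U> i s\<close>] by blast
  show "\<exists>!t. t \<in> carrier (gr (sections F (\<Union>\<U>)) i) \<and> (\<forall>U\<in>\<U>. restr F (\<Union>\<U>) U i t = s U)"
  proof (rule ex1I[of _ t])
    show "t \<in> carrier (gr (sections F (\<Union>\<U>)) i) \<and> (\<forall>U\<in>\<U>. restr F (\<Union>\<U>) U i t = s U)"
      using t op s by (simp add: scal_one)
    fix u assume u: "u \<in> carrier (gr (sections F (\<Union>\<U>)) i) \<and> (\<forall>U\<in>\<U>. restr F (\<Union>\<U>) U i u = s U)"
    \<comment> \<open>Uniqueness is available in \<open>glues\<close> for sections that vanish
      locally, hence the passage to the difference.\<close>
    let ?d = "u \<ominus>\<^bsub>gr (sections F (\<Union>\<U>)) i\<^esub> t"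
    have d: "?d \<in> carrier (gr (sections F (\<Union>\<U>)) i)"
      using u t by (simp add: real_space_closed real_space_sections o)
    have "restr F (\<Union>\<U>) U i ?d = \<zero>\<^bsub>gr (sections F U) i\<^esub>" if U: "U \<in> \<U>" for U
    proof -
      have "restr F (\<Union>\<U>) U i ?d = restr F (\<Union>\<U>) U i u \<ominus>\<^bsub>gr (sections F U) i\<^esub> restr F (\<Union>\<U>) U i t"
        using u t U op o
        by (intro linear_map_minus[OF real_space_sections real_space_sections restr_linear])
          (auto simp: Union_upper)
      then show ?thesis
        using u t(2)[OF U] U s[OF U] op[OF U]
        by (simp add: scal_one real_space_minus_eq_zero_iff real_space_sections)
    qed
    then have "scal (\<Union>\<U>) i (\<one>\<^bsub>C.functions\<^esub>) ?d = \<zero>\<^bsub>gr (sections F (\<Union>\<U>)) i\<^esub>"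
      using op by (intro gluesD(3)[OF assms d]) auto
    then show "u = t"
      using u t d o by (simp add: scal_one real_space_minus_eq_zero_iff real_space_sections)
  qed
qed

text \<open>A substitute for a partition of unity. The unit splits as g + h with \<open>g\<close> in
  the ideal of gluing functions and \<open>h\<close>, the product of all 1 - \<open>b i\<close>,
  vanishing on every \<open>B i\<close>; as the \<open>B i\<close> cover the space and
  \<open>C\<close> is a sheaf, \<open>h\<close> is zero.\<close>

lemma sheaf_if_glues_locally:
  assumes C: "sheaf X C" and "finite I" and b: "\<And>i. i \<in> I \<Longrightarrow> glues (b i)"
    and B: "\<And>i. i \<in> I \<Longrightarrow> openin X (B i)"
    and bB: "\<And>i. i \<in> I \<Longrightarrow> restr C (topspace X) (B i) 0 (b i) = gone (sections C (B i))"
    and cover: "topspace X \<subseteq> (\<Union>i\<in>I. B i)"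
  shows "sheaf X F"
proof -
  interpret R: cring C.functions by (rule C.cring_functions)
  interpret CS: sheaf X C by (rule C)
  have "\<exists>g h. glues g \<and> h \<in> carrier C.functions \<and> g \<oplus>\<^bsub>C.functions\<^esub> h = \<one>\<^bsub>C.functions\<^esub> \<and>
      (\<forall>i\<in>I. restr C (topspace X) (B i) 0 h = \<zero>\<^bsub>gr (sections C (B i)) 0\<^esub>)"
    using \<open>finite I\<close> b B bB
  proof (induction I)
    case empty
    show ?case
      by (intro exI[of _ "\<zero>\<^bsub>C.functions\<^esub>"] exI[of _ "\<one>\<^bsub>C.functions\<^esub>"]) (simp add: glues_zero)
  next
    case (insert i I)
    then obtain g h where g: "glues g" and h: "h \<in> carrier C.functions"
      and gh: "g \<oplus>\<^bsub>C.functions\<^esub> h = \<one>\<^bsub>C.functions\<^esub>"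
      and hB: "\<And>j. j \<in> I \<Longrightarrow> restr C (topspace X) (B j) 0 h = \<zero>\<^bsub>gr (sections C (B j)) 0\<^esub>" by auto
    have gc: "g \<in> carrier C.functions" and bc: "b i \<in> carrier C.functions" and bg: "glues (b i)"
      using gluesD(1)[OF g] insert.prems(1)[of i] gluesD(1)[of "b i"] by simp_all
    \<comment> \<open>With b = \<open>b i\<close>, g + h = 1 gives g + h b + h (1 - b) = 1; the
      middle term joins the ideal, and the last one acquires the factor that vanishes on the new
      set.\<close>
    define g' where "g' = g \<oplus>\<^bsub>C.functions\<^esub> h \<otimes>\<^bsub>C.functions\<^esub> b i"
    define h' where "h' = h \<otimes>\<^bsub>C.functions\<^esub> (\<one>\<^bsub>C.functions\<^esub> \<ominus>\<^bsub>C.functions\<^esub> b i)"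
    have "glues g'" unfolding g'_def by (intro glues_add glues_mult g bg h)
    moreover have "h' \<in> carrier C.functions" unfolding h'_def using h bc by simp
    moreover have "g' \<oplus>\<^bsub>C.functions\<^esub> h' = g \<oplus>\<^bsub>C.functions\<^esub> h"
      unfolding g'_def h'_def using gc h bc by algebra
    moreover have "restr C (topspace X) (B j) 0 h' = \<zero>\<^bsub>gr (sections C (B j)) 0\<^esub>" if j: "j \<in> insert i I" for j
    proof -
      have o: "openin X (B j)" using insert.prems(2) j by auto
      interpret r: ring_hom_cring C.functions "ring0 (sections C (B j))" "restr C (topspace X) (B j) 0"
        by (rule C.restr_ring_hom[OF openin_topspace o openin_subset[OF o]])
      have "restr C (topspace X) (B j) 0 h' = restr C (topspace X) (B j) 0 h \<otimes>\<^bsub>ring0 (sections C (B j))\<^esub>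
          (\<one>\<^bsub>ring0 (sections C (B j))\<^esub> \<ominus>\<^bsub>ring0 (sections C (B j))\<^esub> restr C (topspace X) (B j) 0 (b i))"
        unfolding h'_def using h bc by (simp add: a_minus_def)
      also have "\<dots> = \<zero>\<^bsub>ring0 (sections C (B j))\<^esub>"
      proof (cases "j = i")
        case True
        then have "restr C (topspace X) (B j) 0 (b i) = \<one>\<^bsub>ring0 (sections C (B j))\<^esub>"
          using insert.prems(3) by (simp add: ring0_simps)
        then show ?thesis using h by (simp add: a_minus_def r.S.r_neg)
      next
        case False
        then have "restr C (topspace X) (B j) 0 h = \<zero>\<^bsub>ring0 (sections C (B j))\<^esub>"
          using hB j by (simp add: ring0_simps)
        then show ?thesis using bc by (simp add: a_minus_def)
      qed
      finally show ?thesis by (simp add: ring0_simps)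
    qed
    ultimately show ?case using gh by metis
  qed
  then obtain g h where g: "glues g" and h: "h \<in> carrier C.functions"
    and gh: "g \<oplus>\<^bsub>C.functions\<^esub> h = \<one>\<^bsub>C.functions\<^esub>"
    and hB: "\<And>i. i \<in> I \<Longrightarrow> restr C (topspace X) (B i) 0 h = \<zero>\<^bsub>gr (sections C (B i)) 0\<^esub>" by auto
  have "h = \<zero>\<^bsub>C.functions\<^esub>"
    unfolding ring0_simps
  proof (rule CS.section_eqI[OF openin_topspace])
    show "h \<in> carrier (gr (sections C (topspace X)) 0)" using h by (simp add: ring0_simps)
    show "\<zero>\<^bsub>gr (sections C (topspace X)) 0\<^esub> \<in> carrier (gr (sections C (topspace X)) 0)"
      by (simp add: real_space_closed C.real_space_sections)
    fix x assume "x \<in> topspace X"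
    then obtain i where i: "i \<in> I" "x \<in> B i" using cover by auto
    then show "\<exists>W. openin X W \<and> x \<in> W \<and> W \<subseteq> topspace X \<and>
        restr C (topspace X) W 0 h = restr C (topspace X) W 0 \<zero>\<^bsub>gr (sections C (topspace X)) 0\<^esub>"
      using B openin_subset by (intro exI[of _ "B i"]) (auto simp: hB C.restr_zero)
  qed
  then have "g = \<one>\<^bsub>C.functions\<^esub>" using gh gluesD(1)[OF g] by simp
  then show ?thesis using g sheaf_if_glues_one by simp
qed

end

text \<open>With the structure sheaf viewed as a module over itself, extension by zero applies to
  coordinate functions as well as to sections.\<close>

definition self_module :: "('m, 'a) alg_presheaf \<Rightarrow> ('m, 'a, 'a) mod_presheaf" where
  "self_module C = \<lparr>sections = (\<lambda>U. \<lparr>gr = gr (sections C U), gact = gmult (sections C U)\<rparr>),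
     restr = restr C\<rparr>"

lemma self_module_simps [simp]:
  "gr (sections (self_module C) U) = gr (sections C U)"
  "gact (sections (self_module C) U) = gmult (sections C U)"
  "restr (self_module C) = restr C"
  by (simp_all add: self_module_def)

lemma (in algebra_sheaf) module_sheaf_self: "module_sheaf X C (self_module C)"
proof -
  have gm: "graded_module (sections C U) (sections (self_module C) U)" if "openin X U" for U
  proof -
    interpret graded_algebra "sections C U" by (rule sections_algebra[OF that])
    show ?thesis
      by (intro graded_module.intro graded_vector_space.intro graded_module_axioms.intro
          graded_algebra_axioms) (simp_all add: vector_space mult_bilinear mult_assoc one_mult)
  qed
  show ?thesis
  proof (intro module_sheaf.intro module_presheaf.intro sheaf.intro presheaf.intro
      module_presheaf_axioms.intro sheaf_axioms.intro algebra_presheaf_axioms)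
    show "graded_vector_space (sections (self_module C) U)" if "openin X U" for U
      using gm[OF that] by (simp add: graded_module_def)
    show "restr (self_module C) U V (i + j) (gact (sections (self_module C) U) i j f s) =
        gact (sections (self_module C) V) i j (restr C U V i f) (restr (self_module C) U V j s)"
      if "openin X U" "openin X V" "V \<subseteq> U" "f \<in> carrier (gr (sections C U) i)"
        "s \<in> carrier (gr (sections (self_module C) U) j)" for U V f i s j
      using restr_algebra_hom[OF that(1-3)] that(4,5) by (simp add: graded_algebra_hom_def)
    show "\<exists>!t. t \<in> carrier (gr (sections (self_module C) (\<Union>\<U>)) i) \<and>
        (\<forall>U\<in>\<U>. restr (self_module C) (\<Union>\<U>) U i t = s U)"
      if "\<And>U. U \<in> \<U> \<Longrightarrow> openin X U"
        "\<And>U. U \<in> \<U> \<Longrightarrow> s U \<in> carrier (gr (sections (self_module C) U) i)"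
        "\<And>U V. \<lbrakk>U \<in> \<U>; V \<in> \<U>\<rbrakk> \<Longrightarrow>
          restr (self_module C) U (U \<inter> V) i (s U) = restr (self_module C) V (U \<inter> V) i (s V)"
      for \<U> s i
      using glue[of \<U> s i] that unfolding self_module_simps by blast
  qed (use gm in \<open>simp_all add: graded_module_def restr_linear restr_id restr_trans\<close>)
qed

section \<open>Extension by zero\<close>

text \<open>The support of \<open>a\<close> lies in \<open>W\<close>, expressed without closures:
  \<open>Q\<close> is an open set on which \<open>a\<close> vanishes and which contains everything
  outside \<open>W\<close>.\<close>

definition (in algebra_presheaf) cutoff :: "'a \<Rightarrow> 'm set \<Rightarrow> 'm set \<Rightarrow> bool" where
  "cutoff a W Q \<longleftrightarrow> a \<in> carrier functions \<and> openin X W \<and> openin X Q \<and> W \<union> Q = topspace X \<and>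
     restr C (topspace X) Q 0 a = \<zero>\<^bsub>gr (sections C Q) 0\<^esub>"

context sheaf
begin

lemma section_eqI2:
  assumes U: "openin X U" "openin X W" "openin X Q" and cover: "U \<subseteq> W \<union> Q"
    and s: "s \<in> carrier (gr (sections F U) i)" and t: "t \<in> carrier (gr (sections F U) i)"
    and eq: "restr F U (U \<inter> W) i s = restr F U (U \<inter> W) i t" "restr F U (U \<inter> Q) i s = restr F U (U \<inter> Q) i t"
  shows "s = t"
proof (rule section_eqI[OF U(1) s t])
  fix x assume x: "x \<in> U"
  show "\<exists>V. openin X V \<and> x \<in> V \<and> V \<subseteq> U \<and> restr F U V i s = restr F U V i t"
  proof (cases "x \<in> W")
    case True
    with x U eq(1) show ?thesis by (intro exI[of _ "U \<inter> W"]) auto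
  next
    case False
    with x U eq(2) cover show ?thesis by (intro exI[of _ "U \<inter> Q"]) auto
  qed
qed

lemma glue2:
  assumes o: "openin X V" "openin X W"
    and s: "s \<in> carrier (gr (sections F V) i)" and t: "t \<in> carrier (gr (sections F W) i)"
    and eq: "restr F V (V \<inter> W) i s = restr F W (V \<inter> W) i t"
  obtains u where "u \<in> carrier (gr (sections F (V \<union> W)) i)"
    "restr F (V \<union> W) V i u = s" "restr F (V \<union> W) W i u = t"
proof -
  let ?s = "\<lambda>U. if U = V then s else t"
  \<comment> \<open>For \<open>V = W\<close> the family \<open>?s\<close> assigns \<open>s\<close>
    to both members, which is harmless because the two sections are then equal.\<close>
  have st: "s = t" if "V = W"
    using eq s t o that by (simp add: restr_id)
  have "\<exists>!u. u \<in> carrier (gr (sections F (\<Union>{V, W})) i) \<and>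
      (\<forall>U\<in>{V, W}. restr F (\<Union>{V, W}) U i u = ?s U)"
  proof (rule glue)
    fix U U' assume "U \<in> {V, W}" "U' \<in> {V, W}"
    then show "restr F U (U \<inter> U') i (?s U) = restr F U' (U \<inter> U') i (?s U')"
      using eq by (auto simp: Int_commute)
  qed (use o s t in auto)
  then obtain u where u: "u \<in> carrier (gr (sections F (V \<union> W)) i)"
    "\<forall>U\<in>{V, W}. restr F (V \<union> W) U i u = ?s U" by auto
  show ?thesis by (rule that[OF u(1)]) (use u(2) st in auto)
qed

end

context module_sheaf
begin

text \<open>The product of \<open>a\<close> and \<open>y\<close> over \<open>U \<inter> W\<close>,
  continued by zero to \<open>U\<close>; the section \<open>y\<close> itself may fail to extend. The
  result is linear and natural in \<open>y\<close>, which allows its use on all open sets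
  \<open>U\<close> at once.\<close>

definition ext :: "'a \<Rightarrow> 'm set \<Rightarrow> 'm set \<Rightarrow> 'm set \<Rightarrow> int \<Rightarrow> 'b \<Rightarrow> 'b" where
  "ext a W Q U k y = (THE t. t \<in> carrier (gr (sections F U) k) \<and>
     restr F U (U \<inter> W) k t = scal (U \<inter> W) k a y \<and>
     restr F U (U \<inter> Q) k t = \<zero>\<^bsub>gr (sections F (U \<inter> Q)) k\<^esub>)"

context
  fixes a W Q
  assumes cut: "C.cutoff a W Q"
begin

lemma cutoffD: "a \<in> carrier C.functions" "openin X W" "openin X Q" "W \<union> Q = topspace X"
    "restr C (topspace X) Q 0 a = \<zero>\<^bsub>gr (sections C Q) 0\<^esub>"
  using cut by (auto simp: C.cutoff_def)

lemma scal_cutoff_zero: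
  assumes V: "openin X V" "V \<subseteq> Q" and t: "t \<in> carrier (gr (sections F V) k)"
  shows "scal V k a t = \<zero>\<^bsub>gr (sections F V) k\<^esub>"
proof (rule scal_eq_zero[OF V(1) _ t])
  have "restr C (topspace X) V 0 a = restr C Q V 0 (restr C (topspace X) Q 0 a)"
    using cutoffD V openin_subset[OF cutoffD(3)]
    by (subst C.restr_trans) (auto simp: ring0_simps)
  then show "restr C (topspace X) V 0 a = \<zero>\<^bsub>gr (sections C V) 0\<^esub>"
    using cutoffD(3,5) V by (simp add: C.restr_zero)
qed

text \<open>On the overlap of \<open>W\<close> and \<open>Q\<close> the function \<open>a\<close>
  vanishes, so the product of \<open>a\<close> and \<open>y\<close> agrees with zero there; gluing
  along two open sets suffices.\<close>

lemma ext_ex1: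
  assumes U: "openin X U" and y: "y \<in> carrier (gr (sections F (U \<inter> W)) k)"
  shows "\<exists>!t. t \<in> carrier (gr (sections F U) k) \<and>
     restr F U (U \<inter> W) k t = scal (U \<inter> W) k a y \<and>
     restr F U (U \<inter> Q) k t = \<zero>\<^bsub>gr (sections F (U \<inter> Q)) k\<^esub>"
proof (rule ex_ex1I)
  have o: "openin X (U \<inter> W)" "openin X (U \<inter> Q)" "openin X ((U \<inter> W) \<inter> (U \<inter> Q))"
    using U cutoffD by auto
  have un: "(U \<inter> W) \<union> (U \<inter> Q) = U" using cutoffD(4) openin_subset[OF U] by auto
  have "restr F (U \<inter> W) ((U \<inter> W) \<inter> (U \<inter> Q)) k (scal (U \<inter> W) k a y) =
      scal ((U \<inter> W) \<inter> (U \<inter> Q)) k a (restr F (U \<inter> W) ((U \<inter> W) \<inter> (U \<inter> Q)) k y)"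
    using o y cutoffD(1) by (intro restr_scal) auto
  also have "\<dots> = \<zero>\<^bsub>gr (sections F ((U \<inter> W) \<inter> (U \<inter> Q))) k\<^esub>"
    using o y by (intro scal_cutoff_zero restr_closed) auto
  also have "\<dots> = restr F (U \<inter> Q) ((U \<inter> W) \<inter> (U \<inter> Q)) k \<zero>\<^bsub>gr (sections F (U \<inter> Q)) k\<^esub>"
    using o by (intro restr_zero[symmetric]) auto
  finally have eq: "restr F (U \<inter> W) ((U \<inter> W) \<inter> (U \<inter> Q)) k (scal (U \<inter> W) k a y) =
    restr F (U \<inter> Q) ((U \<inter> W) \<inter> (U \<inter> Q)) k \<zero>\<^bsub>gr (sections F (U \<inter> Q)) k\<^esub>" .
  obtain t where "t \<in> carrier (gr (sections F ((U \<inter> W) \<union> (U \<inter> Q))) k)"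
    "restr F ((U \<inter> W) \<union> (U \<inter> Q)) (U \<inter> W) k t = scal (U \<inter> W) k a y"
    "restr F ((U \<inter> W) \<union> (U \<inter> Q)) (U \<inter> Q) k t = \<zero>\<^bsub>gr (sections F (U \<inter> Q)) k\<^esub>"
    by (rule glue2[OF o(1,2) scal_closed[OF o(1) cutoffD(1) y]
        real_space_closed(2)[OF real_space_sections[OF o(2)]] eq])
  then show "\<exists>t. t \<in> carrier (gr (sections F U) k) \<and>
     restr F U (U \<inter> W) k t = scal (U \<inter> W) k a y \<and>
     restr F U (U \<inter> Q) k t = \<zero>\<^bsub>gr (sections F (U \<inter> Q)) k\<^esub>"
    unfolding un by blast
  show "t = t'" if "t \<in> carrier (gr (sections F U) k) \<and>
     restr F U (U \<inter> W) k t = scal (U \<inter> W) k a y \<and>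
     restr F U (U \<inter> Q) k t = \<zero>\<^bsub>gr (sections F (U \<inter> Q)) k\<^esub>"
    "t' \<in> carrier (gr (sections F U) k) \<and>
     restr F U (U \<inter> W) k t' = scal (U \<inter> W) k a y \<and>
     restr F U (U \<inter> Q) k t' = \<zero>\<^bsub>gr (sections F (U \<inter> Q)) k\<^esub>" for t t'
    using that U cutoffD openin_subset[OF U] by (intro section_eqI2[of U W Q t k t']) auto
qed

lemma ext_closed: "\<lbrakk>openin X U; y \<in> carrier (gr (sections F (U \<inter> W)) k)\<rbrakk> \<Longrightarrow>
    ext a W Q U k y \<in> carrier (gr (sections F U) k)"
  and restr_ext: "\<lbrakk>openin X U; y \<in> carrier (gr (sections F (U \<inter> W)) k)\<rbrakk> \<Longrightarrow>
    restr F U (U \<inter> W) k (ext a W Q U k y) = scal (U \<inter> W) k a y"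
  and restr_ext_zero: "\<lbrakk>openin X U; y \<in> carrier (gr (sections F (U \<inter> W)) k)\<rbrakk> \<Longrightarrow>
    restr F U (U \<inter> Q) k (ext a W Q U k y) = \<zero>\<^bsub>gr (sections F (U \<inter> Q)) k\<^esub>"
  unfolding ext_def using theI'[OF ext_ex1] by blast+

lemma ext_eqI:
  assumes "openin X U" "y \<in> carrier (gr (sections F (U \<inter> W)) k)" "t \<in> carrier (gr (sections F U) k)"
    and "restr F U (U \<inter> W) k t = scal (U \<inter> W) k a y"
    and "restr F U (U \<inter> Q) k t = \<zero>\<^bsub>gr (sections F (U \<inter> Q)) k\<^esub>"
  shows "ext a W Q U k y = t"
  unfolding ext_def using assms by (intro the1_equality[OF ext_ex1]) auto

lemma ext_linear:
  assumes U: "openin X U"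
  shows "linear_map (gr (sections F (U \<inter> W)) k) (gr (sections F U) k) (ext a W Q U k)"
proof (rule linear_mapI)
  fix y z r assume y: "y \<in> carrier (gr (sections F (U \<inter> W)) k)"
  have o: "openin X (U \<inter> W)" "openin X (U \<inter> Q)" using U cutoffD by auto
  note V = real_space_sections[OF o(1)] and VQ = real_space_sections[OF o(2)] and VU = real_space_sections[OF U]
  note e = ext_closed[OF U] restr_ext[OF U] restr_ext_zero[OF U]
  show "ext a W Q U k y \<in> carrier (gr (sections F U) k)" using e y by simp
  note lin = linear_map_add[OF scal_linear[OF o(1) cutoffD(1)]]
    linear_map_smult[OF scal_linear[OF o(1) cutoffD(1)]]
  show "ext a W Q U k (r \<odot>\<^bsub>gr (sections F (U \<inter> W)) k\<^esub> y) = r \<odot>\<^bsub>gr (sections F U) k\<^esub> ext a W Q U k y"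
    using y U o V VU VQ by (intro ext_eqI)
      (simp_all add: e restr_smult lin real_space_closed real_space_smult_zero)
  assume z: "z \<in> carrier (gr (sections F (U \<inter> W)) k)"
  show "ext a W Q U k (y \<oplus>\<^bsub>gr (sections F (U \<inter> W)) k\<^esub> z) =
      ext a W Q U k y \<oplus>\<^bsub>gr (sections F U) k\<^esub> ext a W Q U k z"
    using y z U o V VU VQ by (intro ext_eqI)
      (simp_all add: e restr_add lin real_space_closed abelian_monoid.l_zero[OF real_space_abelian_monoid])
qed

lemma restr_ext_natural:
  assumes U: "openin X U" and V: "openin X V" and VU: "V \<subseteq> U"
    and y: "y \<in> carrier (gr (sections F (U \<inter> W)) k)"
  shows "restr F U V k (ext a W Q U k y) = ext a W Q V k (restr F (U \<inter> W) (V \<inter> W) k y)"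
proof -
  have o: "openin X (U \<inter> W)" "openin X (U \<inter> Q)" "openin X (V \<inter> W)" "openin X (V \<inter> Q)"
    using U V cutoffD by auto
  have sub: "V \<inter> W \<subseteq> U \<inter> W" "V \<inter> Q \<subseteq> U \<inter> Q" using VU by auto
  note e = ext_closed[OF U y]
  have 1: "restr F U (V \<inter> W) k (ext a W Q U k y) = scal (V \<inter> W) k a (restr F (U \<inter> W) (V \<inter> W) k y)"
    using restr_trans[OF U o(1,3) sub(1) _ e] restr_ext[OF U y] restr_scal[OF o(1,3) sub(1) cutoffD(1) y]
    by simp
  have 2: "restr F U (V \<inter> Q) k (ext a W Q U k y) = \<zero>\<^bsub>gr (sections F (V \<inter> Q)) k\<^esub>"
    using restr_trans[OF U o(2,4) sub(2) _ e] restr_ext_zero[OF U y] restr_zero[OF o(2,4) sub(2)]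
    by simp
  show ?thesis
    by (rule ext_eqI[symmetric, OF V restr_closed[OF o(1,3) sub(1) y] restr_closed[OF U V VU e]])
      (simp_all add: restr_trans[OF U V _ _ VU e] o 1 2)
qed

lemma ext_act:
  assumes U: "openin X U" and f: "f \<in> carrier (gr (sections C U) l)"
    and y: "y \<in> carrier (gr (sections F (U \<inter> W)) k)"
  shows "ext a W Q U (l + k) (gact (sections F (U \<inter> W)) l k (restr C U (U \<inter> W) l f) y) =
    gact (sections F U) l k f (ext a W Q U k y)"
proof -
  have o: "openin X (U \<inter> W)" "openin X (U \<inter> Q)" using U cutoffD by auto
  note e = ext_closed[OF U y]
  have fr: "restr C U (U \<inter> W) l f \<in> carrier (gr (sections C (U \<inter> W)) l)"
    "restr C U (U \<inter> Q) l f \<in> carrier (gr (sections C (U \<inter> Q)) l)"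
    using U o f by (auto intro: C.restr_closed)
  interpret MW: graded_module "sections C (U \<inter> W)" "sections F (U \<inter> W)" by (rule sections_module[OF o(1)])
  interpret MQ: graded_module "sections C (U \<inter> Q)" "sections F (U \<inter> Q)" by (rule sections_module[OF o(2)])
  interpret MU: graded_module "sections C U" "sections F U" by (rule sections_module[OF U])
  show ?thesis
    using U o f e y fr
    by (intro ext_eqI) (auto simp: restr_act restr_ext restr_ext_zero scal_act cutoffD
        linear_map_zero[OF MQ.vector_space MQ.vector_space MQ.linear_act])
qed

end

end

section \<open>Frames on all smaller open sets\<close>

context module_sheaf
begin

definition comb :: "'m set \<Rightarrow> nat \<Rightarrow> (nat \<Rightarrow> int) \<Rightarrow> (nat \<Rightarrow> 'b) \<Rightarrow> 'm set \<Rightarrow> int \<Rightarrow> (nat \<Rightarrow> 'a) \<Rightarrow> 'b" where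
  "comb W r d e V k f = (\<Oplus>\<^bsub>gr (sections F V) k\<^esub>b\<in>{..<r}.
     gact (sections F V) (k - d b) (d b) (f b) (restr F W V (d b) (e b)))"

text \<open>Stronger than \<open>is_frame\<close>: coordinates exist over every open subset of
  \<open>W\<close>. The degrees are kept apart from the sections so that frames over different open
  sets can share the same \<open>r\<close> and \<open>d\<close>.\<close>

definition frame_on :: "'m set \<Rightarrow> nat \<Rightarrow> (nat \<Rightarrow> int) \<Rightarrow> (nat \<Rightarrow> 'b) \<Rightarrow> bool" where
  "frame_on W r d e \<longleftrightarrow> openin X W \<and> (\<forall>b<r. e b \<in> carrier (gr (sections F W) (d b))) \<and>
     (\<forall>V k. openin X V \<longrightarrow> V \<subseteq> W \<longrightarrow> (\<forall>s\<in>carrier (gr (sections F V) k).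
        \<exists>!f. f \<in> (\<Pi>\<^sub>E b\<in>{..<r}. carrier (gr (sections C V) (k - d b))) \<and> s = comb W r d e V k f))"

definition coord :: "'m set \<Rightarrow> nat \<Rightarrow> (nat \<Rightarrow> int) \<Rightarrow> (nat \<Rightarrow> 'b) \<Rightarrow> 'm set \<Rightarrow> int \<Rightarrow> 'b \<Rightarrow> nat \<Rightarrow> 'a" where
  "coord W r d e V k s = (THE f. f \<in> (\<Pi>\<^sub>E b\<in>{..<r}. carrier (gr (sections C V) (k - d b))) \<and>
     s = comb W r d e V k f)"

context
  fixes W :: "'m set" and r :: nat and d :: "nat \<Rightarrow> int" and e :: "nat \<Rightarrow> 'b"
  assumes W: "openin X W" and e: "\<And>b. b < r \<Longrightarrow> e b \<in> carrier (gr (sections F W) (d b))"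
begin

lemma comb_term_closed:
  assumes V: "openin X V" "V \<subseteq> W" and b: "b < r" and f: "f \<in> carrier (gr (sections C V) (k - d b))"
  shows "gact (sections F V) (k - d b) (d b) f (restr F W V (d b) (e b)) \<in> carrier (gr (sections F V) k)"
  using graded_module.act_closed[OF sections_module[OF V(1)] f restr_closed[OF W V e[OF b]]] by simp

lemma comb_closed:
  assumes V: "openin X V" "V \<subseteq> W" and f: "\<And>b. b < r \<Longrightarrow> f b \<in> carrier (gr (sections C V) (k - d b))"
  shows "comb W r d e V k f \<in> carrier (gr (sections F V) k)"
  unfolding comb_def using V f
  by (intro real_space_finsum_closed real_space_sections comb_term_closed) auto

lemma comb_cong:
  assumes V: "openin X V" "V \<subseteq> W" and f: "\<And>b. b < r \<Longrightarrow> f b \<in> carrier (gr (sections C V) (k - d b))"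
    and eq: "\<And>b. b < r \<Longrightarrow> g b = f b"
  shows "comb W r d e V k g = comb W r d e V k f"
  unfolding comb_def using V f eq
  by (intro real_space_finsum_cong real_space_sections comb_term_closed) auto

lemma comb_add:
  assumes V: "openin X V" "V \<subseteq> W" and f: "\<And>b. b < r \<Longrightarrow> f b \<in> carrier (gr (sections C V) (k - d b))"
    and g: "\<And>b. b < r \<Longrightarrow> g b \<in> carrier (gr (sections C V) (k - d b))"
  shows "comb W r d e V k (\<lambda>b. f b \<oplus>\<^bsub>gr (sections C V) (k - d b)\<^esub> g b) =
    comb W r d e V k f \<oplus>\<^bsub>gr (sections F V) k\<^esub> comb W r d e V k g"
proof -
  interpret A: abelian_monoid "gr (sections F V) k"
    by (rule real_space_abelian_monoid[OF real_space_sections[OF V(1)]])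
  interpret M: graded_module "sections C V" "sections F V" by (rule sections_module[OF V(1)])
  let ?t = "\<lambda>f b. gact (sections F V) (k - d b) (d b) (f b) (restr F W V (d b) (e b))"
  have "comb W r d e V k (\<lambda>b. f b \<oplus>\<^bsub>gr (sections C V) (k - d b)\<^esub> g b) =
    (\<Oplus>\<^bsub>gr (sections F V) k\<^esub>b\<in>{..<r}. ?t f b \<oplus>\<^bsub>gr (sections F V) k\<^esub> ?t g b)"
    unfolding comb_def
  proof (rule A.finsum_cong')
    fix b assume "b \<in> {..<r}"
    then show "gact (sections F V) (k - d b) (d b) (f b \<oplus>\<^bsub>gr (sections C V) (k - d b)\<^esub> g b)
        (restr F W V (d b) (e b)) = ?t f b \<oplus>\<^bsub>gr (sections F V) k\<^esub> ?t g b"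
      using linear_map_add[OF M.linear_act_left[OF restr_closed[OF W V e]] f g, of b] by simp
  qed (use V f g comb_term_closed in auto)
  also have "\<dots> = comb W r d e V k f \<oplus>\<^bsub>gr (sections F V) k\<^esub> comb W r d e V k g"
    unfolding comb_def using V f g comb_term_closed by (intro A.finsum_addf) auto
  finally show ?thesis .
qed

lemma comb_act:
  assumes V: "openin X V" "V \<subseteq> W" and f: "\<And>b. b < r \<Longrightarrow> f b \<in> carrier (gr (sections C V) (k - d b))"
    and h: "h \<in> carrier (gr (sections C V) l)"
  shows "comb W r d e V (l + k) (\<lambda>b. gmult (sections C V) l (k - d b) h (f b)) =
    gact (sections F V) l k h (comb W r d e V k f)"
proof -
  interpret M: graded_module "sections C V" "sections F V" by (rule sections_module[OF V(1)])
  let ?t = "\<lambda>b. gact (sections F V) (k - d b) (d b) (f b) (restr F W V (d b) (e b))"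
  have "gact (sections F V) l k h (comb W r d e V k f) =
      (\<Oplus>\<^bsub>gr (sections F V) (l + k)\<^esub>b\<in>{..<r}. gact (sections F V) l k h (?t b))"
    unfolding comb_def using V f comb_term_closed
    by (intro linear_map_finsum[OF M.vector_space M.vector_space M.linear_act[OF h]]) auto
  also have "\<dots> = comb W r d e V (l + k) (\<lambda>b. gmult (sections C V) l (k - d b) h (f b))"
    unfolding comb_def
  proof (rule M.gr_finsum_cong)
    fix b assume b: "b \<in> {..<r}"
    then have fb: "f b \<in> carrier (gr (sections C V) (k - d b))" using f by simp
    have eb: "restr F W V (d b) (e b) \<in> carrier (gr (sections F V) (d b))"
      using b by (intro restr_closed[OF W V] e) simp
    show "gact (sections F V) l k h (?t b) = gact (sections F V) (l + k - d b) (d b)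
        (gmult (sections C V) l (k - d b) h (f b)) (restr F W V (d b) (e b))"
      using M.act_assoc[OF h fb eb] by (simp add: add_diff_eq)
    have "gmult (sections C V) l (k - d b) h (f b) \<in> carrier (gr (sections C V) (l + k - d b))"
      using M.A.mult_closed[OF h fb] by (simp add: add_diff_eq)
    then show "gact (sections F V) (l + k - d b) (d b) (gmult (sections C V) l (k - d b) h (f b))
        (restr F W V (d b) (e b)) \<in> carrier (gr (sections F V) (l + k))"
      using b by (intro comb_term_closed V) auto
  qed
  finally show ?thesis by simp
qed

lemma restr_comb:
  assumes V: "openin X V" "V \<subseteq> W" and V': "openin X V'" "V' \<subseteq> V"
    and f: "\<And>b. b < r \<Longrightarrow> f b \<in> carrier (gr (sections C V) (k - d b))"
  shows "restr F V V' k (comb W r d e V k f) = comb W r d e V' k (\<lambda>b. restr C V V' (k - d b) (f b))"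
proof -
  let ?t = "\<lambda>b. gact (sections F V) (k - d b) (d b) (f b) (restr F W V (d b) (e b))"
  have VW: "V' \<subseteq> W" using V V' by auto
  have "restr F V V' k (comb W r d e V k f) = (\<Oplus>\<^bsub>gr (sections F V') k\<^esub>b\<in>{..<r}. restr F V V' k (?t b))"
    unfolding comb_def using V V' f comb_term_closed
    by (intro linear_map_finsum[OF real_space_sections real_space_sections restr_linear]) auto
  also have "\<dots> = comb W r d e V' k (\<lambda>b. restr C V V' (k - d b) (f b))"
    unfolding comb_def
  proof (rule real_space_finsum_cong[OF real_space_sections[OF V'(1)]])
    fix b assume b: "b \<in> {..<r}"
    then have fb: "f b \<in> carrier (gr (sections C V) (k - d b))" using f by simp
    have eb: "e b \<in> carrier (gr (sections F W) (d b))" using b e by simp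
    show "restr F V V' k (?t b) =
        gact (sections F V') (k - d b) (d b) (restr C V V' (k - d b) (f b)) (restr F W V' (d b) (e b))"
      using restr_act[OF V(1) V' fb restr_closed[OF W V eb]] restr_trans[OF W V(1) V'(1,2) V(2) eb]
      by simp
    show "gact (sections F V') (k - d b) (d b) (restr C V V' (k - d b) (f b)) (restr F W V' (d b) (e b))
        \<in> carrier (gr (sections F V') k)"
      using b by (intro comb_term_closed V' VW C.restr_closed[OF V(1) V' fb]) auto
  qed
  finally show ?thesis .
qed

end

section \<open>Coordinates with respect to a frame\<close>

context
  fixes W :: "'m set" and r :: nat and d :: "nat \<Rightarrow> int" and e :: "nat \<Rightarrow> 'b"
  assumes fr: "frame_on W r d e"
begin

lemma frame_onD: "openin X W" "b < r \<Longrightarrow> e b \<in> carrier (gr (sections F W) (d b))"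
  using fr by (auto simp: frame_on_def)

context
  fixes V
  assumes V: "openin X V" "V \<subseteq> W"
begin

lemma coord_ex1: "s \<in> carrier (gr (sections F V) k) \<Longrightarrow>
  \<exists>!f. f \<in> (\<Pi>\<^sub>E b\<in>{..<r}. carrier (gr (sections C V) (k - d b))) \<and> s = comb W r d e V k f"
  using fr V by (simp add: frame_on_def)

lemma coord_closed: "\<lbrakk>s \<in> carrier (gr (sections F V) k); b < r\<rbrakk> \<Longrightarrow>
    coord W r d e V k s b \<in> carrier (gr (sections C V) (k - d b))"
  and comb_coord: "s \<in> carrier (gr (sections F V) k) \<Longrightarrow> comb W r d e V k (coord W r d e V k s) = s"
  unfolding coord_def using theI'[OF coord_ex1, of s k] by (auto simp: PiE_iff)

lemma coord_eqI:
  assumes f: "\<And>b. b < r \<Longrightarrow> f b \<in> carrier (gr (sections C V) (k - d b))"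
    and s: "s = comb W r d e V k f" and b: "b < r"
  shows "coord W r d e V k s b = f b"
proof -
  have eq: "comb W r d e V k (restrict f {..<r}) = comb W r d e V k f"
    by (rule comb_cong[OF frame_onD V f]) auto
  have "s \<in> carrier (gr (sections F V) k)"
    unfolding s by (rule comb_closed[OF frame_onD V f])
  then have "coord W r d e V k s = restrict f {..<r}"
    unfolding coord_def using f by (intro the1_equality[OF coord_ex1]) (auto simp: s eq)
  then show ?thesis using b by simp
qed

lemma coord_linear:
  assumes b: "b < r"
  shows "linear_map (gr (sections F V) k) (gr (sections C V) (k - d b)) (\<lambda>s. coord W r d e V k s b)"
proof (rule linear_mapI)
  fix s t q assume s: "s \<in> carrier (gr (sections F V) k)"
  show "coord W r d e V k s b \<in> carrier (gr (sections C V) (k - d b))"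
    by (rule coord_closed[OF s b])
  interpret M: graded_module "sections C V" "sections F V" by (rule sections_module[OF V(1)])
  show "coord W r d e V k (q \<odot>\<^bsub>gr (sections F V) k\<^esub> s) b =
      q \<odot>\<^bsub>gr (sections C V) (k - d b)\<^esub> coord W r d e V k s b"
  proof (rule coord_eqI[OF _ _ b])
    \<comment> \<open>A real scalar acts as a degree zero function, namely the scalar times the
      unit. This reduces homogeneity over the reals to linearity over the algebra,
      \<open>comb_act\<close>.\<close>
    let ?h = "q \<odot>\<^bsub>gr (sections C V) 0\<^esub> gone (sections C V)"
    have one: "gone (sections C V) \<in> carrier (gr (sections C V) 0)" by (rule M.A.one_closed)
    have h: "?h \<in> carrier (gr (sections C V) 0)" using one by simp
    have m: "gmult (sections C V) 0 (k - d b) ?h (coord W r d e V k s b) =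
      q \<odot>\<^bsub>gr (sections C V) (k - d b)\<^esub> coord W r d e V k s b" if "b < r" for b
      using linear_map_smult[OF M.A.linear_mult_left[OF coord_closed[OF s that]] one, of q]
        M.A.one_mult[OF coord_closed[OF s that]] by simp
    have "q \<odot>\<^bsub>gr (sections F V) k\<^esub> s = gact (sections F V) 0 k ?h (comb W r d e V k (coord W r d e V k s))"
      using M.smult_act[OF one s] M.one_act[OF s] comb_coord[OF s] by simp
    also have "\<dots> = comb W r d e V k (\<lambda>b. gmult (sections C V) 0 (k - d b) ?h (coord W r d e V k s b))"
      using comb_act[OF frame_onD V coord_closed[OF s] h] by simp
    also have "\<dots> = comb W r d e V k (\<lambda>b. q \<odot>\<^bsub>gr (sections C V) (k - d b)\<^esub> coord W r d e V k s b)"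
      using coord_closed[OF s] by (intro comb_cong[OF frame_onD V _ m]) auto
    finally show "q \<odot>\<^bsub>gr (sections F V) k\<^esub> s =
      comb W r d e V k (\<lambda>b. q \<odot>\<^bsub>gr (sections C V) (k - d b)\<^esub> coord W r d e V k s b)" .
  qed (simp add: coord_closed[OF s])
  assume t: "t \<in> carrier (gr (sections F V) k)"
  show "coord W r d e V k (s \<oplus>\<^bsub>gr (sections F V) k\<^esub> t) b =
      coord W r d e V k s b \<oplus>\<^bsub>gr (sections C V) (k - d b)\<^esub> coord W r d e V k t b"
    using comb_add[OF frame_onD V coord_closed[OF s] coord_closed[OF t]]
    by (intro coord_eqI[OF _ _ b]) (auto simp: coord_closed s t comb_coord)
qed

lemma coord_act:
  assumes s: "s \<in> carrier (gr (sections F V) k)" and h: "h \<in> carrier (gr (sections C V) l)" and b: "b < r"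
  shows "coord W r d e V (l + k) (gact (sections F V) l k h s) b =
    gmult (sections C V) l (k - d b) h (coord W r d e V k s b)"
proof (rule coord_eqI[OF _ _ b])
  interpret M: graded_module "sections C V" "sections F V" by (rule sections_module[OF V(1)])
  show "gmult (sections C V) l (k - d b) h (coord W r d e V k s b)
      \<in> carrier (gr (sections C V) (l + k - d b))" if "b < r" for b
    using M.A.mult_closed[OF h coord_closed[OF s that]] by (simp add: add_diff_eq)
  show "gact (sections F V) l k h s =
      comb W r d e V (l + k) (\<lambda>b. gmult (sections C V) l (k - d b) h (coord W r d e V k s b))"
    using comb_act[OF frame_onD V coord_closed[OF s] h] comb_coord[OF s] by simp
qed

end

lemma restr_coord:
  assumes V: "openin X V" "V \<subseteq> W" and s: "s \<in> carrier (gr (sections F V) k)"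
    and V': "openin X V'" "V' \<subseteq> V" and b: "b < r"
  shows "restr C V V' (k - d b) (coord W r d e V k s b) = coord W r d e V' k (restr F V V' k s) b"
proof -
  have VW: "V' \<subseteq> W" using V V' by auto
  let ?f = "\<lambda>b. restr C V V' (k - d b) (coord W r d e V k s b)"
  have f: "?f b \<in> carrier (gr (sections C V') (k - d b))" if "b < r" for b
    by (rule C.restr_closed[OF V(1) V' coord_closed[OF V s that]])
  have c: "restr F V V' k s = comb W r d e V' k ?f"
    using restr_comb[where r = r and d = d and e = e and f = "coord W r d e V k s",
        OF frame_onD V V' coord_closed[OF V s]] comb_coord[OF V s] by simp
  show ?thesis
    by (rule coord_eqI[OF V'(1) VW f c b, symmetric])
qed

end

end

section \<open>Frames make the tensor product presheaf a sheaf locally\<close>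

locale sheaf_pair = CS: algebra_sheaf X C + S: module_sheaf X C S + P: module_sheaf X C P
  for X :: "'m topology" and C :: "('m, 'a) alg_presheaf" and S :: "('m, 'a, 'b) mod_presheaf"
    and P :: "('m, 'a, 'c) mod_presheaf"
begin

sublocale presheaf_pair X C S P by unfold_locales

sublocale T: module_presheaf X C "tensor_presheaf C S P" by (rule module_presheaf_tensor)

sublocale Cm: module_sheaf X C "self_module C" by (rule CS.module_sheaf_self)

section \<open>Coordinates and frames cut off by a function\<close>

context
  fixes a W Q r d e
  assumes cut: "CS.cutoff a W Q" and fr: "S.frame_on W r d e"
begin

lemmas aW = S.cutoffD[OF cut]
lemmas eW = S.frame_onD[OF fr]

definition cut_coord :: "'m set \<Rightarrow> int \<Rightarrow> 'b \<Rightarrow> nat \<Rightarrow> 'a" where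
  "cut_coord U i s b = Cm.ext a W Q U (i - d b) (S.coord W r d e (U \<inter> W) i (restr S U (U \<inter> W) i s) b)"

definition cut_frame :: "'m set \<Rightarrow> nat \<Rightarrow> 'b" where
  "cut_frame U b = S.ext a W Q U (d b) (restr S W (U \<inter> W) (d b) (e b))"

lemma openin_Int_W: "openin X U \<Longrightarrow> openin X (U \<inter> W)" using aW by auto

lemma coord_W_closed:
  "\<lbrakk>openin X U; s \<in> carrier (gr (sections S U) i); b < r\<rbrakk> \<Longrightarrow>
    S.coord W r d e (U \<inter> W) i (restr S U (U \<inter> W) i s) b \<in> carrier (gr (sections C (U \<inter> W)) (i - d b))"
  by (intro S.coord_closed[OF fr openin_Int_W] S.restr_closed openin_Int_W) auto

lemma cut_coord_linear:
  assumes U: "openin X U" and b: "b < r"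
  shows "linear_map (gr (sections S U) i) (gr (sections C U) (i - d b)) (\<lambda>s. cut_coord U i s b)"
proof -
  have sub: "U \<inter> W \<subseteq> U" "U \<inter> W \<subseteq> W" by auto
  show ?thesis
    unfolding cut_coord_def
    using linear_map_comp[OF linear_map_comp[OF S.restr_linear[OF U openin_Int_W[OF U] sub(1)]
      S.coord_linear[OF fr openin_Int_W[OF U] sub(2) b]] Cm.ext_linear[OF cut U, simplified]]
    by simp
qed

lemmas cut_coord_closed = linear_map_closed[OF cut_coord_linear]

lemma cut_coord_act:
  assumes U: "openin X U" and f: "f \<in> carrier (gr (sections C U) l)"
    and s: "s \<in> carrier (gr (sections S U) i)" and b: "b < r"
  shows "cut_coord U (l + i) (gact (sections S U) l i f s) b =
    gmult (sections C U) l (i - d b) f (cut_coord U i s b)"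
proof -
  have sub: "U \<inter> W \<subseteq> U" "U \<inter> W \<subseteq> W" by auto
  note o = openin_Int_W[OF U]
  have "S.coord W r d e (U \<inter> W) (l + i) (restr S U (U \<inter> W) (l + i) (gact (sections S U) l i f s)) b =
    gmult (sections C (U \<inter> W)) l (i - d b) (restr C U (U \<inter> W) l f)
      (S.coord W r d e (U \<inter> W) i (restr S U (U \<inter> W) i s) b)"
    using S.restr_act[OF U o sub(1) f s]
      S.coord_act[OF fr o sub(2) S.restr_closed[OF U o sub(1) s] CS.restr_closed[OF U o sub(1) f] b]
    by simp
  then show ?thesis
    using Cm.ext_act[OF cut U f, of _ "i - d b"] coord_W_closed[OF U s b]
    unfolding cut_coord_def by (simp add: add_diff_eq)
qed

lemma restr_cut_coord:
  assumes U: "openin X U" and V: "openin X V" and VU: "V \<subseteq> U"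
    and s: "s \<in> carrier (gr (sections S U) i)" and b: "b < r"
  shows "restr C U V (i - d b) (cut_coord U i s b) = cut_coord V i (restr S U V i s) b"
proof -
  have sub: "U \<inter> W \<subseteq> U" "U \<inter> W \<subseteq> W" "V \<inter> W \<subseteq> U \<inter> W" "V \<inter> W \<subseteq> V" using VU by auto
  note o = openin_Int_W[OF U] openin_Int_W[OF V]
  have "restr S (U \<inter> W) (V \<inter> W) i (restr S U (U \<inter> W) i s) = restr S V (V \<inter> W) i (restr S U V i s)"
    using S.restr_trans[OF U o(1,2) sub(3,1) s] S.restr_trans[OF U V o(2) sub(4) VU s] by simp
  then show ?thesis
    using Cm.restr_ext_natural[OF cut U V VU, of _ "i - d b"] coord_W_closed[OF U s b]
      S.restr_coord[OF fr o(1) sub(2) S.restr_closed[OF U o(1) sub(1) s] o(2) sub(3) b]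
    unfolding cut_coord_def by simp
qed

lemma cut_frame_closed: "\<lbrakk>openin X U; b < r\<rbrakk> \<Longrightarrow> cut_frame U b \<in> carrier (gr (sections S U) (d b))"
  unfolding cut_frame_def
  by (intro S.ext_closed[OF cut] S.restr_closed openin_Int_W eW) auto

lemma restr_cut_frame:
  assumes U: "openin X U" and V: "openin X V" and VU: "V \<subseteq> U" and b: "b < r"
  shows "restr S U V (d b) (cut_frame U b) = cut_frame V b"
proof -
  have sub: "U \<inter> W \<subseteq> W" "V \<inter> W \<subseteq> U \<inter> W" using VU by auto
  note o = openin_Int_W[OF U] openin_Int_W[OF V]
  show ?thesis
    unfolding cut_frame_def
    using S.restr_ext_natural[OF cut U V VU S.restr_closed[OF eW(1) o(1) sub(1) eW(2)[OF b]]]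
      S.restr_trans[OF eW(1) o sub(2,1) eW(2)[OF b]] by simp
qed

lemma act_scal_scal:
  assumes V: "openin X V" and f: "f \<in> carrier (gr (sections C V) l)" and s: "s \<in> carrier (gr (sections S V) i)"
    and g: "g \<in> carrier CS.functions"
  shows "gact (sections S V) l i (Cm.scal V l g f) (S.scal V i g s) =
    S.scal V (l + i) (g \<otimes>\<^bsub>CS.functions\<^esub> g) (gact (sections S V) l i f s)"
proof -
  interpret M: graded_module "sections C V" "sections S V" by (rule S.sections_module[OF V])
  have gs: "S.scal V i g s \<in> carrier (gr (sections S V) i)" by (rule S.scal_closed[OF V g s])
  have "gact (sections S V) l i (Cm.scal V l g f) (S.scal V i g s) =
      S.scal V (l + i) g (gact (sections S V) l i f (S.scal V i g s))"
    unfolding Cm.scal_def S.scal_def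
    using M.act_assoc[OF S.restr_function_closed[OF V g] f gs] by (simp add: S.scal_def)
  also have "\<dots> = S.scal V (l + i) g (S.scal V (l + i) g (gact (sections S V) l i f s))"
    using S.scal_act[OF V g f s] by simp
  also have "\<dots> = S.scal V (l + i) (g \<otimes>\<^bsub>CS.functions\<^esub> g) (gact (sections S V) l i f s)"
    using S.scal_mult[OF V g g M.act_closed[OF f s]] by simp
  finally show ?thesis .
qed

text \<open>Over \<open>W\<close> this is the expansion of \<open>s\<close> in the frame, with one
  factor \<open>a\<close> from the coordinate and one from the frame section; over \<open>Q\<close>
  both sides vanish. As \<open>W\<close> and \<open>Q\<close> cover, the sheaf property of
  \<open>S\<close> gives equality over \<open>U\<close>.\<close>

lemma cut_frame_expansion:
  assumes U: "openin X U" and s: "s \<in> carrier (gr (sections S U) i)"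
  shows "(\<Oplus>\<^bsub>gr (sections S U) i\<^esub>b\<in>{..<r}. gact (sections S U) (i - d b) (d b) (cut_coord U i s b) (cut_frame U b)) =
    S.scal U i (a \<otimes>\<^bsub>CS.functions\<^esub> a) s" (is "?L = ?R")
proof -
  interpret R: cring CS.functions by (rule CS.cring_functions)
  interpret MU: graded_module "sections C U" "sections S U" by (rule S.sections_module[OF U])
  have aa: "a \<otimes>\<^bsub>CS.functions\<^esub> a \<in> carrier CS.functions" using aW by simp
  let ?t = "\<lambda>b. gact (sections S U) (i - d b) (d b) (cut_coord U i s b) (cut_frame U b)"
  have t: "?t b \<in> carrier (gr (sections S U) i)" if "b < r" for b
    using MU.act_closed[OF cut_coord_closed[OF U that s] cut_frame_closed[OF U that]] by simp
  \<comment> \<open>The left side commutes with restriction, so it can be evaluated separately over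
    \<open>U \<inter> W\<close> and over \<open>U \<inter> Q\<close>.\<close>
  have restr_L: "restr S U V i ?L = (\<Oplus>\<^bsub>gr (sections S V) i\<^esub>b\<in>{..<r}.
      gact (sections S V) (i - d b) (d b) (restr C U V (i - d b) (cut_coord U i s b)) (restr S U V (d b) (cut_frame U b)))"
    if V: "openin X V" "V \<subseteq> U" for V
  proof -
    interpret MV: graded_module "sections C V" "sections S V" by (rule S.sections_module[OF V(1)])
    have "restr S U V i ?L = (\<Oplus>\<^bsub>gr (sections S V) i\<^esub>b\<in>{..<r}. restr S U V i (?t b))"
      using t by (intro linear_map_finsum[OF MU.vector_space MV.vector_space S.restr_linear[OF U V]]) auto
    also have "\<dots> = (\<Oplus>\<^bsub>gr (sections S V) i\<^esub>b\<in>{..<r}.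
      gact (sections S V) (i - d b) (d b) (restr C U V (i - d b) (cut_coord U i s b)) (restr S U V (d b) (cut_frame U b)))"
    proof (rule MV.gr_finsum_cong)
      fix b assume b: "b \<in> {..<r}"
      then have cl: "cut_coord U i s b \<in> carrier (gr (sections C U) (i - d b))"
        "cut_frame U b \<in> carrier (gr (sections S U) (d b))"
        by (auto intro: cut_coord_closed cut_frame_closed U s)
      show "restr S U V i (?t b) = gact (sections S V) (i - d b) (d b)
          (restr C U V (i - d b) (cut_coord U i s b)) (restr S U V (d b) (cut_frame U b))"
        using S.restr_act[OF U V cl] by simp
      show "gact (sections S V) (i - d b) (d b) (restr C U V (i - d b) (cut_coord U i s b))
          (restr S U V (d b) (cut_frame U b)) \<in> carrier (gr (sections S V) i)"
        using MV.act_closed[OF CS.restr_closed[OF U V cl(1)] S.restr_closed[OF U V cl(2)]] by simp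
    qed
    finally show ?thesis .
  qed
  have L: "?L \<in> carrier (gr (sections S U) i)" using t by (intro MU.gr_finsum_closed) auto
  show ?thesis
  proof (rule S.section_eqI2[OF U aW(2,3) _ L S.scal_closed[OF U aa s]])
    show "U \<subseteq> W \<union> Q" using aW(4) openin_subset[OF U] by simp
    have o: "openin X (U \<inter> W)" "openin X (U \<inter> Q)" using U aW by auto
    have sub: "U \<inter> W \<subseteq> U" "U \<inter> W \<subseteq> W" "U \<inter> Q \<subseteq> U" "U \<inter> Q \<subseteq> Q" by auto
    let ?s = "restr S U (U \<inter> W) i s"
    have s': "?s \<in> carrier (gr (sections S (U \<inter> W)) i)" by (rule S.restr_closed[OF U o(1) sub(1) s])
    interpret MW: graded_module "sections C (U \<inter> W)" "sections S (U \<inter> W)" by (rule S.sections_module[OF o(1)])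
    interpret MQ: graded_module "sections C (U \<inter> Q)" "sections S (U \<inter> Q)" by (rule S.sections_module[OF o(2)])
    let ?u = "\<lambda>b. gact (sections S (U \<inter> W)) (i - d b) (d b) (S.coord W r d e (U \<inter> W) i ?s b)
      (restr S W (U \<inter> W) (d b) (e b))"
    have u: "?u b \<in> carrier (gr (sections S (U \<inter> W)) i)" if "b < r" for b
      using S.comb_term_closed[where d = d and e = e, OF eW o(1) sub(2) that S.coord_closed[OF fr o(1) sub(2) s' that]] .
    have "restr S U (U \<inter> W) i ?L = (\<Oplus>\<^bsub>gr (sections S (U \<inter> W)) i\<^esub>b\<in>{..<r}.
        S.scal (U \<inter> W) i (a \<otimes>\<^bsub>CS.functions\<^esub> a) (?u b))"
      unfolding restr_L[OF o(1) sub(1)]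
    proof (rule MW.gr_finsum_cong)
      fix b assume b: "b \<in> {..<r}"
      have eb: "restr S W (U \<inter> W) (d b) (e b) \<in> carrier (gr (sections S (U \<inter> W)) (d b))"
        using b by (intro S.restr_closed[OF aW(2) o(1) sub(2)] eW) simp
      have cb: "S.coord W r d e (U \<inter> W) i ?s b \<in> carrier (gr (sections C (U \<inter> W)) (i - d b))"
        using b by (intro S.coord_closed[OF fr o(1) sub(2) s']) simp
      show "gact (sections S (U \<inter> W)) (i - d b) (d b) (restr C U (U \<inter> W) (i - d b) (cut_coord U i s b))
          (restr S U (U \<inter> W) (d b) (cut_frame U b)) = S.scal (U \<inter> W) i (a \<otimes>\<^bsub>CS.functions\<^esub> a) (?u b)"
        unfolding cut_coord_def cut_frame_def
        using Cm.restr_ext[OF cut U, of _ "i - d b"] S.restr_ext[OF cut U eb] cb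
          act_scal_scal[OF o(1) cb eb aW(1)] by simp
      show "S.scal (U \<inter> W) i (a \<otimes>\<^bsub>CS.functions\<^esub> a) (?u b) \<in> carrier (gr (sections S (U \<inter> W)) i)"
        using b by (intro S.scal_closed[OF o(1) aa] u) simp
    qed
    also have "\<dots> = S.scal (U \<inter> W) i (a \<otimes>\<^bsub>CS.functions\<^esub> a) (\<Oplus>\<^bsub>gr (sections S (U \<inter> W)) i\<^esub>b\<in>{..<r}. ?u b)"
      using u by (intro linear_map_finsum[OF MW.vector_space MW.vector_space S.scal_linear[OF o(1) aa], symmetric]) auto
    also have "(\<Oplus>\<^bsub>gr (sections S (U \<inter> W)) i\<^esub>b\<in>{..<r}. ?u b) = ?s"
      using S.comb_coord[OF fr o(1) sub(2) s'] by (simp add: S.comb_def)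
    also have "S.scal (U \<inter> W) i (a \<otimes>\<^bsub>CS.functions\<^esub> a) ?s = restr S U (U \<inter> W) i ?R"
      by (rule S.restr_scal[OF U o(1) sub(1) aa s, symmetric])
    finally show "restr S U (U \<inter> W) i ?L = restr S U (U \<inter> W) i ?R" .
    have "restr S U (U \<inter> Q) i ?L = (\<Oplus>\<^bsub>gr (sections S (U \<inter> Q)) i\<^esub>b\<in>{..<r}. \<zero>\<^bsub>gr (sections S (U \<inter> Q)) i\<^esub>)"
      unfolding restr_L[OF o(2) sub(3)]
    proof (rule MQ.gr_finsum_cong)
      fix b assume b: "b \<in> {..<r}"
      have eb: "restr S W (U \<inter> W) (d b) (e b) \<in> carrier (gr (sections S (U \<inter> W)) (d b))"
        using b by (intro S.restr_closed[OF aW(2) o(1) sub(2)] eW) simp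
      have z: "restr S U (U \<inter> Q) (d b) (cut_frame U b) = \<zero>\<^bsub>gr (sections S (U \<inter> Q)) (d b)\<^esub>"
        unfolding cut_frame_def by (rule S.restr_ext_zero[OF cut U eb])
      have "restr C U (U \<inter> Q) (i - d b) (cut_coord U i s b) \<in> carrier (gr (sections C (U \<inter> Q)) (i - d b))"
        using b by (intro CS.restr_closed[OF U o(2) sub(3)] cut_coord_closed U s) auto
      from linear_map_zero[OF MQ.vector_space MQ.vector_space MQ.linear_act[OF this, of "d b"]]
      show "gact (sections S (U \<inter> Q)) (i - d b) (d b) (restr C U (U \<inter> Q) (i - d b) (cut_coord U i s b))
          (restr S U (U \<inter> Q) (d b) (cut_frame U b)) = \<zero>\<^bsub>gr (sections S (U \<inter> Q)) i\<^esub>"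
        unfolding z by simp
    qed simp
    also have "\<dots> = \<zero>\<^bsub>gr (sections S (U \<inter> Q)) i\<^esub>"
      by (rule abelian_monoid.finsum_zero[OF MQ.gr_abelian_monoid])
    also have "\<dots> = restr S U (U \<inter> Q) i ?R"
    proof -
      have sQ: "restr S U (U \<inter> Q) i s \<in> carrier (gr (sections S (U \<inter> Q)) i)"
        by (rule S.restr_closed[OF U o(2) sub(3) s])
      show ?thesis
        using S.restr_scal[OF U o(2) sub(3) aa s] S.scal_mult[OF o(2) aW(1) aW(1) sQ]
          S.scal_cutoff_zero[OF cut o(2) sub(4)] sQ by simp
    qed
    finally show "restr S U (U \<inter> Q) i ?L = restr S U (U \<inter> Q) i ?R" .
  qed
qed

text \<open>The sign makes \<open>s \<otimes> p \<mapsto> \<plusminus> f\<^sup>b(s) p\<close> balanced, where \<open>f\<^sup>b\<close> is the \<open>b\<close>-th coordinate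
  cut off by \<open>a\<close>.\<close>

definition cut_contract :: "nat \<Rightarrow> 'm set \<Rightarrow> int \<Rightarrow> int \<Rightarrow> 'b \<Rightarrow> int \<Rightarrow> 'c \<Rightarrow> 'c" where
  "cut_contract b U k i s j p = koszul_sign (i - d b) (d b) \<odot>\<^bsub>gr (sections P U) (k - d b)\<^esub>
     gact (sections P U) (i - d b) j (cut_coord U i s b) p"

lemma balanced_cut_contract:
  assumes U: "openin X U" and b: "b < r"
  shows "balanced_bilinear (sections C U) (sections S U) (sections P U) k
    (gr (sections P U) (k - d b)) (cut_contract b U k)"
proof (rule balanced_bilinearI)
  interpret MP: graded_module "sections C U" "sections P U" by (rule P.sections_module[OF U])
  interpret MS: graded_module "sections C U" "sections S U" by (rule S.sections_module[OF U])
  fix i j s assume k: "i + j = k" and s: "s \<in> carrier (gr (sections S U) i)"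
  have kd: "i - d b + j = k - d b" using k by simp
  show "linear_map (gr (sections P U) j) (gr (sections P U) (k - d b)) (cut_contract b U k i s j)"
    unfolding cut_contract_def using MP.linear_act[OF cut_coord_closed[OF U b s], of j, unfolded kd]
    by (rule linear_map_smult_const[OF MP.vector_space])
next
  interpret MP: graded_module "sections C U" "sections P U" by (rule P.sections_module[OF U])
  fix i j p assume k: "i + j = k" and p: "p \<in> carrier (gr (sections P U) j)"
  have kd: "i - d b + j = k - d b" using k by simp
  show "linear_map (gr (sections S U) i) (gr (sections P U) (k - d b)) (\<lambda>s. cut_contract b U k i s j p)"
    unfolding cut_contract_def
    by (intro linear_map_smult_const[OF MP.vector_space]
        linear_map_comp[OF cut_coord_linear[OF U b] MP.linear_act_left[OF p, of "i - d b", unfolded kd]])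
next
  interpret MP: graded_module "sections C U" "sections P U" by (rule P.sections_module[OF U])
  interpret MS: graded_module "sections C U" "sections S U" by (rule S.sections_module[OF U])
  fix i l j s f p
  assume k: "i + l + j = k" and s: "s \<in> carrier (gr (sections S U) i)"
    and f: "f \<in> carrier (gr (sections C U) l)" and p: "p \<in> carrier (gr (sections P U) j)"
  note c = cut_coord_closed[OF U b s]
  let ?c = "cut_coord U i s b" and ?x = "gact (sections P U) l (i - d b + j) f (gact (sections P U) (i - d b) j (cut_coord U i s b) p)"
  have kd: "l + (i - d b + j) = k - d b" "i - d b + (l + j) = k - d b" "i + l - d b + j = k - d b" using k by auto
  have x: "?x \<in> carrier (gr (sections P U) (k - d b))"
    using MP.act_closed[OF f MP.act_closed[OF c p]] unfolding kd .
  have fs: "gact (sections S U) l i f s \<in> carrier (gr (sections S U) (i + l))"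
    using MS.act_closed[OF f s] by (simp add: add.commute)
  have fc: "gmult (sections C U) l (i - d b) f ?c \<in> carrier (gr (sections C U) (i + l - d b))"
    using MP.A.mult_closed[OF f c] by (simp add: algebra_simps)
  have "cut_coord U (i + l) (right_act (sections S U) i l s f) b =
      koszul_sign l i \<odot>\<^bsub>gr (sections C U) (i + l - d b)\<^esub> gmult (sections C U) l (i - d b) f ?c"
    using linear_map_smult[OF cut_coord_linear[OF U b] fs] cut_coord_act[OF U f s b]
    by (simp add: right_act_def add.commute)
  then have "cut_contract b U k (i + l) (right_act (sections S U) i l s f) j p =
    (koszul_sign (i + l - d b) (d b) * koszul_sign l i) \<odot>\<^bsub>gr (sections P U) (k - d b)\<^esub>
      gact (sections P U) (i + l - d b) j (gmult (sections C U) l (i - d b) f ?c) p"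
    using MP.smult_act[OF fc p, unfolded kd] MP.act_closed[OF fc p, unfolded kd]
    by (simp add: cut_contract_def MP.gr_smult_assoc)
  also have "gact (sections P U) (i + l - d b) j (gmult (sections C U) l (i - d b) f ?c) p = ?x"
    using MP.act_assoc[OF f c p] by (simp add: algebra_simps)
  \<comment> \<open>The exponents of the two signs differ by the even number 2 l
    \<open>d b\<close>.\<close>
  also have "koszul_sign (i + l - d b) (d b) * koszul_sign l i = koszul_sign (i - d b) (d b) * koszul_sign (i - d b) l"
    by (auto simp: koszul_sign_def)
  also have "\<dots> \<odot>\<^bsub>gr (sections P U) (k - d b)\<^esub> ?x = cut_contract b U k i s (l + j) (gact (sections P U) l j f p)"
    using MP.act_commute[OF c f p, unfolded kd] x by (simp add: cut_contract_def MP.gr_smult_assoc)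
  finally show "cut_contract b U k (i + l) (right_act (sections S U) i l s f) j p =
    cut_contract b U k i s (l + j) (gact (sections P U) l j f p)" .
qed

text \<open>The linear map that the universal property attaches to \<open>cut_contract\<close>. Pure
  tensors determine it, so on the carrier the choice operator selects a unique function.\<close>

definition contract :: "nat \<Rightarrow> 'm set \<Rightarrow> int \<Rightarrow> (('b, 'c) tensor_symbol \<Rightarrow> real) set \<Rightarrow> 'c" where
  "contract b U k = (SOME L. linear_map (gr (sections TP U) k) (gr (sections P U) (k - d b)) L \<and>
     (\<forall>i s j p. i + j = k \<longrightarrow> s \<in> carrier (gr (sections S U) i) \<longrightarrow> p \<in> carrier (gr (sections P U) j) \<longrightarrow>
       L (ten U k i s j p) = cut_contract b U k i s j p))"

lemma contract:
  assumes U: "openin X U" and b: "b < r"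
  shows contract_linear: "linear_map (gr (sections TP U) k) (gr (sections P U) (k - d b)) (contract b U k)"
    and contract_pure: "\<lbrakk>i + j = k; s \<in> carrier (gr (sections S U) i); p \<in> carrier (gr (sections P U) j)\<rbrakk> \<Longrightarrow>
      contract b U k (ten U k i s j p) = cut_contract b U k i s j p"
proof -
  have "linear_map (gr (sections TP U) k) (gr (sections P U) (k - d b)) (contract b U k) \<and>
     (\<forall>i s j p. i + j = k \<longrightarrow> s \<in> carrier (gr (sections S U) i) \<longrightarrow> p \<in> carrier (gr (sections P U) j) \<longrightarrow>
       contract b U k (ten U k i s j p) = cut_contract b U k i s j p)"
    unfolding contract_def
    using tensor_pair.tensor_lift[OF tensor_pair_sections[OF U] P.real_space_sections[OF U] balanced_cut_contract[OF U b]]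
    unfolding tensor_presheaf_simps(1)[symmetric] by (rule someI_ex)
  then show "linear_map (gr (sections TP U) k) (gr (sections P U) (k - d b)) (contract b U k)"
    "\<lbrakk>i + j = k; s \<in> carrier (gr (sections S U) i); p \<in> carrier (gr (sections P U) j)\<rbrakk> \<Longrightarrow>
      contract b U k (ten U k i s j p) = cut_contract b U k i s j p" by blast+
qed

lemma restr_contract:
  assumes U: "openin X U" and V: "openin X V" and VU: "V \<subseteq> U" and b: "b < r"
    and t: "t \<in> carrier (gr (sections TP U) k)"
  shows "restr P U V (k - d b) (contract b U k t) = contract b V k (restr TP U V k t)"
proof (rule tensor_section_map_eq[OF U P.real_space_sections[OF V]
      linear_map_comp[OF contract_linear[OF U b] P.restr_linear[OF U V VU]]
      linear_map_comp[OF linear_tensor_restr[OF U V VU] contract_linear[OF V b]] _ t])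
  interpret MP: graded_module "sections C U" "sections P U" by (rule P.sections_module[OF U])
  fix i s j p assume k: "i + j = k" and s: "s \<in> carrier (gr (sections S U) i)" and p: "p \<in> carrier (gr (sections P U) j)"
  have kd: "i - d b + j = k - d b" using k by simp
  note c = cut_coord_closed[OF U b s]
  have "restr P U V (k - d b) (cut_contract b U k i s j p) = cut_contract b V k i (restr S U V i s) j (restr P U V j p)"
    using P.restr_act[OF U V VU c p, unfolded kd] MP.act_closed[OF c p, unfolded kd]
      restr_cut_coord[OF U V VU s b]
    by (simp add: cut_contract_def P.restr_smult[OF U V VU])
  then show "restr P U V (k - d b) (contract b U k (ten U k i s j p)) = contract b V k (restr TP U V k (ten U k i s j p))"
    using k s p S.restr_closed[OF U V VU s] P.restr_closed[OF U V VU p]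
    by (simp add: contract_pure[OF U b] contract_pure[OF V b] restr_pure_tensor[OF U V VU])
qed

definition expand :: "'m set \<Rightarrow> int \<Rightarrow> (nat \<Rightarrow> 'c) \<Rightarrow> (('b, 'c) tensor_symbol \<Rightarrow> real) set" where
  "expand U k q = (\<Oplus>\<^bsub>gr (sections TP U) k\<^esub>b\<in>{..<r}. ten U k (d b) (cut_frame U b) (k - d b) (q b))"

lemma expand_term_linear:
  assumes U: "openin X U" and b: "b < r"
  shows "linear_map (gr (sections P U) (k - d b)) (gr (sections TP U) k)
    (ten U k (d b) (cut_frame U b) (k - d b))"
  using tensor_pair.ten_linear_right[OF tensor_pair_sections[OF U] _ cut_frame_closed[OF U b], of "k - d b" k]
  by (simp add: tensor_presheaf_simps)

lemma expand_closed:
  assumes U: "openin X U" and q: "\<And>b. b < r \<Longrightarrow> q b \<in> carrier (gr (sections P U) (k - d b))"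
  shows "expand U k q \<in> carrier (gr (sections TP U) k)"
  unfolding expand_def using q
  by (intro real_space_finsum_closed[OF T.real_space_sections[OF U]] linear_map_closed[OF expand_term_linear[OF U]]) auto

lemma restr_expand:
  assumes U: "openin X U" and V: "openin X V" and VU: "V \<subseteq> U"
    and q: "\<And>b. b < r \<Longrightarrow> q b \<in> carrier (gr (sections P U) (k - d b))"
  shows "restr TP U V k (expand U k q) = expand V k (\<lambda>b. restr P U V (k - d b) (q b))"
proof -
  have "restr TP U V k (expand U k q) = (\<Oplus>\<^bsub>gr (sections TP V) k\<^esub>b\<in>{..<r}.
      restr TP U V k (ten U k (d b) (cut_frame U b) (k - d b) (q b)))"
    unfolding expand_def using q linear_map_closed[OF expand_term_linear[OF U]]
    by (intro linear_map_finsum[OF T.real_space_sections[OF U] T.real_space_sections[OF V] T.restr_linear[OF U V VU]]) auto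
  also have "\<dots> = expand V k (\<lambda>b. restr P U V (k - d b) (q b))"
    unfolding expand_def
  proof (rule real_space_finsum_cong[OF T.real_space_sections[OF V]])
    fix b assume "b \<in> {..<r}"
    then have b: "b < r" by simp
    show "restr TP U V k (ten U k (d b) (cut_frame U b) (k - d b) (q b)) =
      ten V k (d b) (cut_frame V b) (k - d b) (restr P U V (k - d b) (q b))"
      using restr_pure_tensor[OF U V VU _ cut_frame_closed[OF U b] q[OF b], of k] restr_cut_frame[OF U V VU b] by simp
    show "ten V k (d b) (cut_frame V b) (k - d b) (restr P U V (k - d b) (q b)) \<in> carrier (gr (sections TP V) k)"
      by (rule linear_map_closed[OF expand_term_linear[OF V b] P.restr_closed[OF U V VU q[OF b]]])
  qed
  finally show ?thesis .
qed

text \<open>On a pure tensor the coordinate moves across the tensor sign, from \<open>p\<close> to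
  the frame section. Turning the right action obtained there into a left action costs the sign that
  \<open>cut_contract\<close> already carries, so the two cancel and
  \<open>cut_frame_expansion\<close> applies.\<close>

lemma expand_contract:
  assumes U: "openin X U" and t: "t \<in> carrier (gr (sections TP U) k)"
  shows "expand U k (\<lambda>b. contract b U k t) = T.scal U k (a \<otimes>\<^bsub>CS.functions\<^esub> a) t"
proof -
  interpret R: cring CS.functions by (rule CS.cring_functions)
  interpret MP: graded_module "sections C U" "sections P U" by (rule P.sections_module[OF U])
  interpret MS: graded_module "sections C U" "sections S U" by (rule S.sections_module[OF U])
  interpret TU: tensor_pair "sections C U" "sections S U" "sections P U" by (rule tensor_pair_sections[OF U])
  have aa: "a \<otimes>\<^bsub>CS.functions\<^esub> a \<in> carrier CS.functions" using aW by simp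
  have lin: "linear_map (gr (sections TP U) k) (gr (sections TP U) k) (\<lambda>t. expand U k (\<lambda>b. contract b U k t))"
    unfolding expand_def
    by (intro linear_map_finsum_fun T.real_space_sections[OF U]
        linear_map_comp[OF contract_linear[OF U] expand_term_linear[OF U]]) auto
  show ?thesis
  proof (rule tensor_section_map_eq[OF U T.real_space_sections[OF U] lin T.scal_linear[OF U aa] _ t])
    fix i s j p assume k: "i + j = k" and s: "s \<in> carrier (gr (sections S U) i)" and p: "p \<in> carrier (gr (sections P U) j)"
    let ?u = "\<lambda>b. gact (sections S U) (i - d b) (d b) (cut_coord U i s b) (cut_frame U b)"
    have u: "?u b \<in> carrier (gr (sections S U) i)" if "b < r" for b
      using MS.act_closed[OF cut_coord_closed[OF U that s] cut_frame_closed[OF U that]] by simp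
    note left = TU.ten_linear_left[OF k p]
    have "expand U k (\<lambda>b. contract b U k (ten U k i s j p)) = (\<Oplus>\<^bsub>gr (sections TP U) k\<^esub>b\<in>{..<r}. ten U k i (?u b) j p)"
      unfolding expand_def
    proof (rule real_space_finsum_cong[OF T.real_space_sections[OF U]])
      fix b assume "b \<in> {..<r}"
      then have b: "b < r" by simp
      note c = cut_coord_closed[OF U b s] and f = cut_frame_closed[OF U b]
      have kd: "i - d b + j = k - d b" "d b + (i - d b) = i" "d b + (i - d b) + j = k" using k by auto
      let ?\<kappa> = "koszul_sign (i - d b) (d b)"
      have cp: "gact (sections P U) (i - d b) j (cut_coord U i s b) p \<in> carrier (gr (sections P U) (k - d b))"
        using MP.act_closed[OF c p] unfolding kd .
      have "ten U k (d b) (cut_frame U b) (k - d b) (contract b U k (ten U k i s j p)) =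
        ?\<kappa> \<odot>\<^bsub>gr TU.T k\<^esub> ten U k (d b) (cut_frame U b) (k - d b) (gact (sections P U) (i - d b) j (cut_coord U i s b) p)"
        using linear_map_smult[OF expand_term_linear[OF U b] cp]
        by (simp add: contract_pure[OF U b k s p] cut_contract_def tensor_presheaf_simps)
      also have "\<dots> = ?\<kappa> \<odot>\<^bsub>gr TU.T k\<^esub> ten U k i (right_act (sections S U) (d b) (i - d b) (cut_frame U b) (cut_coord U i s b)) j p"
        using TU.ten_balanced[OF kd(3) f c p, unfolded kd] by simp
      also have "right_act (sections S U) (d b) (i - d b) (cut_frame U b) (cut_coord U i s b) = ?\<kappa> \<odot>\<^bsub>gr (sections S U) i\<^esub> ?u b"
        by (simp add: right_act_def)
      also have "?\<kappa> \<odot>\<^bsub>gr TU.T k\<^esub> ten U k i (?\<kappa> \<odot>\<^bsub>gr (sections S U) i\<^esub> ?u b) j p = ten U k i (?u b) j p"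
        using linear_map_smult[OF left u[OF b]] linear_map_closed[OF left u[OF b]]
        by (simp add: real_space_smult_assoc[OF TU.real_space_tensor] real_space_smult_one[OF TU.real_space_tensor])
      finally show "ten U k (d b) (cut_frame U b) (k - d b) (contract b U k (ten U k i s j p)) = ten U k i (?u b) j p" .
      show "ten U k i (?u b) j p \<in> carrier (gr (sections TP U) k)"
        using linear_map_closed[OF left u[OF b]] by (simp add: tensor_presheaf_simps)
    qed
    also have "\<dots> = ten U k i (\<Oplus>\<^bsub>gr (sections S U) i\<^esub>b\<in>{..<r}. ?u b) j p"
      using linear_map_finsum[OF MS.vector_space TU.real_space_tensor left, of "{..<r}" ?u] u
      by (simp add: tensor_presheaf_simps)
    also have "\<dots> = ten U k i (S.scal U i (a \<otimes>\<^bsub>CS.functions\<^esub> a) s) j p"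
      by (simp add: cut_frame_expansion[OF U s])
    also have "\<dots> = T.scal U k (a \<otimes>\<^bsub>CS.functions\<^esub> a) (ten U k i s j p)"
      using TU.act_pure_tensor[OF S.restr_function_closed[OF U aa] k s p]
      by (simp add: T.scal_def S.scal_def tensor_presheaf_simps)
    finally show "expand U k (\<lambda>b. contract b U k (ten U k i s j p)) = T.scal U k (a \<otimes>\<^bsub>CS.functions\<^esub> a) (ten U k i s j p)" .
  qed
qed

text \<open>Here the sheaf property of \<open>P\<close> enters: the contractions of a compatible
  family form compatible families in \<open>P\<close> and glue there, and the contractions of a
  locally vanishing tensor are zero. Applying \<open>expand\<close> then restores the tensor up to
  the square of \<open>a\<close>.\<close>

lemma glues_square: "T.glues (a \<otimes>\<^bsub>CS.functions\<^esub> a)"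
  unfolding T.glues_def
proof (intro conjI allI impI ballI)
  interpret R: cring CS.functions by (rule CS.cring_functions)
  show "a \<otimes>\<^bsub>CS.functions\<^esub> a \<in> carrier CS.functions" using aW by simp
next
  fix \<U> k s assume comp: "T.compatible \<U> k s"
  note op = T.compatibleD(1)[OF comp] and s = T.compatibleD(2)[OF comp] and o = T.compatibleD(3)[OF comp]
  have "\<exists>q. q \<in> carrier (gr (sections P (\<Union>\<U>)) (k - d b)) \<and>
      (\<forall>U\<in>\<U>. restr P (\<Union>\<U>) U (k - d b) q = contract b U k (s U))" if b: "b < r" for b
  proof (rule ex1_implies_ex, rule P.glue)
    fix U V assume UV: "U \<in> \<U>" "V \<in> \<U>"
    have oi: "openin X (U \<inter> V)" using op UV by auto
    have "restr TP U (U \<inter> V) k (s U) = restr TP V (U \<inter> V) k (s V)"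
      using comp UV unfolding T.compatible_def by blast
    then show "restr P U (U \<inter> V) (k - d b) (contract b U k (s U)) = restr P V (U \<inter> V) (k - d b) (contract b V k (s V))"
      using restr_contract[OF op[OF UV(1)] oi Int_lower1 b s[OF UV(1)]]
        restr_contract[OF op[OF UV(2)] oi Int_lower2 b s[OF UV(2)]] by simp
  next
    fix U assume U: "U \<in> \<U>"
    show "openin X U" by (rule op[OF U])
    show "contract b U k (s U) \<in> carrier (gr (sections P U) (k - d b))"
      by (rule linear_map_closed[OF contract_linear[OF op[OF U] b] s[OF U]])
  qed
  then obtain q where q: "\<And>b. b < r \<Longrightarrow> q b \<in> carrier (gr (sections P (\<Union>\<U>)) (k - d b))"
    and rq: "\<And>b U. b < r \<Longrightarrow> U \<in> \<U> \<Longrightarrow> restr P (\<Union>\<U>) U (k - d b) (q b) = contract b U k (s U)"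
    by metis
  show "\<exists>t\<in>carrier (gr (sections TP (\<Union>\<U>)) k). \<forall>U\<in>\<U>. restr TP (\<Union>\<U>) U k t = T.scal U k (a \<otimes>\<^bsub>CS.functions\<^esub> a) (s U)"
  proof (rule bexI[of _ "expand (\<Union>\<U>) k q"], intro ballI)
    fix U assume U: "U \<in> \<U>"
    have "expand U k (\<lambda>b. restr P (\<Union>\<U>) U (k - d b) (q b)) = expand U k (\<lambda>b. contract b U k (s U))"
      unfolding expand_def
      using linear_map_closed[OF expand_term_linear[OF op[OF U]] linear_map_closed[OF contract_linear[OF op[OF U]] s[OF U]]]
      by (intro real_space_finsum_cong[OF T.real_space_sections[OF op[OF U]]]) (auto simp: rq U)
    then show "restr TP (\<Union>\<U>) U k (expand (\<Union>\<U>) k q) = T.scal U k (a \<otimes>\<^bsub>CS.functions\<^esub> a) (s U)"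
      using restr_expand[OF o op[OF U] Union_upper[OF U] q] expand_contract[OF op[OF U] s[OF U]] by simp
  qed (rule expand_closed[OF o q])
next
  fix \<U> k t
  assume t: "t \<in> carrier (gr (sections TP (\<Union>\<U>)) k)" and op: "\<forall>U\<in>\<U>. openin X U"
    and z: "\<forall>U\<in>\<U>. restr TP (\<Union>\<U>) U k t = \<zero>\<^bsub>gr (sections TP U) k\<^esub>"
  have o: "openin X (\<Union>\<U>)" using op by auto
  have c: "contract b (\<Union>\<U>) k t = \<zero>\<^bsub>gr (sections P (\<Union>\<U>)) (k - d b)\<^esub>" if b: "b < r" for b
  proof (rule P.section_eqI[OF o linear_map_closed[OF contract_linear[OF o b] t]
        real_space_closed(2)[OF P.real_space_sections[OF o]]])
    fix x assume "x \<in> \<Union>\<U>"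
    then obtain U where U: "U \<in> \<U>" "x \<in> U" by auto
    then have oU: "openin X U" "U \<subseteq> \<Union>\<U>" using op by auto
    have "restr P (\<Union>\<U>) U (k - d b) (contract b (\<Union>\<U>) k t) = restr P (\<Union>\<U>) U (k - d b) \<zero>\<^bsub>gr (sections P (\<Union>\<U>)) (k - d b)\<^esub>"
      using restr_contract[OF o oU b t] P.restr_zero[OF o oU] z U
        linear_map_zero[OF T.real_space_sections[OF oU(1)] P.real_space_sections[OF oU(1)] contract_linear[OF oU(1) b]]
      by simp
    then show "\<exists>W. openin X W \<and> x \<in> W \<and> W \<subseteq> \<Union>\<U> \<and> restr P (\<Union>\<U>) W (k - d b) (contract b (\<Union>\<U>) k t) =
        restr P (\<Union>\<U>) W (k - d b) \<zero>\<^bsub>gr (sections P (\<Union>\<U>)) (k - d b)\<^esub>"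
      using oU U by blast
  qed
  have "T.scal (\<Union>\<U>) k (a \<otimes>\<^bsub>CS.functions\<^esub> a) t = expand (\<Union>\<U>) k (\<lambda>b. contract b (\<Union>\<U>) k t)"
    by (rule expand_contract[OF o t, symmetric])
  also have "\<dots> = (\<Oplus>\<^bsub>gr (sections TP (\<Union>\<U>)) k\<^esub>b\<in>{..<r}. \<zero>\<^bsub>gr (sections TP (\<Union>\<U>)) k\<^esub>)"
    unfolding expand_def
  proof (rule real_space_finsum_cong[OF T.real_space_sections[OF o]])
    fix b assume "b \<in> {..<r}"
    then show "ten (\<Union>\<U>) k (d b) (cut_frame (\<Union>\<U>) b) (k - d b) (contract b (\<Union>\<U>) k t) = \<zero>\<^bsub>gr (sections TP (\<Union>\<U>)) k\<^esub>"
      using linear_map_zero[OF P.real_space_sections[OF o] T.real_space_sections[OF o] expand_term_linear[OF o, of b]]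
      by (simp add: c)
  qed (rule real_space_closed(2)[OF T.real_space_sections[OF o]])
  also have "\<dots> = \<zero>\<^bsub>gr (sections TP (\<Union>\<U>)) k\<^esub>"
    by (rule abelian_monoid.finsum_zero[OF real_space_abelian_monoid[OF T.real_space_sections[OF o]]])
  finally show "T.scal (\<Union>\<U>) k (a \<otimes>\<^bsub>CS.functions\<^esub> a) t = \<zero>\<^bsub>gr (sections TP (\<Union>\<U>)) k\<^esub>" .
qed

end

end

section \<open>Frames from local frames\<close>

context module_sheaf
begin

text \<open>A combination over \<open>V\<close> sees only the restrictions of the frame sections to
  \<open>V\<close>, which is how frames given over different open sets are compared.\<close>

lemma comb_change_frame:
  assumes V: "openin X V" and "openin X W" "V \<subseteq> W" "\<And>b. b < r \<Longrightarrow> e b \<in> carrier (gr (sections F W) (d b))"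
    and f: "\<And>b. b < r \<Longrightarrow> f b \<in> carrier (gr (sections C V) (k - d b))"
    and eq: "\<And>b. b < r \<Longrightarrow> restr F W V (d b) (e b) = restr F W' V (d b) (e' b)"
  shows "comb W r d e V k f = comb W' r d e' V k f"
proof -
  have "comb W' r d e' V k f = comb W r d e V k f"
    unfolding comb_def
  proof (rule real_space_finsum_cong[OF real_space_sections[OF V]])
    fix b assume "b \<in> {..<r}"
    then have b: "b < r" by simp
    show "gact (sections F V) (k - d b) (d b) (f b) (restr F W V (d b) (e b)) \<in> carrier (gr (sections F V) k)"
      by (rule comb_term_closed[where d = d and e = e and r = r, OF assms(2,4) V assms(3) b f[OF b]])
  qed (simp add: eq)
  then show ?thesis by simp
qed

lemma comb_zero:
  assumes V: "openin X V" "openin X W" "V \<subseteq> W" "\<And>b. b < r \<Longrightarrow> e b \<in> carrier (gr (sections F W) (d b))"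
  shows "comb W r d e V k (\<lambda>b. \<zero>\<^bsub>gr (sections C V) (k - d b)\<^esub>) = \<zero>\<^bsub>gr (sections F V) k\<^esub>"
proof -
  interpret M: graded_module "sections C V" "sections F V" by (rule sections_module[OF V(1)])
  have "comb W r d e V k (\<lambda>b. \<zero>\<^bsub>gr (sections C V) (k - d b)\<^esub>) =
      (\<Oplus>\<^bsub>gr (sections F V) k\<^esub>b\<in>{..<r}. \<zero>\<^bsub>gr (sections F V) k\<^esub>)"
    unfolding comb_def
  proof (rule M.gr_finsum_cong)
    fix b assume "b \<in> {..<r}"
    then have eb: "restr F W V (d b) (e b) \<in> carrier (gr (sections F V) (d b))"
      using V by (intro restr_closed) auto
    show "gact (sections F V) (k - d b) (d b) \<zero>\<^bsub>gr (sections C V) (k - d b)\<^esub> (restr F W V (d b) (e b)) =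
        \<zero>\<^bsub>gr (sections F V) k\<^esub>"
      using linear_map_zero[OF M.A.vector_space M.vector_space M.linear_act_left[OF eb, of "k - d b"]] by simp
  qed simp
  then show ?thesis by (simp add: abelian_monoid.finsum_zero[OF M.gr_abelian_monoid])
qed

end

text \<open>Coordinates are sections of \<open>C\<close>, so gluing frames uses that
  \<open>C\<close> is a sheaf as well. The geometry of the manifold enters through bump functions,
  which the lemmas take as a hypothesis.\<close>

locale manifold_module = module_sheaf X C F + CS: algebra_sheaf X C
  for X :: "'m topology" and C :: "('m, 'a) alg_presheaf" and F :: "('m, 'a, 'b) mod_presheaf"
begin

sublocale Cm: module_sheaf X C "self_module C" by (rule CS.module_sheaf_self)

text \<open>Uniqueness makes local coordinates agree on overlaps, so that they glue; hence it is
  enough to find coordinates near each point. By linearity, uniqueness reduces to the zero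
  section.\<close>

lemma frame_onI_local:
  assumes W: "openin X W" and e: "\<And>b. b < r \<Longrightarrow> e b \<in> carrier (gr (sections F W) (d b))"
    and uniq: "\<And>V k f b. \<lbrakk>openin X V; V \<subseteq> W; \<And>b. b < r \<Longrightarrow> f b \<in> carrier (gr (sections C V) (k - d b));
      comb W r d e V k f = \<zero>\<^bsub>gr (sections F V) k\<^esub>; b < r\<rbrakk> \<Longrightarrow> f b = \<zero>\<^bsub>gr (sections C V) (k - d b)\<^esub>"
    and ex: "\<And>V k s x. \<lbrakk>openin X V; V \<subseteq> W; s \<in> carrier (gr (sections F V) k); x \<in> V\<rbrakk> \<Longrightarrow>
      \<exists>B f. openin X B \<and> x \<in> B \<and> B \<subseteq> V \<and> (\<forall>b<r. f b \<in> carrier (gr (sections C B) (k - d b))) \<and>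
        restr F V B k s = comb W r d e B k f"
  shows "frame_on W r d e"
proof -
  have uniq2: "f b = g b"
    if V: "openin X V" "V \<subseteq> W" and f: "\<And>b. b < r \<Longrightarrow> f b \<in> carrier (gr (sections C V) (k - d b))"
      and g: "\<And>b. b < r \<Longrightarrow> g b \<in> carrier (gr (sections C V) (k - d b))"
      and eq: "comb W r d e V k f = comb W r d e V k g" and b: "b < r" for V k f g b
  proof -
    let ?h = "\<lambda>b. f b \<ominus>\<^bsub>gr (sections C V) (k - d b)\<^esub> g b"
    interpret M: graded_module "sections C V" "sections F V" by (rule sections_module[OF V(1)])
    interpret Mk: abelian_group "gr (sections F V) k" by (rule M.gr_abelian_group)
    have h: "?h b \<in> carrier (gr (sections C V) (k - d b))" if "b < r" for b
      using f[OF that] g[OF that] by simp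
    have hg: "?h b \<oplus>\<^bsub>gr (sections C V) (k - d b)\<^esub> g b = f b" if "b < r" for b
    proof -
      interpret A: abelian_group "gr (sections C V) (k - d b)" by (rule M.A.gr_abelian_group)
      show ?thesis using f[OF that] g[OF that] by (simp add: a_minus_def A.a_assoc A.l_neg)
    qed
    have c1: "comb W r d e V k ?h \<in> carrier (gr (sections F V) k)"
      by (rule comb_closed[OF W e V h])
    have c2: "comb W r d e V k g \<in> carrier (gr (sections F V) k)"
      by (rule comb_closed[OF W e V g])
    have "comb W r d e V k f = comb W r d e V k (\<lambda>b. ?h b \<oplus>\<^bsub>gr (sections C V) (k - d b)\<^esub> g b)"
      using f hg by (intro comb_cong[OF W e V, symmetric]) auto
    also have "\<dots> = comb W r d e V k ?h \<oplus>\<^bsub>gr (sections F V) k\<^esub> comb W r d e V k g"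
      by (rule comb_add[OF W e V h g])
    finally have z: "comb W r d e V k ?h = \<zero>\<^bsub>gr (sections F V) k\<^esub>"
      using c1 c2 eq by (simp add: Mk.add.r_cancel_one')
    have "?h b = \<zero>\<^bsub>gr (sections C V) (k - d b)\<^esub>"
      using uniq[of V ?h k b, OF V h z b] by simp
    then show ?thesis
      using real_space_minus_eq_zero_iff[OF M.A.vector_space f[OF b] g[OF b]] by simp
  qed
  have "\<exists>!f. f \<in> (\<Pi>\<^sub>E b\<in>{..<r}. carrier (gr (sections C V) (k - d b))) \<and> s = comb W r d e V k f"
    if V: "openin X V" "V \<subseteq> W" and s: "s \<in> carrier (gr (sections F V) k)" for V k s
  proof (rule ex_ex1I)
    define \<B> where "\<B> = {B. openin X B \<and> B \<subseteq> V \<and>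
      (\<exists>f. (\<forall>b<r. f b \<in> carrier (gr (sections C B) (k - d b))) \<and> restr F V B k s = comb W r d e B k f)}"
    have un: "\<Union>\<B> = V"
    proof
      show "V \<subseteq> \<Union>\<B>"
      proof
        fix x assume "x \<in> V"
        from ex[OF V s this] show "x \<in> \<Union>\<B>" unfolding \<B>_def by blast
      qed
    qed (auto simp: \<B>_def)
    have "\<forall>B\<in>\<B>. \<exists>f. (\<forall>b<r. f b \<in> carrier (gr (sections C B) (k - d b))) \<and> restr F V B k s = comb W r d e B k f"
      by (simp add: \<B>_def)
    from bchoice[OF this] obtain f where
      f: "\<And>B b. B \<in> \<B> \<Longrightarrow> b < r \<Longrightarrow> f B b \<in> carrier (gr (sections C B) (k - d b))"
      and sf: "\<And>B. B \<in> \<B> \<Longrightarrow> restr F V B k s = comb W r d e B k (f B)" by blast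
    have B: "openin X B" "B \<subseteq> V" "B \<subseteq> W" if "B \<in> \<B>" for B using that V by (auto simp: \<B>_def)
    have "\<exists>g. g \<in> carrier (gr (sections C V) (k - d b)) \<and> (\<forall>B\<in>\<B>. restr C V B (k - d b) g = f B b)"
      if b: "b < r" for b
    proof -
      have "\<exists>!g. g \<in> carrier (gr (sections C (\<Union>\<B>)) (k - d b)) \<and> (\<forall>B\<in>\<B>. restr C (\<Union>\<B>) B (k - d b) g = f B b)"
      proof (rule CS.glue)
        fix B B' assume BB: "B \<in> \<B>" "B' \<in> \<B>"
        have o: "openin X (B \<inter> B')" using B BB by auto
        have sub: "B \<inter> B' \<subseteq> W" "B \<inter> B' \<subseteq> V" using B(2,3)[OF BB(1)] by auto
        have "comb W r d e (B \<inter> B') k (\<lambda>b. restr C B (B \<inter> B') (k - d b) (f B b)) =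
            restr F B (B \<inter> B') k (restr F V B k s)"
          unfolding sf[OF BB(1)]
          by (rule restr_comb[OF W e B(1,3)[OF BB(1)] o Int_lower1 f[OF BB(1)], symmetric])
        also have "\<dots> = restr F B' (B \<inter> B') k (restr F V B' k s)"
          using restr_trans[OF V(1) B(1)[OF BB(1)] o Int_lower1 B(2)[OF BB(1)] s]
            restr_trans[OF V(1) B(1)[OF BB(2)] o Int_lower2 B(2)[OF BB(2)] s] by simp
        also have "\<dots> = comb W r d e (B \<inter> B') k (\<lambda>b. restr C B' (B \<inter> B') (k - d b) (f B' b))"
          unfolding sf[OF BB(2)]
          by (rule restr_comb[OF W e B(1,3)[OF BB(2)] o Int_lower2 f[OF BB(2)]])
        finally have eq: "comb W r d e (B \<inter> B') k (\<lambda>b. restr C B (B \<inter> B') (k - d b) (f B b)) =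
          comb W r d e (B \<inter> B') k (\<lambda>b. restr C B' (B \<inter> B') (k - d b) (f B' b))" .
        show "restr C B (B \<inter> B') (k - d b) (f B b) = restr C B' (B \<inter> B') (k - d b) (f B' b)"
          using uniq2[OF o sub(1) C.restr_closed[OF B(1)[OF BB(1)] o Int_lower1 f[OF BB(1)]]
                C.restr_closed[OF B(1)[OF BB(2)] o Int_lower2 f[OF BB(2)]] eq b] .
      qed (use B f b in auto)
      then show ?thesis unfolding un by blast
    qed
    then obtain g where g: "\<And>b. b < r \<Longrightarrow> g b \<in> carrier (gr (sections C V) (k - d b))"
      and gf: "\<And>b B. b < r \<Longrightarrow> B \<in> \<B> \<Longrightarrow> restr C V B (k - d b) (g b) = f B b" by metis
    have "s = comb W r d e V k g"
    proof (rule section_eqI[OF V(1) s comb_closed[OF W e V g]])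
      fix x assume "x \<in> V"
      then obtain Bx where Bx: "Bx \<in> \<B>" "x \<in> Bx" using un by auto
      have "restr F V Bx k (comb W r d e V k g) = comb W r d e Bx k (\<lambda>b. restr C V Bx (k - d b) (g b))"
        by (rule restr_comb[OF W e V B(1,2)[OF Bx(1)] g])
      also have "\<dots> = comb W r d e Bx k (f Bx)"
        using f[OF Bx(1)] gf[OF _ Bx(1)] by (intro comb_cong[OF W e B(1,3)[OF Bx(1)]]) auto
      finally show "\<exists>B. openin X B \<and> x \<in> B \<and> B \<subseteq> V \<and> restr F V B k s = restr F V B k (comb W r d e V k g)"
        using Bx(2) B(1,2)[OF Bx(1)] sf[OF Bx(1)] by (intro exI[of _ Bx]) simp
    qed
    also have "\<dots> = comb W r d e V k (restrict g {..<r})"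
      by (rule comb_cong[OF W e V g, symmetric]) auto
    finally show "\<exists>f. f \<in> (\<Pi>\<^sub>E b\<in>{..<r}. carrier (gr (sections C V) (k - d b))) \<and> s = comb W r d e V k f"
      using g by (intro exI[of _ "restrict g {..<r}"]) auto
  next
    fix f g
    assume f: "f \<in> (\<Pi>\<^sub>E b\<in>{..<r}. carrier (gr (sections C V) (k - d b))) \<and> s = comb W r d e V k f"
      and g: "g \<in> (\<Pi>\<^sub>E b\<in>{..<r}. carrier (gr (sections C V) (k - d b))) \<and> s = comb W r d e V k g"
    show "f = g"
    proof (rule PiE_ext[OF conjunct1[OF f] conjunct1[OF g]])
      fix b assume "b \<in> {..<r}"
      then show "f b = g b" using f g by (intro uniq2[OF V, of f k g b]) (auto simp: PiE_iff)
    qed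
  qed
  then show ?thesis using W e by (simp add: frame_on_def)
qed

lemma frame_on_uniq:
  assumes fr: "frame_on W r d e" and V: "openin X V" "V \<subseteq> W"
    and f: "\<And>b. b < r \<Longrightarrow> f b \<in> carrier (gr (sections C V) (k - d b))"
    and z: "comb W r d e V k f = \<zero>\<^bsub>gr (sections F V) k\<^esub>" and b: "b < r"
  shows "f b = \<zero>\<^bsub>gr (sections C V) (k - d b)\<^esub>"
proof -
  have zc: "\<zero>\<^bsub>gr (sections C V) (k - d b)\<^esub> \<in> carrier (gr (sections C V) (k - d b))" for b
    by (rule real_space_closed(2)[OF C.real_space_sections[OF V(1)]])
  have "coord W r d e V k \<zero>\<^bsub>gr (sections F V) k\<^esub> b = f b"
    by (rule coord_eqI[OF fr V f z[symmetric] b])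
  moreover have "coord W r d e V k \<zero>\<^bsub>gr (sections F V) k\<^esub> b = \<zero>\<^bsub>gr (sections C V) (k - d b)\<^esub>"
    by (rule coord_eqI[OF fr V zc comb_zero[OF V(1) frame_onD(1)[OF fr] V(2) frame_onD(2)[OF fr], symmetric] b])
  ultimately show ?thesis by simp
qed

lemma frame_on_subset:
  assumes fr: "frame_on W r d e" and V: "openin X V" "V \<subseteq> W"
  shows "frame_on V r d (\<lambda>b. restr F W V (d b) (e b))"
proof -
  note W = frame_onD(1)[OF fr] and e = frame_onD(2)[OF fr]
  have e': "restr F W V (d b) (e b) \<in> carrier (gr (sections F V) (d b))" if "b < r" for b
    by (rule restr_closed[OF W V e[OF that]])
  have c: "comb W r d e U k f = comb V r d (\<lambda>b. restr F W V (d b) (e b)) U k f"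
    if U: "openin X U" "U \<subseteq> V" and f: "\<And>b. b < r \<Longrightarrow> f b \<in> carrier (gr (sections C U) (k - d b))" for U k f
  proof (rule comb_change_frame[OF U(1) W _ e f])
    show "U \<subseteq> W" using U V by auto
    show "restr F W U (d b) (e b) = restr F V U (d b) (restr F W V (d b) (e b))" if "b < r" for b
      by (rule restr_trans[OF W V(1) U V(2) e[OF that], symmetric])
  qed
  show ?thesis
  proof (rule frame_onI_local[OF V(1) e'])
    fix U k f b assume U: "openin X U" "U \<subseteq> V" and f: "\<And>b. b < r \<Longrightarrow> f b \<in> carrier (gr (sections C U) (k - d b))"
      and z: "comb V r d (\<lambda>b. restr F W V (d b) (e b)) U k f = \<zero>\<^bsub>gr (sections F U) k\<^esub>" and b: "b < r"
    show "f b = \<zero>\<^bsub>gr (sections C U) (k - d b)\<^esub>"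
      using U V z by (intro frame_on_uniq[OF fr U(1) _ f _ b]) (auto simp: c[OF U f])
  next
    fix U k s x assume U: "openin X U" "U \<subseteq> V" and s: "s \<in> carrier (gr (sections F U) k)" and x: "x \<in> U"
    have UW: "U \<subseteq> W" using U V by auto
    note cl = coord_closed[OF fr U(1) UW s]
    have "restr F U U k s = comb V r d (\<lambda>b. restr F W V (d b) (e b)) U k (coord W r d e U k s)"
      using comb_coord[OF fr U(1) UW s] c[OF U cl] restr_id[OF U(1) s] by simp
    then show "\<exists>B f. openin X B \<and> x \<in> B \<and> B \<subseteq> U \<and> (\<forall>b<r. f b \<in> carrier (gr (sections C B) (k - d b))) \<and>
        restr F U B k s = comb V r d (\<lambda>b. restr F W V (d b) (e b)) B k f"
      using U x cl by (intro exI[of _ U] exI[of _ "coord W r d e U k s"]) auto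
  qed
qed

text \<open>Frames of the same graded rank may list their degrees in different orders; a permutation
  brings all of them to one common \<open>d\<close>.\<close>

lemma frame_on_permute:
  assumes fr: "frame_on W r d e" and \<pi>: "bij_betw \<pi> {..<r} {..<r}"
  shows "frame_on W r (\<lambda>b. d (\<pi> b)) (\<lambda>b. e (\<pi> b))"
proof -
  note W = frame_onD(1)[OF fr] and e = frame_onD(2)[OF fr]
  have \<pi>r: "\<pi> b < r" if "b < r" for b using \<pi> that by (auto simp: bij_betw_def)
  define \<rho> where "\<rho> = the_inv_into {..<r} \<pi>"
  have \<rho>r: "\<rho> b < r" if "b < r" for b
    using bij_betw_the_inv_into[OF \<pi>] that by (auto simp: bij_betw_def \<rho>_def)
  have \<pi>\<rho>: "\<pi> (\<rho> b) = b" if "b < r" for b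
    using \<pi> that by (auto simp: \<rho>_def bij_betw_def intro!: f_the_inv_into_f)
  have \<rho>\<pi>: "\<rho> (\<pi> b) = b" if "b < r" for b
    using \<pi> that by (auto simp: \<rho>_def bij_betw_def intro!: the_inv_into_f_f)
  have c: "comb W r (\<lambda>b. d (\<pi> b)) (\<lambda>b. e (\<pi> b)) V k (\<lambda>b. f (\<pi> b)) = comb W r d e V k f"
    if V: "openin X V" "V \<subseteq> W" and f: "\<And>b. b < r \<Longrightarrow> f b \<in> carrier (gr (sections C V) (k - d b))" for V k f
  proof -
    interpret A: abelian_monoid "gr (sections F V) k"
      by (rule real_space_abelian_monoid[OF real_space_sections[OF V(1)]])
    have "\<pi> ` {..<r} = {..<r}" using \<pi> by (simp add: bij_betw_def)
    moreover have "(\<Oplus>\<^bsub>gr (sections F V) k\<^esub>b\<in>\<pi> ` {..<r}. gact (sections F V) (k - d b) (d b) (f b) (restr F W V (d b) (e b))) =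
      (\<Oplus>\<^bsub>gr (sections F V) k\<^esub>b\<in>{..<r}. gact (sections F V) (k - d (\<pi> b)) (d (\<pi> b)) (f (\<pi> b)) (restr F W V (d (\<pi> b)) (e (\<pi> b))))"
      using \<pi> \<pi>r comb_term_closed[OF W e V _ f] by (intro A.finsum_reindex) (auto simp: bij_betw_def)
    ultimately show ?thesis by (simp add: comb_def)
  qed
  show ?thesis
  proof (rule frame_onI_local[OF W])
    show "e (\<pi> b) \<in> carrier (gr (sections F W) (d (\<pi> b)))" if "b < r" for b by (rule e[OF \<pi>r[OF that]])
    fix V k f b assume V: "openin X V" "V \<subseteq> W"
      and f: "\<And>b. b < r \<Longrightarrow> f b \<in> carrier (gr (sections C V) (k - d (\<pi> b)))"
      and z: "comb W r (\<lambda>b. d (\<pi> b)) (\<lambda>b. e (\<pi> b)) V k f = \<zero>\<^bsub>gr (sections F V) k\<^esub>" and b: "b < r"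
    have f': "f (\<rho> b) \<in> carrier (gr (sections C V) (k - d b))" if "b < r" for b
      using f[OF \<rho>r[OF that]] \<pi>\<rho>[OF that] by simp
    have "comb W r (\<lambda>b. d (\<pi> b)) (\<lambda>b. e (\<pi> b)) V k (\<lambda>b. f (\<rho> (\<pi> b))) =
        comb W r (\<lambda>b. d (\<pi> b)) (\<lambda>b. e (\<pi> b)) V k f"
      using f \<rho>\<pi> e \<pi>r by (intro comb_cong[OF W _ V]) auto
    with c[OF V f'] z have "comb W r d e V k (\<lambda>b. f (\<rho> b)) = \<zero>\<^bsub>gr (sections F V) k\<^esub>" by simp
    from frame_on_uniq[OF fr V f' this \<pi>r[OF b]] show "f b = \<zero>\<^bsub>gr (sections C V) (k - d (\<pi> b))\<^esub>"
      by (simp add: \<rho>\<pi>[OF b])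
  next
    fix V k s x assume V: "openin X V" "V \<subseteq> W" and s: "s \<in> carrier (gr (sections F V) k)" and x: "x \<in> V"
    note cl = coord_closed[OF fr V s]
    have "restr F V V k s = comb W r (\<lambda>b. d (\<pi> b)) (\<lambda>b. e (\<pi> b)) V k (\<lambda>b. coord W r d e V k s (\<pi> b))"
      using comb_coord[OF fr V s] c[OF V cl] restr_id[OF V(1) s] by simp
    then show "\<exists>B f. openin X B \<and> x \<in> B \<and> B \<subseteq> V \<and>
        (\<forall>b<r. f b \<in> carrier (gr (sections C B) (k - d (\<pi> b)))) \<and>
        restr F V B k s = comb W r (\<lambda>b. d (\<pi> b)) (\<lambda>b. e (\<pi> b)) B k f"
      using V x cl \<pi>r by (intro exI[of _ V] exI[of _ "\<lambda>b. coord W r d e V k s (\<pi> b)"]) auto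
  qed
qed

text \<open>Locality over the empty set leaves no point to check. This makes compatibility on empty
  overlaps automatic.\<close>

lemma section_empty_eq:
  "\<lbrakk>s \<in> carrier (gr (sections F {}) k); t \<in> carrier (gr (sections F {}) k)\<rbrakk> \<Longrightarrow> s = t"
  by (rule section_eqI[of "{}"]) auto

text \<open>The frame sections glue because distinct members have empty overlap, provided every
  member uses the same \<open>r\<close> and \<open>d\<close>. This is what allows infinitely many
  small open sets to be treated as one.\<close>

lemma frame_on_disjoint_Union:
  assumes fr: "\<And>V. V \<in> \<V> \<Longrightarrow> \<exists>e. frame_on V r d e" and disj: "pairwise disjnt \<V>"
  shows "\<exists>e. frame_on (\<Union>\<V>) r d e"
proof -
  obtain \<epsilon> where \<epsilon>: "\<And>V. V \<in> \<V> \<Longrightarrow> frame_on V r d (\<epsilon> V)" using fr by metis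
  have op: "openin X V" if "V \<in> \<V>" for V by (rule frame_onD(1)[OF \<epsilon>[OF that]])
  then have W: "openin X (\<Union>\<V>)" by auto
  have "\<exists>e. e \<in> carrier (gr (sections F (\<Union>\<V>)) (d b)) \<and> (\<forall>V\<in>\<V>. restr F (\<Union>\<V>) V (d b) e = \<epsilon> V b)"
    if b: "b < r" for b
  proof (rule ex1_implies_ex, rule glue[OF op])
    fix V V' assume V: "V \<in> \<V>" "V' \<in> \<V>"
    show "restr F V (V \<inter> V') (d b) (\<epsilon> V b) = restr F V' (V \<inter> V') (d b) (\<epsilon> V' b)"
    proof (cases "V = V'")
      case False
      then have "V \<inter> V' = {}" using disj V by (auto simp: pairwise_def disjnt_def)
      then show ?thesis
        using op V frame_onD(2)[OF \<epsilon>[OF V(1)] b] frame_onD(2)[OF \<epsilon>[OF V(2)] b]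
        by (intro section_empty_eq[of _ "d b"]) (auto intro!: restr_closed)
    qed simp
  qed (use frame_onD(2)[OF \<epsilon> b] in auto)
  then obtain e where e: "\<And>b. b < r \<Longrightarrow> e b \<in> carrier (gr (sections F (\<Union>\<V>)) (d b))"
    and re: "\<And>b V. b < r \<Longrightarrow> V \<in> \<V> \<Longrightarrow> restr F (\<Union>\<V>) V (d b) (e b) = \<epsilon> V b" by metis
  have c: "comb (\<Union>\<V>) r d e U k f = comb V r d (\<epsilon> V) U k f"
    if V: "V \<in> \<V>" and U: "openin X U" "U \<subseteq> V" and f: "\<And>b. b < r \<Longrightarrow> f b \<in> carrier (gr (sections C U) (k - d b))"
    for U V k f
  proof (rule comb_change_frame[OF U(1) W _ e f])
    show "U \<subseteq> \<Union>\<V>" using U V by auto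
    show "restr F (\<Union>\<V>) U (d b) (e b) = restr F V U (d b) (\<epsilon> V b)" if "b < r" for b
      using restr_trans[OF W op[OF V] U Union_upper[OF V] e[OF that]] re[OF that V] by simp
  qed
  have "frame_on (\<Union>\<V>) r d e"
  proof (rule frame_onI_local[OF W e])
    fix U k f b assume U: "openin X U" "U \<subseteq> \<Union>\<V>" and f: "\<And>b. b < r \<Longrightarrow> f b \<in> carrier (gr (sections C U) (k - d b))"
      and z: "comb (\<Union>\<V>) r d e U k f = \<zero>\<^bsub>gr (sections F U) k\<^esub>" and b: "b < r"
    show "f b = \<zero>\<^bsub>gr (sections C U) (k - d b)\<^esub>"
    proof (rule CS.section_eqI[OF U(1) f[OF b] real_space_closed(2)[OF C.real_space_sections[OF U(1)]]])
      fix x assume x: "x \<in> U"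
      then obtain V where V: "V \<in> \<V>" "x \<in> V" using U by auto
      let ?V = "U \<inter> V"
      have o: "openin X ?V" using U op V by auto
      have rf: "restr C U ?V (k - d b) (f b) \<in> carrier (gr (sections C ?V) (k - d b))" if "b < r" for b
        by (rule C.restr_closed[OF U(1) o Int_lower1 f[OF that]])
      have "comb V r d (\<epsilon> V) ?V k (\<lambda>b. restr C U ?V (k - d b) (f b)) = restr F U ?V k (comb (\<Union>\<V>) r d e U k f)"
        using c[OF V(1) o Int_lower2 rf] restr_comb[OF W e U o Int_lower1 f] by simp
      also have "\<dots> = \<zero>\<^bsub>gr (sections F ?V) k\<^esub>" unfolding z by (rule restr_zero[OF U(1) o Int_lower1])
      finally have z': "comb V r d (\<epsilon> V) ?V k (\<lambda>b. restr C U ?V (k - d b) (f b)) = \<zero>\<^bsub>gr (sections F ?V) k\<^esub>" .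
      have "restr C U ?V (k - d b) (f b) = \<zero>\<^bsub>gr (sections C ?V) (k - d b)\<^esub>"
        using frame_on_uniq[OF \<epsilon>[OF V(1)] o Int_lower2 _ z' b] rf by simp
      then show "\<exists>B. openin X B \<and> x \<in> B \<and> B \<subseteq> U \<and>
          restr C U B (k - d b) (f b) = restr C U B (k - d b) \<zero>\<^bsub>gr (sections C U) (k - d b)\<^esub>"
        using o x V C.restr_zero[OF U(1) o Int_lower1] by (intro exI[of _ ?V]) auto
    qed
  next
    fix U k s x assume U: "openin X U" "U \<subseteq> \<Union>\<V>" and s: "s \<in> carrier (gr (sections F U) k)" and x: "x \<in> U"
    then obtain V where V: "V \<in> \<V>" "x \<in> V" by auto
    let ?V = "U \<inter> V"
    have o: "openin X ?V" using U op V by auto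
    have rs: "restr F U ?V k s \<in> carrier (gr (sections F ?V) k)" by (rule restr_closed[OF U(1) o Int_lower1 s])
    note cl = coord_closed[OF \<epsilon>[OF V(1)] o Int_lower2 rs]
    have "restr F U ?V k s = comb (\<Union>\<V>) r d e ?V k (coord V r d (\<epsilon> V) ?V k (restr F U ?V k s))"
      using comb_coord[OF \<epsilon>[OF V(1)] o Int_lower2 rs] c[OF V(1) o Int_lower2 cl] by simp
    then show "\<exists>B f. openin X B \<and> x \<in> B \<and> B \<subseteq> U \<and> (\<forall>b<r. f b \<in> carrier (gr (sections C B) (k - d b))) \<and>
        restr F U B k s = comb (\<Union>\<V>) r d e B k f"
      using o x V cl by (intro exI[of _ ?V] exI[of _ "coord V r d (\<epsilon> V) ?V k (restr F U ?V k s)"]) auto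
  qed
  then show ?thesis by blast
qed

end

section \<open>Bump functions\<close>

definition (in algebra_presheaf) bump :: "'a \<Rightarrow> 'm set \<Rightarrow> 'm set \<Rightarrow> bool" where
  "bump a B V \<longleftrightarrow> (\<exists>Q. cutoff a V Q) \<and> openin X B \<and> B \<subseteq> V \<and>
     restr C (topspace X) B 0 a = gone (sections C B)"

text \<open>Near a point, a section extends to larger open sets: where the bump function is one, the
  extension by zero is the given section.\<close>

lemma (in module_sheaf) restr_ext_bump:
  assumes cut: "C.cutoff a V Q" and bump: "C.bump a B V" and U: "openin X U" "V \<subseteq> U"
    and y: "y \<in> carrier (gr (sections F V) k)"
  shows "restr F U B k (ext a V Q U k y) = restr F V B k y"
proof -
  have B: "openin X B" "B \<subseteq> V" "restr C (topspace X) B 0 a = gone (sections C B)" using bump by (auto simp: C.bump_def)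
  have V: "openin X V" "U \<inter> V = V" using cutoffD[OF cut] U by auto
  have y': "y \<in> carrier (gr (sections F (U \<inter> V)) k)" using y V by simp
  have "restr F U B k (ext a V Q U k y) = restr F V B k (restr F U V k (ext a V Q U k y))"
    using restr_trans[OF U(1) V(1) B(1,2) U(2) ext_closed[OF cut U(1) y']] by simp
  also have "restr F U V k (ext a V Q U k y) = scal V k a y"
    using restr_ext[OF cut U(1) y'] V by simp
  also have "restr F V B k (scal V k a y) = scal B k a (restr F V B k y)"
    by (rule restr_scal[OF V(1) B(1,2) cutoffD(1)[OF cut] y])
  also have "\<dots> = restr F V B k y"
    by (rule scal_eq_self[OF B(1,3) restr_closed[OF V(1) B(1,2) y]])
  finally show ?thesis .
qed

text \<open>A frame over \<open>U\<close> speaks only of sections over \<open>U\<close>. A section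
  over a smaller \<open>V\<close>, or the coefficients of a relation between frame sections over
  \<open>V\<close>, are multiplied by a bump function and extended by zero to \<open>U\<close>,
  where the frame property applies; near the given point nothing has changed.\<close>

lemma (in manifold_module) frame_on_if_is_frame:
  assumes bumps: "\<And>x V. \<lbrakk>openin X V; x \<in> V\<rbrakk> \<Longrightarrow> \<exists>a B. x \<in> B \<and> C.bump a B V"
    and U: "openin X U" and fr: "is_frame (sections C U) (sections F U) es"
  shows "frame_on U (length es) (\<lambda>b. fst (es ! b)) (\<lambda>b. snd (es ! b))"
proof -
  define r d e where "r = length es" and "d = (\<lambda>b. fst (es ! b))" and "e = (\<lambda>b. snd (es ! b))"
  interpret M: graded_module "sections C U" "sections F U" by (rule sections_module[OF U])
  have e: "e b \<in> carrier (gr (sections F U) (d b))" if "b < r" for b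
    using fr that nth_mem[of b es] by (auto simp: is_frame_def r_def d_def e_def split_beta)
  \<comment> \<open>\<open>comb\<close> contains restrictions from \<open>U\<close> to
    \<open>U\<close>, which are the identity on sections.\<close>
  have comb_U: "(\<Oplus>\<^bsub>gr (sections F U) k\<^esub>i\<in>{..<length es}.
      gact (sections F U) (k - fst (es ! i)) (fst (es ! i)) (f i) (snd (es ! i))) = comb U r d e U k f"
    if "\<And>b. b < r \<Longrightarrow> f b \<in> carrier (gr (sections C U) (k - d b))" for k f
    unfolding comb_def r_def[symmetric] using comb_term_closed[OF U e U subset_refl _ that]
    by (intro M.gr_finsum_cong) (auto simp: d_def e_def restr_id[OF U e[unfolded d_def e_def]])
  have ex1: "\<exists>!f. f \<in> (\<Pi>\<^sub>E b\<in>{..<r}. carrier (gr (sections C U) (k - d b))) \<and> s = comb U r d e U k f"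
    if s: "s \<in> carrier (gr (sections F U) k)" for s k
  proof -
    have eqv: "(f \<in> (\<Pi>\<^sub>E i\<in>{..<length es}. carrier (gr (sections C U) (k - fst (es ! i)))) \<and>
          s = (\<Oplus>\<^bsub>gr (sections F U) k\<^esub>i\<in>{..<length es}.
                 gact (sections F U) (k - fst (es ! i)) (fst (es ! i)) (f i) (snd (es ! i)))) \<longleftrightarrow>
        f \<in> (\<Pi>\<^sub>E b\<in>{..<r}. carrier (gr (sections C U) (k - d b))) \<and> s = comb U r d e U k f" for f
      using comb_U[of f k] by (auto simp: r_def d_def PiE_iff)
    have "\<exists>!f. f \<in> (\<Pi>\<^sub>E i\<in>{..<length es}. carrier (gr (sections C U) (k - fst (es ! i)))) \<and>
          s = (\<Oplus>\<^bsub>gr (sections F U) k\<^esub>i\<in>{..<length es}.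
                 gact (sections F U) (k - fst (es ! i)) (fst (es ! i)) (f i) (snd (es ! i)))"
      using fr s unfolding is_frame_def by blast
    then show ?thesis unfolding eqv .
  qed
  have "frame_on U r d e"
  proof (rule frame_onI_local[OF U e])
    fix V k f b assume V: "openin X V" "V \<subseteq> U" and f: "\<And>b. b < r \<Longrightarrow> f b \<in> carrier (gr (sections C V) (k - d b))"
      and z: "comb U r d e V k f = \<zero>\<^bsub>gr (sections F V) k\<^esub>" and b: "b < r"
    show "f b = \<zero>\<^bsub>gr (sections C V) (k - d b)\<^esub>"
    proof (rule CS.section_eqI[OF V(1) f[OF b] real_space_closed(2)[OF C.real_space_sections[OF V(1)]]])
      fix x assume x: "x \<in> V"
      obtain a B where aB: "x \<in> B" "C.bump a B V" using bumps[OF V(1) x] by blast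
      then obtain Q where cut: "C.cutoff a V Q" and B: "openin X B" "B \<subseteq> V" by (auto simp: C.bump_def)
      note aD = cutoffD[OF cut]
      have UV: "U \<inter> V = V" using V by auto
      define g where "g b = Cm.ext a V Q U (k - d b) (f b)" for b
      have fU: "f b \<in> carrier (gr (sections C (U \<inter> V)) (k - d b))" if "b < r" for b using f[OF that] UV by simp
      have g: "g b \<in> carrier (gr (sections C U) (k - d b))" if "b < r" for b
        using Cm.ext_closed[OF cut U, of "f b" "k - d b"] fU[OF that] by (simp add: g_def)
      have oQ: "openin X (U \<inter> Q)" using U aD by auto
      have VU: "openin X (U \<inter> V)" "U \<inter> V \<subseteq> U" using V UV by auto
      \<comment> \<open>The cut off coefficients still satisfy the relation: over \<open>V\<close>
        the combination is \<open>a\<close> times zero, and over \<open>Q\<close> all coefficients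
        vanish.\<close>
      have "comb U r d e U k g = \<zero>\<^bsub>gr (sections F U) k\<^esub>"
      proof (rule section_eqI2[OF U V(1) aD(3) _ comb_closed[OF U e U subset_refl g] M.gr_closed(2)])
        show "U \<subseteq> V \<union> Q" using aD(4) openin_subset[OF U] by simp
        have "restr F U (U \<inter> V) k (comb U r d e U k g) = comb U r d e (U \<inter> V) k (\<lambda>b. restr C U (U \<inter> V) (k - d b) (g b))"
          by (rule restr_comb[OF U e U subset_refl VU g])
        also have "\<dots> = comb U r d e (U \<inter> V) (0 + k) (\<lambda>b. gmult (sections C (U \<inter> V)) 0 (k - d b) (restr C (topspace X) (U \<inter> V) 0 a) (f b))"
        proof (simp only: add_0, rule comb_cong[OF U e VU])
          fix b assume b: "b < r"
          show "restr C U (U \<inter> V) (k - d b) (g b) = gmult (sections C (U \<inter> V)) 0 (k - d b) (restr C (topspace X) (U \<inter> V) 0 a) (f b)"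
            using Cm.restr_ext[OF cut U, of "f b" "k - d b"] fU[OF b] by (simp add: g_def Cm.scal_def)
          show "gmult (sections C (U \<inter> V)) 0 (k - d b) (restr C (topspace X) (U \<inter> V) 0 a) (f b) \<in> carrier (gr (sections C (U \<inter> V)) (k - d b))"
            using Cm.scal_closed[OF VU(1) aD(1), of "f b" "k - d b"] fU[OF b] by (simp add: Cm.scal_def)
        qed
        also have "\<dots> = gact (sections F (U \<inter> V)) 0 k (restr C (topspace X) (U \<inter> V) 0 a) (comb U r d e (U \<inter> V) k f)"
          by (rule comb_act[OF U e VU fU restr_function_closed[OF VU(1) aD(1)]])
        also have "\<dots> = \<zero>\<^bsub>gr (sections F (U \<inter> V)) k\<^esub>"
        proof -
          interpret MV: graded_module "sections C (U \<inter> V)" "sections F (U \<inter> V)" by (rule sections_module[OF VU(1)])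
          have "comb U r d e (U \<inter> V) k f = \<zero>\<^bsub>gr (sections F (U \<inter> V)) k\<^esub>" using z UV by simp
          then show ?thesis
            using linear_map_zero[OF MV.vector_space MV.vector_space MV.linear_act[OF restr_function_closed[OF VU(1) aD(1)], of k]]
            by simp
        qed
        also have "\<dots> = restr F U (U \<inter> V) k \<zero>\<^bsub>gr (sections F U) k\<^esub>" by (rule restr_zero[OF U VU, symmetric])
        finally show "restr F U (U \<inter> V) k (comb U r d e U k g) = restr F U (U \<inter> V) k \<zero>\<^bsub>gr (sections F U) k\<^esub>" .
        have "restr F U (U \<inter> Q) k (comb U r d e U k g) = comb U r d e (U \<inter> Q) k (\<lambda>b. restr C U (U \<inter> Q) (k - d b) (g b))"
          by (rule restr_comb[OF U e U subset_refl oQ Int_lower1 g])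
        also have "\<dots> = comb U r d e (U \<inter> Q) k (\<lambda>b. \<zero>\<^bsub>gr (sections C (U \<inter> Q)) (k - d b)\<^esub>)"
        proof (rule comb_cong[OF U e oQ Int_lower1])
          fix b assume b: "b < r"
          show "restr C U (U \<inter> Q) (k - d b) (g b) = \<zero>\<^bsub>gr (sections C (U \<inter> Q)) (k - d b)\<^esub>"
            using Cm.restr_ext_zero[OF cut U, of "f b" "k - d b"] fU[OF b] by (simp add: g_def)
        qed (use real_space_closed(2)[OF C.real_space_sections[OF oQ]] in auto)
        also have "\<dots> = \<zero>\<^bsub>gr (sections F (U \<inter> Q)) k\<^esub>" by (rule comb_zero[OF oQ U Int_lower1 e])
        also have "\<dots> = restr F U (U \<inter> Q) k \<zero>\<^bsub>gr (sections F U) k\<^esub>" by (rule restr_zero[OF U oQ Int_lower1, symmetric])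
        finally show "restr F U (U \<inter> Q) k (comb U r d e U k g) = restr F U (U \<inter> Q) k \<zero>\<^bsub>gr (sections F U) k\<^esub>" .
      qed
      moreover have "comb U r d e U k (restrict g {..<r}) = comb U r d e U k g"
        by (rule comb_cong[OF U e U subset_refl g]) auto
      ultimately have 1: "restrict g {..<r} \<in> (\<Pi>\<^sub>E b\<in>{..<r}. carrier (gr (sections C U) (k - d b))) \<and>
          \<zero>\<^bsub>gr (sections F U) k\<^esub> = comb U r d e U k (restrict g {..<r})"
        using g by simp
      let ?z = "\<lambda>b. \<zero>\<^bsub>gr (sections C U) (k - d b)\<^esub>"
      have "comb U r d e U k (restrict ?z {..<r}) = comb U r d e U k ?z"
        by (rule comb_cong[OF U e U subset_refl]) auto
      also have "\<dots> = \<zero>\<^bsub>gr (sections F U) k\<^esub>"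
        by (rule comb_zero[OF U U subset_refl e])
      finally have 2: "restrict ?z {..<r} \<in> (\<Pi>\<^sub>E b\<in>{..<r}. carrier (gr (sections C U) (k - d b))) \<and>
          \<zero>\<^bsub>gr (sections F U) k\<^esub> = comb U r d e U k (restrict ?z {..<r})"
        by simp
      have "restrict g {..<r} = restrict ?z {..<r}"
        using ex1[OF M.gr_closed(2)[of k]] 1 2 by blast
      then have gz: "g b = \<zero>\<^bsub>gr (sections C U) (k - d b)\<^esub>" using b by (metis lessThan_iff restrict_apply')
      have "restr C V B (k - d b) (f b) = restr C U B (k - d b) (g b)"
        using Cm.restr_ext_bump[OF cut aB(2) U V(2), of "f b" "k - d b"] f[OF b] by (simp add: g_def)
      also have "\<dots> = restr C V B (k - d b) \<zero>\<^bsub>gr (sections C V) (k - d b)\<^esub>"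
        using V B by (simp add: gz C.restr_zero U)
      finally show "\<exists>B. openin X B \<and> x \<in> B \<and> B \<subseteq> V \<and>
          restr C V B (k - d b) (f b) = restr C V B (k - d b) \<zero>\<^bsub>gr (sections C V) (k - d b)\<^esub>"
        using B aB by auto
    qed
  next
    fix V k s x assume V: "openin X V" "V \<subseteq> U" and s: "s \<in> carrier (gr (sections F V) k)" and x: "x \<in> V"
    obtain a B where aB: "x \<in> B" "C.bump a B V" using bumps[OF V(1) x] by blast
    then obtain Q where cut: "C.cutoff a V Q" and B: "openin X B" "B \<subseteq> V" by (auto simp: C.bump_def)
    have UV: "U \<inter> V = V" using V by auto
    have s': "ext a V Q U k s \<in> carrier (gr (sections F U) k)"
      using ext_closed[OF cut U, of s k] s UV by simp
    obtain f where f: "\<And>b. b < r \<Longrightarrow> f b \<in> carrier (gr (sections C U) (k - d b))"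
      and sf: "ext a V Q U k s = comb U r d e U k f"
      using ex1_implies_ex[OF ex1[OF s']] by (auto simp: PiE_iff)
    have BU: "B \<subseteq> U" using B V by auto
    have "restr F V B k s = comb U r d e B k (\<lambda>b. restr C U B (k - d b) (f b))"
      using restr_ext_bump[OF cut aB(2) U V(2) s] restr_comb[OF U e U subset_refl B(1) BU f] sf by simp
    then show "\<exists>B f. openin X B \<and> x \<in> B \<and> B \<subseteq> V \<and> (\<forall>b<r. f b \<in> carrier (gr (sections C B) (k - d b))) \<and>
        restr F V B k s = comb U r d e B k f"
      using B aB(1) C.restr_closed[OF U B(1) BU f]
      by (intro exI[of _ B] exI[of _ "\<lambda>b. restr C U B (k - d b) (f b)"]) auto
  qed
  then show ?thesis by (simp add: r_def d_def e_def)
qed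

section \<open>Combining bump functions\<close>

context algebra_sheaf
begin

lemma one_section_closed: "openin X U \<Longrightarrow> gone (sections C U) \<in> carrier (gr (sections C U) 0)"
  using graded_algebra.one_closed[OF sections_algebra] .

text \<open>Base case for finite unions: over the empty set all functions coincide, so even zero
  equals one there.\<close>

lemma bump_empty: "openin X V \<Longrightarrow> bump (\<zero>\<^bsub>functions\<^esub>) {} V"
proof -
  assume V: "openin X V"
  have z: "\<zero>\<^bsub>functions\<^esub> \<in> carrier functions"
    using real_space_closed(2)[OF real_space_sections[OF openin_topspace]] by (simp add: ring0_simps)
  have "cutoff (\<zero>\<^bsub>functions\<^esub>) V (topspace X)"
    using V z openin_subset[OF V] by (auto simp: cutoff_def ring0_simps restr_zero)
  moreover have "restr C (topspace X) {} 0 (\<zero>\<^bsub>functions\<^esub>) = gone (sections C {})"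
    using z one_section_closed[of "{}"]
    by (intro section_eqI[of "{}"]) (auto simp: ring0_simps intro!: restr_closed)
  ultimately show ?thesis by (auto simp: bump_def)
qed

lemma bump_Un:
  assumes "bump a B V" "bump a' B' V"
  shows "\<exists>b. bump b (B \<union> B') V"
proof -
  interpret R: cring "functions" by (rule cring_functions)
  obtain Q Q' where cut: "cutoff a V Q" "cutoff a' V Q'" using assms by (auto simp: bump_def)
  then have a: "a \<in> carrier functions" "a' \<in> carrier functions" and o: "openin X V" "openin X Q" "openin X Q'"
    and cov: "V \<union> Q = topspace X" "V \<union> Q' = topspace X"
    and aQ: "restr C (topspace X) Q 0 a = \<zero>\<^bsub>gr (sections C Q) 0\<^esub>"
      "restr C (topspace X) Q' 0 a' = \<zero>\<^bsub>gr (sections C Q') 0\<^esub>"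
    by (auto simp: cutoff_def)
  have B: "openin X B" "B \<subseteq> V" "restr C (topspace X) B 0 a = gone (sections C B)"
    and B': "openin X B'" "B' \<subseteq> V" "restr C (topspace X) B' 0 a' = gone (sections C B')"
    using assms by (auto simp: bump_def)
  \<comment> \<open>Chosen such that 1 - b = (1 - a) (1 - a'): \<open>b\<close> is one where either
    function is one, and zero where both vanish.\<close>
  define b where "b = a \<oplus>\<^bsub>functions\<^esub> a' \<otimes>\<^bsub>functions\<^esub> (\<one>\<^bsub>functions\<^esub> \<ominus>\<^bsub>functions\<^esub> a)"
  have b: "b \<in> carrier functions" using a by (simp add: b_def)
  have rb: "restr C (topspace X) U 0 b = restr C (topspace X) U 0 a \<oplus>\<^bsub>ring0 (sections C U)\<^esub>
      restr C (topspace X) U 0 a' \<otimes>\<^bsub>ring0 (sections C U)\<^esub>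
        (\<one>\<^bsub>ring0 (sections C U)\<^esub> \<ominus>\<^bsub>ring0 (sections C U)\<^esub> restr C (topspace X) U 0 a)"
    if "openin X U" for U
  proof -
    interpret r: ring_hom_cring "functions" "ring0 (sections C U)" "restr C (topspace X) U 0"
      by (rule restr_ring_hom[OF openin_topspace that openin_subset[OF that]])
    show ?thesis using a by (simp add: b_def a_minus_def)
  qed
  have rcl: "restr C (topspace X) U 0 c \<in> carrier (ring0 (sections C U))" if "openin X U" "c \<in> carrier functions" for U c
    using restr_closed[OF openin_topspace that(1) openin_subset[OF that(1)], of c 0] that(2) by (simp add: ring0_simps)
  have R: "cring (ring0 (sections C U))" if "openin X U" for U
    by (rule graded_algebra.cring_ring0[OF sections_algebra[OF that]])
  have tr: "restr C (topspace X) W 0 c = restr C U W 0 (restr C (topspace X) U 0 c)"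
    if "openin X U" "openin X W" "W \<subseteq> U" "c \<in> carrier functions" for U W c
    using that openin_subset[OF that(1)] by (intro restr_trans[symmetric]) (auto simp: ring0_simps)
  have QQ: "openin X (Q \<inter> Q')" using o by auto
  have "restr C (topspace X) (Q \<inter> Q') 0 b = \<zero>\<^bsub>gr (sections C (Q \<inter> Q')) 0\<^esub>"
  proof -
    interpret RQ: cring "ring0 (sections C (Q \<inter> Q'))" by (rule R[OF QQ])
    have z: "restr C (topspace X) (Q \<inter> Q') 0 a = \<zero>\<^bsub>ring0 (sections C (Q \<inter> Q'))\<^esub>"
      "restr C (topspace X) (Q \<inter> Q') 0 a' = \<zero>\<^bsub>ring0 (sections C (Q \<inter> Q'))\<^esub>"
      using tr[OF o(2) QQ Int_lower1 a(1)] tr[OF o(3) QQ Int_lower2 a(2)]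
        restr_zero[OF o(2) QQ Int_lower1] restr_zero[OF o(3) QQ Int_lower2]
      by (simp_all add: aQ ring0_simps)
    have "restr C (topspace X) (Q \<inter> Q') 0 b = \<zero>\<^bsub>ring0 (sections C (Q \<inter> Q'))\<^esub>"
      unfolding rb[OF QQ] z by simp
    then show ?thesis by (simp add: ring0_simps)
  qed
  moreover have "V \<union> (Q \<inter> Q') = topspace X" using cov by auto
  ultimately have "cutoff b V (Q \<inter> Q')" using b o QQ by (simp add: cutoff_def)
  moreover have "restr C (topspace X) (B \<union> B') 0 b = gone (sections C (B \<union> B'))"
  proof (rule section_eqI2[OF _ B(1) B'(1) subset_refl])
    have un: "openin X (B \<union> B')" using B B' by auto
    then show "openin X (B \<union> B')" .
    show "restr C (topspace X) (B \<union> B') 0 b \<in> carrier (gr (sections C (B \<union> B')) 0)"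
      using rcl[OF un b] by (simp add: ring0_simps)
    show "gone (sections C (B \<union> B')) \<in> carrier (gr (sections C (B \<union> B')) 0)" by (rule one_section_closed[OF un])
    have i: "(B \<union> B') \<inter> B = B" "(B \<union> B') \<inter> B' = B'" by auto
    have one: "restr C (B \<union> B') B 0 (gone (sections C (B \<union> B'))) = gone (sections C B)"
      "restr C (B \<union> B') B' 0 (gone (sections C (B \<union> B'))) = gone (sections C B')"
      using un B B' by (auto intro: restr_one)
    interpret RB: cring "ring0 (sections C B)" by (rule R[OF B(1)])
    interpret RB': cring "ring0 (sections C B')" by (rule R[OF B'(1)])
    have "restr C (topspace X) B 0 b = \<one>\<^bsub>ring0 (sections C B)\<^esub>"
      using rb[OF B(1)] B(3) rcl[OF B(1) a(2)]
      by (simp add: ring0_simps(3)[symmetric] a_minus_def RB.r_neg)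
    then show "restr C (B \<union> B') ((B \<union> B') \<inter> B) 0 (restr C (topspace X) (B \<union> B') 0 b) =
        restr C (B \<union> B') ((B \<union> B') \<inter> B) 0 (gone (sections C (B \<union> B')))"
      using tr[OF un B(1) _ b] i one by (simp add: ring0_simps)
    have "restr C (topspace X) B' 0 b = \<one>\<^bsub>ring0 (sections C B')\<^esub>"
    proof -
      let ?x = "restr C (topspace X) B' 0 a"
      have x: "?x \<in> carrier (ring0 (sections C B'))" by (rule rcl[OF B'(1) a(1)])
      have "restr C (topspace X) B' 0 b = ?x \<oplus>\<^bsub>ring0 (sections C B')\<^esub> (\<one>\<^bsub>ring0 (sections C B')\<^esub> \<ominus>\<^bsub>ring0 (sections C B')\<^esub> ?x)"
        using rb[OF B'(1)] B'(3) x by (simp add: ring0_simps(3)[symmetric])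
      also have "\<dots> = \<one>\<^bsub>ring0 (sections C B')\<^esub>" using x by algebra
      finally show ?thesis .
    qed
    then show "restr C (B \<union> B') ((B \<union> B') \<inter> B') 0 (restr C (topspace X) (B \<union> B') 0 b) =
        restr C (B \<union> B') ((B \<union> B') \<inter> B') 0 (gone (sections C (B \<union> B')))"
      using tr[OF un B'(1) _ b] i one by (simp add: ring0_simps)
  qed
  ultimately show ?thesis using B B' unfolding bump_def by blast
qed

lemma bump_compact:
  assumes bumps: "\<And>x. x \<in> K \<Longrightarrow> \<exists>a B. x \<in> B \<and> bump a B V"
    and K: "compactin X K" and V: "openin X V"
  shows "\<exists>a B. K \<subseteq> B \<and> bump a B V"
proof -
  define \<B> where "\<B> = {B. \<exists>a. bump a B V}"
  have "\<And>B. B \<in> \<B> \<Longrightarrow> openin X B" by (auto simp: \<B>_def bump_def)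
  moreover have "K \<subseteq> \<Union>\<B>" using bumps unfolding \<B>_def by blast
  ultimately obtain \<F> where \<F>: "finite \<F>" "\<F> \<subseteq> \<B>" "K \<subseteq> \<Union>\<F>"
    using compactinD[OF K, of \<B>] by blast
  have "\<exists>a. bump a (\<Union>\<F>) V"
    using \<F>(1,2)
  proof (induction \<F>)
    case empty
    then show ?case using bump_empty[OF V] by auto
  next
    case (insert B \<F>)
    then obtain a a' where "bump a B V" "bump a' (\<Union>\<F>) V" by (auto simp: \<B>_def)
    from bump_Un[OF this] show ?case by simp
  qed
  then show ?thesis using \<F> by blast
qed

text \<open>The pieces are glued rather than summed, which disjointness permits. Local finiteness
  provides an open set on which all of them vanish and which, together with the union, covers the
  space.\<close>

lemma bump_disjoint_Union:
  assumes bump: "\<And>V. V \<in> \<V> \<Longrightarrow> bump (a V) (B V) V" and disj: "pairwise disjnt \<V>"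
    and lf: "locally_finite_in X \<V>"
  shows "\<exists>b. bump b (\<Union>V\<in>\<V>. B V) (\<Union>\<V>)"
proof -
  have "\<exists>Q. \<forall>V\<in>\<V>. cutoff (a V) V (Q V)"
    using bump unfolding bump_def by metis
  then obtain Q where cut: "\<And>V. V \<in> \<V> \<Longrightarrow> cutoff (a V) V (Q V)" by blast
  have ac: "a V \<in> carrier (gr (sections C (topspace X)) 0)" and oV: "openin X V" and oQ: "openin X (Q V)"
    and cov: "V \<union> Q V = topspace X" and aQ: "restr C (topspace X) (Q V) 0 (a V) = \<zero>\<^bsub>gr (sections C (Q V)) 0\<^esub>"
    if "V \<in> \<V>" for V
    using cut[OF that] by (auto simp: cutoff_def ring0_simps)
  have oB: "openin X (B V)" and BV: "B V \<subseteq> V" and aB: "restr C (topspace X) (B V) 0 (a V) = gone (sections C (B V))"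
    if "V \<in> \<V>" for V
    using bump[OF that] by (auto simp: bump_def)
  define W where "W = \<Union>\<V>"
  have W: "openin X W" using oV by (auto simp: W_def)
  have VW: "V \<subseteq> W" if "V \<in> \<V>" for V using that by (auto simp: W_def)
  \<comment> \<open>The interior of the common zero region: the largest open set contained in every
    \<open>Q V\<close>.\<close>
  define Z where "Z = \<Union>{G. openin X G \<and> (\<forall>V\<in>\<V>. G \<subseteq> Q V)}"
  have Z: "openin X Z" by (auto simp: Z_def)
  have ZQ: "Z \<subseteq> Q V" if "V \<in> \<V>" for V using that by (auto simp: Z_def)
  have WZ: "W \<union> Z = topspace X"
  proof
    show "topspace X \<subseteq> W \<union> Z"
    proof
      fix x assume x: "x \<in> topspace X"
      obtain G where G: "openin X G" "x \<in> G" "finite {V \<in> \<V>. V \<inter> G \<noteq> {}}"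
        using lf x unfolding locally_finite_in_def by blast
      let ?\<F> = "{V \<in> \<V>. V \<inter> G \<noteq> {}}"
      show "x \<in> W \<union> Z"
      proof (cases "x \<in> W")
        case False
        \<comment> \<open>Only finitely many \<open>V\<close> meet \<open>G\<close>, and for these
          the sets \<open>Q V\<close> are intersected. A \<open>V\<close> that misses
          \<open>G\<close> has \<open>G\<close> inside \<open>Q V\<close> already, since
          \<open>V\<close> and \<open>Q V\<close> cover the space.\<close>
        let ?G = "G \<inter> topspace X \<inter> \<Inter>(Q ` ?\<F>)"
        have xQ: "x \<in> Q V" if "V \<in> \<V>" for V using False cov[OF that] x that by (auto simp: W_def)
        have "openin X ?G"
        proof (cases "?\<F> = {}")
          case True
          show ?thesis unfolding True using G by (simp add: openin_Int)
        next
          case False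
          then show ?thesis using G oQ by (intro openin_Int openin_Inter) auto
        qed
        moreover have "?G \<subseteq> Q V" if "V \<in> \<V>" for V
        proof (cases "V \<inter> G = {}")
          case True
          then show ?thesis using cov[OF that] by auto
        next
          case False
          then show ?thesis using that by blast
        qed
        moreover have "x \<in> ?G" using G x xQ by auto
        ultimately show ?thesis unfolding Z_def by blast
      qed auto
    qed
  qed (use W Z openin_subset in auto)
  have "\<exists>!t. t \<in> carrier (gr (sections C W) 0) \<and> (\<forall>V\<in>\<V>. restr C W V 0 t = restr C (topspace X) V 0 (a V))"
    unfolding W_def
  proof (rule glue[OF oV])
    fix V V' assume V: "V \<in> \<V>" "V' \<in> \<V>"
    show "restr C V (V \<inter> V') 0 (restr C (topspace X) V 0 (a V)) = restr C V' (V \<inter> V') 0 (restr C (topspace X) V' 0 (a V'))"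
    proof (cases "V = V'")
      case False
      then have "V \<inter> V' = {}" using disj V by (auto simp: pairwise_def disjnt_def)
      then show ?thesis
        using V oV ac openin_subset[OF oV[OF V(1)]] openin_subset[OF oV[OF V(2)]]
        by (intro section_eqI[of "{}" _ 0]) (auto intro!: restr_closed)
    qed simp
  next
    fix V assume V: "V \<in> \<V>"
    show "restr C (topspace X) V 0 (a V) \<in> carrier (gr (sections C V) 0)"
      by (rule restr_closed[OF openin_topspace oV[OF V] openin_subset[OF oV[OF V]] ac[OF V]])
  qed
  then obtain t where t: "t \<in> carrier (gr (sections C W) 0)"
    and tV: "\<And>V. V \<in> \<V> \<Longrightarrow> restr C W V 0 t = restr C (topspace X) V 0 (a V)" by blast
  have oWZ: "openin X (W \<inter> Z)" using W Z by auto
  have "restr C W (W \<inter> Z) 0 t = \<zero>\<^bsub>gr (sections C (W \<inter> Z)) 0\<^esub>"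
  proof (rule section_eqI[OF oWZ restr_closed[OF W oWZ Int_lower1 t] real_space_closed(2)[OF real_space_sections[OF oWZ]]])
    fix x assume x: "x \<in> W \<inter> Z"
    then obtain V where V: "V \<in> \<V>" "x \<in> V" by (auto simp: W_def)
    let ?G = "V \<inter> Z"
    have oG: "openin X ?G" using oV[OF V(1)] Z by auto
    have sub: "?G \<subseteq> W \<inter> Z" "?G \<subseteq> Q V" "V \<subseteq> topspace X" "Q V \<subseteq> topspace X"
      using VW[OF V(1)] ZQ[OF V(1)] openin_subset[OF oV[OF V(1)]] openin_subset[OF oQ[OF V(1)]] by auto
    have "restr C (W \<inter> Z) ?G 0 (restr C W (W \<inter> Z) 0 t) = restr C V ?G 0 (restr C W V 0 t)"
      using restr_trans[OF W oWZ oG sub(1) Int_lower1 t] restr_trans[OF W oV[OF V(1)] oG Int_lower1 VW[OF V(1)] t]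
      by simp
    also have "\<dots> = restr C (Q V) ?G 0 (restr C (topspace X) (Q V) 0 (a V))"
      using tV[OF V(1)] restr_trans[OF openin_topspace oV[OF V(1)] oG Int_lower1 sub(3) ac[OF V(1)]]
        restr_trans[OF openin_topspace oQ[OF V(1)] oG sub(2,4) ac[OF V(1)]] by simp
    also have "\<dots> = \<zero>\<^bsub>gr (sections C ?G) 0\<^esub>"
      unfolding aQ[OF V(1)] by (rule restr_zero[OF oQ[OF V(1)] oG sub(2)])
    also have "\<dots> = restr C (W \<inter> Z) ?G 0 \<zero>\<^bsub>gr (sections C (W \<inter> Z)) 0\<^esub>"
      by (rule restr_zero[OF oWZ oG sub(1), symmetric])
    finally show "\<exists>G. openin X G \<and> x \<in> G \<and> G \<subseteq> W \<inter> Z \<and> restr C (W \<inter> Z) G 0 (restr C W (W \<inter> Z) 0 t) =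
        restr C (W \<inter> Z) G 0 \<zero>\<^bsub>gr (sections C (W \<inter> Z)) 0\<^esub>"
      using oG sub(1) x V by (intro exI[of _ ?G]) auto
  qed
  also have "\<dots> = restr C Z (W \<inter> Z) 0 \<zero>\<^bsub>gr (sections C Z) 0\<^esub>"
    by (rule restr_zero[OF Z oWZ Int_lower2, symmetric])
  finally obtain b where b: "b \<in> carrier (gr (sections C (topspace X)) 0)"
    "restr C (topspace X) W 0 b = t" "restr C (topspace X) Z 0 b = \<zero>\<^bsub>gr (sections C Z) 0\<^esub>"
    using glue2[OF W Z t real_space_closed(2)[OF real_space_sections[OF Z]]] unfolding WZ by blast
  have "cutoff b W Z" using b W Z WZ by (simp add: cutoff_def ring0_simps)
  moreover have "restr C (topspace X) (\<Union>V\<in>\<V>. B V) 0 b = gone (sections C (\<Union>V\<in>\<V>. B V))"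
  proof -
    have o: "openin X (\<Union>V\<in>\<V>. B V)" using oB by auto
    have rc: "restr C (topspace X) (\<Union>V\<in>\<V>. B V) 0 b \<in> carrier (gr (sections C (\<Union>V\<in>\<V>. B V)) 0)"
      by (rule restr_closed[OF openin_topspace o openin_subset[OF o] b(1)])
    show ?thesis
    proof (rule section_eqI[OF o rc one_section_closed[OF o]])
      fix x assume "x \<in> (\<Union>V\<in>\<V>. B V)"
      then obtain V where V: "V \<in> \<V>" "x \<in> B V" by auto
      have sub: "B V \<subseteq> (\<Union>V\<in>\<V>. B V)" "V \<subseteq> topspace X" "W \<subseteq> topspace X" "B V \<subseteq> W"
        using V BV[OF V(1)] VW[OF V(1)] openin_subset[OF oV[OF V(1)]] openin_subset[OF W] by auto
      have "restr C (\<Union>V\<in>\<V>. B V) (B V) 0 (restr C (topspace X) (\<Union>V\<in>\<V>. B V) 0 b) = restr C W (B V) 0 (restr C (topspace X) W 0 b)"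
        using restr_trans[OF openin_topspace o oB[OF V(1)] sub(1) openin_subset[OF o] b(1)]
          restr_trans[OF openin_topspace W oB[OF V(1)] sub(4,3) b(1)] by simp
      also have "\<dots> = restr C V (B V) 0 (restr C W V 0 t)"
        unfolding b(2) using restr_trans[OF W oV[OF V(1)] oB[OF V(1)] BV[OF V(1)] VW[OF V(1)] t] by simp
      also have "\<dots> = gone (sections C (B V))"
        using tV[OF V(1)] restr_trans[OF openin_topspace oV[OF V(1)] oB[OF V(1)] BV[OF V(1)] sub(2) ac[OF V(1)]] aB[OF V(1)]
        by simp
      also have "\<dots> = restr C (\<Union>V\<in>\<V>. B V) (B V) 0 (gone (sections C (\<Union>V\<in>\<V>. B V)))"
        by (rule restr_one[OF o oB[OF V(1)] sub(1), symmetric])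
      finally show "\<exists>G. openin X G \<and> x \<in> G \<and> G \<subseteq> (\<Union>V\<in>\<V>. B V) \<and>
          restr C (\<Union>V\<in>\<V>. B V) G 0 (restr C (topspace X) (\<Union>V\<in>\<V>. B V) 0 b) =
          restr C (\<Union>V\<in>\<V>. B V) G 0 (gone (sections C (\<Union>V\<in>\<V>. B V)))"
        using oB[OF V(1)] V sub(1) by blast
    qed
  qed
  moreover have "openin X (\<Union>V\<in>\<V>. B V)" "(\<Union>V\<in>\<V>. B V) \<subseteq> W"
    using oB BV by (auto simp: W_def)
  ultimately have "bump b (\<Union>V\<in>\<V>. B V) W" unfolding bump_def by blast
  then show ?thesis unfolding W_def by blast
qed

end

subsection \<open>Smooth bump functions on Euclidean space\<close>

text \<open>Functions of one variable suffice: the bump functions on cubes are products of functions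
  of single coordinates, and their partial derivatives are again such products.\<close>

primrec real_Ck :: "nat \<Rightarrow> (real \<Rightarrow> real) \<Rightarrow> bool" where
  "real_Ck 0 f \<longleftrightarrow> continuous_on UNIV f"
| "real_Ck (Suc k) f \<longleftrightarrow> (\<exists>f'. (\<forall>x. (f has_real_derivative f' x) (at x)) \<and> real_Ck k f')"

lemma real_Ck_SucI:
  "\<lbrakk>\<And>x. (f has_real_derivative f' x) (at x); real_Ck k f'\<rbrakk> \<Longrightarrow> real_Ck (Suc k) f"
  by auto

lemma real_Ck_continuous: "real_Ck k f \<Longrightarrow> continuous_on UNIV f"
  by (cases k) (auto intro!: continuous_at_imp_continuous_on intro: DERIV_isCont)

lemma real_Ck_Suc_imp: "real_Ck (Suc k) f \<Longrightarrow> real_Ck k f"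
proof (induction k arbitrary: f)
  case 0
  then show ?case using real_Ck_continuous[OF 0] by simp
next
  case (Suc k)
  then obtain f' where "\<And>x. (f has_real_derivative f' x) (at x)" "real_Ck (Suc k) f'"
    unfolding real_Ck.simps(2)[of "Suc k"] by blast
  with Suc.IH[of f'] show ?case by auto
qed

lemma real_Ck_const: "real_Ck k (\<lambda>_. c)"
  by (induction k arbitrary: c) (auto intro!: exI[of _ "\<lambda>_. 0"] derivative_eq_intros)

lemma real_Ck_add: "real_Ck k f \<Longrightarrow> real_Ck k g \<Longrightarrow> real_Ck k (\<lambda>x. f x + g x)"
proof (induction k arbitrary: f g)
  case 0
  then show ?case by (auto intro: continuous_intros)
next
  case (Suc k)
  then obtain f' g' where "\<And>x. (f has_real_derivative f' x) (at x)" "real_Ck k f'"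
    "\<And>x. (g has_real_derivative g' x) (at x)" "real_Ck k g'" by auto
  then show ?case using Suc.IH[of f' g'] by (auto intro!: exI[of _ "\<lambda>x. f' x + g' x"] DERIV_add)
qed

lemma real_Ck_mult: "real_Ck k f \<Longrightarrow> real_Ck k g \<Longrightarrow> real_Ck k (\<lambda>x. f x * g x)"
proof (induction k arbitrary: f g)
  case 0
  then show ?case by (auto intro: continuous_intros)
next
  case (Suc k)
  then obtain f' g' where f: "\<And>x. (f has_real_derivative f' x) (at x)" "real_Ck k f'"
    and g: "\<And>x. (g has_real_derivative g' x) (at x)" "real_Ck k g'" by auto
  have "real_Ck k (\<lambda>x. f' x * g x + g' x * f x)"
    using Suc.IH[OF f(2) real_Ck_Suc_imp[OF Suc.prems(2)]] Suc.IH[OF g(2) real_Ck_Suc_imp[OF Suc.prems(1)]]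
    by (rule real_Ck_add)
  with DERIV_mult[OF f(1) g(1)] show ?case by (rule real_Ck_SucI)
qed

lemma real_Ck_affine: "real_Ck k f \<Longrightarrow> real_Ck k (\<lambda>x. f (c * x + b))"
proof (induction k arbitrary: f)
  case 0
  then show ?case by (auto intro!: continuous_on_compose2[of UNIV f] continuous_intros)
next
  case (Suc k)
  then obtain f' where f': "\<And>x. (f has_real_derivative f' x) (at x)" "real_Ck k f'" by auto
  have "((\<lambda>x. f (c * x + b)) has_real_derivative f' (c * x + b) * c) (at x)" for x
    by (rule DERIV_chain2[OF f'(1)]) (auto intro!: derivative_eq_intros)
  moreover have "real_Ck k (\<lambda>x. f' (c * x + b) * c)"
    by (intro real_Ck_mult real_Ck_const Suc.IH f')
  ultimately show ?case by (rule real_Ck_SucI)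
qed

lemma real_Ck_inverse:
  "real_Ck k f \<Longrightarrow> (\<And>x. f x \<noteq> 0) \<Longrightarrow> real_Ck k (\<lambda>x. inverse (f x))"
proof (induction k)
  case 0
  then show ?case by (auto intro: continuous_intros)
next
  case (Suc k)
  then obtain f' where f': "\<And>x. (f has_real_derivative f' x) (at x)" "real_Ck k f'" by auto
  have inv: "real_Ck k (\<lambda>x. inverse (f x))"
    by (rule Suc.IH[OF real_Ck_Suc_imp[OF Suc.prems(1)] Suc.prems(2)])
  have "((\<lambda>x. inverse (f x)) has_real_derivative - 1 * (f' x * (inverse (f x) * inverse (f x)))) (at x)" for x
    using DERIV_inverse_fun[OF f'(1) Suc.prems(2), of x] by (simp add: mult_ac)
  moreover have "real_Ck k (\<lambda>x. - 1 * (f' x * (inverse (f x) * inverse (f x))))"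
    by (intro real_Ck_mult real_Ck_const inv f')
  ultimately show ?case by (rule real_Ck_SucI)
qed

text \<open>For p = 1 this is the standard smooth function that is flat at 0. The polynomial in 1/x
  makes the family closed under differentiation, so one derivative formula yields smoothness of all
  orders.\<close>

definition flat :: "real poly \<Rightarrow> real \<Rightarrow> real" where
  "flat p x = (if x > 0 then poly p (inverse x) * exp (- inverse x) else 0)"

lemma poly_mult_exp_tendsto_0: "((\<lambda>x. poly p x * exp (- x)) \<longlongrightarrow> 0) at_top" for p :: "real poly"
proof -
  have "((\<lambda>x. \<Sum>i\<le>degree p. coeff p i * (x ^ i / exp x)) \<longlongrightarrow> (\<Sum>i\<le>degree p. coeff p i * 0)) at_top"
    by (intro tendsto_sum tendsto_mult tendsto_const tendsto_power_div_exp_0)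
  then show ?thesis
    by (simp add: poly_altdef sum_divide_distrib exp_minus field_simps)
qed

text \<open>With y = 1/x the derivative of p(y) exp(-y) is y^2 (p(y) - p'(y)) exp(-y), which
  explains the polynomial. At 0 the one-sided difference quotients are computed directly.\<close>

lemma flat_has_derivative:
  "(flat p has_real_derivative flat ([:0, 0, 1:] * (p - pderiv p)) x) (at x)"
proof -
  consider "x > 0" | "x < 0" | "x = 0" by linarith
  then show ?thesis
  proof cases
    case 1
    have "((\<lambda>x. poly p (inverse x) * exp (- inverse x)) has_real_derivative
        flat ([:0, 0, 1:] * (p - pderiv p)) x) (at x)"
      using 1 by (auto intro!: derivative_eq_intros DERIV_chain2[OF poly_DERIV]
          simp: flat_def algebra_simps power2_eq_square)
    then show ?thesis
      by (rule has_field_derivative_transform_within_open[of _ _ _ "{0<..}"]) (use 1 in \<open>auto simp: flat_def\<close>)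
  next
    case 2
    have "((\<lambda>x. 0) has_real_derivative flat ([:0, 0, 1:] * (p - pderiv p)) x) (at x)"
      using 2 by (simp add: flat_def)
    then show ?thesis
      by (rule has_field_derivative_transform_within_open[of _ _ _ "{..<0}"]) (use 2 in \<open>auto simp: flat_def\<close>)
  next
    case 3
    \<comment> \<open>To the right of 0 the difference quotient is p(1/h) exp(-1/h) / h; dividing by
      h is one more factor 1/h, hence \<open>pCons 0 p\<close>.\<close>
    have "((\<lambda>h. poly (pCons 0 p) (inverse h) * exp (- inverse h)) \<longlongrightarrow> 0) (at_right (0::real))"
      by (rule filterlim_compose[OF poly_mult_exp_tendsto_0 filterlim_inverse_at_top_right])
    then have "((\<lambda>h. (flat p (0 + h) - flat p 0) / h) \<longlongrightarrow> 0) (at_right 0)"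
      by (rule Lim_transform_eventually)
        (auto simp: eventually_at_right_field flat_def field_simps intro!: exI[of _ 1])
    moreover have "((\<lambda>h. (flat p (0 + h) - flat p 0) / h) \<longlongrightarrow> 0) (at_left 0)"
      by (rule Lim_transform_eventually[OF tendsto_const[of 0]])
        (auto simp: eventually_at_left_field flat_def intro!: exI[of _ "-1"])
    ultimately have "((\<lambda>h. (flat p (0 + h) - flat p 0) / h) \<longlongrightarrow> 0) (at 0)"
      by (simp add: filterlim_at_split)
    then show ?thesis unfolding 3 DERIV_def by (simp add: flat_def)
  qed
qed

lemma real_Ck_flat: "real_Ck k (flat p)"
proof (induction k arbitrary: p)
  case 0
  show ?case by (auto intro!: continuous_at_imp_continuous_on DERIV_isCont[OF flat_has_derivative])
next
  case (Suc k)
  then show ?case using flat_has_derivative[of p] by auto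
qed

definition smooth_step :: "real \<Rightarrow> real" where
  "smooth_step t = flat 1 t * inverse (flat 1 t + flat 1 (1 - t))"

lemma real_Ck_smooth_step: "real_Ck k smooth_step"
proof -
  \<comment> \<open>The numbers t and 1 - t cannot both be nonpositive, and neither summand is
    negative.\<close>
  have pos: "flat 1 t + flat 1 (1 - t) \<noteq> 0" for t
  proof -
    have "flat 1 t \<ge> 0" "flat 1 (1 - t) \<ge> 0" "flat 1 t > 0 \<or> flat 1 (1 - t) > 0"
      by (auto simp: flat_def)
    then show ?thesis by linarith
  qed
  have "real_Ck k (\<lambda>t. flat 1 (- 1 * t + 1))" by (intro real_Ck_affine real_Ck_flat)
  then have "real_Ck k (\<lambda>t. flat 1 (1 - t))" by (simp add: algebra_simps)
  then show ?thesis
    unfolding smooth_step_def[abs_def]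
    by (intro real_Ck_mult real_Ck_inverse real_Ck_add real_Ck_flat pos)
qed

lemma smooth_step_simps: "t \<le> 0 \<Longrightarrow> smooth_step t = 0" "t \<ge> 1 \<Longrightarrow> smooth_step t = 1"
  by (auto simp: smooth_step_def flat_def)

text \<open>The plateau is [-1, 1] and the support lies in [-2, 2]; the ratio 2 reappears in the
  radii of the boxes below. The arguments have the literal form c t + b that
  \<open>real_Ck_affine\<close> expects.\<close>

definition hat :: "real \<Rightarrow> real" where
  "hat t = smooth_step (1 * t + 2) * smooth_step (- 1 * t + 2)"

lemma real_Ck_hat: "real_Ck k hat"
  unfolding hat_def[abs_def] by (intro real_Ck_mult real_Ck_affine real_Ck_smooth_step)

lemma hat_simps: "\<bar>t\<bar> \<le> 1 \<Longrightarrow> hat t = 1" "\<bar>t\<bar> \<ge> 2 \<Longrightarrow> hat t = 0"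
proof -
  show "\<bar>t\<bar> \<le> 1 \<Longrightarrow> hat t = 1" by (simp add: hat_def smooth_step_simps)
  assume "\<bar>t\<bar> \<ge> 2"
  then have "t + 2 \<le> 0 \<or> - t + 2 \<le> 0" by linarith
  then show "hat t = 0" by (auto simp: hat_def smooth_step_simps)
qed

text \<open>Points of the model space are sequences that vanish from index \<open>n\<close> on.
  Assigning zero to all other sequences lets the function vanish at every sequence outside a compact
  box, as \<open>smooth_functions\<close> demands zero everywhere outside the open set.\<close>

definition product_function :: "nat \<Rightarrow> (nat \<Rightarrow> real \<Rightarrow> real) \<Rightarrow> (nat \<Rightarrow> real) \<Rightarrow> real" where
  "product_function n G x = (if \<forall>i\<ge>n. x i = 0 then \<Prod>i<n. G i (x i) else 0)"

lemma continuous_map_product_function: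
  assumes G: "\<And>i. i < n \<Longrightarrow> continuous_on UNIV (G i)"
  shows "continuous_map (subtopology (Euclidean_space n) U) euclideanreal (product_function n G)"
proof -
  have "continuous_map (powertop_real UNIV) euclideanreal (\<lambda>x. G i (x i))" if "i < n" for i
    using continuous_map_compose[OF continuous_map_product_projection[of i UNIV "\<lambda>_. euclideanreal"], of euclideanreal "G i"]
      G[OF that] by (simp add: o_def)
  then have "continuous_map (powertop_real UNIV) euclideanreal (\<lambda>x. \<Prod>i<n. G i (x i))"
    by (intro continuous_map_prod) auto
  then have "continuous_map (subtopology (Euclidean_space n) U) euclideanreal (\<lambda>x. \<Prod>i<n. G i (x i))"
    unfolding Euclidean_space_def by (intro continuous_map_from_subtopology)
  then show ?thesis
    by (rule continuous_map_eq) (auto simp: product_function_def topspace_Euclidean_space)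
qed

text \<open>The partial derivative in direction i replaces the i-th factor by its derivative and
  leaves a product of the same kind, so induction on \<open>k\<close> applies.\<close>

lemma Ck_on_product_function:
  assumes "\<And>i. i < n \<Longrightarrow> real_Ck k (G i)" and U: "U \<subseteq> topspace (Euclidean_space n)"
  shows "Ck_on k n U (product_function n G)"
  using assms(1)
proof (induction k arbitrary: G)
  case 0
  then show ?case by (simp add: continuous_map_product_function)
next
  case (Suc k)
  have cont: "continuous_on UNIV (G i)" if "i < n" for i
    by (rule real_Ck_continuous[OF Suc.prems[OF that]])
  have "\<exists>g. Ck_on k n U g \<and>
      (\<forall>x\<in>U. ((\<lambda>t. product_function n G (x(i := t))) has_real_derivative g x) (at (x i)))" if i: "i < n" for i
  proof -
    obtain G' where G': "\<And>x. (G i has_real_derivative G' x) (at x)" "real_Ck k G'"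
      using Suc.prems[OF i] by auto
    have "Ck_on k n U (product_function n (G(i := G')))"
      using Suc.prems real_Ck_Suc_imp G'(2) by (intro Suc.IH) auto
    moreover have "((\<lambda>t. product_function n G (x(i := t))) has_real_derivative
        product_function n (G(i := G')) x) (at (x i))" if x: "x \<in> U" for x
    proof -
      have x0: "\<forall>i\<ge>n. x i = 0" using x U by (auto simp: topspace_Euclidean_space)
      let ?P = "\<Prod>j\<in>{..<n} - {i}. G j (x j)"
      have split: "(\<Prod>j<n. H j (y j)) = H i (y i) * (\<Prod>j\<in>{..<n} - {i}. H j (y j))" for H :: "nat \<Rightarrow> real \<Rightarrow> real" and y
        using i by (intro prod.remove) auto
      have "product_function n G (x(i := t)) = G i t * ?P" for t
      proof -
        have "(\<Prod>j\<in>{..<n} - {i}. G j ((x(i := t)) j)) = ?P" by (rule prod.cong) auto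
        then have "(\<Prod>j<n. G j ((x(i := t)) j)) = G i t * ?P"
          using split[of G "x(i := t)"] by simp
        moreover have "\<forall>j\<ge>n. (x(i := t)) j = 0" using x0 i by simp
        ultimately show ?thesis unfolding product_function_def by metis
      qed
      moreover have "product_function n (G(i := G')) x = G' (x i) * ?P"
      proof -
        have "(\<Prod>j\<in>{..<n} - {i}. (G(i := G')) j (x j)) = ?P" by (rule prod.cong) auto
        then have "(\<Prod>j<n. (G(i := G')) j (x j)) = G' (x i) * ?P"
          using split[of "G(i := G')" x] by simp
        then show ?thesis unfolding product_function_def using x0 by metis
      qed
      ultimately show ?thesis using DERIV_cmult_right[OF G'(1)[of "x i"], of ?P] by simp
    qed
    ultimately show ?thesis by blast
  qed
  then show ?case using cont by (simp add: continuous_map_product_function)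
qed

text \<open>A basic open set of the product topology restricts only finitely many coordinates. The
  closed box of radius 2 \<epsilon> leaves room for a bump function that is one on the box of radius
  \<epsilon>.\<close>

lemma openin_Euclidean_space_box:
  assumes V: "openin (Euclidean_space n) V" and c: "c \<in> V"
  shows "\<exists>\<epsilon>>0. \<forall>x\<in>topspace (Euclidean_space n). (\<forall>i<n. \<bar>x i - c i\<bar> \<le> 2 * \<epsilon>) \<longrightarrow> x \<in> V"
proof -
  obtain T where T: "openin (powertop_real UNIV) T" "V = T \<inter> {x. \<forall>i\<ge>n. x i = 0}"
    using V unfolding Euclidean_space_def openin_subtopology by auto
  obtain B where B: "finite {i. B i \<noteq> topspace euclideanreal}" "\<And>i. openin euclideanreal (B i)"
    "c \<in> PiE UNIV B" "PiE UNIV B \<subseteq> T"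
    using T c unfolding openin_product_topology_alt by fastforce
  let ?I = "{i. B i \<noteq> UNIV}"
  have "\<exists>d>0. \<forall>y. \<bar>y - c i\<bar> < d \<longrightarrow> y \<in> B i" for i
  proof -
    have "open (B i)" "c i \<in> B i" using B by auto
    then obtain d where "d > 0" "ball (c i) d \<subseteq> B i" by (auto elim: openE)
    then show ?thesis by (intro exI[of _ d]) (auto simp: dist_real_def abs_minus_commute subset_iff)
  qed
  then obtain \<delta> where \<delta>: "\<And>i. \<delta> i > 0" "\<And>i y. \<bar>y - c i\<bar> < \<delta> i \<Longrightarrow> y \<in> B i" by metis
  \<comment> \<open>Dividing by 3 makes 2 \<epsilon> strictly smaller than each
    \<open>\<delta> i\<close> with i in \<open>?I\<close>; the 1 covers the case that no coordinate
    is restricted.\<close>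
  define \<epsilon> where "\<epsilon> = Min (insert 1 (\<delta> ` ?I)) / 3"
  have fin: "finite (insert 1 (\<delta> ` ?I))" using B(1) by simp
  have \<epsilon>: "\<epsilon> > 0" unfolding \<epsilon>_def using fin \<delta>(1) by (subst zero_less_divide_iff) (auto simp: Min_gr_iff)
  have \<epsilon>\<delta>: "2 * \<epsilon> < \<delta> i" if "i \<in> ?I" for i
  proof -
    have "Min (insert 1 (\<delta> ` ?I)) \<le> \<delta> i" using fin that by (intro Min_le) auto
    then show ?thesis using \<epsilon> by (simp add: \<epsilon>_def)
  qed
  have "x \<in> V" if x: "x \<in> topspace (Euclidean_space n)" "\<forall>i<n. \<bar>x i - c i\<bar> \<le> 2 * \<epsilon>" for x
  proof -
    have x0: "\<forall>i\<ge>n. x i = 0" and c0: "\<forall>i\<ge>n. c i = 0" using x T c by (auto simp: topspace_Euclidean_space)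
    have "x i \<in> B i" for i
    proof (cases "i \<in> ?I")
      case True
      have "\<bar>x i - c i\<bar> \<le> 2 * \<epsilon>" using x(2) x0 c0 \<epsilon> by (cases "i < n") auto
      with \<epsilon>\<delta>[OF True] show ?thesis by (intro \<delta>(2)) simp
    qed auto
    then have "x \<in> T" using B(4) by (auto simp: PiE_UNIV_domain)
    then show ?thesis using T x0 by auto
  qed
  with \<epsilon> show ?thesis by blast
qed

text \<open>A product of compact intervals, degenerate from index \<open>n\<close> on, to which
  Tychonoff's theorem applies.\<close>

lemma compactin_Euclidean_box:
  "compactin (Euclidean_space n) {x. (\<forall>i<n. \<bar>x i - c i\<bar> \<le> \<epsilon>) \<and> (\<forall>i\<ge>n. x i = 0)}"
proof -
  have eq: "{x. (\<forall>i<n. \<bar>x i - c i\<bar> \<le> \<epsilon>) \<and> (\<forall>i\<ge>n. x i = 0)} =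
      PiE UNIV (\<lambda>i. if i < n then {c i - \<epsilon>..c i + \<epsilon>} else {0})"
  proof (rule Set.set_eqI)
    fix x
    have "(\<forall>i. x i \<in> (if i < n then {c i - \<epsilon>..c i + \<epsilon>} else {0})) \<longleftrightarrow>
        (\<forall>i<n. \<bar>x i - c i\<bar> \<le> \<epsilon>) \<and> (\<forall>i\<ge>n. x i = 0)"
    proof (intro iffI conjI allI impI)
      fix i assume *: "\<forall>i. x i \<in> (if i < n then {c i - \<epsilon>..c i + \<epsilon>} else {0})"
      from *[rule_format, of i] show "i < n \<Longrightarrow> \<bar>x i - c i\<bar> \<le> \<epsilon>" "i \<ge> n \<Longrightarrow> x i = 0"
        by (auto simp: abs_le_iff)
    next
      fix i assume *: "(\<forall>i<n. \<bar>x i - c i\<bar> \<le> \<epsilon>) \<and> (\<forall>i\<ge>n. x i = 0)"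
      show "x i \<in> (if i < n then {c i - \<epsilon>..c i + \<epsilon>} else {0})"
        using *[THEN conjunct1, rule_format, of i] *[THEN conjunct2, rule_format, of i]
        by (auto simp: abs_le_iff not_less)
    qed
    then show "x \<in> {x. (\<forall>i<n. \<bar>x i - c i\<bar> \<le> \<epsilon>) \<and> (\<forall>i\<ge>n. x i = 0)} \<longleftrightarrow>
        x \<in> PiE UNIV (\<lambda>i. if i < n then {c i - \<epsilon>..c i + \<epsilon>} else {0})"
      by (simp add: PiE_UNIV_domain Pi_iff)
  qed
  have "compactin (powertop_real UNIV) (PiE UNIV (\<lambda>i. if i < n then {c i - \<epsilon>..c i + \<epsilon>} else {0}))"
    unfolding compactin_PiE by auto
  then show ?thesis
    unfolding Euclidean_space_def compactin_subtopology eq[symmetric] by auto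
qed

lemma openin_Euclidean_cube:
  "openin (Euclidean_space n) {x \<in> topspace (Euclidean_space n). \<forall>i<n. \<bar>x i - c i\<bar> < \<epsilon>}"
proof -
  have cm: "continuous_map (Euclidean_space n) euclideanreal (\<lambda>x. \<bar>x i - c i\<bar>)" for i
    unfolding Euclidean_space_def
    by (intro continuous_map_real_abs continuous_map_from_subtopology continuous_map_diff
        continuous_map_product_projection) auto
  have "openin (Euclidean_space n) {x \<in> topspace (Euclidean_space n). \<bar>x i - c i\<bar> \<in> {..<\<epsilon>}}" for i
    by (rule openin_continuous_map_preimage[OF cm]) auto
  then have "openin (Euclidean_space n) (topspace (Euclidean_space n) \<inter>
      (\<Inter>i\<in>{..<n}. {x \<in> topspace (Euclidean_space n). \<bar>x i - c i\<bar> \<in> {..<\<epsilon>}}))"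
    \<comment> \<open>For \<open>n = 0\<close> the intersection over the empty index set is
      \<open>UNIV\<close>, a case outside \<open>openin_Inter\<close>.\<close>
    by (cases "n = 0") (auto intro!: openin_Int openin_Inter)
  also have "\<dots> = {x \<in> topspace (Euclidean_space n). \<forall>i<n. \<bar>x i - c i\<bar> < \<epsilon>}" by auto
  finally show ?thesis .
qed

lemma Ck_on_zero: "Ck_on k n U (\<lambda>_. 0)"
  by (induction k) (auto intro!: exI[of _ "\<lambda>_. 0"])

lemma model_sheaf_simps:
  "carrier (gr (sections (model_sheaf m) U) k) =
    {F. (\<forall>p\<in>multi_indices (variable_degrees m) k. F p \<in> smooth_functions (m 0) U) \<and>
            (\<forall>p. p \<notin> multi_indices (variable_degrees m) k \<longrightarrow> F p = (\<lambda>_. 0))}"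
  "\<zero>\<^bsub>gr (sections (model_sheaf m) U) k\<^esub> = (\<lambda>p x. 0)"
  "gone (sections (model_sheaf m) U) = (\<lambda>p x. if (\<forall>i. p i = 0) \<and> x \<in> U then 1 else 0)"
  "restr (model_sheaf m) U V k F = (\<lambda>p x. if x \<in> V then F p x else 0)"
  by (simp_all add: model_sheaf_def Let_def)

lemma direct_image_simps:
  "sections (direct_image U h C) W = sections C {y\<in>U. h y \<in> W}"
  "restr (direct_image U h C) W W' = restr C {y\<in>U. h y \<in> W} {y\<in>U. h y \<in> W'}"
  by (simp_all add: direct_image_def)

text \<open>A product of rescaled hats, supported in the box \<open>K\<close> of radius 2 \<epsilon>
  and equal to one on the open cube \<open>B\<close> of radius \<epsilon>, is regarded as a power
  series whose only nonzero coefficient belongs to the monomial 1.\<close>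

lemma model_bump:
  assumes V: "openin (Euclidean_space (m 0)) V" and V0: "openin (Euclidean_space (m 0)) V0" "V0 \<subseteq> V"
    and c: "c \<in> V0"
  obtains F K B where "F \<in> carrier (gr (sections (model_sheaf m) V) 0)"
    "compactin (Euclidean_space (m 0)) K" "K \<subseteq> V0"
    "openin (Euclidean_space (m 0)) B" "c \<in> B" "B \<subseteq> V0"
    "restr (model_sheaf m) V (V - K) 0 F = \<zero>\<^bsub>gr (sections (model_sheaf m) (V - K)) 0\<^esub>"
    "restr (model_sheaf m) V B 0 F = gone (sections (model_sheaf m) B)"
proof -
  define n where "n = m 0"
  have VE: "V \<subseteq> topspace (Euclidean_space n)" using openin_subset[OF V] by (simp add: n_def)
  obtain \<epsilon> where \<epsilon>: "\<epsilon> > 0" and box: "\<And>x. \<lbrakk>\<forall>i\<ge>n. x i = 0; \<forall>i<n. \<bar>x i - c i\<bar> \<le> 2 * \<epsilon>\<rbrakk> \<Longrightarrow> x \<in> V0"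
    using openin_Euclidean_space_box[OF V0(1) c] by (auto simp: topspace_Euclidean_space n_def)
  define G where "G i t = hat ((1 / \<epsilon>) * t + (- c i / \<epsilon>))" for i t
  have G_arg: "(1 / \<epsilon>) * t + (- c i / \<epsilon>) = (t - c i) / \<epsilon>" for t i by (simp add: diff_divide_distrib)
  have G1: "G i t = 1" if "\<bar>t - c i\<bar> \<le> \<epsilon>" for i t
    unfolding G_def G_arg using that \<epsilon> by (intro hat_simps) (simp add: abs_divide)
  have G0: "G i t = 0" if "\<bar>t - c i\<bar> \<ge> 2 * \<epsilon>" for i t
    unfolding G_def G_arg using that \<epsilon> by (intro hat_simps) (simp add: abs_divide le_divide_eq)
  define \<rho> where "\<rho> = product_function n G"
  define K where "K = {x. (\<forall>i<n. \<bar>x i - c i\<bar> \<le> 2 * \<epsilon>) \<and> (\<forall>i\<ge>n. x i = 0)}"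
  define B where "B = {x \<in> topspace (Euclidean_space n). \<forall>i<n. \<bar>x i - c i\<bar> < \<epsilon>}"
  have KV: "K \<subseteq> V0" using box by (auto simp: K_def)
  have c0: "\<forall>i\<ge>n. c i = 0" using c V0 VE by (auto simp: topspace_Euclidean_space)
  have \<rho>K: "\<rho> x = 0" if xK: "x \<notin> K" for x
  proof (cases "\<forall>i\<ge>n. x i = 0")
    case True
    then obtain i where "i < n" "\<bar>x i - c i\<bar> > 2 * \<epsilon>" using xK by (auto simp: K_def not_le)
    then have "(\<Prod>i<n. G i (x i)) = 0" using G0[where i = i and t = "x i"] by (intro prod_zero) auto
    then show ?thesis by (simp add: \<rho>_def product_function_def)
  qed (auto simp: \<rho>_def product_function_def)
  have \<rho>B: "\<rho> x = 1" if "x \<in> B" for x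
  proof -
    have "\<forall>i\<ge>n. x i = 0" using that by (simp add: B_def topspace_Euclidean_space)
    moreover have "(\<Prod>i<n. G i (x i)) = 1" using that by (intro prod.neutral) (auto simp: B_def less_imp_le G1)
    ultimately show ?thesis by (simp add: \<rho>_def product_function_def)
  qed
  have Ck: "Ck_on k n V \<rho>" for k
    unfolding \<rho>_def G_def using VE by (intro Ck_on_product_function real_Ck_affine real_Ck_hat)
  have \<rho>V: "\<rho> \<in> smooth_functions n V"
    using Ck \<rho>K KV V0(2) by (auto simp: smooth_functions_def)
  have zV: "(\<lambda>_. 0) \<in> smooth_functions n V" by (simp add: smooth_functions_def Ck_on_zero)
  define F where "F p = (if \<forall>i. p i = (0::nat) then \<rho> else (\<lambda>_. 0))" for p :: "nat \<Rightarrow> nat"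
  have m0: "p \<in> multi_indices (variable_degrees m) 0" if "\<forall>i. p i = 0" for p
    using that by (simp add: multi_indices_def)
  show ?thesis
  proof (rule that[of F K B])
    show "F \<in> carrier (gr (sections (model_sheaf m) V) 0)"
      using \<rho>V zV m0 by (auto simp: model_sheaf_simps F_def n_def)
    show "compactin (Euclidean_space (m 0)) K" unfolding K_def n_def by (rule compactin_Euclidean_box)
    show "K \<subseteq> V0" by (rule KV)
    show "c \<in> B" using c0 \<epsilon> by (auto simp: B_def topspace_Euclidean_space)
    show "B \<subseteq> V0"
    proof
      fix x assume "x \<in> B"
      then have x: "\<forall>i\<ge>n. x i = 0" "\<forall>i<n. \<bar>x i - c i\<bar> < \<epsilon>"
        by (auto simp: B_def topspace_Euclidean_space)
      have "\<bar>x i - c i\<bar> \<le> 2 * \<epsilon>" if "i < n" for i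
        using x(2)[rule_format, OF that] \<epsilon> by linarith
      with x(1) show "x \<in> V0" by (intro box) auto
    qed
    show "openin (Euclidean_space (m 0)) B" unfolding B_def n_def by (rule openin_Euclidean_cube)
    show "restr (model_sheaf m) V (V - K) 0 F = \<zero>\<^bsub>gr (sections (model_sheaf m) (V - K)) 0\<^esub>"
      using \<rho>K by (auto simp: model_sheaf_simps F_def fun_eq_iff)
    show "restr (model_sheaf m) V B 0 F = gone (sections (model_sheaf m) B)"
      using \<rho>B by (auto simp: model_sheaf_simps F_def fun_eq_iff)
  qed
qed

text \<open>A bump function of the model is transported through the chart and extended by zero. The
  extension exists because the compact set \<open>K'\<close> containing the support is closed in
  \<open>X\<close>, which is where the Hausdorff property is used.\<close>

lemma (in graded_manifold) local_bumps:
  assumes V': "openin X V'" and x: "x \<in> V'"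
  shows "\<exists>a B. x \<in> B \<and> bump a B V'"
proof -
  let ?E = "Euclidean_space (m 0)"
  have "x \<in> topspace X" using V' x openin_subset by auto
  from local_model[OF this] obtain U V h \<Phi> where U: "openin X U" "x \<in> U" and V: "openin ?E V"
    and h: "homeomorphic_map (subtopology X U) (subtopology ?E V) h"
    and iso: "algebra_presheaf_iso (subtopology ?E V) (model_sheaf m) (direct_image U h C) \<Phi>" by blast
  have topU: "topspace (subtopology X U) = U" and topV: "topspace (subtopology ?E V) = V"
    using openin_subset[OF U(1)] openin_subset[OF V] by auto
  obtain g where g: "homeomorphic_maps (subtopology X U) (subtopology ?E V) h g"
    using h unfolding homeomorphic_map_maps by blast
  have gh: "g (h y) = y" if "y \<in> U" for y using g that topU by (simp add: homeomorphic_maps_def)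
  have hg: "h (g z) = z" if "z \<in> V" for z using g that topV by (simp add: homeomorphic_maps_def)
  have hV: "h y \<in> V" if "y \<in> U" for y
    using homeomorphic_imp_surjective_map[OF h] topU topV that by auto
  have gU: "g z \<in> U" if "z \<in> V" for z
    using g that topU topV by (auto simp: homeomorphic_maps_def continuous_map_def Pi_iff)
  have pre: "openin X {y \<in> U. h y \<in> W}" if "openin ?E W" for W
  proof -
    have "continuous_map (subtopology X U) ?E h"
      using homeomorphic_imp_continuous_map[OF h] by (simp add: continuous_map_in_subtopology)
    from openin_continuous_map_preimage[OF this that] show ?thesis
      using U(1) unfolding topU by (simp add: openin_open_subtopology)
  qed
  \<comment> \<open>The support has to end up inside \<open>V'\<close>, so the model is shrunk to
    the part of the chart that corresponds to \<open>U \<inter> V'\<close>.\<close>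
  define V0 where "V0 = {z \<in> V. g z \<in> V'}"
  have V0: "openin ?E V0" "V0 \<subseteq> V"
  proof -
    have "continuous_map (subtopology ?E V) X g"
      using g by (auto simp: homeomorphic_maps_def continuous_map_in_subtopology)
    from openin_continuous_map_preimage[OF this V'] show "openin ?E V0"
      using V unfolding topV V0_def by (simp add: openin_open_subtopology)
  qed (auto simp: V0_def)
  have hx: "h x \<in> V0" using x U hV gh by (simp add: V0_def)
  obtain F K B where F: "F \<in> carrier (gr (sections (model_sheaf m) V) 0)"
    and K: "compactin ?E K" "K \<subseteq> V0" and B: "openin ?E B" "h x \<in> B" "B \<subseteq> V0"
    and FK: "restr (model_sheaf m) V (V - K) 0 F = \<zero>\<^bsub>gr (sections (model_sheaf m) (V - K)) 0\<^esub>"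
    and FB: "restr (model_sheaf m) V B 0 F = gone (sections (model_sheaf m) B)"
    by (rule model_bump[where m = m, OF V V0 hx])
  define K' where "K' = g ` K"
  define Q where "Q = topspace X - K'"
  define B' where "B' = {y \<in> U. h y \<in> B}"
  have K'V: "K' \<subseteq> U \<inter> V'" using K V0(2) gU by (auto simp: K'_def V0_def)
  have "compactin X K'"
  proof -
    have "compactin (subtopology ?E V) K" using K V0 by (simp add: compactin_subtopology)
    moreover have "continuous_map (subtopology ?E V) X g"
      using g by (auto simp: homeomorphic_maps_def continuous_map_in_subtopology)
    ultimately show ?thesis unfolding K'_def by (rule image_compactin)
  qed
  then have "closedin X K'" using hausdorff by (simp add: compactin_imp_closedin)
  then have Q: "openin X Q" by (simp add: Q_def openin_diff)
  have EK: "closedin ?E K"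
    using K(1) by (intro compactin_imp_closedin) (auto simp: Euclidean_space_def Hausdorff_space_subtopology Hausdorff_space_product_topology)
  have op: "openin (subtopology ?E V) V" "openin (subtopology ?E V) (V - K)" "openin (subtopology ?E V) B"
    using V EK B V0(2) by (auto simp: openin_open_subtopology)
  have BV: "B \<subseteq> V" using B V0 by auto
  have hom: "graded_algebra_hom (sections (model_sheaf m) W) (sections (direct_image U h C) W) (\<Phi> W)"
    if "openin (subtopology ?E V) W" for W
    using iso that by (simp add: algebra_presheaf_iso_def)
  have nat: "restr (direct_image U h C) V W 0 (\<Phi> V 0 F) = \<Phi> W 0 (restr (model_sheaf m) V W 0 F)"
    if "openin (subtopology ?E V) W" "W \<subseteq> V" for W
    using iso F op(1) that by (simp add: algebra_presheaf_iso_def)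
  have preV: "{y \<in> U. h y \<in> V} = U" using hV by auto
  have preK: "{y \<in> U. h y \<in> V - K} = U \<inter> Q"
  proof -
    have "h y \<in> K \<longleftrightarrow> y \<in> K'" if "y \<in> U" for y
    proof
      show "h y \<in> K \<Longrightarrow> y \<in> K'" using imageI[of "h y" K g] gh[OF that] by (simp add: K'_def)
      assume "y \<in> K'"
      then obtain z where "z \<in> K" "y = g z" by (auto simp: K'_def)
      then show "h y \<in> K" using hg[of z] K(2) V0(2) by auto
    qed
    then show ?thesis using hV openin_subset[OF U(1)] by (auto simp: Q_def)
  qed
  define a where "a = \<Phi> V 0 F"
  have a: "a \<in> carrier (gr (sections C U) 0)"
    using linear_map_closed[OF algebra_hom_linear[OF hom[OF op(1)]] F] by (simp add: a_def direct_image_simps preV)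
  have aQ: "restr C U (U \<inter> Q) 0 a = \<zero>\<^bsub>gr (sections C (U \<inter> Q)) 0\<^esub>"
  proof -
    have gv: "graded_vector_space (sections (model_sheaf m) (V - K))"
        "graded_vector_space (sections (direct_image U h C) (V - K))"
      using hom[OF op(2)] by (auto simp: graded_algebra_hom_def graded_algebra_def)
    have z: "\<Phi> (V - K) 0 \<zero>\<^bsub>gr (sections (model_sheaf m) (V - K)) 0\<^esub> = \<zero>\<^bsub>gr (sections (direct_image U h C) (V - K)) 0\<^esub>"
      by (rule linear_map_zero[OF graded_vector_space.vector_space[OF gv(1)]
            graded_vector_space.vector_space[OF gv(2)] algebra_hom_linear[OF hom[OF op(2)]]])
    show ?thesis
      using nat[OF op(2) Diff_subset] z unfolding FK direct_image_simps preV preK a_def by (rule trans)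
  qed
  have aB: "restr C U B' 0 a = gone (sections C B')"
    using nat[OF op(3) BV] FB hom[OF op(3)]
    by (simp add: a_def direct_image_simps preV B'_def graded_algebra_hom_def)
  have B': "openin X B'" "x \<in> B'" "B' \<subseteq> U" using pre[OF B(1)] B(2) U by (auto simp: B'_def)
  have B'V: "B' \<subseteq> V'"
  proof
    fix y assume "y \<in> B'"
    then have "y \<in> U" "h y \<in> V0" using B by (auto simp: B'_def)
    then show "y \<in> V'" using gh by (auto simp: V0_def)
  qed
  have UQ: "U \<union> Q = topspace X" using K'V openin_subset[OF U(1)] by (auto simp: Q_def)
  have oUQ: "openin X (U \<inter> Q)" using U Q by auto
  have eq: "restr C U (U \<inter> Q) 0 a = restr C Q (U \<inter> Q) 0 \<zero>\<^bsub>gr (sections C Q) 0\<^esub>"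
    using aQ restr_zero[OF Q oUQ Int_lower2] by simp
  obtain t where t: "t \<in> carrier (gr (sections C (topspace X)) 0)"
    "restr C (topspace X) U 0 t = a" "restr C (topspace X) Q 0 t = \<zero>\<^bsub>gr (sections C Q) 0\<^esub>"
    using glue2[OF U(1) Q a real_space_closed(2)[OF real_space_sections[OF Q]] eq] unfolding UQ by blast
  have "V' \<union> Q = topspace X" using K'V openin_subset[OF V'] by (auto simp: Q_def)
  then have "cutoff t V' Q" using t V' Q by (simp add: cutoff_def ring0_simps)
  moreover have "restr C (topspace X) B' 0 t = gone (sections C B')"
    using restr_trans[OF openin_topspace U(1) B'(1,3) openin_subset[OF U(1)] t(1)] t(2) aB by simp
  ultimately have "bump t B' V'" using B' B'V unfolding bump_def by blast
  then show ?thesis using B' by blast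
qed

section \<open>Coloured covers\<close>

text \<open>With a fixed finite set of colours, the disjoint unions of the sets of one colour turn a cover
  by small sets into a finite cover, over whose members the bundle is still free.\<close>

definition colourable :: "'m topology \<Rightarrow> 'c set \<Rightarrow> 'm set \<Rightarrow> bool" where
  "colourable X I K \<longleftrightarrow> (\<forall>\<U>. (\<forall>U\<in>\<U>. openin X U) \<longrightarrow> K \<subseteq> \<Union>\<U> \<longrightarrow>
     (\<exists>\<Q>. K \<subseteq> (\<Union>c\<in>I. \<Union>(\<Q> c)) \<and> (\<forall>c\<in>I. finite (\<Q> c) \<and> pairwise disjnt (\<Q> c) \<and>
        (\<forall>Q\<in>\<Q> c. compactin X Q \<and> (\<exists>U\<in>\<U>. Q \<subseteq> U)))))"

lemma colourableE:
  assumes "colourable X I K" "\<forall>U\<in>\<U>. openin X U" "K \<subseteq> \<Union>\<U>"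
  obtains \<Q> where "K \<subseteq> (\<Union>c\<in>I. \<Union>(\<Q> c))"
    "\<And>c. c \<in> I \<Longrightarrow> finite (\<Q> c) \<and> pairwise disjnt (\<Q> c) \<and>
        (\<forall>Q\<in>\<Q> c. compactin X Q \<and> (\<exists>U\<in>\<U>. Q \<subseteq> U))"
proof -
  have "\<exists>\<Q>. K \<subseteq> (\<Union>c\<in>I. \<Union>(\<Q> c)) \<and> (\<forall>c\<in>I. finite (\<Q> c) \<and> pairwise disjnt (\<Q> c) \<and>
        (\<forall>Q\<in>\<Q> c. compactin X Q \<and> (\<exists>U\<in>\<U>. Q \<subseteq> U)))"
    using assms(1)[unfolded colourable_def, rule_format, of \<U>] assms(2,3) by simp
  then show ?thesis using that by auto
qed

lemma colourable_empty: "colourable X I {}"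
  unfolding colourable_def by (intro allI impI exI[of _ "\<lambda>_. {}"]) auto

text \<open>The complement of \<open>K\<close> is added to the cover, and afterwards only the sets
  meeting \<open>K\<close> are kept; these cannot lie in the complement and so lie in members of the
  original cover.\<close>

lemma colourable_subset:
  assumes L: "colourable X I L" "L \<subseteq> topspace X" and K: "closedin X K" "K \<subseteq> L"
  shows "colourable X I K"
  unfolding colourable_def
proof (intro allI impI)
  fix \<U> assume \<U>: "\<forall>U\<in>\<U>. openin X U" "K \<subseteq> \<Union>\<U>"
  let ?\<V> = "insert (topspace X - K) \<U>"
  show "\<exists>\<Q>. K \<subseteq> (\<Union>c\<in>I. \<Union>(\<Q> c)) \<and> (\<forall>c\<in>I. finite (\<Q> c) \<and> pairwise disjnt (\<Q> c) \<and>
        (\<forall>Q\<in>\<Q> c. compactin X Q \<and> (\<exists>U\<in>\<U>. Q \<subseteq> U)))"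
  proof -
    have "\<forall>U\<in>?\<V>. openin X U" "L \<subseteq> \<Union>?\<V>" using \<U> K L(2) by auto
    from L(1) this obtain \<Q> where \<Q>: "L \<subseteq> (\<Union>c\<in>I. \<Union>(\<Q> c))" and
      \<Q>c: "\<And>c. c \<in> I \<Longrightarrow> finite (\<Q> c) \<and> pairwise disjnt (\<Q> c) \<and>
        (\<forall>Q\<in>\<Q> c. compactin X Q \<and> (\<exists>U\<in>?\<V>. Q \<subseteq> U))"
      by (rule colourableE) blast
    show ?thesis
    proof (intro exI[of _ "\<lambda>c. {Q \<in> \<Q> c. Q \<inter> K \<noteq> {}}"] conjI ballI)
      show "K \<subseteq> (\<Union>c\<in>I. \<Union>{Q \<in> \<Q> c. Q \<inter> K \<noteq> {}})" using \<Q> K(2) by blast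
      fix c assume c: "c \<in> I"
      show "finite {Q \<in> \<Q> c. Q \<inter> K \<noteq> {}}" using \<Q>c[OF c] by simp
      show "pairwise disjnt {Q \<in> \<Q> c. Q \<inter> K \<noteq> {}}" using \<Q>c[OF c] by (auto simp: pairwise_def)
      fix Q assume Q: "Q \<in> {Q \<in> \<Q> c. Q \<inter> K \<noteq> {}}"
      then show "compactin X Q" using \<Q>c[OF c] by auto
      show "\<exists>U\<in>\<U>. Q \<subseteq> U" using \<Q>c[OF c] Q by blast
    qed
  qed
qed

text \<open>The same colours suffice because the cover of \<open>L\<close> is chosen after the
  finite family for \<open>K\<close>: it can be made so fine that a set for \<open>L\<close> meets
  at most one set for \<open>K\<close> of each colour.\<close>

lemma colourable_Un:
  assumes X: "Hausdorff_space X" and K: "colourable X I K" and L: "colourable X I L" and "finite I"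
    and LX: "L \<subseteq> topspace X"
  shows "colourable X I (K \<union> L)"
  unfolding colourable_def
proof (intro allI impI)
  fix \<U> assume \<U>: "\<forall>U\<in>\<U>. openin X U" "K \<union> L \<subseteq> \<Union>\<U>"
  then have "K \<subseteq> \<Union>\<U>" by auto
  from K \<U>(1) this obtain \<Q> where \<Q>: "K \<subseteq> (\<Union>c\<in>I. \<Union>(\<Q> c))" and
    \<Q>c: "\<And>c. c \<in> I \<Longrightarrow> finite (\<Q> c) \<and> pairwise disjnt (\<Q> c) \<and>
        (\<forall>Q\<in>\<Q> c. compactin X Q \<and> (\<exists>U\<in>\<U>. Q \<subseteq> U))"
    by (rule colourableE) blast
  have "\<exists>\<mu>. \<forall>Q\<in>(\<Union>c\<in>I. \<Q> c). \<mu> Q \<in> \<U> \<and> Q \<subseteq> \<mu> Q"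
    using \<Q>c by (intro bchoice) blast
  then obtain \<mu> where \<mu>: "\<And>c Q. c \<in> I \<Longrightarrow> Q \<in> \<Q> c \<Longrightarrow> \<mu> Q \<in> \<U> \<and> Q \<subseteq> \<mu> Q" by blast
  have clQ: "closedin X Q" if "c \<in> I" "Q \<in> \<Q> c" for c Q
    using \<Q>c[OF that(1)] that(2) X by (simp add: compactin_imp_closedin)
  text \<open>Sets so small that one meeting some \<open>Q\<close> stays in \<open>\<mu> Q\<close> and misses the other sets
    of the same colour; these can be merged into \<open>Q\<close>.\<close>
  define small where "small W \<longleftrightarrow> (\<exists>U\<in>\<U>. W \<subseteq> U) \<and>
    (\<forall>c\<in>I. \<forall>Q\<in>\<Q> c. W \<inter> Q \<noteq> {} \<longrightarrow> W \<subseteq> \<mu> Q \<and> (\<forall>Q'\<in>\<Q> c. Q' \<noteq> Q \<longrightarrow> W \<inter> Q' = {}))" for W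
  have smallD: "W \<subseteq> \<mu> Q \<and> (\<forall>Q'\<in>\<Q> c. Q' \<noteq> Q \<longrightarrow> W \<inter> Q' = {})"
    if "small W" "c \<in> I" "Q \<in> \<Q> c" "W \<inter> Q \<noteq> {}" for W c Q
    using that unfolding small_def by blast
  have small_subset: "small T" if W: "small W" "T \<subseteq> W" for T W
    unfolding small_def
  proof (intro conjI ballI impI)
    show "\<exists>U\<in>\<U>. T \<subseteq> U" using W unfolding small_def by (meson subset_trans)
    fix c Q assume c: "c \<in> I" "Q \<in> \<Q> c" and TQ: "T \<inter> Q \<noteq> {}"
    then have "W \<inter> Q \<noteq> {}" using W(2) by blast
    note * = smallD[OF W(1) c this]
    then show "T \<subseteq> \<mu> Q" using W(2) by blast
    fix Q' assume "Q' \<in> \<Q> c" "Q' \<noteq> Q"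
    with * have "W \<inter> Q' = {}" by blast
    then show "T \<inter> Q' = {}" using W(2) by blast
  qed
  have cover: "L \<subseteq> \<Union>{W. openin X W \<and> small W}"
  proof
    fix y assume y: "y \<in> L"
    then obtain U where U: "U \<in> \<U>" "y \<in> U" using \<U>(2) by auto
    let ?\<A> = "\<Union>c\<in>I. \<Q> c"
    have fin: "finite ?\<A>" using \<Q>c \<open>finite I\<close> by auto
    \<comment> \<open>A neighbourhood of \<open>y\<close> that decides each of the finitely many
      sets \<open>Q\<close>: it stays inside \<open>\<mu> Q\<close> if \<open>y\<close> lies in
      \<open>Q\<close>, and off \<open>Q\<close> otherwise. It is open because compact sets are
      closed in a Hausdorff space.\<close>
    define W where "W = U \<inter> topspace X \<inter> (\<Inter>Q\<in>?\<A>. if y \<in> Q then \<mu> Q else topspace X - Q)"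
    have "openin X W"
    proof (cases "?\<A> = {}")
      case True
      show ?thesis unfolding W_def True using U \<U>(1) by (simp add: openin_Int)
    next
      case False
      have "openin X (\<Inter>Q\<in>?\<A>. if y \<in> Q then \<mu> Q else topspace X - Q)"
      proof (rule openin_Inter)
        show "(\<lambda>Q. if y \<in> Q then \<mu> Q else topspace X - Q) ` ?\<A> \<noteq> {}" unfolding image_is_empty by (rule False)
        fix S assume "S \<in> (\<lambda>Q. if y \<in> Q then \<mu> Q else topspace X - Q) ` ?\<A>"
        then obtain c Q where cQ: "c \<in> I" "Q \<in> \<Q> c" "S = (if y \<in> Q then \<mu> Q else topspace X - Q)" by auto
        then show "openin X S"
          using \<mu>[OF cQ(1,2)] \<U>(1) clQ[OF cQ(1,2)] by (cases "y \<in> Q") auto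
      qed (intro finite_imageI fin)
      then show ?thesis unfolding W_def using U \<U>(1) by (intro openin_Int) auto
    qed
    moreover have yW: "y \<in> W" using y U LX \<mu> by (auto simp: W_def)
    moreover have "small W"
      unfolding small_def
    proof (intro conjI ballI impI)
      show "\<exists>U\<in>\<U>. W \<subseteq> U" using U by (auto simp: W_def)
      fix c Q assume c: "c \<in> I" and Q: "Q \<in> \<Q> c" and WQ: "W \<inter> Q \<noteq> {}"
      have sub: "W \<subseteq> (if y \<in> Q' then \<mu> Q' else topspace X - Q')" if "Q' \<in> \<Q> c" for Q'
        using that c by (auto simp: W_def split: if_splits)
      have yQ: "y \<in> Q" using sub[OF Q] WQ by (auto split: if_splits)
      then show "W \<subseteq> \<mu> Q" using sub[OF Q] by simp
      fix Q' assume Q': "Q' \<in> \<Q> c" "Q' \<noteq> Q"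
      then have "disjnt Q Q'" using \<Q>c[OF c] Q by (auto simp: pairwise_def)
      then have "y \<notin> Q'" using yQ by (auto simp: disjnt_def)
      then show "W \<inter> Q' = {}" using sub[OF Q'(1)] by auto
    qed
    ultimately show "y \<in> \<Union>{W. openin X W \<and> small W}" by blast
  qed
  have "\<forall>U\<in>{W. openin X W \<and> small W}. openin X U" by simp
  from L this cover obtain \<T> where \<T>: "L \<subseteq> (\<Union>c\<in>I. \<Union>(\<T> c))" and
    \<T>c0: "\<And>c. c \<in> I \<Longrightarrow> finite (\<T> c) \<and> pairwise disjnt (\<T> c) \<and>
        (\<forall>T\<in>\<T> c. compactin X T \<and> (\<exists>W\<in>{W. openin X W \<and> small W}. T \<subseteq> W))"
    by (rule colourableE) blast
  have \<T>s: "small T" if "c \<in> I" "T \<in> \<T> c" for c T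
    using \<T>c0[OF that(1)] that(2) small_subset by blast
  define merge where "merge c Q = Q \<union> \<Union>{T \<in> \<T> c. T \<inter> Q \<noteq> {}}" for c Q
  define \<R> where "\<R> c = merge c ` \<Q> c \<union> {T \<in> \<T> c. \<forall>Q\<in>\<Q> c. T \<inter> Q = {}}" for c
  show "\<exists>\<Q>. K \<union> L \<subseteq> (\<Union>c\<in>I. \<Union>(\<Q> c)) \<and> (\<forall>c\<in>I. finite (\<Q> c) \<and> pairwise disjnt (\<Q> c) \<and>
        (\<forall>Q\<in>\<Q> c. compactin X Q \<and> (\<exists>U\<in>\<U>. Q \<subseteq> U)))"
  proof (intro exI[of _ \<R>] conjI ballI)
    show "K \<union> L \<subseteq> (\<Union>c\<in>I. \<Union>(\<R> c))"
    proof
      fix y assume "y \<in> K \<union> L"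
      then consider c Q where "c \<in> I" "Q \<in> \<Q> c" "y \<in> Q" | c T where "c \<in> I" "T \<in> \<T> c" "y \<in> T"
        using \<Q> \<T> by blast
      then show "y \<in> (\<Union>c\<in>I. \<Union>(\<R> c))"
      proof cases
        case 1
        then have "y \<in> merge c Q" "merge c Q \<in> \<R> c" by (auto simp: merge_def \<R>_def)
        then show ?thesis using 1 by blast
      next
        case 2
        show ?thesis
        proof (cases "\<forall>Q\<in>\<Q> c. T \<inter> Q = {}")
          case True
          then have "T \<in> \<R> c" using 2 by (auto simp: \<R>_def)
          then show ?thesis using 2 by blast
        next
          case False
          then obtain Q where "Q \<in> \<Q> c" "T \<inter> Q \<noteq> {}" by auto
          then have "y \<in> merge c Q" "merge c Q \<in> \<R> c" using 2 by (auto simp: merge_def \<R>_def)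
          then show ?thesis using 2 by blast
        qed
      qed
    qed
    fix c assume c: "c \<in> I"
    show "finite (\<R> c)" using \<Q>c[OF c] \<T>c0[OF c] by (auto simp: \<R>_def)
    have TT: "T = T'" if "T \<in> \<T> c" "T' \<in> \<T> c" "x \<in> T" "x \<in> T'" for T T' x
      using \<T>c0[OF c] that by (metis disjnt_iff pairwiseD)
    have QQ: "Q = Q'" if "Q \<in> \<Q> c" "Q' \<in> \<Q> c" "x \<in> Q" "x \<in> Q'" for Q Q' x
      using \<Q>c[OF c] that by (metis disjnt_iff pairwiseD)
    have TQ: "Q = Q'" if "T \<in> \<T> c" "Q \<in> \<Q> c" "Q' \<in> \<Q> c" "T \<inter> Q \<noteq> {}" "T \<inter> Q' \<noteq> {}" for T Q Q'
      using smallD[OF \<T>s[OF c that(1)] c that(2,4)] that(3,5) by blast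
    \<comment> \<open>On either side a common point lies in the set itself or in a set attached to
      it; in each of the four cases disjointness or smallness forces \<open>Q = Q'\<close>.\<close>
    have mm: "Q = Q'" if Q: "Q \<in> \<Q> c" "Q' \<in> \<Q> c" and x: "x \<in> merge c Q" "x \<in> merge c Q'" for Q Q' x
    proof -
      consider "x \<in> Q" "x \<in> Q'" | T where "T \<in> \<T> c" "T \<inter> Q \<noteq> {}" "x \<in> T" "x \<in> Q'"
        | T where "T \<in> \<T> c" "T \<inter> Q' \<noteq> {}" "x \<in> T" "x \<in> Q"
        | T T' where "T \<in> \<T> c" "T \<inter> Q \<noteq> {}" "x \<in> T" "T' \<in> \<T> c" "T' \<inter> Q' \<noteq> {}" "x \<in> T'"
        using x unfolding merge_def by blast
      then show ?thesis
      proof cases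
        case 1 then show ?thesis using QQ Q by blast
      next
        case 2 then show ?thesis using TQ[OF _ Q] by blast
      next
        case 3 then show ?thesis using TQ[OF _ Q] by blast
      next
        case 4
        then have "T = T'" using TT by blast
        then show ?thesis using TQ[OF _ Q] 4 by blast
      qed
    qed
    have mT: False if mt: "Q \<in> \<Q> c" "T \<in> \<T> c" "\<forall>Q\<in>\<Q> c. T \<inter> Q = {}" "x \<in> merge c Q" "x \<in> T" for Q T x
    proof -
      have "x \<notin> Q" using mt by blast
      then obtain T' where T': "T' \<in> \<T> c" "T' \<inter> Q \<noteq> {}" "x \<in> T'" using mt(4) unfolding merge_def by blast
      then have "T' = T" using TT[OF T'(1) mt(2) T'(3) mt(5)] by simp
      then show False using mt(1,3) T'(2) by blast
    qed
    show "pairwise disjnt (\<R> c)"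
    proof (rule pairwiseI, unfold disjnt_iff, intro allI notI)
      fix R R' x assume R: "R \<in> \<R> c" "R' \<in> \<R> c" "R \<noteq> R'" and x: "x \<in> R \<and> x \<in> R'"
      from R(1,2) show False
        unfolding \<R>_def
      proof (elim UnE imageE CollectE conjE)
        fix Q Q' assume "R = merge c Q" "Q \<in> \<Q> c" "R' = merge c Q'" "Q' \<in> \<Q> c"
        then show False using mm[of Q Q' x] x R(3) by auto
      next
        fix Q assume "R = merge c Q" "Q \<in> \<Q> c" "R' \<in> \<T> c" "\<forall>Q\<in>\<Q> c. R' \<inter> Q = {}"
        then show False using mT[of Q R' x] x by auto
      next
        fix Q assume "R' = merge c Q" "Q \<in> \<Q> c" "R \<in> \<T> c" "\<forall>Q\<in>\<Q> c. R \<inter> Q = {}"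
        then show False using mT[of Q R x] x by auto
      next
        assume "R \<in> \<T> c" "R' \<in> \<T> c"
        then show False using TT[of R R' x] x R(3) by auto
      qed
    qed
    fix R assume "R \<in> \<R> c"
    then consider Q where "Q \<in> \<Q> c" "R = merge c Q" | "R \<in> \<T> c" unfolding \<R>_def by blast
    then have "compactin X R \<and> (\<exists>U\<in>\<U>. R \<subseteq> U)"
    proof cases
      case 1
      have "compactin X (\<Union>{T \<in> \<T> c. T \<inter> Q \<noteq> {}})"
        using \<T>c0[OF c] by (intro compactin_Union) auto
      moreover have "compactin X Q" using \<Q>c[OF c] 1 by auto
      ultimately have "compactin X R" unfolding 1 merge_def by (intro compactin_Un)
      moreover have "T \<subseteq> \<mu> Q" if "T \<in> \<T> c" "T \<inter> Q \<noteq> {}" for T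
        using smallD[OF \<T>s[OF c that(1)] c 1(1) that(2)] by blast
      then have "R \<subseteq> \<mu> Q" unfolding 1 merge_def using \<mu>[OF c 1(1)] by blast
      ultimately show ?thesis using \<mu>[OF c 1(1)] by blast
    next
      case 2
      have "\<exists>U\<in>\<U>. R \<subseteq> U" using \<T>s[OF c 2] unfolding small_def by (rule conjunct1)
      moreover have "compactin X R" using \<T>c0[OF c] 2 by blast
      ultimately show ?thesis by blast
    qed
    then show "compactin X R" "\<exists>U\<in>\<U>. R \<subseteq> U" by auto
  qed
qed

text \<open>In the chart, space is cut into closed cubes of side \<delta> with integer index
  vectors. Distinct cubes whose indices have equal parities differ by at least 2 in some index, so
  even the closed cubes are disjoint; closedness in turn makes their traces on \<open>K\<close>
  compact.\<close>

lemma colourable_chart: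
  assumes U: "openin X U" and K: "compactin X K" "K \<subseteq> U" and X: "Hausdorff_space X"
    and V: "openin (Euclidean_space n) V"
    and h: "homeomorphic_map (subtopology X U) (subtopology (Euclidean_space n) V) h"
  shows "colourable X ({..<n} \<rightarrow>\<^sub>E (UNIV :: bool set)) K"
  unfolding colourable_def
proof (intro allI impI)
  fix \<W> assume \<W>: "\<forall>W\<in>\<W>. openin X W" "K \<subseteq> \<Union>\<W>"
  let ?E = "Euclidean_space n"
  have topU: "topspace (subtopology X U) = U" and topV: "topspace (subtopology ?E V) = V"
    using openin_subset[OF U] openin_subset[OF V] by auto
  have inj: "inj_on h U" using homeomorphic_imp_injective_map[OF h] topU by simp
  have hV: "h ` U = V" using homeomorphic_imp_surjective_map[OF h] topU topV by simp
  have hE: "h y \<in> topspace ?E" if "y \<in> U" for y using hV that openin_subset[OF V] by auto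
  have coord: "continuous_map (subtopology X U) euclideanreal (\<lambda>y. h y i)" for i
  proof -
    have "continuous_map (subtopology X U) ?E h"
      using homeomorphic_imp_continuous_map[OF h] by (simp add: continuous_map_in_subtopology)
    moreover have "continuous_map ?E euclideanreal (\<lambda>x. x i)"
      unfolding Euclidean_space_def
      by (intro continuous_map_from_subtopology continuous_map_product_projection) auto
    ultimately show ?thesis using continuous_map_compose by (force simp: o_def)
  qed
  have local: "\<exists>\<epsilon>>0. \<exists>W\<in>\<W>. \<forall>w\<in>U. (\<forall>i<n. \<bar>h w i - h y i\<bar> \<le> 2 * \<epsilon>) \<longrightarrow> w \<in> W" if y: "y \<in> K" for y
  proof -
    obtain W where W: "W \<in> \<W>" "y \<in> W" using y \<W> by auto
    have "openin (subtopology X U) (W \<inter> U)" using W \<W> U by (auto simp: openin_open_subtopology)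
    then have "openin (subtopology ?E V) (h ` (W \<inter> U))"
      using homeomorphic_imp_open_map[OF h] by (simp add: open_map_def)
    then have oh: "openin ?E (h ` (W \<inter> U))" using V by (simp add: openin_open_subtopology)
    have yh: "h y \<in> h ` (W \<inter> U)" using W y K by auto
    obtain \<epsilon> where \<epsilon>: "\<epsilon> > 0"
      "\<And>x. x \<in> topspace ?E \<Longrightarrow> (\<forall>i<n. \<bar>x i - h y i\<bar> \<le> 2 * \<epsilon>) \<Longrightarrow> x \<in> h ` (W \<inter> U)"
      using openin_Euclidean_space_box[OF oh yh] by auto
    have "w \<in> W" if wU: "w \<in> U" "\<forall>i<n. \<bar>h w i - h y i\<bar> \<le> 2 * \<epsilon>" for w
    proof -
      obtain w' where "w' \<in> W" "w' \<in> U" "h w = h w'" using \<epsilon>(2)[OF hE[OF wU(1)] wU(2)] by blast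
      then show ?thesis using inj_onD[OF inj, of w w'] wU(1) by simp
    qed
    then show ?thesis using \<epsilon>(1) W by blast
  qed
  then obtain \<epsilon> where \<epsilon>: "\<And>y. y \<in> K \<Longrightarrow> \<epsilon> y > 0"
    and \<epsilon>W: "\<And>y. y \<in> K \<Longrightarrow> \<exists>W\<in>\<W>. \<forall>w\<in>U. (\<forall>i<n. \<bar>h w i - h y i\<bar> \<le> 2 * \<epsilon> y) \<longrightarrow> w \<in> W" by metis
  define G where "G y = {w \<in> U. \<forall>i<n. \<bar>h w i - h y i\<bar> < \<epsilon> y}" for y
  have oG: "openin X (G y)" for y
  proof -
    have "continuous_map (subtopology X U) euclideanreal (\<lambda>w. \<bar>h w i - h y i\<bar>)" for i
      by (intro continuous_map_real_abs continuous_map_diff coord) auto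
    from openin_continuous_map_preimage[OF this, of "{..<\<epsilon> y}"]
    have "openin X {w \<in> U. \<bar>h w i - h y i\<bar> \<in> {..<\<epsilon> y}}" for i
      using U unfolding topU by (simp add: openin_open_subtopology)
    then have "openin X (U \<inter> (\<Inter>i\<in>{..<n}. {w \<in> U. \<bar>h w i - h y i\<bar> \<in> {..<\<epsilon> y}}))"
      using U by (cases "n = 0") (auto intro!: openin_Int openin_Inter)
    also have "\<dots> = G y" by (auto simp: G_def)
    finally show ?thesis .
  qed
  have "K \<subseteq> \<Union>(G ` K)" using \<epsilon> K by (auto simp: G_def)
  with compactinD[OF K(1), of "G ` K"] oG obtain \<F> where \<F>: "finite \<F>" "\<F> \<subseteq> G ` K" "K \<subseteq> \<Union>\<F>" by blast
  obtain Y where Y: "finite Y" "Y \<subseteq> K" "\<F> = G ` Y" using finite_subset_image[OF \<F>(1,2)] by blast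
  \<comment> \<open>A Lebesgue number in the maximum norm: points within \<delta> of some
    \<open>y\<close> that is itself within \<open>\<epsilon> y0\<close> of \<open>y0\<close> stay
    within 2 \<open>\<epsilon> y0\<close> of \<open>y0\<close>, hence in one member of the cover.
    The 1 covers the case that \<open>Y\<close> is empty.\<close>
  define \<delta> where "\<delta> = Min (insert 1 (\<epsilon> ` Y))"
  have \<delta>: "\<delta> > 0" unfolding \<delta>_def using Y \<epsilon> by (subst Min_gr_iff) auto
  have \<delta>\<epsilon>: "\<delta> \<le> \<epsilon> y" if "y \<in> Y" for y unfolding \<delta>_def using Y that by (intro Min_le) auto
  have fine: "\<exists>W\<in>\<W>. T \<subseteq> W"
    if T: "T \<subseteq> U" "y \<in> T" "y \<in> K" "\<And>w i. w \<in> T \<Longrightarrow> i < n \<Longrightarrow> \<bar>h w i - h y i\<bar> \<le> \<delta>" for T y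
  proof -
    obtain y0 where y0: "y0 \<in> Y" "y \<in> G y0" using \<F>(3) Y T(3) by auto
    obtain W where W: "W \<in> \<W>" "\<And>w. \<lbrakk>w \<in> U; \<forall>i<n. \<bar>h w i - h y0 i\<bar> \<le> 2 * \<epsilon> y0\<rbrakk> \<Longrightarrow> w \<in> W"
      using \<epsilon>W[OF subsetD[OF Y(2) y0(1)]] by blast
    have "w \<in> W" if w: "w \<in> T" for w
    proof (rule W(2))
      show "\<forall>i<n. \<bar>h w i - h y0 i\<bar> \<le> 2 * \<epsilon> y0"
      proof (intro allI impI)
        fix i assume i: "i < n"
        have "\<bar>h w i - h y i\<bar> \<le> \<delta>" "\<bar>h y i - h y0 i\<bar> < \<epsilon> y0" using T(4)[OF w i] y0 i by (auto simp: G_def)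
        with \<delta>\<epsilon>[OF y0(1)] show "\<bar>h w i - h y0 i\<bar> \<le> 2 * \<epsilon> y0" by linarith
      qed
    qed (use T w in auto)
    then show ?thesis using W by blast
  qed
  define cell where "cell z = {w \<in> K. \<forall>i<n. of_int (z i) * \<delta> \<le> h w i \<and> h w i \<le> (of_int (z i) + 1) * \<delta>}" for z :: "nat \<Rightarrow> int"
  define fl where "fl y = (\<lambda>i\<in>{..<n}. \<lfloor>h y i / \<delta>\<rfloor>)" for y
  define colour where "colour z = (\<lambda>i\<in>{..<n}. even (z i))" for z :: "nat \<Rightarrow> int"
  have cell_fl: "y \<in> cell (fl y)" if "y \<in> K" for y
  proof -
    have "of_int \<lfloor>h y i / \<delta>\<rfloor> * \<delta> \<le> h y i \<and> h y i \<le> (of_int \<lfloor>h y i / \<delta>\<rfloor> + 1) * \<delta>" for i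
    proof -
      have q: "of_int \<lfloor>h y i / \<delta>\<rfloor> \<le> h y i / \<delta>" "h y i / \<delta> \<le> of_int \<lfloor>h y i / \<delta>\<rfloor> + 1" by linarith+
      have "h y i / \<delta> * \<delta> = h y i" using \<delta> by simp
      then show ?thesis
        using mult_right_mono[OF q(1), of \<delta>] mult_right_mono[OF q(2), of \<delta>] \<delta> by simp
    qed
    then show ?thesis using that by (simp add: cell_def fl_def)
  qed
  \<comment> \<open>The coordinates are bounded on the compact set \<open>K\<close>, so only
    finitely many index vectors occur.\<close>
  have finZ: "finite (fl ` K)"
  proof -
    have "\<exists>M. \<forall>y\<in>K. \<bar>h y i\<bar> \<le> M" for i
    proof -
      have "compactin (subtopology X U) K" using K by (simp add: compactin_subtopology)
      from image_compactin[OF this coord[of i]] have "compact ((\<lambda>y. h y i) ` K)" by simp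
      then have "bounded ((\<lambda>y. h y i) ` K)" by (rule compact_imp_bounded)
      then show ?thesis by (auto simp: bounded_iff)
    qed
    then obtain M where M: "\<And>i y. y \<in> K \<Longrightarrow> \<bar>h y i\<bar> \<le> M i" by metis
    have "fl y \<in> PiE {..<n} (\<lambda>i. {\<lfloor>- M i / \<delta>\<rfloor>..\<lfloor>M i / \<delta>\<rfloor>})" if "y \<in> K" for y
    proof -
      have "\<lfloor>- M i / \<delta>\<rfloor> \<le> \<lfloor>h y i / \<delta>\<rfloor> \<and> \<lfloor>h y i / \<delta>\<rfloor> \<le> \<lfloor>M i / \<delta>\<rfloor>" for i
        using M[OF that, of i] \<delta> by (intro conjI floor_mono divide_right_mono) auto
      then show ?thesis by (auto simp: fl_def)
    qed
    then have "fl ` K \<subseteq> PiE {..<n} (\<lambda>i. {\<lfloor>- M i / \<delta>\<rfloor>..\<lfloor>M i / \<delta>\<rfloor>})" by auto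
    then show ?thesis by (rule finite_subset) (auto intro!: finite_PiE)
  qed
  have cell_compact: "compactin X (cell z)" for z
  proof -
    have cl: "closedin (subtopology X U) {w \<in> U. h w i \<in> {of_int (z i) * \<delta>..(of_int (z i) + 1) * \<delta>}}" for i
    proof -
      have "closedin euclideanreal {of_int (z i) * \<delta>..(of_int (z i) + 1) * \<delta>}" by simp
      from closedin_continuous_map_preimage[OF coord[of i] this] show ?thesis unfolding topU .
    qed
    have "closedin (subtopology X U) (U \<inter> (\<Inter>i\<in>{..<n}. {w \<in> U. h w i \<in> {of_int (z i) * \<delta>..(of_int (z i) + 1) * \<delta>}}))"
      using cl closedin_topspace[of "subtopology X U"] unfolding topU
      by (cases "n = 0") (auto intro!: closedin_Int closedin_Inter)
    moreover have "compactin (subtopology X U) K" using K by (simp add: compactin_subtopology)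
    ultimately have "compactin (subtopology X U) (K \<inter>
        (U \<inter> (\<Inter>i\<in>{..<n}. {w \<in> U. h w i \<in> {of_int (z i) * \<delta>..(of_int (z i) + 1) * \<delta>}})))"
      by (intro compact_Int_closedin)
    also have "K \<inter> (U \<inter> (\<Inter>i\<in>{..<n}. {w \<in> U. h w i \<in> {of_int (z i) * \<delta>..(of_int (z i) + 1) * \<delta>}})) = cell z"
      using K(2) by (auto simp: cell_def)
    finally show ?thesis by (simp add: compactin_subtopology)
  qed
  have cell_disj: "cell z \<inter> cell z' = {}"
    if z: "z \<in> fl ` K" "z' \<in> fl ` K" "colour z = colour z'" "z \<noteq> z'" for z z'
  proof -
    \<comment> \<open>Outside the index range both vectors are \<open>undefined\<close>, so distinct
      vectors differ at some i below \<open>n\<close>.\<close>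
    have "z i = z' i" if "\<not> i < n" for i using z(1,2) that by (auto simp: fl_def)
    then have "\<exists>i<n. z i \<noteq> z' i" using z(4) by (meson ext)
    then obtain i where i: "i < n" "z i \<noteq> z' i" by blast
    have "even (z i) = even (z' i)" using fun_cong[OF z(3), of i] i by (simp add: colour_def)
    then have "z i + 2 \<le> z' i \<or> z' i + 2 \<le> z i" using i(2) by presburger
    then have "(of_int (z i) :: real) + 2 \<le> of_int (z' i) \<or> (of_int (z' i) :: real) + 2 \<le> of_int (z i)" by linarith
    then have "(of_int (z i) + 1) * \<delta> < of_int (z' i) * \<delta> \<or> (of_int (z' i) + 1) * \<delta> < of_int (z i) * \<delta>"
      using \<delta> by (auto intro!: mult_strict_right_mono)
    then show ?thesis using i(1) by (force simp: cell_def)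
  qed
  let ?\<Q> = "\<lambda>c. cell ` {z \<in> fl ` K. colour z = c}"
  show "\<exists>\<Q>. K \<subseteq> (\<Union>c\<in>{..<n} \<rightarrow>\<^sub>E (UNIV :: bool set). \<Union>(\<Q> c)) \<and>
      (\<forall>c\<in>{..<n} \<rightarrow>\<^sub>E (UNIV :: bool set). finite (\<Q> c) \<and> pairwise disjnt (\<Q> c) \<and>
        (\<forall>Q\<in>\<Q> c. compactin X Q \<and> (\<exists>U\<in>\<W>. Q \<subseteq> U)))"
  proof (intro exI[of _ ?\<Q>] conjI ballI)
    show "K \<subseteq> (\<Union>c\<in>{..<n} \<rightarrow>\<^sub>E (UNIV :: bool set). \<Union>(?\<Q> c))"
    proof
      fix y assume y: "y \<in> K"
      have "colour (fl y) \<in> {..<n} \<rightarrow>\<^sub>E (UNIV :: bool set)" by (auto simp: colour_def)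
      then show "y \<in> (\<Union>c\<in>{..<n} \<rightarrow>\<^sub>E (UNIV :: bool set). \<Union>(?\<Q> c))"
        using cell_fl[OF y] y by blast
    qed
    fix c :: "nat \<Rightarrow> bool"
    show "finite (?\<Q> c)" using finZ by auto
    show "pairwise disjnt (?\<Q> c)"
    proof (rule pairwiseI)
      fix Q Q' assume Q: "Q \<in> ?\<Q> c" "Q' \<in> ?\<Q> c" "Q \<noteq> Q'"
      obtain z where z: "z \<in> fl ` K" "colour z = c" "Q = cell z" using Q(1) by blast
      obtain z' where z': "z' \<in> fl ` K" "colour z' = c" "Q' = cell z'" using Q(2) by blast
      have "z \<noteq> z'" using Q(3) z(3) z'(3) by blast
      then have "cell z \<inter> cell z' = {}" using z z' by (intro cell_disj) simp_all
      then show "disjnt Q Q'" unfolding z(3) z'(3) disjnt_def .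
    qed
    fix Q assume "Q \<in> ?\<Q> c"
    then obtain y where y: "y \<in> K" "Q = cell (fl y)" by auto
    then show "compactin X Q" using cell_compact by simp
    show "\<exists>W\<in>\<W>. Q \<subseteq> W"
    proof (rule fine[of Q y])
      show "Q \<subseteq> U" using y K by (auto simp: cell_def)
      show "y \<in> Q" using cell_fl y by simp
      show "y \<in> K" by (rule y(1))
      fix w i assume "w \<in> Q" "i < n"
      then have "of_int (fl y i) * \<delta> \<le> h w i \<and> h w i \<le> of_int (fl y i) * \<delta> + \<delta>"
        "of_int (fl y i) * \<delta> \<le> h y i \<and> h y i \<le> of_int (fl y i) * \<delta> + \<delta>"
        using cell_fl[OF y(1)] y(2) by (auto simp: cell_def algebra_simps)
      then show "\<bar>h w i - h y i\<bar> \<le> \<delta>" by linarith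
    qed
  qed
qed

section \<open>Local compactness, separation of compact sets, exhaustion\<close>

lemma Euclidean_compact_neighbourhood:
  assumes V: "openin (Euclidean_space n) V" and c: "c \<in> V"
  obtains B K where "openin (Euclidean_space n) B" "c \<in> B" "B \<subseteq> K" "K \<subseteq> V" "compactin (Euclidean_space n) K"
proof -
  obtain \<epsilon> where \<epsilon>: "\<epsilon> > 0" "\<And>x. x \<in> topspace (Euclidean_space n) \<Longrightarrow> (\<forall>i<n. \<bar>x i - c i\<bar> \<le> 2 * \<epsilon>) \<Longrightarrow> x \<in> V"
    using openin_Euclidean_space_box[OF V c] by auto
  define B where "B = {x \<in> topspace (Euclidean_space n). \<forall>i<n. \<bar>x i - c i\<bar> < \<epsilon>}"
  define K where "K = {x. (\<forall>i<n. \<bar>x i - c i\<bar> \<le> \<epsilon>) \<and> (\<forall>i\<ge>n. x i = 0)}"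
  have "openin (Euclidean_space n) B" unfolding B_def by (rule openin_Euclidean_cube)
  moreover have "c \<in> B" using c \<epsilon>(1) openin_subset[OF V] by (auto simp: B_def)
  moreover have "B \<subseteq> K" by (auto simp: B_def K_def topspace_Euclidean_space less_imp_le)
  moreover have "K \<subseteq> V"
  proof
    fix x assume x: "x \<in> K"
    have "\<bar>x i - c i\<bar> \<le> 2 * \<epsilon>" if "i < n" for i
    proof -
      have "\<bar>x i - c i\<bar> \<le> \<epsilon>" using x that by (simp add: K_def)
      then show ?thesis using \<epsilon>(1) by linarith
    qed
    with x show "x \<in> V" by (intro \<epsilon>(2)) (auto simp: K_def topspace_Euclidean_space)
  qed
  moreover have "compactin (Euclidean_space n) K" unfolding K_def by (rule compactin_Euclidean_box)
  ultimately show ?thesis by (rule that)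
qed

lemma compact_separation_family:
  assumes X: "Hausdorff_space X" and fin: "finite \<Q>" and disj: "pairwise disjnt \<Q>"
    and \<mu>: "\<And>Q. Q \<in> \<Q> \<Longrightarrow> compactin X Q \<and> openin X (\<mu> Q) \<and> Q \<subseteq> \<mu> Q"
  shows "\<exists>\<nu>. (\<forall>Q\<in>\<Q>. openin X (\<nu> Q) \<and> Q \<subseteq> \<nu> Q \<and> \<nu> Q \<subseteq> \<mu> Q) \<and>
    (\<forall>Q\<in>\<Q>. \<forall>Q'\<in>\<Q>. Q \<noteq> Q' \<longrightarrow> \<nu> Q \<inter> \<nu> Q' = {})"
proof -
  have "\<exists>A B. Q \<in> \<Q> \<longrightarrow> Q' \<in> \<Q> \<longrightarrow> Q \<noteq> Q' \<longrightarrow>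
      openin X A \<and> openin X B \<and> Q \<subseteq> A \<and> Q' \<subseteq> B \<and> disjnt A B" for Q Q'
  proof (cases "Q \<in> \<Q> \<and> Q' \<in> \<Q> \<and> Q \<noteq> Q'")
    case True
    then have "disjnt Q Q'" using disj by (auto simp: pairwise_def)
    with True show ?thesis
      using Hausdorff_space_compact_separation[OF X, of Q Q'] \<mu> by metis
  qed auto
  then obtain A B where AB: "\<And>Q Q'. \<lbrakk>Q \<in> \<Q>; Q' \<in> \<Q>; Q \<noteq> Q'\<rbrakk> \<Longrightarrow>
      openin X (A Q Q') \<and> openin X (B Q Q') \<and> Q \<subseteq> A Q Q' \<and> Q' \<subseteq> B Q Q' \<and> disjnt (A Q Q') (B Q Q')" by metis
  \<comment> \<open>Each ordered pair was separated on its own, so a set is trimmed both as first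
    and as second member of a pair. Disjointness of \<open>\<nu> Q\<close> and
    \<open>\<nu> Q'\<close> then comes from \<open>A Q Q'\<close> and \<open>B Q Q'\<close>.\<close>
  define \<nu> where "\<nu> Q = \<Inter>(insert (\<mu> Q) ((\<lambda>Q'. A Q Q' \<inter> B Q' Q) ` (\<Q> - {Q})))" for Q
  have "openin X (\<nu> Q) \<and> Q \<subseteq> \<nu> Q \<and> \<nu> Q \<subseteq> \<mu> Q" if Q: "Q \<in> \<Q>" for Q
  proof (intro conjI)
    show "openin X (\<nu> Q)"
      unfolding \<nu>_def
    proof (rule openin_Inter)
      fix S assume "S \<in> insert (\<mu> Q) ((\<lambda>Q'. A Q Q' \<inter> B Q' Q) ` (\<Q> - {Q}))"
      then consider "S = \<mu> Q" | Q' where "Q' \<in> \<Q>" "Q' \<noteq> Q" "S = A Q Q' \<inter> B Q' Q" by blast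
      then show "openin X S"
      proof cases
        case 1 then show ?thesis using \<mu>[OF Q] by simp
      next
        case 2 then show ?thesis using AB[OF Q, of Q'] AB[of Q' Q] Q by auto
      qed
    qed (use fin in auto)
    show "\<nu> Q \<subseteq> \<mu> Q" by (auto simp: \<nu>_def)
    have "Q \<subseteq> A Q Q' \<inter> B Q' Q" if "Q' \<in> \<Q>" "Q' \<noteq> Q" for Q'
      using AB[OF Q, of Q'] AB[of Q' Q] Q that by auto
    then show "Q \<subseteq> \<nu> Q" using \<mu>[OF Q] unfolding \<nu>_def by blast
  qed
  moreover have "\<nu> Q \<inter> \<nu> Q' = {}" if Q: "Q \<in> \<Q>" "Q' \<in> \<Q>" "Q \<noteq> Q'" for Q Q'
  proof -
    have "\<nu> Q \<subseteq> A Q Q'" "\<nu> Q' \<subseteq> B Q Q'" using Q unfolding \<nu>_def by blast+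
    then show ?thesis using AB[OF Q] unfolding disjnt_def by blast
  qed
  ultimately show ?thesis by (intro exI[of _ \<nu>]) blast
qed

text \<open>Second countability yields countably many relatively compact open sets
  \<open>N m\<close> that cover. Each new stage is a finite union of them that contains the closure
  of the previous stage and the next \<open>N m\<close>, so every point is reached.\<close>

lemma compact_exhaustion:
  assumes X: "Hausdorff_space X" "second_countable X"
    and nbhd: "\<And>x. x \<in> topspace X \<Longrightarrow> \<exists>N L. openin X N \<and> x \<in> N \<and> N \<subseteq> L \<and> compactin X L"
  shows "\<exists>A :: nat \<Rightarrow> 'a set. A 0 = {} \<and> (\<forall>m. openin X (A m) \<and> compactin X (X closure_of A m) \<and>
    X closure_of A m \<subseteq> A (Suc m)) \<and> (\<Union>m. A m) = topspace X"
proof -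
  define \<N> where "\<N> = {N. openin X N \<and> compactin X (X closure_of N)}"
  have cl: "compactin X (X closure_of N)" if "N \<subseteq> L" "compactin X L" for N L
    using that X(1) by (intro closed_compactin[OF that(2)] closure_of_minimal) (auto intro: compactin_imp_closedin)
  have cov: "\<Union>\<N> = topspace X"
  proof
    show "topspace X \<subseteq> \<Union>\<N>" using nbhd cl unfolding \<N>_def by blast
  qed (auto simp: \<N>_def dest: openin_subset)
  obtain \<M> where \<M>: "countable \<M>" "\<M> \<subseteq> \<N>" "\<Union>\<M> = topspace X"
    using Lindelof_spaceD[OF second_countable_imp_Lindelof_space[OF X(2)], of \<N>] cov by (auto simp: \<N>_def)
  \<comment> \<open>The empty set is added so that the countable family is nonempty and can be
    enumerated by the natural numbers.\<close>
  define N where "N = from_nat_into (insert {} \<M>)"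
  have rN: "range N = insert {} \<M>" unfolding N_def using \<M>(1) by (intro range_from_nat_into) auto
  have N: "openin X (N i)" "compactin X (X closure_of N i)" for i
  proof -
    have "N i = {} \<or> N i \<in> \<N>" using rN \<M>(2) by blast
    then show "openin X (N i)" "compactin X (X closure_of N i)" by (auto simp: \<N>_def)
  qed
  \<comment> \<open>The clause for \<open>m = 0\<close> belongs to the invariant, since dependent
    choice by itself does not fix the starting value.\<close>
  have "\<exists>A :: nat \<Rightarrow> 'a set. \<forall>m. (openin X (A m) \<and> compactin X (X closure_of A m) \<and> (m = 0 \<longrightarrow> A m = {})) \<and>
      X closure_of A m \<subseteq> A (Suc m) \<and> N m \<subseteq> A (Suc m)"
  proof (rule dependent_nat_choice)
    show "\<exists>A. openin X A \<and> compactin X (X closure_of A) \<and> ((0::nat) = 0 \<longrightarrow> A = {})" by (intro exI[of _ "{}"]) auto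
    fix A :: "'a set" and m :: nat assume A: "openin X A \<and> compactin X (X closure_of A) \<and> (m = 0 \<longrightarrow> A = {})"
    have comp: "compactin X (X closure_of A \<union> X closure_of N m)" using A N(2) by (intro compactin_Un) auto
    have "X closure_of A \<union> X closure_of N m \<subseteq> \<Union>(range N)"
      using rN \<M>(3) closure_of_subset_topspace[of X] by auto
    then obtain \<F> where \<F>: "finite \<F>" "\<F> \<subseteq> range N" "X closure_of A \<union> X closure_of N m \<subseteq> \<Union>\<F>"
      using compactinD[OF comp, of "range N"] N(1) by blast
    have o: "openin X (\<Union>\<F>)" using \<F> N(1) by (intro openin_Union) auto
    have "compactin X (X closure_of \<Union>\<F>)"
      unfolding closure_of_Union[OF \<F>(1)] using \<F> N(2) by (intro compactin_Union) auto
    moreover have "N m \<subseteq> \<Union>\<F>" using \<F>(3) closure_of_subset[OF openin_subset[OF N(1)[of m]]] by blast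
    ultimately show "\<exists>A'. (openin X A' \<and> compactin X (X closure_of A') \<and> (Suc m = 0 \<longrightarrow> A' = {})) \<and>
        X closure_of A \<subseteq> A' \<and> N m \<subseteq> A'"
      using o \<F>(3) by (intro exI[of _ "\<Union>\<F>"]) auto
  qed
  then obtain A where A: "\<And>m. openin X (A m)" "\<And>m. compactin X (X closure_of A m)" "A 0 = {}"
    "\<And>m. X closure_of A m \<subseteq> A (Suc m)" "\<And>m. N m \<subseteq> A (Suc m)" by blast
  have "(\<Union>m. A m) = topspace X"
  proof
    show "(\<Union>m. A m) \<subseteq> topspace X" using openin_subset[OF A(1)] by blast
    have "topspace X \<subseteq> \<Union>(range N)" using rN \<M>(3) by auto
    also have "\<dots> \<subseteq> (\<Union>m. A m)" using A(5) by blast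
    finally show "topspace X \<subseteq> (\<Union>m. A m)" .
  qed
  with A(1-4) show ?thesis by (intro exI[of _ A]) simp
qed

text \<open>Disjoint families for neighbouring shells of an exhaustion are kept apart by the shell number
  modulo three.\<close>

lemma coloured_cover:
  assumes X: "Hausdorff_space X" "second_countable X" and "finite I"
    and nbhd: "\<And>x. x \<in> topspace X \<Longrightarrow> \<exists>N L. openin X N \<and> x \<in> N \<and> N \<subseteq> L \<and> compactin X L \<and> colourable X I L"
    and \<U>: "\<And>U. U \<in> \<U> \<Longrightarrow> openin X U" "topspace X \<subseteq> \<Union>\<U>"
  obtains \<P> :: "'c \<times> nat \<Rightarrow> ('a set \<times> 'a set) set" where
    "\<And>c Q V. \<lbrakk>c \<in> I \<times> {..<3}; (Q, V) \<in> \<P> c\<rbrakk> \<Longrightarrow> Q \<noteq> {} \<and> compactin X Q \<and> openin X V \<and> Q \<subseteq> V \<and> (\<exists>U\<in>\<U>. V \<subseteq> U)"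
    "\<And>c p p'. \<lbrakk>c \<in> I \<times> {..<3}; p \<in> \<P> c; p' \<in> \<P> c; p \<noteq> p'\<rbrakk> \<Longrightarrow> snd p \<inter> snd p' = {}"
    "\<And>c. c \<in> I \<times> {..<3} \<Longrightarrow> locally_finite_in X (snd ` \<P> c)"
    "topspace X \<subseteq> (\<Union>c\<in>I \<times> {..<3}. \<Union>(fst ` \<P> c))"
proof -
  have "\<exists>N L. openin X N \<and> x \<in> N \<and> N \<subseteq> L \<and> compactin X L" if "x \<in> topspace X" for x
    using nbhd[OF that] by blast
  from compact_exhaustion[OF X this] obtain A where A0: "A 0 = {}" and A: "\<And>m. openin X (A m)"
    "\<And>m. compactin X (X closure_of A m)" "\<And>m. X closure_of A m \<subseteq> A (Suc m)" and AX: "(\<Union>m. A m) = topspace X"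
    by blast
  have Acl: "A m \<subseteq> X closure_of A m" for m by (rule closure_of_subset[OF openin_subset[OF A(1)]])
  have A_mono: "A m \<subseteq> A m'" if "m \<le> m'" for m m'
    using that by (induction rule: dec_induct) (use Acl A(3) in blast)+
  have compact_col: "colourable X I K" if K: "compactin X K" for K
  proof -
    define \<N> where "\<N> = {N. openin X N \<and> (\<exists>L. N \<subseteq> L \<and> compactin X L \<and> colourable X I L)}"
    have "K \<subseteq> \<Union>\<N>"
    proof
      fix x assume "x \<in> K"
      then have "x \<in> topspace X" using compactin_subset_topspace[OF K] by auto
      from nbhd[OF this] show "x \<in> \<Union>\<N>" unfolding \<N>_def by blast
    qed
    then obtain \<F> where \<F>: "finite \<F>" "\<F> \<subseteq> \<N>" "K \<subseteq> \<Union>\<F>"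
      using compactinD[OF K, of \<N>] by (auto simp: \<N>_def)
    have "\<exists>L. \<Union>\<F> \<subseteq> L \<and> L \<subseteq> topspace X \<and> colourable X I L"
      using \<F>(1,2)
    proof (induction \<F>)
      case empty
      show ?case using colourable_empty[of X I] by (intro exI[of _ "{}"]) auto
    next
      case (insert N \<F>)
      then obtain L where L: "\<Union>\<F> \<subseteq> L" "L \<subseteq> topspace X" "colourable X I L" by auto
      obtain L' where L': "N \<subseteq> L'" "compactin X L'" "colourable X I L'" using insert.prems by (auto simp: \<N>_def)
      have "L' \<subseteq> topspace X" using L'(2) by (rule compactin_subset_topspace)
      from colourable_Un[OF X(1) L(3) L'(3) \<open>finite I\<close> this]
      have "colourable X I (L \<union> L')" .
      moreover have "\<Union>(insert N \<F>) \<subseteq> L \<union> L'" using L(1) L'(1) by blast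
      moreover have "L \<union> L' \<subseteq> topspace X" using L(2) \<open>L' \<subseteq> topspace X\<close> by blast
      ultimately show ?case by blast
    qed
    then obtain L where L: "\<Union>\<F> \<subseteq> L" "L \<subseteq> topspace X" "colourable X I L" by (elim exE conjE)
    have "K \<subseteq> L" using L(1) \<F>(3) by (rule order_trans[rotated])
    then show ?thesis by (rule colourable_subset[OF L(3,2) compactin_imp_closedin[OF X(1) K]])
  qed
  define H where "H m = X closure_of A (Suc m) - A m" for m
  \<comment> \<open>An open neighbourhood of the shell \<open>H m\<close>, so tight that regions
    whose numbers differ by at least 3 are disjoint. For \<open>m = 0\<close> the truncated
    difference gives \<open>A 0\<close>, which is empty.\<close>
  define R where "R m = A (Suc (Suc m)) - X closure_of A (m - 1)" for m
  have R_open: "openin X (R m)" for m by (simp add: R_def A openin_diff)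
  have HR: "H m \<subseteq> R m" for m
  proof -
    have "X closure_of A (m - 1) \<subseteq> A m" using A(3)[of "m - 1"] A0 by (cases m) auto
    then show ?thesis using A(3)[of "Suc m"] unfolding H_def R_def by blast
  qed
  have HK: "compactin X (H m)" for m
  proof (rule closed_compactin[OF A(2)[of "Suc m"]])
    show "closedin X (H m)" unfolding H_def by (intro closedin_diff closedin_closure_of A)
  qed (auto simp: H_def)
  have R_disj: "R m \<inter> R m' = {}" if "m + 3 \<le> m'" for m m'
  proof -
    have "R m \<subseteq> A (Suc (Suc m))" by (auto simp: R_def)
    also have "\<dots> \<subseteq> A (m' - 1)" using that by (intro A_mono) simp
    also have "\<dots> \<subseteq> X closure_of A (m' - 1)" by (rule Acl)
    finally show ?thesis by (auto simp: R_def)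
  qed
  have "\<exists>\<Q>. H m \<subseteq> (\<Union>c\<in>I. \<Union>(\<Q> c)) \<and> (\<forall>c\<in>I. finite (\<Q> c) \<and> pairwise disjnt (\<Q> c) \<and>
      (\<forall>Q\<in>\<Q> c. compactin X Q \<and> (\<exists>V\<in>(\<lambda>U. U \<inter> R m) ` \<U>. Q \<subseteq> V)))" for m
  proof -
    have o: "\<forall>V\<in>(\<lambda>U. U \<inter> R m) ` \<U>. openin X V" using \<U>(1) R_open by auto
    have c: "H m \<subseteq> \<Union>((\<lambda>U. U \<inter> R m) ` \<U>)"
      using HR[of m] \<U>(2) openin_subset[OF R_open[of m]] by blast
    show ?thesis by (rule colourableE[OF compact_col[OF HK] o c]) blast
  qed
  then obtain \<Q> where HQ: "\<And>m. H m \<subseteq> (\<Union>c\<in>I. \<Union>(\<Q> m c))"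
    and \<Q>: "\<And>m c. c \<in> I \<Longrightarrow> finite (\<Q> m c) \<and> pairwise disjnt (\<Q> m c) \<and>
      (\<forall>Q\<in>\<Q> m c. compactin X Q \<and> (\<exists>V\<in>(\<lambda>U. U \<inter> R m) ` \<U>. Q \<subseteq> V))" by metis
  \<comment> \<open>The compact sets of one colour are thickened to disjoint open sets that still
    stay in the region of their shell and in a member of the cover. The room between
    \<open>Q\<close> and \<open>\<nu> Q\<close> is what a bump function uses to descend from one to
    zero.\<close>
  define good where "good m c \<nu> \<longleftrightarrow> (\<forall>Q\<in>\<Q> m c. openin X (\<nu> Q) \<and> Q \<subseteq> \<nu> Q \<and> \<nu> Q \<subseteq> R m \<and> (\<exists>U\<in>\<U>. \<nu> Q \<subseteq> U)) \<and>
      (\<forall>Q\<in>\<Q> m c. \<forall>Q'\<in>\<Q> m c. Q \<noteq> Q' \<longrightarrow> \<nu> Q \<inter> \<nu> Q' = {})" for m c and \<nu> :: "'a set \<Rightarrow> 'a set"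
  have "\<exists>\<nu>. good m c \<nu>" if c: "c \<in> I" for m c
  proof -
    have "\<forall>Q\<in>\<Q> m c. \<exists>V. V \<in> (\<lambda>U. U \<inter> R m) ` \<U> \<and> Q \<subseteq> V" using \<Q>[OF c, of m] by blast
    from bchoice[OF this] obtain \<mu> where \<mu>: "\<And>Q. Q \<in> \<Q> m c \<Longrightarrow> \<mu> Q \<in> (\<lambda>U. U \<inter> R m) ` \<U> \<and> Q \<subseteq> \<mu> Q" by blast
    have "compactin X Q \<and> openin X (\<mu> Q) \<and> Q \<subseteq> \<mu> Q" if Q: "Q \<in> \<Q> m c" for Q
    proof (intro conjI)
      show "compactin X Q" using \<Q>[OF c, of m] Q by blast
      obtain U where "U \<in> \<U>" "\<mu> Q = U \<inter> R m" using \<mu>[OF Q] by blast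
      then show "openin X (\<mu> Q)" using \<U>(1) R_open by auto
    qed (use \<mu>[OF Q] in blast)
    note \<mu>' = this
    have fin: "finite (\<Q> m c)" and disj: "pairwise disjnt (\<Q> m c)"
      using \<Q>[OF c, of m] by simp_all
    have "\<exists>\<nu>. (\<forall>Q\<in>\<Q> m c. openin X (\<nu> Q) \<and> Q \<subseteq> \<nu> Q \<and> \<nu> Q \<subseteq> \<mu> Q) \<and>
        (\<forall>Q\<in>\<Q> m c. \<forall>Q'\<in>\<Q> m c. Q \<noteq> Q' \<longrightarrow> \<nu> Q \<inter> \<nu> Q' = {})"
      by (rule compact_separation_family[OF X(1) fin disj]) (rule \<mu>')
    then obtain \<nu> where
      \<nu>': "\<forall>Q\<in>\<Q> m c. openin X (\<nu> Q) \<and> Q \<subseteq> \<nu> Q \<and> \<nu> Q \<subseteq> \<mu> Q" and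
      \<nu>_disj: "\<forall>Q\<in>\<Q> m c. \<forall>Q'\<in>\<Q> m c. Q \<noteq> Q' \<longrightarrow> \<nu> Q \<inter> \<nu> Q' = {}"
      by (elim exE conjE)
    note \<nu> = bspec[OF \<nu>']
    have "\<nu> Q \<subseteq> R m \<and> (\<exists>U\<in>\<U>. \<nu> Q \<subseteq> U)" if Q: "Q \<in> \<Q> m c" for Q
      using \<nu>[OF Q] \<mu>[OF Q] by blast
    then have "\<forall>Q\<in>\<Q> m c. openin X (\<nu> Q) \<and> Q \<subseteq> \<nu> Q \<and> \<nu> Q \<subseteq> R m \<and> (\<exists>U\<in>\<U>. \<nu> Q \<subseteq> U)"
      using \<nu> by simp
    with \<nu>_disj show ?thesis unfolding good_def by (intro exI[of _ \<nu>] conjI)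
  qed
  note ex = this
  define \<nu> where "\<nu> m c = (SOME \<nu>. good m c \<nu>)" for m c
  have good: "good m c (\<nu> m c)" if "c \<in> I" for m c unfolding \<nu>_def using ex[OF that] by (rule someI_ex)
  have \<nu>: "openin X (\<nu> m c Q) \<and> Q \<subseteq> \<nu> m c Q \<and> \<nu> m c Q \<subseteq> R m \<and> (\<exists>U\<in>\<U>. \<nu> m c Q \<subseteq> U)"
    if "c \<in> I" "Q \<in> \<Q> m c" for m c Q
    using good[OF that(1), of m] that(2) unfolding good_def by (elim conjE) (rule bspec)
  have \<nu>_disj: "\<nu> m c Q \<inter> \<nu> m c Q' = {}" if "c \<in> I" "Q \<in> \<Q> m c" "Q' \<in> \<Q> m c" "Q \<noteq> Q'" for m c Q Q'
    using conjunct2[OF good[OF that(1), of m, unfolded good_def]] that(2-4) by blast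
  \<comment> \<open>Shells congruent modulo 3 are combined. Discarding empty \<open>Q\<close>
    ensures that an open set occurs with only one compact set, since distinct pairs have disjoint
    open sets.\<close>
  define \<P> where "\<P> ct = {(Q, \<nu> m (fst ct) Q) | m Q. m mod 3 = snd ct \<and> Q \<in> \<Q> m (fst ct) \<and> Q \<noteq> {}}" for ct :: "'c \<times> nat"
  have \<P>E: "\<exists>m Q. p = (Q, \<nu> m (fst ct) Q) \<and> m mod 3 = snd ct \<and> Q \<in> \<Q> m (fst ct) \<and> Q \<noteq> {}" if "p \<in> \<P> ct" for p ct
    using that by (auto simp: \<P>_def)
  show ?thesis
  proof (rule that[of \<P>])
    fix ct Q V assume ct: "ct \<in> I \<times> {..<3::nat}" and QV: "(Q, V) \<in> \<P> ct"
    then have c: "fst ct \<in> I" by auto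
    obtain m where m: "V = \<nu> m (fst ct) Q" "Q \<in> \<Q> m (fst ct)" "Q \<noteq> {}" using \<P>E[OF QV] by auto
    have "compactin X Q" using \<Q>[OF c, of m] m by blast
    then show "Q \<noteq> {} \<and> compactin X Q \<and> openin X V \<and> Q \<subseteq> V \<and> (\<exists>U\<in>\<U>. V \<subseteq> U)"
      using \<nu>[OF c m(2)] m by blast
  next
    fix ct p p' assume ct: "ct \<in> I \<times> {..<3::nat}" and p: "p \<in> \<P> ct" "p' \<in> \<P> ct" "p \<noteq> p'"
    then have c: "fst ct \<in> I" by auto
    obtain m Q where m: "p = (Q, \<nu> m (fst ct) Q)" "m mod 3 = snd ct" "Q \<in> \<Q> m (fst ct)" using \<P>E[OF p(1)] by blast
    obtain m' Q' where m': "p' = (Q', \<nu> m' (fst ct) Q')" "m' mod 3 = snd ct" "Q' \<in> \<Q> m' (fst ct)" using \<P>E[OF p(2)] by blast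
    show "snd p \<inter> snd p' = {}"
    proof (cases "m = m'")
      case True
      then have "Q \<noteq> Q'" using p(3) m m' by auto
      then show ?thesis using \<nu>_disj[OF c m(3)] m' m(1) True by simp
    next
      case False
      have "m mod 3 = m' mod 3" using m(2) m'(2) by simp
      have gap: "m + 3 \<le> m'" if "m < m'" "m mod 3 = m' mod 3" for m m' :: nat using that by presburger
      have "m + 3 \<le> m' \<or> m' + 3 \<le> m"
        using False gap[of m m'] gap[of m' m] \<open>m mod 3 = m' mod 3\<close> by linarith
      then have "R m \<inter> R m' = {}" using R_disj[of m m'] R_disj[of m' m] by blast
      then show ?thesis using \<nu>[OF c m(3)] \<nu>[OF c m'(3)] m(1) m'(1) by auto
    qed
  next
    fix ct assume ct: "ct \<in> I \<times> {..<3::nat}"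
    then have c: "fst ct \<in> I" by auto
    have PV: "\<exists>m Q. V = \<nu> m (fst ct) Q \<and> Q \<in> \<Q> m (fst ct)" if V: "V \<in> snd ` \<P> ct" for V
    proof -
      obtain p where p: "p \<in> \<P> ct" "V = snd p" using V by blast
      show ?thesis using \<P>E[OF p(1)] p(2) by auto
    qed
    show "locally_finite_in X (snd ` \<P> ct)"
      unfolding locally_finite_in_def
    proof (intro conjI ballI)
      show "\<Union>(snd ` \<P> ct) \<subseteq> topspace X"
      proof (rule Union_least)
        fix V assume "V \<in> snd ` \<P> ct"
        then obtain m Q where "V = \<nu> m (fst ct) Q" "Q \<in> \<Q> m (fst ct)" using PV by blast
        then show "V \<subseteq> topspace X" using \<nu>[OF c] openin_subset by metis
      qed
      fix x assume "x \<in> topspace X"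
      then obtain j where j: "x \<in> A j" using AX by blast
      \<comment> \<open>A region with number m > j avoids \<open>A j\<close>, so only the finitely
        many sets of the shells up to j can meet it.\<close>
      have "{V \<in> snd ` \<P> ct. V \<inter> A j \<noteq> {}} \<subseteq> (\<Union>m\<le>j. \<nu> m (fst ct) ` \<Q> m (fst ct))"
      proof
        fix V assume "V \<in> {V \<in> snd ` \<P> ct. V \<inter> A j \<noteq> {}}"
        then have V: "V \<in> snd ` \<P> ct" "V \<inter> A j \<noteq> {}" by auto
        obtain m Q where mQ: "V = \<nu> m (fst ct) Q" "Q \<in> \<Q> m (fst ct)" using PV[OF V(1)] by blast
        have "m \<le> j"
        proof (rule ccontr)
          assume "\<not> m \<le> j"
          then have "A j \<subseteq> A (m - 1)" by (intro A_mono) simp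
          then have "A j \<subseteq> X closure_of A (m - 1)" using Acl by blast
          then have "R m \<inter> A j = {}" by (auto simp: R_def)
          then show False using \<nu>[OF c mQ(2)] mQ(1) V(2) by blast
        qed
        then show "V \<in> (\<Union>m\<le>j. \<nu> m (fst ct) ` \<Q> m (fst ct))" using mQ by blast
      qed
      moreover have "finite (\<Union>m\<le>j. \<nu> m (fst ct) ` \<Q> m (fst ct))" using \<Q>[OF c] by blast
      ultimately have "finite {V \<in> snd ` \<P> ct. V \<inter> A j \<noteq> {}}" by (rule finite_subset)
      then show "\<exists>V. openin X V \<and> x \<in> V \<and> finite {U \<in> snd ` \<P> ct. U \<inter> V \<noteq> {}}"
        using A(1) j by blast
    qed
  next
    show "topspace X \<subseteq> (\<Union>ct\<in>I \<times> {..<3::nat}. \<Union>(fst ` \<P> ct))"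
    proof
      fix x assume "x \<in> topspace X"
      then obtain j where "x \<in> A j" using AX by blast
      \<comment> \<open>The least stage containing \<open>x\<close> is positive because
        \<open>A 0\<close> is empty; its predecessor is the number of the shell.\<close>
      define m where "m = (LEAST m. x \<in> A m) - 1"
      have "x \<in> A (LEAST m. x \<in> A m)" by (rule LeastI) fact
      then have "(LEAST m. x \<in> A m) = Suc m" using A0 by (cases "LEAST m. x \<in> A m") (auto simp: m_def)
      then have "x \<in> A (Suc m)" "x \<notin> A m"
        using \<open>x \<in> A (LEAST m. x \<in> A m)\<close> not_less_Least[of m "\<lambda>m. x \<in> A m"] by auto
      then have "x \<in> H m" using Acl[of "Suc m"] by (auto simp: H_def)
      then obtain c Q where cQ: "c \<in> I" "Q \<in> \<Q> m c" "x \<in> Q" using HQ[of m] by blast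
      then have "(Q, \<nu> m c Q) \<in> \<P> (c, m mod 3)" by (auto simp: \<P>_def)
      then have "Q \<in> fst ` \<P> (c, m mod 3)" by force
      moreover have "(c, m mod 3) \<in> I \<times> {..<3::nat}" using cQ by simp
      ultimately show "x \<in> (\<Union>ct\<in>I \<times> {..<3::nat}. \<Union>(fst ` \<P> ct))" using cQ(3) by blast
    qed
  qed
qed

section \<open>Tensor products of vector bundles\<close>

text \<open>Frames must share \<open>d\<close> as a total function, also beyond the length of the
  list, where list access has an unspecified value that depends only on the length and the
  index.\<close>

lemma nth_beyond_length: "\<lbrakk>length xs = length ys; length xs \<le> n\<rbrakk> \<Longrightarrow> xs ! n = ys ! n"
proof (induction xs ys arbitrary: n rule: list_induct2)
  case (Cons x xs y ys)
  then show ?case by (cases n) auto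
qed simp

lemma mset_degrees_if_graded_rank_eq:
  fixes e e' :: "(int \<times> 'x) list"
  assumes "graded_rank e = graded_rank e'"
  shows "mset (map fst e) = mset (map fst e')"
proof (rule multiset_eqI)
  have "count (mset (map fst e)) j = graded_rank e j" for j and e :: "(int \<times> 'x) list"
    unfolding graded_rank_def by (induction e) auto
  then show "count (mset (map fst e)) j = count (mset (map fst e')) j" for j using assms by simp
qed

text \<open>The degree list of one frame serves as reference. Equal graded ranks mean equal
  multisets of degrees, so a permutation brings every other frame to this list.\<close>

lemma (in manifold_module) frame_cover:
  assumes bumps: "\<And>x V. \<lbrakk>openin X V; x \<in> V\<rbrakk> \<Longrightarrow> \<exists>a B. x \<in> B \<and> C.bump a B V"
    and vb: "graded_vector_bundle X C F"
  shows "\<exists>\<U> r d. (\<forall>U\<in>\<U>. openin X U) \<and> \<Union>\<U> = topspace X \<and> (\<forall>U\<in>\<U>. \<exists>e. frame_on U r d e)"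
proof -
  obtain \<U> \<rho> where oU: "\<forall>U\<in>\<U>. openin X U" and cover: "\<Union>\<U> = topspace X"
    and frames: "\<forall>U\<in>\<U>. \<exists>e. is_frame (sections C U) (sections F U) e \<and> graded_rank e = \<rho>"
    using graded_vector_bundle.local_frames[OF vb] by (elim exE conjE)
  note \<U> = bspec[OF oU] and fr = bspec[OF frames]
  show ?thesis
  proof (cases "\<U> = {}")
    case True
    then show ?thesis using cover by (intro exI[of _ "{}"]) simp
  next
    case False
    then obtain U0 where "U0 \<in> \<U>" by blast
    from fr[OF this] obtain es0 where "is_frame (sections C U0) (sections F U0) es0"
      and es0: "graded_rank es0 = \<rho>" by (elim exE conjE)
    define d where "d b = fst (es0 ! b)" for b
    have "\<exists>e. frame_on U (length es0) d e" if U: "U \<in> \<U>" for U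
    proof -
      obtain es where es: "is_frame (sections C U) (sections F U) es" "graded_rank es = \<rho>"
        using fr[OF U] by (elim exE conjE)
      have ms: "mset (map fst es0) = mset (map fst es)"
        using es0 es(2) by (intro mset_degrees_if_graded_rank_eq) simp
      have len: "length es0 = length es" using mset_eq_length[OF ms] by simp
      obtain f where f: "bij_betw f {..<length es} {..<length es}"
        "\<And>b. b < length es \<Longrightarrow> fst (es0 ! b) = fst (es ! f b)"
      proof -
        from permutation_Ex_bij[OF ms] obtain f where f: "bij_betw f {..<length es0} {..<length es}"
          "\<forall>b<length es0. map fst es0 ! b = map fst es ! f b" by auto
        moreover have "f b < length es" if "b < length es" for b
          using f(1) len that by (auto simp: bij_betw_def)
        ultimately show ?thesis using len by (intro that[of f]) simp_all
      qed
      \<comment> \<open>Beyond the length the permutation is continued by the identity, as the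
        equality of degree functions has to hold there too.\<close>
      define \<pi> where "\<pi> b = (if b < length es then f b else b)" for b
      have "bij_betw \<pi> {..<length es} {..<length es}"
        using f(1) by (subst bij_betw_cong[of _ _ f]) (auto simp: \<pi>_def)
      from frame_on_permute[OF frame_on_if_is_frame[OF bumps \<U>[OF U] es(1)] this]
      have "frame_on U (length es) (\<lambda>b. fst (es ! \<pi> b)) (\<lambda>b. snd (es ! \<pi> b))" .
      moreover have "(\<lambda>b. fst (es ! \<pi> b)) = d"
        using f(2) nth_beyond_length[of es0 es] len by (auto simp: d_def \<pi>_def not_less)
      ultimately show ?thesis using len by auto
    qed
    then have "\<forall>U\<in>\<U>. \<exists>e. frame_on U (length es0) d e" ..
    with oU cover show ?thesis by blast
  qed
qed

section \<open>The sheaf property of the tensor product presheaf\<close>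

context graded_manifold
begin

lemma colourable_neighbourhood:
  assumes x: "x \<in> topspace X"
  shows "\<exists>N L. openin X N \<and> x \<in> N \<and> N \<subseteq> L \<and> compactin X L \<and>
    colourable X ({..<m 0} \<rightarrow>\<^sub>E (UNIV :: bool set)) L"
proof -
  let ?E = "Euclidean_space (m 0)"
  from local_model[OF x] obtain U V h where U: "openin X U" "x \<in> U" and V: "openin ?E V"
    and h: "homeomorphic_map (subtopology X U) (subtopology ?E V) h" by blast
  have topU: "topspace (subtopology X U) = U" and topV: "topspace (subtopology ?E V) = V"
    using openin_subset[OF U(1)] openin_subset[OF V] by auto
  obtain g where g: "homeomorphic_maps (subtopology X U) (subtopology ?E V) h g"
    using h unfolding homeomorphic_map_maps by blast
  have gh: "g (h y) = y" if "y \<in> U" for y using g that topU by (simp add: homeomorphic_maps_def)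
  have hx: "h x \<in> V" using homeomorphic_imp_surjective_map[OF h] topU topV U(2) by auto
  have gU: "g z \<in> U" if "z \<in> V" for z
    using g that topU topV by (auto simp: homeomorphic_maps_def continuous_map_def Pi_iff)
  obtain B K where B: "openin ?E B" "h x \<in> B" "B \<subseteq> K" and K: "K \<subseteq> V" "compactin ?E K"
    using Euclidean_compact_neighbourhood[OF V hx] by blast
  have "continuous_map (subtopology X U) ?E h"
    using homeomorphic_imp_continuous_map[OF h] by (simp add: continuous_map_in_subtopology)
  from openin_continuous_map_preimage[OF this B(1)] have N: "openin X {y \<in> U. h y \<in> B}"
    using U(1) unfolding topU by (simp add: openin_open_subtopology)
  have "compactin (subtopology ?E V) K" using K by (simp add: compactin_subtopology)
  moreover have "continuous_map (subtopology ?E V) X g"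
    using g by (auto simp: homeomorphic_maps_def continuous_map_in_subtopology)
  ultimately have L: "compactin X (g ` K)" by (rule image_compactin)
  have "g ` K \<subseteq> U" using gU K(1) by auto
  then have "colourable X ({..<m 0} \<rightarrow>\<^sub>E (UNIV :: bool set)) (g ` K)"
    by (rule colourable_chart[OF U(1) L _ hausdorff V h])
  moreover have "{y \<in> U. h y \<in> B} \<subseteq> g ` K"
  proof
    fix y assume "y \<in> {y \<in> U. h y \<in> B}"
    then have "g (h y) = y" "h y \<in> K" using gh B(3) by auto
    then show "y \<in> g ` K" by (metis imageI)
  qed
  ultimately show ?thesis using N L U(2) B(2) by (intro exI[of _ "{y \<in> U. h y \<in> B}"] exI[of _ "g ` K"]) simp
qed

lemma bump_of_disjoint_pairs:
  assumes Q: "\<And>Q V. (Q, V) \<in> \<P> \<Longrightarrow> Q \<noteq> {} \<and> compactin X Q \<and> openin X V \<and> Q \<subseteq> V"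
    and disj: "\<And>p p'. \<lbrakk>p \<in> \<P>; p' \<in> \<P>; p \<noteq> p'\<rbrakk> \<Longrightarrow> snd p \<inter> snd p' = {}"
    and lf: "locally_finite_in X (snd ` \<P>)"
  shows "\<exists>b B. bump b B (\<Union>(snd ` \<P>)) \<and> \<Union>(fst ` \<P>) \<subseteq> B"
proof -
  have "\<exists>a B. bump a B V \<and> (\<forall>Q. (Q, V) \<in> \<P> \<longrightarrow> Q \<subseteq> B)" if V: "V \<in> snd ` \<P>" for V
  proof -
    obtain Q where QV: "(Q, V) \<in> \<P>" using V by auto
    have "\<exists>a B. x \<in> B \<and> bump a B V" if "x \<in> Q" for x
      using local_bumps[of V x] Q[OF QV] that by blast
    then obtain a B where aB: "Q \<subseteq> B" "bump a B V" using bump_compact[of Q V] Q[OF QV] by blast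
    \<comment> \<open>Two distinct pairs with the same open set would make it disjoint from itself,
      hence empty, although it contains the nonempty set \<open>Q\<close>.\<close>
    have "Q' = Q" if "(Q', V) \<in> \<P>" for Q'
      using disj[OF that QV] Q[OF QV] by auto
    then show ?thesis using aB by (intro exI[of _ a] exI[of _ B]) auto
  qed
  then obtain a B where aB: "\<And>V. V \<in> snd ` \<P> \<Longrightarrow> bump (a V) (B V) V"
    and QB: "\<And>Q V. (Q, V) \<in> \<P> \<Longrightarrow> Q \<subseteq> B V" by (metis image_eqI snd_conv)
  have "pairwise disjnt (snd ` \<P>)"
  proof (rule pairwiseI)
    fix V V' assume V: "V \<in> snd ` \<P>" "V' \<in> snd ` \<P>" "V \<noteq> V'"
    then obtain p p' where "p \<in> \<P>" "p' \<in> \<P>" "V = snd p" "V' = snd p'" by blast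
    then show "disjnt V V'" using disj[of p p'] V(3) unfolding disjnt_def by blast
  qed
  from bump_disjoint_Union[OF aB this lf] obtain b where "bump b (\<Union>V\<in>snd ` \<P>. B V) (\<Union>(snd ` \<P>))" by blast
  moreover have "\<Union>(fst ` \<P>) \<subseteq> (\<Union>V\<in>snd ` \<P>. B V)" using QB by fastforce
  ultimately show ?thesis by blast
qed

text \<open>Each colour contributes one open set, the disjoint union of its members, with a frame of
  \<open>S\<close> and a cutoff that equals one on all compact sets of that colour. The squares of
  these finitely many cutoffs satisfy \<open>glues\<close> and are one on open sets that cover the
  space.\<close>

theorem sheaf_tensor_presheaf:
  assumes S: "graded_vector_bundle X C S" and P: "module_sheaf X C P"
  shows "sheaf X (tensor_presheaf C S P)"
proof -
  have Sm: "module_sheaf X C S" using S by (simp add: graded_vector_bundle_def)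
  interpret M: manifold_module X C S
    using Sm algebra_sheaf_axioms by (simp add: manifold_module_def)
  interpret SP: sheaf_pair X C S P
    using Sm P algebra_sheaf_axioms by (simp add: sheaf_pair_def)
  interpret R: cring "functions" by (rule cring_functions)
  have "\<exists>\<U> r d. (\<forall>U\<in>\<U>. openin X U) \<and> \<Union>\<U> = topspace X \<and> (\<forall>U\<in>\<U>. \<exists>e. M.frame_on U r d e)"
    by (rule M.frame_cover[OF local_bumps S])
  then obtain \<U> r d where oU: "\<forall>U\<in>\<U>. openin X U" and \<U>: "\<Union>\<U> = topspace X"
    and frames: "\<forall>U\<in>\<U>. \<exists>e. M.frame_on U r d e" by (elim exE conjE)
  note fr = bspec[OF frames]
  let ?I = "{..<m 0} \<rightarrow>\<^sub>E (UNIV :: bool set)"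
  let ?J = "?I \<times> {..<3::nat}"
  have fin: "finite ?I" by (intro finite_PiE) auto
  show ?thesis
  proof (rule coloured_cover[OF hausdorff second_countable fin colourable_neighbourhood bspec[OF oU] equalityD2[OF \<U>]])
    fix \<P> :: "(nat \<Rightarrow> bool) \<times> nat \<Rightarrow> ('m set \<times> 'm set) set"
    assume \<P>: "\<And>c Q V. \<lbrakk>c \<in> ?J; (Q, V) \<in> \<P> c\<rbrakk> \<Longrightarrow> Q \<noteq> {} \<and> compactin X Q \<and> openin X V \<and> Q \<subseteq> V \<and> (\<exists>U\<in>\<U>. V \<subseteq> U)"
      and disj: "\<And>c p p'. \<lbrakk>c \<in> ?J; p \<in> \<P> c; p' \<in> \<P> c; p \<noteq> p'\<rbrakk> \<Longrightarrow> snd p \<inter> snd p' = {}"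
      and lf: "\<And>c. c \<in> ?J \<Longrightarrow> locally_finite_in X (snd ` \<P> c)"
      and cover: "topspace X \<subseteq> (\<Union>c\<in>?J. \<Union>(fst ` \<P> c))"
    have "\<exists>b B. SP.T.glues b \<and> openin X B \<and> restr C (topspace X) B 0 b = gone (sections C B) \<and>
        \<Union>(fst ` \<P> c) \<subseteq> B" if c: "c \<in> ?J" for c
    proof -
      obtain a B where bump: "bump a B (\<Union>(snd ` \<P> c))" and QB: "\<Union>(fst ` \<P> c) \<subseteq> B"
        using bump_of_disjoint_pairs[OF _ disj[OF c] lf[OF c]] \<P>[OF c] by blast
      obtain Q where cut: "cutoff a (\<Union>(snd ` \<P> c)) Q" using bump by (auto simp: bump_def)
      have "\<exists>e. M.frame_on V r d e" if V: "V \<in> snd ` \<P> c" for V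
      proof -
        obtain Q where "(Q, V) \<in> \<P> c" using V by auto
        then obtain U where U: "U \<in> \<U>" "V \<subseteq> U" "openin X V" using \<P>[OF c] by blast
        obtain e where "M.frame_on U r d e" using fr[OF U(1)] by blast
        from M.frame_on_subset[OF this U(3,2)] show ?thesis by blast
      qed
      moreover have "pairwise disjnt (snd ` \<P> c)"
      proof (rule pairwiseI)
        fix V V' assume V: "V \<in> snd ` \<P> c" "V' \<in> snd ` \<P> c" "V \<noteq> V'"
        then obtain p p' where "p \<in> \<P> c" "p' \<in> \<P> c" "V = snd p" "V' = snd p'" by blast
        then show "disjnt V V'" using disj[OF c, of p p'] V(3) unfolding disjnt_def by blast
      qed
      ultimately obtain e where e: "M.frame_on (\<Union>(snd ` \<P> c)) r d e"
        using M.frame_on_disjoint_Union by blast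
      have a: "a \<in> carrier functions" and B: "openin X B" and aB: "restr C (topspace X) B 0 a = gone (sections C B)"
        using cut bump by (auto simp: cutoff_def bump_def)
      interpret r: ring_hom_cring "functions" "ring0 (sections C B)" "restr C (topspace X) B 0"
        by (rule restr_ring_hom[OF openin_topspace B openin_subset[OF B]])
      have "gone (sections C B) = \<one>\<^bsub>ring0 (sections C B)\<^esub>" by (simp add: ring0_simps)
      \<comment> \<open>Restriction is a ring homomorphism and the unit is its own square, so the
        square of \<open>a\<close> is still one on \<open>B\<close>.\<close>
      then have "restr C (topspace X) B 0 (a \<otimes>\<^bsub>functions\<^esub> a) = gone (sections C B)"
        using a aB by simp
      then show ?thesis using SP.glues_square[OF cut e] B QB by blast
    qed
    then obtain b B where b: "\<And>c. c \<in> ?J \<Longrightarrow> SP.T.glues (b c)" and B: "\<And>c. c \<in> ?J \<Longrightarrow> openin X (B c)"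
      "\<And>c. c \<in> ?J \<Longrightarrow> restr C (topspace X) (B c) 0 (b c) = gone (sections C (B c))"
      and QB: "\<And>c. c \<in> ?J \<Longrightarrow> \<Union>(fst ` \<P> c) \<subseteq> B c" by metis
    show ?thesis
    proof (rule SP.T.sheaf_if_glues_locally[OF sheaf_axioms _ b B])
      show "finite ?J" using fin by simp
      show "topspace X \<subseteq> (\<Union>c\<in>?J. B c)" by (rule order_trans[OF cover UN_mono[OF subset_refl QB]])
    qed
  qed
qed

end

theorem theorem4p38:
  fixes m :: "int \<Rightarrow> nat" and X :: "'m topology" and C :: "('m, 'a) alg_presheaf"
    and S :: "('m, 'a, 'b) mod_presheaf" and P :: "('m, 'a, 'c) mod_presheaf"
  assumes "graded_manifold m X C"
    and "graded_vector_bundle X C S"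
    and "graded_vector_bundle X C P"
  shows "module_presheaf_iso X C (tensor_presheaf C S P) (tensor_sheaf X C S P)
           (sff X (tensor_presheaf C S P))
       \<and> module_sheaf X C (tensor_presheaf C S P)
       \<and> (\<forall>U. openin X U \<longrightarrow>
            graded_module_iso (sections C U)
              (tensor_module (sections C U) (sections S U) (sections P U))
              (sections (tensor_sheaf X C S P) U)
              (sff X (tensor_presheaf C S P) U))"
proof -
  interpret M: graded_manifold m X C by (rule assms(1))
  interpret S: graded_vector_bundle X C S by (rule assms(2))
  interpret P: graded_vector_bundle X C P by (rule assms(3))
  interpret SP: presheaf_pair X C S P by unfold_locales
  \<comment> \<open>With the tensor product presheaf known to be a sheaf, all claims become
    instances of the general results on the sheafification of a sheaf.\<close>
  interpret T: module_sheaf X C "tensor_presheaf C S P"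
    using SP.module_presheaf_tensor M.sheaf_tensor_presheaf[OF assms(2) P.module_sheaf_axioms]
    by (simp add: module_sheaf_def)
  show ?thesis
    unfolding tensor_sheaf_def
    using T.sheafification_iso T.module_sheaf_axioms T.sff_hom T.sff_bij
    by (simp add: graded_module_iso_def tensor_presheaf_simps(1))
qed

end
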